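(* Let $k$ be a field, let $\Lambda$ be a finite-dimensional quadratic monomial $k$-algebra and let $\Lambda^!$ be its quadratic dual. Every object of the category $\Lambda^!\text{-}\mathrm{Fp}^{\mathbb Z}/\Lambda^!\text{-}\mathrm{gmod}$ (respectively, $\Lambda^!\text{-}\mathrm{Fcp}^{\mathbb Z}/\Lambda^!\text{-}\mathrm{gmod}$) is isomorphic in that category to (the image of) a linear (respectively, colinear) $\Lambda^!$-module.
   Context: A finite-dimensional quadratic monomial algebra is $\Lambda=kQ/I$ with $Q$ a finite quiver (vertex set $Q_0$) and $I$ an admissible ideal generated by paths of length $2$. Paths compose like functions: for $\alpha\colon x\to y$, $\beta\colon y\to z$, the path $\beta\alpha$ goes from $x$ to $z$. The quadratic (Koszul) dual is $\Lambda^!=kQ^{\mathrm{op}}/I^!$, with $I^!$ generated by the paths $\alpha^{\mathrm{op}}\beta^{\mathrm{op}}$ for all composable $\alpha,\beta$ with $\beta\alpha\notin I$; it is graded by path length and possibly infinite-dimensional (its global dimension is finite). Graded $\Lambda^!$-modules are $\mathbb Z$-graded left modules with finite-dimensional homogeneous components (arrows raise the degree by $1$), with degree-preserving morphisms; $M\langle i\rangle_n=M_{n-i}$. $P^!_x=\Lambda^!e_x$ is the indecomposable graded projective generated in degree $0$, and $I^!_x$ the indecomposable graded injective with socle in degree $0$: $I_x^!(y)=\operatorname{Hom}_k(\Lambda^!(y,x),k)$, where $\Lambda^!(y,x)$ is the span of nonzero paths from $y$ to $x$ and the dual of a path of length $n$ has degree $-n$. $\Lambda^!\text{-}\mathrm{gmod}$: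 finite-dimensional graded modules. $\Lambda^!\text{-}\mathrm{Fp}^{\mathbb Z}$: graded modules $M$ with an exact sequence $P^1\to P^0\to M\to0$, with $P^0,P^1$ finite direct sums of modules $P^!_x\langle i\rangle$. $\Lambda^!\text{-}\mathrm{Fcp}^{\mathbb Z}$: graded modules $N$ with an exact sequence $0\to N\to I^0\to I^1$, with $I^0,I^1$ finite direct sums of modules $I_x^!\langle i\rangle$. Both are abelian and the quotients are Serre quotients. A graded $\Lambda^!$-module is Koszul if it has a finite projective resolution whose $n$-th term (homological degree $n$) is a finite direct sum of modules $P^!_x\langle n\rangle$ for each $n\ge0$. It is coKoszul if it has a finite injective coresolution $0\to M\to I^0\to I^1\to\cdots$ with $I^n$ a finite direct sum of modules $I^!_x\langle -n\rangle$ for each $n\ge0$. A graded module $M$ is linear (resp. colinear) if $M\langle -i\rangle$ is Koszul (resp. coKoszul) for some integer $i$. The zero module is allowed. *)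

theory Defs
  imports
    "Graph_Theory.Arc_Walk"
    "HOL-Algebra.QuotRing"
    "HOL-Algebra.Ideal_Product"
    "HOL-Algebra.Module"
    "HOL-Library.Poly_Mapping"
    "HOL-Library.FuncSet"
begin

section \<open>Path algebras and quadratic duals\<close>

text \<open>
  A quiver is a \<^locale>\<open>fin_digraph\<close> (loops and parallel arrows are allowed there).  The pair
  \<open>(u, p)\<close> is the path that starts at \<open>u\<close> and runs through the arrows of \<open>p\<close>, the arrow traversed
  first being the head of the list; \<open>(u, [])\<close> is the trivial path at \<open>u\<close>.  So the path written
  \<open>\<beta>\<alpha>\<close> in the functional convention is \<open>(tail Q \<alpha>, [\<alpha>, \<beta>])\<close>.
\<close>

type_synonym ('v, 'e) path = "'v \<times> 'e list"
type_synonym ('v, 'e, 'k) path_elem = "('v, 'e) path \<Rightarrow>\<^sub>0 'k"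

definition paths :: "('v, 'e) pre_digraph \<Rightarrow> ('v, 'e) path set" where
  "paths Q = {(u, p). \<exists>v. pre_digraph.awalk Q u p v}"

definition path_end :: "('v, 'e) pre_digraph \<Rightarrow> ('v, 'e) path \<Rightarrow> 'v" where
  "path_end Q p = last (pre_digraph.awalk_verts Q (fst p) (snd p))"

text \<open>The product of paths \<open>p q\<close> is ``first \<open>q\<close>, then \<open>p\<close>''.\<close>

definition path_times :: "('v, 'e) pre_digraph \<Rightarrow> ('v, 'e, 'k::field) path_elem
    \<Rightarrow> ('v, 'e, 'k) path_elem \<Rightarrow> ('v, 'e, 'k) path_elem" where
  "path_times Q f g = (\<Sum>p\<in>Poly_Mapping.keys f. \<Sum>q\<in>Poly_Mapping.keys g.
     if fst p = path_end Q q
     then Poly_Mapping.single (fst q, snd q @ snd p)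
            (Poly_Mapping.lookup f p * Poly_Mapping.lookup g q)
     else 0)"

text \<open>\<open>path_scalar Q c\<close> is \<open>c\<close> times the identity \<open>\<Sum>\<^sub>x e\<^sub>x\<close>.\<close>

definition path_scalar :: "('v, 'e) pre_digraph \<Rightarrow> 'k::field \<Rightarrow> ('v, 'e, 'k) path_elem" where
  "path_scalar Q c = (\<Sum>v\<in>verts Q. Poly_Mapping.single (v, []) c)"

definition path_algebra :: "('v, 'e) pre_digraph \<Rightarrow> ('v, 'e, 'k::field) path_elem ring" where
  "path_algebra Q = \<lparr>carrier = {f. Poly_Mapping.keys f \<subseteq> paths Q}, mult = path_times Q,
     one = path_scalar Q 1, zero = 0, add = (+)\<rparr>"

definition path_basis :: "('v, 'e) path \<Rightarrow> ('v, 'e, 'k::field) path_elem" where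
  "path_basis p = Poly_Mapping.single p 1"

definition arrow_ideal :: "('v, 'e) pre_digraph \<Rightarrow> ('v, 'e, 'k::field) path_elem set" where
  "arrow_ideal Q = Idl\<^bsub>path_algebra Q\<^esub> {path_basis (tail Q a, [a]) | a. a \<in> arcs Q}"

definition ideal_power :: "('a, 'b) ring_scheme \<Rightarrow> 'a set \<Rightarrow> nat \<Rightarrow> 'a set" where
  "ideal_power R J n = (ideal_prod R J ^^ n) (carrier R)"

definition admissible :: "('v, 'e) pre_digraph \<Rightarrow> ('v, 'e, 'k::field) path_elem set \<Rightarrow> bool" where
  "admissible Q I \<longleftrightarrow> ideal I (path_algebra Q) \<and>
     I \<subseteq> ideal_power (path_algebra Q) (arrow_ideal Q) 2 \<and>
     (\<exists>m\<ge>2. ideal_power (path_algebra Q) (arrow_ideal Q) m \<subseteq> I)"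

text \<open>
  The data \<open>(Q, I)\<close> of a quadratic monomial algebra \<open>\<Lambda> = kQ/I\<close>.  Since \<open>Q\<close> is finite and \<open>I\<close>
  is admissible, \<open>\<Lambda>\<close> is finite-dimensional.
\<close>

definition quadratic_monomial ::
    "('v, 'e) pre_digraph \<Rightarrow> ('v, 'e, 'k::field) path_elem set \<Rightarrow> bool" where
  "quadratic_monomial Q I \<longleftrightarrow> fin_digraph Q \<and> admissible Q I \<and>
     (\<exists>S \<subseteq> {p \<in> paths Q. length (snd p) = 2}. I = Idl\<^bsub>path_algebra Q\<^esub> (path_basis ` S))"

definition op_quiver :: "('v, 'e) pre_digraph \<Rightarrow> ('v, 'e) pre_digraph" where
  "op_quiver Q = \<lparr>verts = verts Q, arcs = arcs Q, tail = head Q, head = tail Q\<rparr>"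

text \<open>
  The generators are the paths \<open>\<alpha>\<^sup>o\<^sup>p\<beta>\<^sup>o\<^sup>p\<close>; in \<open>op_quiver Q\<close> such a path starts at the head of \<open>\<beta>\<close>
  and traverses \<open>\<beta>\<close> first.
\<close>

definition quadratic_dual_ideal :: "('v, 'e) pre_digraph
    \<Rightarrow> ('v, 'e, 'k::field) path_elem set \<Rightarrow> ('v, 'e, 'k) path_elem set" where
  "quadratic_dual_ideal Q I = Idl\<^bsub>path_algebra (op_quiver Q)\<^esub>
     {path_basis (head Q \<beta>, [\<beta>, \<alpha>]) | \<alpha> \<beta>. \<alpha> \<in> arcs Q \<and> \<beta> \<in> arcs Q \<and>
        head Q \<alpha> = tail Q \<beta> \<and> path_basis (tail Q \<alpha>, [\<alpha>, \<beta>]) \<notin> I}"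

text \<open>
  The notions below are defined for an arbitrary finite quiver \<open>Q\<close> and an ideal \<open>J\<close> of its path
  algebra generated by paths (so that the grading by path length descends to \<open>kQ/J\<close>).  They are
  used for \<open>\<Lambda>\<^sup>!\<close>, i.e. for \<open>op_quiver Q\<close> and \<open>quadratic_dual_ideal Q I\<close>.
\<close>

type_synonym ('v, 'e, 'k) bq_elem = "('v, 'e, 'k) path_elem set"

definition bq_algebra :: "('v, 'e) pre_digraph \<Rightarrow> ('v, 'e, 'k::field) path_elem set
    \<Rightarrow> ('v, 'e, 'k) bq_elem ring" where
  "bq_algebra Q J = path_algebra Q Quot J"

definition bq_class :: "('v, 'e) pre_digraph \<Rightarrow> ('v, 'e, 'k::field) path_elem set
    \<Rightarrow> ('v, 'e, 'k) path_elem \<Rightarrow> ('v, 'e, 'k) bq_elem" where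
  "bq_class Q J f = J +>\<^bsub>path_algebra Q\<^esub> f"

definition bq_scalar :: "('v, 'e) pre_digraph \<Rightarrow> ('v, 'e, 'k::field) path_elem set
    \<Rightarrow> 'k \<Rightarrow> ('v, 'e, 'k) bq_elem" where
  "bq_scalar Q J c = bq_class Q J (path_scalar Q c)"

definition bq_idem :: "('v, 'e) pre_digraph \<Rightarrow> ('v, 'e, 'k::field) path_elem set
    \<Rightarrow> 'v \<Rightarrow> ('v, 'e, 'k) bq_elem" where
  "bq_idem Q J x = bq_class Q J (path_basis (x, []))"

definition bq_degree :: "('v, 'e) pre_digraph \<Rightarrow> ('v, 'e, 'k::field) path_elem set
    \<Rightarrow> nat \<Rightarrow> ('v, 'e, 'k) bq_elem set" where
  "bq_degree Q J n = bq_class Q J `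
     {f \<in> carrier (path_algebra Q). \<forall>p\<in>Poly_Mapping.keys f. length (snd p) = n}"


section \<open>Graded modules\<close>

text \<open>\<^locale>\<open>Module.module\<close> is restricted to commutative rings; this is the left-module version.\<close>

locale left_module = R?: ring R + M?: abelian_group M for R (structure) and M (structure) +
  assumes smult_closed: "\<lbrakk>a \<in> carrier R; x \<in> carrier M\<rbrakk> \<Longrightarrow> a \<odot>\<^bsub>M\<^esub> x \<in> carrier M"
    and smult_l_distr: "\<lbrakk>a \<in> carrier R; b \<in> carrier R; x \<in> carrier M\<rbrakk> \<Longrightarrow>
      (a \<oplus>\<^bsub>R\<^esub> b) \<odot>\<^bsub>M\<^esub> x = a \<odot>\<^bsub>M\<^esub> x \<oplus>\<^bsub>M\<^esub> b \<odot>\<^bsub>M\<^esub> x"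
    and smult_r_distr: "\<lbrakk>a \<in> carrier R; x \<in> carrier M; y \<in> carrier M\<rbrakk> \<Longrightarrow>
      a \<odot>\<^bsub>M\<^esub> (x \<oplus>\<^bsub>M\<^esub> y) = a \<odot>\<^bsub>M\<^esub> x \<oplus>\<^bsub>M\<^esub> a \<odot>\<^bsub>M\<^esub> y"
    and smult_assoc: "\<lbrakk>a \<in> carrier R; b \<in> carrier R; x \<in> carrier M\<rbrakk> \<Longrightarrow>
      (a \<otimes>\<^bsub>R\<^esub> b) \<odot>\<^bsub>M\<^esub> x = a \<odot>\<^bsub>M\<^esub> (b \<odot>\<^bsub>M\<^esub> x)"
    and smult_one: "x \<in> carrier M \<Longrightarrow> \<one>\<^bsub>R\<^esub> \<odot>\<^bsub>M\<^esub> x = x"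

text \<open>
  As in \<^typ>\<open>('a, 'b) module\<close>, the inherited ring fields \<open>mult\<close> and \<open>one\<close> carry no meaning.
  \<open>hcomp M n\<close> is the homogeneous component \<open>M\<^sub>n\<close>.
\<close>

record ('a, 'b) graded_module = "('a, 'b) module" +
  hcomp :: "int \<Rightarrow> 'b set"

definition fin_dim :: "('v, 'e) pre_digraph \<Rightarrow> ('v, 'e, 'k::field) path_elem set
    \<Rightarrow> (('v, 'e, 'k) bq_elem, 'm) graded_module \<Rightarrow> 'm set \<Rightarrow> bool" where
  "fin_dim Q J M U \<longleftrightarrow> (\<exists>B. finite B \<and> B \<subseteq> U \<and>
     (\<forall>u\<in>U. \<exists>c. u = (\<Oplus>\<^bsub>M\<^esub>b\<in>B. bq_scalar Q J (c b) \<odot>\<^bsub>M\<^esub> b)))"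

definition gr_module :: "('v, 'e) pre_digraph \<Rightarrow> ('v, 'e, 'k::field) path_elem set
    \<Rightarrow> (('v, 'e, 'k) bq_elem, 'm) graded_module \<Rightarrow> bool" where
  "gr_module Q J M \<longleftrightarrow> left_module (bq_algebra Q J) M \<and>
     (\<forall>n. additive_subgroup (hcomp M n) M) \<and>
     (\<forall>x\<in>carrier M. \<exists>!c. (\<forall>n. c n \<in> hcomp M n) \<and> finite {n. c n \<noteq> \<zero>\<^bsub>M\<^esub>} \<and>
        x = (\<Oplus>\<^bsub>M\<^esub>n\<in>{n. c n \<noteq> \<zero>\<^bsub>M\<^esub>}. c n)) \<and>
     (\<forall>i n. \<forall>a\<in>bq_degree Q J i. \<forall>x\<in>hcomp M n. a \<odot>\<^bsub>M\<^esub> x \<in> hcomp M (n + int i)) \<and>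
     (\<forall>n. fin_dim Q J M (hcomp M n))"

text \<open>
  Morphisms are extensional functions (equal to \<^const>\<open>undefined\<close> outside the carrier), so that
  equality of morphisms is equality of functions.
\<close>

definition gr_hom :: "('v, 'e) pre_digraph \<Rightarrow> ('v, 'e, 'k::field) path_elem set
    \<Rightarrow> (('v, 'e, 'k) bq_elem, 'm) graded_module \<Rightarrow> (('v, 'e, 'k) bq_elem, 'n) graded_module
    \<Rightarrow> ('m \<Rightarrow> 'n) set" where
  "gr_hom Q J M N = {f \<in> carrier M \<rightarrow>\<^sub>E carrier N.
     (\<forall>x\<in>carrier M. \<forall>y\<in>carrier M. f (x \<oplus>\<^bsub>M\<^esub> y) = f x \<oplus>\<^bsub>N\<^esub> f y) \<and>
     (\<forall>a\<in>carrier (bq_algebra Q J). \<forall>x\<in>carrier M. f (a \<odot>\<^bsub>M\<^esub> x) = a \<odot>\<^bsub>N\<^esub> f x) \<and>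
     (\<forall>n. f ` hcomp M n \<subseteq> hcomp N n)}"

definition gr_ker :: "('a, 'm) graded_module \<Rightarrow> ('a, 'n) graded_module \<Rightarrow> ('m \<Rightarrow> 'n) \<Rightarrow> 'm set"
  where "gr_ker M N f = {x \<in> carrier M. f x = \<zero>\<^bsub>N\<^esub>}"

definition gr_im :: "('a, 'm) graded_module \<Rightarrow> ('m \<Rightarrow> 'n) \<Rightarrow> 'n set"
  where "gr_im M f = f ` carrier M"

definition gr_shift :: "int \<Rightarrow> ('a, 'm) graded_module \<Rightarrow> ('a, 'm) graded_module" where
  "gr_shift i M = M\<lparr>hcomp := \<lambda>n. hcomp M (n - i)\<rparr>"

definition gr_dsum :: "('a, 'm) graded_module list \<Rightarrow> ('a, nat \<Rightarrow> 'm) graded_module" where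
  "gr_dsum Ms = \<lparr>carrier = (\<Pi>\<^sub>E j\<in>{..<length Ms}. carrier (Ms ! j)),
     mult = undefined, one = undefined,
     zero = (\<lambda>j\<in>{..<length Ms}. \<zero>\<^bsub>Ms ! j\<^esub>),
     add = (\<lambda>f g. \<lambda>j\<in>{..<length Ms}. f j \<oplus>\<^bsub>Ms ! j\<^esub> g j),
     smult = (\<lambda>a f. \<lambda>j\<in>{..<length Ms}. a \<odot>\<^bsub>Ms ! j\<^esub> f j),
     hcomp = (\<lambda>n. \<Pi>\<^sub>E j\<in>{..<length Ms}. hcomp (Ms ! j) n)\<rparr>"

text \<open>The indecomposable projective \<open>(kQ/J)e\<^sub>x\<close>, generated in degree \<open>0\<close>.\<close>

definition gr_proj :: "('v, 'e) pre_digraph \<Rightarrow> ('v, 'e, 'k::field) path_elem set \<Rightarrow> 'v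
    \<Rightarrow> (('v, 'e, 'k) bq_elem, ('v, 'e, 'k) bq_elem) graded_module" where
  "gr_proj Q J x = (let A = bq_algebra Q J;
       P = {a \<otimes>\<^bsub>A\<^esub> bq_idem Q J x | a. a \<in> carrier A}
     in \<lparr>carrier = P, mult = undefined, one = undefined, zero = \<zero>\<^bsub>A\<^esub>, add = add A,
         smult = mult A,
         hcomp = (\<lambda>n. if 0 \<le> n then P \<inter> bq_degree Q J (nat n) else {\<zero>\<^bsub>A\<^esub>})\<rparr>)"

text \<open>
  The indecomposable injective with socle in degree \<open>0\<close>: the graded dual of the right module
  \<open>e\<^sub>x(kQ/J)\<close>, the direct sum over \<open>y\<close> of the spans of the nonzero paths from \<open>y\<close> to \<open>x\<close>.
  An element is a \<open>k\<close>-linear functional that is nonzero on only finitely many degrees, an algebra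
  element \<open>a\<close> acts by \<open>(a\<phi>)(b) = \<phi>(ba)\<close>, and \<open>\<phi>\<close> has degree \<open>m\<close> if it vanishes on all degrees of
  \<open>e\<^sub>x(kQ/J)\<close> other than \<open>-m\<close>.
\<close>

definition bq_right_ideal :: "('v, 'e) pre_digraph \<Rightarrow> ('v, 'e, 'k::field) path_elem set \<Rightarrow> 'v
    \<Rightarrow> ('v, 'e, 'k) bq_elem set" where
  "bq_right_ideal Q J x =
     {bq_idem Q J x \<otimes>\<^bsub>bq_algebra Q J\<^esub> a | a. a \<in> carrier (bq_algebra Q J)}"

definition graded_dual :: "('v, 'e) pre_digraph \<Rightarrow> ('v, 'e, 'k::field) path_elem set \<Rightarrow> 'v
    \<Rightarrow> (('v, 'e, 'k) bq_elem \<Rightarrow> 'k) set" where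
  "graded_dual Q J x = (let A = bq_algebra Q J; E = bq_right_ideal Q J x
     in {\<phi> \<in> extensional E.
          (\<forall>a\<in>E. \<forall>b\<in>E. \<phi> (a \<oplus>\<^bsub>A\<^esub> b) = \<phi> a + \<phi> b) \<and>
          (\<forall>c. \<forall>a\<in>E. \<phi> (bq_scalar Q J c \<otimes>\<^bsub>A\<^esub> a) = c * \<phi> a) \<and>
          finite {n. \<exists>a \<in> E \<inter> bq_degree Q J n. \<phi> a \<noteq> 0}})"

definition gr_inj :: "('v, 'e) pre_digraph \<Rightarrow> ('v, 'e, 'k::field) path_elem set \<Rightarrow> 'v
    \<Rightarrow> (('v, 'e, 'k) bq_elem, ('v, 'e, 'k) bq_elem \<Rightarrow> 'k) graded_module" where
  "gr_inj Q J x = (let A = bq_algebra Q J; E = bq_right_ideal Q J x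
     in \<lparr>carrier = graded_dual Q J x, mult = undefined, one = undefined,
         zero = (\<lambda>b\<in>E. 0), add = (\<lambda>\<phi> \<psi>. \<lambda>b\<in>E. \<phi> b + \<psi> b),
         smult = (\<lambda>a \<phi>. \<lambda>b\<in>E. \<phi> (b \<otimes>\<^bsub>A\<^esub> a)),
         hcomp = (\<lambda>m. {\<phi> \<in> graded_dual Q J x.
            \<forall>n. int n \<noteq> - m \<longrightarrow> (\<forall>b \<in> E \<inter> bq_degree Q J n. \<phi> b = 0)})\<rparr>)"

text \<open>A list of pairs \<open>(x, i)\<close> stands for the direct sum of the \<open>i\<close>-fold shifts at \<open>x\<close>.\<close>

definition proj_sum :: "('v, 'e) pre_digraph \<Rightarrow> ('v, 'e, 'k::field) path_elem set
    \<Rightarrow> ('v \<times> int) list \<Rightarrow> (('v, 'e, 'k) bq_elem, nat \<Rightarrow> ('v, 'e, 'k) bq_elem) graded_module" where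
  "proj_sum Q J xs = gr_dsum (map (\<lambda>(x, i). gr_shift i (gr_proj Q J x)) xs)"

definition inj_sum :: "('v, 'e) pre_digraph \<Rightarrow> ('v, 'e, 'k::field) path_elem set
    \<Rightarrow> ('v \<times> int) list
    \<Rightarrow> (('v, 'e, 'k) bq_elem, nat \<Rightarrow> ('v, 'e, 'k) bq_elem \<Rightarrow> 'k) graded_module" where
  "inj_sum Q J xs = gr_dsum (map (\<lambda>(x, i). gr_shift i (gr_inj Q J x)) xs)"

definition gmod :: "('v, 'e) pre_digraph \<Rightarrow> ('v, 'e, 'k::field) path_elem set
    \<Rightarrow> (('v, 'e, 'k) bq_elem, 'm) graded_module set" where
  "gmod Q J = {M. gr_module Q J M \<and> fin_dim Q J M (carrier M)}"

definition fin_pres :: "('v, 'e) pre_digraph \<Rightarrow> ('v, 'e, 'k::field) path_elem set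
    \<Rightarrow> (('v, 'e, 'k) bq_elem, 'm) graded_module set" where
  "fin_pres Q J = {M. gr_module Q J M \<and>
     (\<exists>xs ys d e. set xs \<subseteq> verts Q \<times> UNIV \<and> set ys \<subseteq> verts Q \<times> UNIV \<and>
        d \<in> gr_hom Q J (proj_sum Q J ys) (proj_sum Q J xs) \<and>
        e \<in> gr_hom Q J (proj_sum Q J xs) M \<and>
        gr_im (proj_sum Q J ys) d = gr_ker (proj_sum Q J xs) M e \<and>
        gr_im (proj_sum Q J xs) e = carrier M)}"

definition fin_copres :: "('v, 'e) pre_digraph \<Rightarrow> ('v, 'e, 'k::field) path_elem set
    \<Rightarrow> (('v, 'e, 'k) bq_elem, 'm) graded_module set" where
  "fin_copres Q J = {N. gr_module Q J N \<and>
     (\<exists>xs ys d e. set xs \<subseteq> verts Q \<times> UNIV \<and> set ys \<subseteq> verts Q \<times> UNIV \<and>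
        e \<in> gr_hom Q J N (inj_sum Q J xs) \<and>
        d \<in> gr_hom Q J (inj_sum Q J xs) (inj_sum Q J ys) \<and>
        gr_ker N (inj_sum Q J xs) e = {\<zero>\<^bsub>N\<^esub>} \<and>
        gr_im N e = gr_ker (inj_sum Q J xs) (inj_sum Q J ys) d)}"

text \<open>
  The \<open>n\<close>-th term of the resolution is the sum of the projectives at the vertices \<open>xs n\<close>, shifted
  by \<open>n\<close>; an empty list is the zero module, so finiteness means that \<open>xs n\<close> is eventually empty.
\<close>

definition koszul :: "('v, 'e) pre_digraph \<Rightarrow> ('v, 'e, 'k::field) path_elem set
    \<Rightarrow> (('v, 'e, 'k) bq_elem, 'm) graded_module \<Rightarrow> bool" where
  "koszul Q J M \<longleftrightarrow> gr_module Q J M \<and>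
     (\<exists>(xs :: nat \<Rightarrow> 'v list) d e. let P = (\<lambda>n. proj_sum Q J (map (\<lambda>x. (x, int n)) (xs n))) in
        (\<forall>n. set (xs n) \<subseteq> verts Q) \<and> (\<exists>l. \<forall>n>l. xs n = []) \<and>
        e \<in> gr_hom Q J (P 0) M \<and> (\<forall>n. d n \<in> gr_hom Q J (P (Suc n)) (P n)) \<and>
        gr_im (P 0) e = carrier M \<and>
        gr_im (P 1) (d 0) = gr_ker (P 0) M e \<and>
        (\<forall>n. gr_im (P (Suc (Suc n))) (d (Suc n)) = gr_ker (P (Suc n)) (P n) (d n)))"

definition cokoszul :: "('v, 'e) pre_digraph \<Rightarrow> ('v, 'e, 'k::field) path_elem set
    \<Rightarrow> (('v, 'e, 'k) bq_elem, 'm) graded_module \<Rightarrow> bool" where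
  "cokoszul Q J M \<longleftrightarrow> gr_module Q J M \<and>
     (\<exists>(xs :: nat \<Rightarrow> 'v list) d e. let I = (\<lambda>n. inj_sum Q J (map (\<lambda>x. (x, - int n)) (xs n))) in
        (\<forall>n. set (xs n) \<subseteq> verts Q) \<and> (\<exists>l. \<forall>n>l. xs n = []) \<and>
        e \<in> gr_hom Q J M (I 0) \<and> (\<forall>n. d n \<in> gr_hom Q J (I n) (I (Suc n))) \<and>
        gr_ker M (I 0) e = {\<zero>\<^bsub>M\<^esub>} \<and>
        gr_im M e = gr_ker (I 0) (I 1) (d 0) \<and>
        (\<forall>n. gr_im (I n) (d n) = gr_ker (I (Suc n)) (I (Suc (Suc n))) (d (Suc n))))"

definition linear_module :: "('v, 'e) pre_digraph \<Rightarrow> ('v, 'e, 'k::field) path_elem set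
    \<Rightarrow> (('v, 'e, 'k) bq_elem, 'm) graded_module \<Rightarrow> bool" where
  "linear_module Q J M \<longleftrightarrow> (\<exists>i. koszul Q J (gr_shift (- i) M))"

definition colinear_module :: "('v, 'e) pre_digraph \<Rightarrow> ('v, 'e, 'k::field) path_elem set
    \<Rightarrow> (('v, 'e, 'k) bq_elem, 'm) graded_module \<Rightarrow> bool" where
  "colinear_module Q J M \<longleftrightarrow> (\<exists>i. cokoszul Q J (gr_shift (- i) M))"


section \<open>Localisations and Serre quotients\<close>

text \<open>\<open>Comp C X Y Z g f\<close> is the composite of \<open>f : X \<rightarrow> Y\<close> and \<open>g : Y \<rightarrow> Z\<close>.\<close>

record ('o, 'f) category =
  Ob :: "'o set"
  Hom :: "'o \<Rightarrow> 'o \<Rightarrow> 'f set"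
  Ident :: "'o \<Rightarrow> 'f"
  Comp :: "'o \<Rightarrow> 'o \<Rightarrow> 'o \<Rightarrow> 'f \<Rightarrow> 'f \<Rightarrow> 'f"

definition isomorphic_in :: "('o, 'f) category \<Rightarrow> 'o \<Rightarrow> 'o \<Rightarrow> bool" where
  "isomorphic_in C X Y \<longleftrightarrow> X \<in> Ob C \<and> Y \<in> Ob C \<and>
     (\<exists>f\<in>Hom C X Y. \<exists>g\<in>Hom C Y X.
        Comp C X Y X g f = Ident C X \<and> Comp C Y X Y f g = Ident C Y)"

text \<open>
  The localisation \<open>C[S\<^sup>-\<^sup>1]\<close> of Gabriel and Zisman, for a set \<open>S\<close> of morphisms given as triples
  (source, morphism, target).  Morphisms are zigzags of morphisms of \<open>C\<close> and formal inverses of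
  elements of \<open>S\<close>, modulo the congruence generated by the evident relations.  The letter
  \<open>Fwd X f Y\<close> is \<open>f : X \<rightarrow> Y\<close>, and \<open>Bwd X s Y\<close> is the formal inverse, from \<open>X\<close> to \<open>Y\<close>, of
  \<open>s : Y \<rightarrow> X\<close>.  Words are read from left to right, the morphism applied first coming first.
\<close>

datatype ('o, 'f) letter = Fwd 'o 'f 'o | Bwd 'o 'f 'o

inductive zigzag :: "('o, 'f) category \<Rightarrow> ('o \<times> 'f \<times> 'o) set
    \<Rightarrow> 'o \<Rightarrow> ('o, 'f) letter list \<Rightarrow> 'o \<Rightarrow> bool"
  for C S where
  zz_nil: "X \<in> Ob C \<Longrightarrow> zigzag C S X [] X"
| zz_fwd: "\<lbrakk>X \<in> Ob C; f \<in> Hom C X Y; zigzag C S Y w Z\<rbrakk> \<Longrightarrow> zigzag C S X (Fwd X f Y # w) Z"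
| zz_bwd: "\<lbrakk>X \<in> Ob C; s \<in> Hom C Y X; (Y, s, X) \<in> S; zigzag C S Y w Z\<rbrakk>
    \<Longrightarrow> zigzag C S X (Bwd X s Y # w) Z"

inductive zz_rule :: "('o, 'f) category \<Rightarrow> ('o, 'f) letter list \<Rightarrow> ('o, 'f) letter list \<Rightarrow> bool"
  for C where
  zz_id: "zz_rule C [Fwd X (Ident C X) X] []"
| zz_comp: "zz_rule C [Fwd X f Y, Fwd Y g Z] [Fwd X (Comp C X Y Z g f) Z]"
| zz_inv_right: "zz_rule C [Fwd X s Y, Bwd Y s X] []"
| zz_inv_left: "zz_rule C [Bwd Y s X, Fwd X s Y] []"

definition zz_step :: "('o, 'f) category \<Rightarrow> ('o \<times> 'f \<times> 'o) set \<Rightarrow> 'o \<Rightarrow> 'o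
    \<Rightarrow> ('o, 'f) letter list \<Rightarrow> ('o, 'f) letter list \<Rightarrow> bool" where
  "zz_step C S X Y w w' \<longleftrightarrow> zigzag C S X w Y \<and> zigzag C S X w' Y \<and>
     (\<exists>u l r v. w = u @ l @ v \<and> w' = u @ r @ v \<and> zz_rule C l r)"

definition zz_rel :: "('o, 'f) category \<Rightarrow> ('o \<times> 'f \<times> 'o) set \<Rightarrow> 'o \<Rightarrow> 'o
    \<Rightarrow> ('o, 'f) letter list rel" where
  "zz_rel C S X Y = {(w, w'). zigzag C S X w Y \<and> zigzag C S X w' Y \<and>
     equivclp (zz_step C S X Y) w w'}"

definition localization :: "('o, 'f) category \<Rightarrow> ('o \<times> 'f \<times> 'o) set
    \<Rightarrow> ('o, ('o, 'f) letter list set) category" where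
  "localization C S = \<lparr>Ob = Ob C,
     Hom = (\<lambda>X Y. {w. zigzag C S X w Y} // zz_rel C S X Y),
     Ident = (\<lambda>X. zz_rel C S X X `` {[]}),
     Comp = (\<lambda>X Y Z \<psi> \<phi>. zz_rel C S X Z `` {u @ v | u v. u \<in> \<phi> \<and> v \<in> \<psi>})\<rparr>"

text \<open>
  The underlying set of a graded module is a subset of the type \<^typ>\<open>'m\<close>.  Components are
  finite-dimensional and there are countably many, so every graded module has an isomorphic copy
  in any infinite type \<^typ>\<open>'m\<close> of at least the cardinality of the field.
\<close>

definition gr_category :: "('v, 'e) pre_digraph \<Rightarrow> ('v, 'e, 'k::field) path_elem set
    \<Rightarrow> (('v, 'e, 'k) bq_elem, 'm) graded_module set
    \<Rightarrow> ((('v, 'e, 'k) bq_elem, 'm) graded_module, 'm \<Rightarrow> 'm) category" where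
  "gr_category Q J \<A> = \<lparr>Ob = \<A>, Hom = gr_hom Q J,
     Ident = (\<lambda>X. \<lambda>x\<in>carrier X. x),
     Comp = (\<lambda>X Y Z g f. compose (carrier X) g f)\<rparr>"

text \<open>
  The morphisms \<open>f : M \<rightarrow> N\<close> whose kernel and cokernel belong to \<open>\<B>\<close>, i.e. for which there is an
  exact sequence \<open>0 \<rightarrow> K \<rightarrow> M \<rightarrow> N \<rightarrow> C \<rightarrow> 0\<close> with \<open>K\<close> and \<open>C\<close> in \<open>\<B>\<close>.  Exactness is that of graded
  modules; the subcategories \<open>\<A>\<close> considered are closed under kernels and cokernels.
\<close>

definition serre_isos :: "('v, 'e) pre_digraph \<Rightarrow> ('v, 'e, 'k::field) path_elem set
    \<Rightarrow> (('v, 'e, 'k) bq_elem, 'm) graded_module set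
    \<Rightarrow> ((('v, 'e, 'k) bq_elem, 'm) graded_module \<times> ('m \<Rightarrow> 'm) \<times>
        (('v, 'e, 'k) bq_elem, 'm) graded_module) set" where
  "serre_isos Q J \<B> = {(M, f, N). f \<in> gr_hom Q J M N \<and>
     (\<exists>K\<in>\<B>. \<exists>i\<in>gr_hom Q J K M. inj_on i (carrier K) \<and> gr_im K i = gr_ker M N f) \<and>
     (\<exists>C\<in>\<B>. \<exists>p\<in>gr_hom Q J N C. gr_im N p = carrier C \<and> gr_ker N C p = gr_im M f)}"

text \<open>
  The Serre quotient \<open>\<A>/\<B>\<close> of the full subcategory \<open>\<A>\<close> of graded modules by its Serre
  subcategory \<open>\<B>\<close>, as the localisation at the morphisms with kernel and cokernel in \<open>\<B>\<close>.
\<close>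

definition serre_quotient :: "('v, 'e) pre_digraph \<Rightarrow> ('v, 'e, 'k::field) path_elem set
    \<Rightarrow> (('v, 'e, 'k) bq_elem, 'm) graded_module set
    \<Rightarrow> (('v, 'e, 'k) bq_elem, 'm) graded_module set
    \<Rightarrow> ((('v, 'e, 'k) bq_elem, 'm) graded_module,
        ((('v, 'e, 'k) bq_elem, 'm) graded_module, 'm \<Rightarrow> 'm) letter list set) category" where
  "serre_quotient Q J \<A> \<B> = localization (gr_category Q J \<A>) (serre_isos Q J \<B>)"

end

theory Submission imports Defs "HOL-Library.Function_Algebras" begin

text \<open>
  The dual of a quadratic monomial algebra is again a monomial algebra with quadratic relations, and a
  finitely presented module over it becomes linear after its low degrees are cut off.  In degrees above
  the generators and relations of a presentation, the module \<open>M\<close> is generated by the preceding degree, and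
  every relation \<open>\<Sum> a u\<^sub>a = 0\<close> comes from the quadratic relations \<open>a b = 0\<close> of the algebra
  (\<open>fin_pres_tail_quadratic\<close>).  The tail has these properties from its lowest degree on.

  A module with these properties, concentrated in degrees \<open>\<ge> 0\<close>, is Koszul (\<open>koszul_if_quadratic\<close>):
  it has generators in degree \<open>0\<close> and relations in degree \<open>1\<close>, and over a quadratic monomial algebra the
  kernel of a linear map of free modules is generated by its linear elements, because relations split
  according to arrows (\<open>syzygy_combination\<close>).  The resolution is finite, because a nonzero term in
  homological degree \<open>n\<close> yields a nonzero path of length about \<open>n\<close> in the original finite-dimensional
  algebra (\<open>linear_resolution_exists\<close>).

  Finitely copresented modules are treated by transposing every step.  There the high degrees are cut off,
  generation by arrows becomes the injectivity of \<open>x \<mapsto> (a x)\<^sub>a\<close>, and exactness of the linear complexes of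
  injectives follows from the double annihilator theorem (\<open>cokoszul_if_quadratic\<close>).

  The inclusion of the tail, or the projection onto the truncation, has finite-dimensional kernel and
  cokernel, because \<open>M\<close> is bounded on the other side.  It therefore becomes invertible in the localisation
  that defines the Serre quotient.  Truncations are linear or colinear, hence belong to the subcategory.
\<close>

section \<open>Linear algebra in coordinate spaces\<close>

interpretation fv: vector_space "%(c::'k::field) (f::'x => 'k) x. c * f x"
 by unfold_locales (auto simp: fun_eq_iff algebra_simps)

interpretation fv_field: vector_space_pair "%(c::'k::field) (f::'x => 'k) x. c * f x" "(*) :: 'k => 'k => 'k"
 by unfold_locales (auto simp: algebra_simps)

lemma sum_fun_apply: "(\<Sum>i\<in>S. f i) x = (\<Sum>i\<in>S. (f i x :: 'k::comm_monoid_add))"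
 by (induction S rule: infinite_finite_induct) auto

lemma fun_eq_sum_units:
 fixes f :: "'x => 'k::field"
 assumes "finite X" and "!!x. x ~: X ==> f x = 0"
 shows "f = (\<Sum>x\<in>X. (%y. f x * (if y = x then 1 else 0)))"
proof
 fix y
 have "(\<Sum>x\<in>X. f x * (if y = x then 1 else 0)) = (\<Sum>x\<in>X. if y = x then f x else 0)"
  by (rule sum.cong) auto
 then show "f y = (\<Sum>x\<in>X. (%y. f x * (if y = x then 1 else 0))) y"
  using assms by (auto simp: sum_fun_apply)
qed

text \<open>
 The double annihilator theorem for finitely many coordinates: outside the span there would be a linear
 form that vanishes on the span but not on \<open>\<phi>\<close>.
\<close>
lemma in_span_if_annihilated:
 fixes \<phi> :: "'x => 'k::field"
 assumes X: "finite X" and L: "!!l x. l \<in> L ==> x ~: X ==> l x = 0"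
  and \<phi>: "!!x. x ~: X ==> \<phi> x = 0"
  and ann: "!!u. [|!!x. x ~: X ==> u x = 0; !!l. l \<in> L ==> (\<Sum>x\<in>X. l x * u x) = 0|]
   ==> (\<Sum>x\<in>X. \<phi> x * u x) = 0"
 shows "\<phi> \<in> fv.span L"
proof (rule ccontr)
 assume n: "\<phi> ~: fv.span L"
 obtain B where B: "B <= L" "fv.independent B" "L <= fv.span B"
  by (rule fv.maximal_independent_subset)
 have "fv.span B = fv.span L"
  using B by (metis fv.span_mono fv.span_span subset_antisym)
 with n have nB: "\<phi> ~: fv.span B" by simp
 then have "fv.independent (insert \<phi> B)" using B(2) by (rule fv.independent_insertI)
 from fv_field.linear_independent_extend[OF this, of "%x. if x = \<phi> then 1 else 0"]
 obtain g where g: "Vector_Spaces.linear (%(c::'k) (f::'x => 'k) x. c * f x) (*) g"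
  and gB: "\<forall>x\<in>insert \<phi> B. g x = (if x = \<phi> then 1 else 0)" by blast
 interpret g: Vector_Spaces.linear "%(c::'k) (f::'x => 'k) x. c * f x" "(*)" g by fact
 have "g b = 0" if "b \<in> B" for b
  using gB that nB fv.span_base[OF that] by auto
 then have gL: "g l = 0" if "l \<in> L" for l
  using g.eq_0_on_span[of B l] B(3) that by blast
 define u where "u x = (if x \<in> X then g (%y. if y = x then 1 else 0) else 0)" for x
 have gf: "g f = (\<Sum>x\<in>X. f x * u x)" if f: "!!x. x ~: X ==> f x = 0" for f
 proof -
  have "g f = g (\<Sum>x\<in>X. (%y. f x * (if y = x then 1 else 0)))"
   using fun_eq_sum_units[OF X f] by simp
  also have "... = (\<Sum>x\<in>X. g (%y. f x * (if y = x then 1 else 0)))"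
   by (rule g.sum)
  also have "... = (\<Sum>x\<in>X. f x * u x)"
   by (rule sum.cong) (auto simp: u_def g.scale)
  finally show ?thesis .
 qed
 have "(\<Sum>x\<in>X. \<phi> x * u x) = 0"
 proof (rule ann)
  show "(\<Sum>x\<in>X. l x * u x) = 0" if "l \<in> L" for l
   using gf[of l] L[OF that] gL[OF that] by simp
 qed (simp add: u_def)
 moreover have "(\<Sum>x\<in>X. \<phi> x * u x) = 1"
  using gf[of \<phi>] \<phi> gB by simp
 ultimately show False by simp
qed

lemma span_imageE:
 fixes row :: "'i => 'x => 'k::field"
 assumes "finite K" "\<phi> \<in> fv.span (row ` K)"
 obtains s where "\<phi> = (%x. \<Sum>\<kappa>\<in>K. s \<kappa> * row \<kappa> x)"
proof -
 have "\<exists>s. \<phi> = (%x. \<Sum>\<kappa>\<in>K. s \<kappa> * row \<kappa> x)" using assms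
 proof (induction K arbitrary: \<phi> rule: finite_induct)
  case empty
  then show ?case by (auto simp: fv.span_empty fun_eq_iff)
 next
  case (insert k K)
  from insert.prems obtain c where "(%x. \<phi> x - c * row k x) \<in> fv.span (row ` K)"
   by (auto simp: fv.span_insert fun_diff_def)
  from insert.IH[OF this] obtain s where s: "(%x. \<phi> x - c * row k x) = (%x. \<Sum>\<kappa>\<in>K. s \<kappa> * row \<kappa> x)"
   by blast
  have "(\<Sum>\<kappa>\<in>insert k K. (s(k := c)) \<kappa> * row \<kappa> x) = \<phi> x" for x
  proof -
   have "(\<Sum>\<kappa>\<in>K. (s(k := c)) \<kappa> * row \<kappa> x) = (\<Sum>\<kappa>\<in>K. s \<kappa> * row \<kappa> x)"
    using insert.hyps by (intro sum.cong) auto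
   then show ?thesis using insert.hyps fun_cong[OF s, of x] by (simp add: algebra_simps diff_eq_eq)
  qed
  then show ?case by (intro exI[of _ "s(k := c)"]) auto
 qed
 then show thesis using that by blast
qed

text \<open>
 Solvability of linear equations by duality.  Exactness of complexes of injectives comes down to this
 form, in which the unknowns are coefficients of the rows.
\<close>
lemma row_combination_if_annihilated:
 fixes row :: "'i => 'x => 'k::field"
 assumes K: "finite K" and X: "finite X"
  and ann: "!!u. [|!!x. x ~: X ==> u x = 0; !!\<kappa>. \<kappa> \<in> K ==> (\<Sum>x\<in>X. row \<kappa> x * u x) = 0|]
   ==> (\<Sum>x\<in>X. \<phi> x * u x) = 0"
 obtains s where "!!x. x \<in> X ==> \<phi> x = (\<Sum>\<kappa>\<in>K. s \<kappa> * row \<kappa> x)"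
proof -
 define cut where "cut f x = (if x \<in> X then f x else 0)" for f :: "'x => 'k" and x
 have cut: "(\<Sum>x\<in>X. cut f x * u x) = (\<Sum>x\<in>X. f x * u x)" for f u
  by (rule sum.cong) (auto simp: cut_def)
 have "cut \<phi> \<in> fv.span ((%\<kappa>. cut (row \<kappa>)) ` K)"
 proof (rule in_span_if_annihilated[OF X])
  fix u :: "'x => 'k"
  assume u: "!!x. x ~: X ==> u x = 0"
   and rel: "!!l. l \<in> (%\<kappa>. cut (row \<kappa>)) ` K ==> (\<Sum>x\<in>X. l x * u x) = 0"
  have "(\<Sum>x\<in>X. row \<kappa> x * u x) = 0" if "\<kappa> \<in> K" for \<kappa>
   using rel[of "cut (row \<kappa>)"] that by (simp add: cut)
  from ann[OF u this] show "(\<Sum>x\<in>X. cut \<phi> x * u x) = 0" by (simp add: cut)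
 qed (auto simp: cut_def)
 from span_imageE[OF K this] obtain s where "cut \<phi> = (%x. \<Sum>\<kappa>\<in>K. s \<kappa> * cut (row \<kappa>) x)" .
 then have "\<phi> x = (\<Sum>\<kappa>\<in>K. s \<kappa> * row \<kappa> x)" if "x \<in> X" for x
  using that by (auto simp: fun_eq_iff cut_def split: if_splits)
 then show thesis by (rule that)
qed


section \<open>Linear syzygies over a quadratic monomial algebra, in coordinates\<close>

text \<open>
 A basis whose members are each supported on the coordinates of one label.  The label of a coordinate
 \<open>(i, a)\<close> will be a vertex of the arrow \<open>a\<close>, so such a member determines an indecomposable projective or
 injective.
\<close>
definition label_basis :: "('x => 'v) => ('x => 'k::field) set => ('v \<times> ('x => 'k)) list => bool"
 where "label_basis lab R bs \<longleftrightarrow>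
  (\<forall>(v, r)\<in>set bs. r \<in> R & (\<exists>x. r x ~= 0) & (\<forall>x. r x ~= 0 --> lab x = v)) &
  (\<forall>t. (\<forall>x. (\<Sum>l<length bs. t l * snd (bs ! l) x) = 0) --> (\<forall>l<length bs. t l = 0)) &
  (\<forall>r\<in>R. \<exists>t. \<forall>x. r x = (\<Sum>l<length bs. t l * snd (bs ! l) x))"

text \<open>
 Closure under restriction to a label makes \<open>R\<close> the direct sum of its parts with one label, so a
 maximal independent set of vectors with one label already spans.
\<close>
lemma label_basis_exists:
 fixes R :: "('x => 'k::field) set" and lab :: "'x => 'v"
 assumes X: "finite X" and supp: "!!r x. r \<in> R ==> x ~: X ==> r x = 0"
  and restr: "!!r v. r \<in> R ==> (%x. if lab x = v then r x else 0) \<in> R"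
 shows "\<exists>bs. label_basis lab R bs"
proof -
 define H where "H = {r \<in> R. \<exists>v. \<forall>x. r x ~= 0 --> lab x = v}"
 obtain B where B: "B <= H" "fv.independent B" "H <= fv.span B"
  by (rule fv.maximal_independent_subset)
 define U where "U = (%x y. if y = x then (1::'k) else 0) ` X"
 have "B <= fv.span U"
 proof
  fix r assume "r \<in> B"
  then have "!!x. x ~: X ==> r x = 0" using B(1) supp by (auto simp: H_def)
  from fun_eq_sum_units[OF X this] have eq: "r = (\<Sum>x\<in>X. (%y. r x * (if y = x then 1 else 0)))" .
  show "r \<in> fv.span U"
   by (subst eq, rule fv.span_sum, rule fv.span_scale, rule fv.span_base) (auto simp: U_def)
 qed
 then have finB: "finite B"
  using fv.independent_span_bound[of U B] B(2) X by (auto simp: U_def)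
 have R_span: "R <= fv.span B"
 proof
  fix r assume r: "r \<in> R"
  have eq: "r = (\<Sum>v\<in>lab ` X. (%x. if lab x = v then r x else 0))"
  proof
   fix x
   show "r x = (\<Sum>v\<in>lab ` X. (%x. if lab x = v then r x else 0)) x"
    using X supp[OF r] by (auto simp: sum_fun_apply)
  qed
  have "(%x. if lab x = v then r x else 0) \<in> fv.span B" for v
   by (rule subsetD[OF B(3)]) (use restr[OF r, of v] in "auto simp: H_def")
  then show "r \<in> fv.span B" by (subst eq) (rule fv.span_sum)
 qed
 obtain rs where rs: "set rs = B" "distinct rs"
  using finite_distinct_list[OF finB] by blast
 have sum_rs: "(\<Sum>l<length rs. g (rs ! l)) = sum g B" for g :: "('x => 'k) => 'k"
  using sum.reindex_bij_betw[OF bij_betw_nth[OF rs(2) refl], where g = g] rs(1) by (simp add: lessThan_atLeast0)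
 have inj_rs: "inj_on ((!) rs) {..<length rs}" using rs(2) by (auto simp: inj_on_def nth_eq_iff_index_eq)
 have sum_rs': "(\<Sum>l<length rs. t l * (rs ! l) x) = (\<Sum>b\<in>B. t (inv_into {..<length rs} ((!) rs) b) * b x)" for t x
  unfolding sum_rs[symmetric] by (intro sum.cong refl) (simp add: inv_into_f_f[OF inj_rs])
 define lb where "lb r = (SOME v. \<forall>x. r x ~= 0 --> lab x = v)" for r :: "'x => 'k"
 have lb: "\<forall>x. r x ~= 0 --> lab x = lb r" if "r \<in> B" for r
  unfolding lb_def by (rule someI_ex) (use that B(1) in "auto simp: H_def")
 define bs where "bs = map (%r. (lb r, r)) rs"
 have len: "length bs = length rs" and nth: "!!l. l < length rs ==> snd (bs ! l) = rs ! l"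
  by (auto simp: bs_def)
 have nz: "\<exists>x. r x ~= 0" if "r \<in> B" for r
 proof (rule ccontr)
  assume "\<not> ?thesis"
  then have "r = 0" by (auto simp: fun_eq_iff)
  with that B(2) fv.dependent_zero show False by blast
 qed
 have ind: "\<forall>l<length rs. t l = 0" if z: "\<forall>x. (\<Sum>l<length rs. t l * (rs ! l) x) = 0" for t
 proof -
  have "(\<Sum>b\<in>B. (%x. t (inv_into {..<length rs} ((!) rs) b) * b x)) = 0"
   using z by (auto simp: fun_eq_iff sum_fun_apply sum_rs')
  then have "\<forall>b\<in>B. t (inv_into {..<length rs} ((!) rs) b) = 0"
   using fv.independent_explicit_finite_subsets[THEN iffD1, rule_format, OF B(2) subset_refl finB,
     of "%b. t (inv_into {..<length rs} ((!) rs) b)"] by blast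
  then have "t (inv_into {..<length rs} ((!) rs) (rs ! l)) = 0" if "l < length rs" for l
   using nth_mem[OF that] rs(1) by blast
  then show ?thesis by (simp add: inv_into_f_f[OF inj_rs])
 qed
 have sp: "\<exists>t. \<forall>x. r x = (\<Sum>l<length rs. t l * (rs ! l) x)" if "r \<in> R" for r
 proof -
  have "(!) rs ` {..<length rs} = B" using rs(1) by (auto simp: set_conv_nth)
  with R_span that have "r \<in> fv.span ((!) rs ` {..<length rs})" by auto
  from span_imageE[OF _ this] show ?thesis by (metis finite_lessThan)
 qed
 have "label_basis lab R bs"
  unfolding label_basis_def
 proof (intro conjI allI impI ballI)
  fix p assume "p \<in> set bs"
  then obtain r where "r \<in> B" "p = (lb r, r)" using rs(1) by (auto simp: bs_def)
  then show "case p of (v, r) => r \<in> R & (\<exists>x. r x ~= 0) & (\<forall>x. r x ~= 0 --> lab x = v)"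
   using lb[of r] nz[of r] B(1) by (auto simp: H_def)
 next
  fix t l assume "\<forall>x. (\<Sum>l<length bs. t l * snd (bs ! l) x) = 0" "l < length bs"
  then show "t l = 0" using ind[of t] by (simp add: len nth)
 next
  fix r assume "r \<in> R"
  then show "\<exists>t. \<forall>x. r x = (\<Sum>l<length bs. t l * snd (bs ! l) x)"
   using sp[of r] by (simp add: len nth)
 qed
 then show ?thesis by blast
qed

text \<open>
 In coordinates, a monomial quadratic algebra is a finite set of arrows and a relation \<open>forb\<close> that says
 which composable pairs have product zero.  The bound on chains of forbidden pairs is where the
 finite-dimensionality of the Koszul dual enters; it makes resolutions finite.
\<close>
locale monomial_relations =
 fixes E :: "'e set" and src tgt :: "'e => 'v" and forb :: "'e => 'e => bool"
 assumes finE: "finite E" and forb_comp: "forb a b ==> tgt a = src b"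
  and bounded: "\<exists>m. \<forall>as. set as <= E --> successively forb as --> length as \<le> m"
begin

text \<open>
 The vectors \<open>bs\<close> are the rows of a map between sums of projectives, with linear entries.  Composing with a
 further row \<open>r\<close> gives the products \<open>a b\<close> with coefficients \<open>\<Sum>\<^sub>j bs\<^sub>j(i, a) r(j, b)\<close>; as the algebra is
 monomial, the composite vanishes if and only if these coefficients vanish for every pair that is
 not forbidden.
\<close>
definition syzygies :: "('v \<times> (nat \<times> 'e => 'k::field)) list => (nat \<times> 'e => 'k) set" where
 "syzygies bs = {r. (\<forall>j b. r (j, b) ~= 0 --> j < length bs & b \<in> E & src b = fst (bs ! j)) &
   (\<forall>b\<in>E. \<forall>i. \<forall>a\<in>E. tgt a = src b --> \<not> forb a b --> (\<Sum>j<length bs. snd (bs ! j) (i, a) * r (j, b)) = 0)}"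

abbreviation step_basis :: "(nat \<times> 'e => 'k::field) set => ('v \<times> (nat \<times> 'e => 'k)) list => bool"
 where "step_basis \<equiv> label_basis (%(i, a). tgt a)"

definition linear_resolution ::
  "'v list => (nat \<times> 'e => 'k::field) set => (nat => ('v \<times> (nat \<times> 'e => 'k)) list) => bool" where
 "linear_resolution xs R bs \<longleftrightarrow> step_basis R (bs 0) &
   (\<forall>n. step_basis (syzygies (bs n)) (bs (Suc n))) & (\<exists>l. \<forall>n\<ge>l. bs n = [])"

definition starts_at :: "'v list => (nat \<times> 'e => 'k::field) set => bool" where
 "starts_at xs R \<longleftrightarrow> (\<forall>r\<in>R. \<forall>i a. r (i, a) ~= 0 --> i < length xs & a \<in> E & src a = xs ! i)"

lemma starts_at_syzygies: "starts_at (map fst bs) (syzygies bs)"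
 by (auto simp: starts_at_def syzygies_def)

lemma step_basis_exists:
 fixes R :: "(nat \<times> 'e => 'k::field) set"
 assumes "starts_at xs R"
  and "!!r v. r \<in> R ==> (%(i, a). if tgt a = v then r (i, a) else 0) \<in> R"
 shows "\<exists>bs. step_basis R bs"
proof (rule label_basis_exists[of "{..<length xs} \<times> E"])
 fix r v assume "r \<in> R"
 from assms(2)[OF this, of v] have "(%(i, a). if tgt a = v then r (i, a) else 0) \<in> R" .
 moreover have "(%(i, a). if tgt a = v then r (i, a) else 0) = (%x. if (case x of (i, a) => tgt a) = v then r x else 0)"
  by (auto simp: fun_eq_iff)
 ultimately show "(%x. if (case x of (i, a) => tgt a) = v then r x else 0) \<in> R"
  by simp
qed (use assms(1) finE in "auto simp: starts_at_def")

lemma syzygies_restrict: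
 assumes "r \<in> syzygies bs"
 shows "(%(i, a). if tgt a = v then r (i, a) else 0) \<in> syzygies bs"
proof -
 have "(\<Sum>j<length bs. snd (bs ! j) (i, a) * (if tgt b = v then r (j, b) else 0)) = 0"
  if "(\<Sum>j<length bs. snd (bs ! j) (i, a) * r (j, b)) = 0" for i a b
  using that by (cases "tgt b = v") auto
 then show ?thesis using assms unfolding syzygies_def by auto
qed

lemma step_basisD:
 assumes "step_basis R bs"
 shows step_basis_mem: "!!l. l < length bs ==> snd (bs ! l) \<in> R"
  and step_basis_nz: "!!l. l < length bs ==> \<exists>i a. snd (bs ! l) (i, a) ~= 0"
  and step_basis_tgt: "!!l i a. l < length bs ==> snd (bs ! l) (i, a) ~= 0 ==> tgt a = fst (bs ! l)"
  and step_basis_indep: "!!t l. (!!i a. (\<Sum>l<length bs. t l * snd (bs ! l) (i, a)) = 0) ==> l < length bs ==> t l = 0"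
  and step_basis_span: "!!r. r \<in> R ==> \<exists>t. \<forall>i a. r (i, a) = (\<Sum>l<length bs. t l * snd (bs ! l) (i, a))"
proof -
 have *: "snd (bs ! l) \<in> R & (\<exists>x. snd (bs ! l) x ~= 0) & (\<forall>i a. snd (bs ! l) (i, a) ~= 0 --> tgt a = fst (bs ! l))"
  if "l < length bs" for l
  using assms nth_mem[OF that] unfolding label_basis_def by (cases "bs ! l") fastforce
 show "!!l. l < length bs ==> snd (bs ! l) \<in> R" using * by blast
 show "!!l. l < length bs ==> \<exists>i a. snd (bs ! l) (i, a) ~= 0" using * by force
 show "!!l i a. l < length bs ==> snd (bs ! l) (i, a) ~= 0 ==> tgt a = fst (bs ! l)" using * by blast
 show "t l = 0" if "!!i a. (\<Sum>l<length bs. t l * snd (bs ! l) (i, a)) = 0" "l < length bs" for t l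
 proof -
  have "\<forall>x. (\<Sum>l<length bs. t l * snd (bs ! l) x) = 0" using that(1) by (simp add: split_paired_All)
  with assms that(2) show ?thesis unfolding label_basis_def by blast
 qed
 show "!!r. r \<in> R ==> \<exists>t. \<forall>i a. r (i, a) = (\<Sum>l<length bs. t l * snd (bs ! l) (i, a))"
  using assms unfolding label_basis_def by force
qed

text \<open>
 Iterating syzygies stops: by linear independence, a nonzero coordinate at stage \<open>n + 1\<close> with arrow \<open>b\<close>
 forces a nonzero one at stage \<open>n\<close> with an arrow \<open>a\<close> such that \<open>(a, b)\<close> is forbidden.  Hence stage \<open>n\<close>
 yields a chain of \<open>n + 1\<close> arrows with forbidden consecutive pairs, and these are bounded.
\<close>
lemma linear_resolution_exists:
 fixes R :: "(nat \<times> 'e => 'k::field) set"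
 assumes st: "starts_at xs R"
  and restr: "!!r v. r \<in> R ==> (%(i, a). if tgt a = v then r (i, a) else 0) \<in> R"
 obtains bs where "linear_resolution xs R bs"
proof -
 obtain b0 where b0: "step_basis R b0" using step_basis_exists[OF assms] by blast
 have ex: "\<exists>c. step_basis (syzygies b) c" for b :: "('v \<times> (nat \<times> 'e => 'k)) list"
  by (rule step_basis_exists[OF starts_at_syzygies]) (rule syzygies_restrict)
 define bs where "bs = rec_nat b0 (%_ b. SOME c. step_basis (syzygies b) c)"
 have bs0: "bs 0 = b0" by (simp add: bs_def)
 have bsS: "step_basis (syzygies (bs n)) (bs (Suc n))" for n
  using someI_ex[OF ex[of "bs n"]] by (simp add: bs_def)
 have sb: "\<exists>R xs. starts_at xs R & step_basis R (bs n)" for n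
  using b0 st bs0 bsS starts_at_syzygies by (cases n) blast+
 have chain: "\<exists>as. set as <= E & successively forb as & length as = Suc n & last as = b"
  if "l < length (bs n)" "snd (bs n ! l) (j, b) ~= 0" for n l j b
  using that
 proof (induction n arbitrary: l j b)
  case 0
  then have "b \<in> E" using b0 st bs0 step_basis_mem[of R b0 l] by (auto simp: starts_at_def)
  then show ?case by (intro exI[of _ "[b]"]) auto
 next
  case (Suc n)
  define r where "r = snd (bs (Suc n) ! l)"
  have r: "r \<in> syzygies (bs n)" using step_basis_mem[OF bsS] Suc.prems by (simp add: r_def)
  then have b: "j < length (bs n)" "b \<in> E" "src b = fst (bs n ! j)"
   using Suc.prems by (auto simp: syzygies_def r_def)
  obtain R' xs' where R': "starts_at xs' R'" "step_basis R' (bs n)" using sb by blast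
  have "\<exists>i a. (\<Sum>l<length (bs n). r (l, b) * snd (bs n ! l) (i, a)) ~= 0"
  proof (rule ccontr)
   assume "\<not> ?thesis"
   then have "r (j, b) = 0"
    using step_basis_indep[OF R'(2), of "%l. r (l, b)" j] b by auto
   with Suc.prems show False by (simp add: r_def)
  qed
  then obtain i a where ia: "(\<Sum>l<length (bs n). r (l, b) * snd (bs n ! l) (i, a)) ~= 0" by blast
  then obtain l' where l': "l' < length (bs n)" "r (l', b) ~= 0" "snd (bs n ! l') (i, a) ~= 0"
   using sum.not_neutral_contains_not_neutral[OF ia] by auto
  have tgt_a: "tgt a = src b"
   using step_basis_tgt[OF R'(2) l'(1,3)] r l'(2) by (auto simp: syzygies_def)
  have aE: "a \<in> E" using R' step_basis_mem[OF R'(2) l'(1)] l'(3) by (auto simp: starts_at_def)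
  have "forb a b"
  proof (rule ccontr)
   assume "\<not> forb a b"
   then have "(\<Sum>j<length (bs n). snd (bs n ! j) (i, a) * r (j, b)) = 0"
    using r b aE tgt_a by (auto simp: syzygies_def)
   with ia show False by (simp add: mult.commute)
  qed
  moreover from Suc.IH[OF l'(1,3)] obtain as where
   "set as <= E" "successively forb as" "length as = Suc n" "last as = a" by blast
  ultimately show ?case using b
   by (intro exI[of _ "as @ [b]"]) (auto simp: successively_append_iff)
 qed
 obtain m where m: "!!as. set as <= E ==> successively forb as ==> length as \<le> m"
  using bounded by blast
 have "bs n = []" if "m \<le> n" for n
 proof (rule ccontr)
  assume "bs n ~= []"
  then have "0 < length (bs n)" by simp
  moreover obtain R' where "step_basis R' (bs n)" using sb by blast
  ultimately obtain j b where "snd (bs n ! 0) (j, b) ~= 0" using step_basis_nz by blast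
  from chain[OF \<open>0 < length (bs n)\<close> this] m that show False by force
 qed
 then show thesis using that[of bs] b0 bs0 bsS by (auto simp: linear_resolution_def)
qed

text \<open>
 A relation that involves a single arrow \<open>b\<close> is a syzygy by itself.  This makes syzygies of the monomial
 algebra linear: a relation with path coefficients can be split according to the first arrow of the
 coefficients, and every part is a multiple of linear syzygies.
\<close>
lemma syzygy_combination:
 fixes u :: "nat => 'k::field"
 assumes cs: "step_basis (syzygies bs) cs" and b: "b \<in> E"
  and supp: "!!j. j < length bs ==> u j ~= 0 ==> fst (bs ! j) = src b"
  and rel: "!!i a. a \<in> E ==> tgt a = src b ==> \<not> forb a b ==> (\<Sum>j<length bs. snd (bs ! j) (i, a) * u j) = 0"
 shows "\<exists>t. \<forall>j a. (\<Sum>l<length cs. snd (cs ! l) (j, a) * t l) = (if a = b & j < length bs then u j else 0)"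
proof -
 define r where "r = (%(j, a). if a = b & j < length bs then u j else 0)"
 have "r \<in> syzygies bs"
  unfolding syzygies_def mem_Collect_eq
 proof (intro conjI allI impI ballI)
  fix b' i a assume "b' \<in> E" "a \<in> E" "tgt a = src b'" "\<not> forb a b'"
  then show "(\<Sum>j<length bs. snd (bs ! j) (i, a) * r (j, b')) = 0"
   using rel[of a i] by (cases "b' = b") (auto simp: r_def)
 qed (use b supp in "auto simp: r_def split: if_splits")
 from step_basis_span[OF cs this] obtain t where
  "\<forall>j a. r (j, a) = (\<Sum>l<length cs. t l * snd (cs ! l) (j, a))" by blast
 then show ?thesis by (intro exI[of _ t]) (auto simp: r_def mult.commute)
qed

text \<open>
 The transpose of the preceding lemma: functionals that annihilate the syzygies are combinations of the
 rows \<open>(i, a)\<close> with \<open>(a, b)\<close> composable and not forbidden.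
\<close>
lemma dual_syzygy_combination:
 fixes \<phi> :: "nat => 'k::field"
 assumes cs: "step_basis (syzygies bs) cs" and b: "b \<in> E" and st: "starts_at xs R" and bs: "step_basis R bs"
  and ann: "!!l. l < length cs ==> (\<Sum>j<length bs. snd (cs ! l) (j, b) * \<phi> j) = 0"
 shows "\<exists>s. \<forall>j<length bs. fst (bs ! j) = src b -->
  \<phi> j = (\<Sum>(i, a)\<in>{(i, a). i < length xs & a \<in> E & tgt a = src b & \<not> forb a b}. s (i, a) * snd (bs ! j) (i, a))"
proof -
 define K where "K = {(i, a). i < length xs & a \<in> E & tgt a = src b & \<not> forb a b}"
 define X where "X = {j. j < length bs & fst (bs ! j) = src b}"
 have "K <= {..<length xs} \<times> E" by (auto simp: K_def)
 then have finK: "finite K" using finE by (meson finite_SigmaI finite_lessThan finite_subset)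
 have finX: "finite X" by (simp add: X_def)
 have zero: "snd (bs ! j) (i, a) = 0" if "j < length bs" "\<not> i < length xs" for i j a
  using step_basis_mem[OF bs that(1)] st that(2) by (auto simp: starts_at_def)
 have "(\<Sum>j\<in>X. \<phi> j * u j) = 0"
  if u: "!!j. j ~: X ==> u j = 0" and rel: "!!\<kappa>. \<kappa> \<in> K ==> (\<Sum>j\<in>X. snd (bs ! j) \<kappa> * u j) = 0" for u
 proof -
  have sumX: "(\<Sum>j<length bs. g j * u j) = (\<Sum>j\<in>X. g j * u j)" for g
   by (rule sum.mono_neutral_right) (auto simp: X_def u)
  have "(\<Sum>j<length bs. snd (bs ! j) (i, a) * u j) = 0"
   if "a \<in> E" "tgt a = src b" "\<not> forb a b" for i a
   using that rel[of "(i, a)"] zero[of _ i a] by (cases "i < length xs") (auto simp: K_def sumX X_def intro!: sum.neutral)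
  from syzygy_combination[OF cs b _ this]
  obtain t where t: "!!j a. (\<Sum>l<length cs. snd (cs ! l) (j, a) * t l) = (if a = b & j < length bs then u j else 0)"
   using u X_def by blast
  have "(\<Sum>j\<in>X. \<phi> j * u j) = (\<Sum>j<length bs. \<phi> j * (\<Sum>l<length cs. snd (cs ! l) (j, b) * t l))"
   by (simp add: sumX[symmetric] t)
  also have "... = (\<Sum>l<length cs. \<Sum>j<length bs. \<phi> j * (snd (cs ! l) (j, b) * t l))"
   unfolding sum_distrib_left by (rule sum.swap)
  also have "... = (\<Sum>l<length cs. t l * (\<Sum>j<length bs. snd (cs ! l) (j, b) * \<phi> j))"
   by (intro sum.cong refl) (auto simp: sum_distrib_left intro!: sum.cong)
  also have "... = 0" by (simp add: ann)
  finally show ?thesis .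
 qed
 from row_combination_if_annihilated[OF finK finX, where row = "%\<kappa> j. snd (bs ! j) \<kappa>" and \<phi> = \<phi>, OF this]
 obtain s where "!!j. j \<in> X ==> \<phi> j = (\<Sum>\<kappa>\<in>K. s \<kappa> * snd (bs ! j) \<kappa>)" by blast
 then show ?thesis unfolding K_def X_def
  by (intro exI[of _ s]) (auto simp: case_prod_unfold intro!: sum.cong)
qed

text \<open>
 Independent vectors take arbitrary values under suitable functionals.
\<close>
lemma dual_generators:
 fixes \<phi> :: "nat => 'k::field"
 assumes st: "starts_at xs R" and bs: "step_basis R bs"
 shows "\<exists>s. \<forall>j<length bs. \<phi> j = (\<Sum>(i, a)\<in>{..<length xs} \<times> E. s (i, a) * snd (bs ! j) (i, a))"
proof -
 have zero: "snd (bs ! j) (i, a) = 0" if "j < length bs" "(i, a) ~: {..<length xs} \<times> E" for i j a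
 proof (rule ccontr)
  assume "snd (bs ! j) (i, a) ~= 0"
  with step_basis_mem[OF bs that(1)] st have "i < length xs & a \<in> E" unfolding starts_at_def by blast
  with that(2) show False by simp
 qed
 have ann: "(\<Sum>j\<in>{..<length bs}. \<phi> j * u j) = 0"
  if "!!j. j ~: {..<length bs} ==> u j = 0" and rel: "!!\<kappa>. \<kappa> \<in> {..<length xs} \<times> E ==> (\<Sum>j\<in>{..<length bs}. snd (bs ! j) \<kappa> * u j) = 0" for u
 proof -
  have "(\<Sum>j<length bs. u j * snd (bs ! j) (i, a)) = 0" for i a
  proof (cases "(i, a) \<in> {..<length xs} \<times> E")
   case True
   from rel[OF this] show ?thesis by (simp only: mult.commute)
  next
   case False
   then show ?thesis using zero by (intro sum.neutral) simp
  qed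
  from step_basis_indep[OF bs this] show ?thesis by simp
 qed
 have "finite ({..<length xs} \<times> E)" using finE by simp
 from row_combination_if_annihilated[OF this finite_lessThan,
   where row = "%\<kappa> j. snd (bs ! j) \<kappa>" and \<phi> = \<phi>, OF ann]
 obtain s where "!!j. j \<in> {..<length bs} ==> \<phi> j = (\<Sum>\<kappa>\<in>{..<length xs} \<times> E. s \<kappa> * snd (bs ! j) \<kappa>)"
  by blast
 then show ?thesis unfolding case_prod_unfold prod.collapse by blast
qed

end

section \<open>Path algebras and their monomial quotients\<close>

abbreviation lookup :: "('a \<Rightarrow>\<^sub>0 'b::zero) => 'a => 'b" where "lookup \<equiv> Poly_Mapping.lookup"
abbreviation keys :: "('a \<Rightarrow>\<^sub>0 'b::zero) => 'a set" where "keys \<equiv> Poly_Mapping.keys"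
abbreviation single :: "'a => 'b::zero => 'a \<Rightarrow>\<^sub>0 'b" where "single \<equiv> Poly_Mapping.single"

lemma sum_singles:
 fixes f :: "'a \<Rightarrow>\<^sub>0 'b::comm_monoid_add"
 assumes "finite S" "keys f <= S"
 shows "(\<Sum>p\<in>S. single p (lookup f p)) = f"
proof (rule poly_mapping_eqI)
 fix q
 have "(\<Sum>p\<in>S. lookup (single p (lookup f p)) q) = (\<Sum>p\<in>S. if p = q then lookup f q else 0)"
  by (intro sum.cong) (auto simp: lookup_single when_def)
 then show "lookup (\<Sum>p\<in>S. single p (lookup f p)) q = lookup f q"
  using assms by (auto simp: lookup_sum in_keys_iff)
qed

lemma additive_ext:
 fixes f :: "'a \<Rightarrow>\<^sub>0 'b::comm_monoid_add"
 assumes "P 0" "!!f g. P f ==> P g ==> P (f + g)" "!!p c. p \<in> keys f ==> P (single p c)"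
 shows "P f"
proof -
 have "P (\<Sum>p\<in>S. single p (lookup f p))" if "finite S" "S <= keys f" for S
  using that by (induction S rule: finite_induct) (auto intro: assms)
 from this[of "keys f"] show ?thesis by (simp add: sum_singles)
qed

lemma path_end_simp: "path_end Q (u, p) = (if p = [] then u else head Q (last p))"
 by (simp add: path_end_def pre_digraph.awalk_verts_conv)

lemma path_end_append: "path_end Q (u, p @ q) = path_end Q (path_end Q (u, p), q)"
 by (simp add: path_end_simp)

lemma paths_Nil [simp]: "(u, []) \<in> paths Q \<longleftrightarrow> u \<in> verts Q"
 by (auto simp: paths_def pre_digraph.awalk_def pre_digraph.cas.simps)

lemma (in wf_digraph) paths_Cons [simp]:
 "(u, a # p) \<in> paths G \<longleftrightarrow> a \<in> arcs G & tail G a = u & (head G a, p) \<in> paths G"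
 by (auto simp: paths_def awalk_Cons_iff)

lemma (in wf_digraph) paths_append:
 "(u, p @ q) \<in> paths G \<longleftrightarrow> (u, p) \<in> paths G & (path_end G (u, p), q) \<in> paths G"
proof (induction p arbitrary: u)
 case Nil
 have "(u, q) \<in> paths G ==> u \<in> verts G" by (cases q) auto
 then show ?case by (auto simp: path_end_simp)
next
 case (Cons a p)
 then show ?case by (auto simp: path_end_simp)
qed

lemma (in wf_digraph) path_end_in_verts: "(u, p) \<in> paths G ==> path_end G (u, p) \<in> verts G"
 by (induction p arbitrary: u) (auto simp: path_end_simp split: if_splits)

lemma (in wf_digraph) paths_start: "p \<in> paths G ==> fst p \<in> verts G"
 by (cases p; cases "snd p") auto


lemma path_times_superset:
 assumes "finite S" "finite T" "keys f <= S" "keys g <= T"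
 shows "path_times Q f g = (\<Sum>p\<in>S. \<Sum>q\<in>T. if fst p = path_end Q q
   then single (fst q, snd q @ snd p) (lookup f p * lookup g q) else 0)"
 unfolding path_times_def using assms
 by (intro sum.mono_neutral_cong_left sum.mono_neutral_left sum.neutral ballI) (auto simp: in_keys_iff)

lemma path_times_add_left: "path_times Q (f + g) h = path_times Q f h + path_times Q g h"
proof -
 define T where "T x p q = (if fst p = path_end Q q
   then single (fst q, snd q @ snd p) (lookup x p * lookup h q) else 0)" for x p q
 define S where "S = keys f \<union> keys g \<union> keys (f + g)"
 have eq: "path_times Q x h = (\<Sum>p\<in>S. \<Sum>q\<in>keys h. T x p q)" if "keys x <= S" for x
  unfolding T_def by (rule path_times_superset) (use that in "auto simp: S_def")
 have T: "T (f + g) p q = T f p q + T g p q" for p q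
  by (simp add: T_def lookup_add single_add distrib_right)
 have "keys f <= S" "keys g <= S" "keys (f + g) <= S" by (auto simp: S_def)
 then show ?thesis by (simp only: eq T sum.distrib)
qed

lemma path_times_add_right: "path_times Q h (f + g) = path_times Q h f + path_times Q h g"
proof -
 define T where "T x p q = (if fst p = path_end Q q
   then single (fst q, snd q @ snd p) (lookup h p * lookup x q) else 0)" for x p q
 define S where "S = keys f \<union> keys g \<union> keys (f + g)"
 have eq: "path_times Q h x = (\<Sum>p\<in>keys h. \<Sum>q\<in>S. T x p q)" if "keys x <= S" for x
  unfolding T_def by (rule path_times_superset) (use that in "auto simp: S_def")
 have T: "T (f + g) p q = T f p q + T g p q" for p q
  by (simp add: T_def lookup_add single_add distrib_left)
 have "keys f <= S" "keys g <= S" "keys (f + g) <= S" by (auto simp: S_def)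
 then show ?thesis by (simp only: eq T sum.distrib)
qed

lemma path_times_zero [simp]: "path_times Q 0 f = 0" "path_times Q f 0 = 0"
 by (simp_all add: path_times_def)

lemma path_times_single:
 "path_times Q (single p c) (single q d) =
   (if fst p = path_end Q q then single (fst q, snd q @ snd p) (c * d) else 0)"
 by (subst path_times_superset[of "{p}" "{q}"]) auto

lemma path_times_sum_left: "path_times Q (\<Sum>i\<in>S. f i) g = (\<Sum>i\<in>S. path_times Q (f i) g)"
 by (induction S rule: infinite_finite_induct) (auto simp: path_times_add_left)

lemma path_times_sum_right: "path_times Q g (\<Sum>i\<in>S. f i) = (\<Sum>i\<in>S. path_times Q g (f i))"
 by (induction S rule: infinite_finite_induct) (auto simp: path_times_add_right)

lemma path_times_assoc: "path_times Q (path_times Q f g) h = path_times Q f (path_times Q g h)"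
proof (induction f rule: additive_ext)
 case (3 p c)
 show ?case
 proof (induction g rule: additive_ext)
  case (3 q d)
  show ?case
  proof (induction h rule: additive_ext)
   case (3 r e)
   have e: "path_end Q (fst r, snd r @ snd q) = path_end Q q" if "fst q = path_end Q r"
    by (simp add: path_end_append that[symmetric])
   show ?case
    by (cases "fst q = path_end Q r"; cases "fst p = path_end Q q")
     (simp_all only: path_times_single e mult.assoc if_True if_False fst_conv snd_conv append_assoc path_times_zero simp_thms)
  qed (simp_all only: path_times_add_right path_times_zero)
 qed (simp_all only: path_times_add_left path_times_add_right path_times_zero)
qed (simp_all only: path_times_add_left path_times_zero)

lemma (in fin_digraph) path_scalar_times:
 assumes "keys f <= paths G"
 shows "path_times G (path_scalar G c) f = (\<Sum>p\<in>keys f. single p (c * lookup f p))"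
  and "path_times G f (path_scalar G c) = (\<Sum>p\<in>keys f. single p (lookup f p * c))"
proof -
 have 1: "path_times G (path_scalar G c) (single p d) = single p (c * d)" if "p \<in> paths G" for p d
 proof -
  have e: "path_end G p \<in> verts G" using that path_end_in_verts[of "fst p" "snd p"] by simp
  have "path_times G (path_scalar G c) (single p d) =
    (\<Sum>v\<in>verts G. if v = path_end G p then single p (c * d) else 0)"
   unfolding path_scalar_def path_times_sum_left by (intro sum.cong) (auto simp: path_times_single)
  with e show ?thesis by simp
 qed
 have 2: "path_times G (single p d) (path_scalar G c) = single p (d * c)" if "p \<in> paths G" for p d
 proof -
  have "path_times G (single p d) (path_scalar G c) =
    (\<Sum>v\<in>verts G. if v = fst p then single p (d * c) else 0)"
   unfolding path_scalar_def path_times_sum_right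
   by (intro sum.cong) (auto simp: path_times_single path_end_simp)
  with paths_start[OF that] show ?thesis by simp
 qed
 have f: "f = (\<Sum>p\<in>keys f. single p (lookup f p))" by (simp add: sum_singles)
 show "path_times G (path_scalar G c) f = (\<Sum>p\<in>keys f. single p (c * lookup f p))"
  by (subst f, unfold path_times_sum_right, intro sum.cong) (use 1 assms in auto)
 show "path_times G f (path_scalar G c) = (\<Sum>p\<in>keys f. single p (lookup f p * c))"
  by (subst f, unfold path_times_sum_left, intro sum.cong) (use 2 assms in auto)
qed

lemma (in wf_digraph) keys_path_times:
 "keys (path_times G f g) <= {(fst q, snd q @ snd p) | p q. p \<in> keys f & q \<in> keys g & fst p = path_end G q}"
proof
 fix r assume r: "r \<in> keys (path_times G f g)"
 let ?t = "%p q. if fst p = path_end G q then single (fst q, snd q @ snd p) (lookup f p * lookup g q) else 0"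
 from r keys_sum[of "%p. \<Sum>q\<in>keys g. ?t p q" "keys f"]
 obtain p where p: "p \<in> keys f" "r \<in> keys (\<Sum>q\<in>keys g. ?t p q)" unfolding path_times_def by blast
 from p(2) keys_sum[of "?t p" "keys g"] obtain q where "q \<in> keys g" "r \<in> keys (?t p q)" by blast
 moreover from this(2) have "fst p = path_end G q" "r = (fst q, snd q @ snd p)"
  by (auto split: if_splits)
 ultimately show "r \<in> {(fst q, snd q @ snd p) | p q. p \<in> keys f & q \<in> keys g & fst p = path_end G q}"
  using p(1) by blast
qed

lemma path_algebra_simps [simp]:
 "carrier (path_algebra Q) = {f. keys f <= paths Q}" "mult (path_algebra Q) = path_times Q"
 "one (path_algebra Q) = path_scalar Q 1" "zero (path_algebra Q) = 0" "add (path_algebra Q) = (+)"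
 by (simp_all add: path_algebra_def)

lemma (in fin_digraph) keys_path_scalar: "keys (path_scalar G c) <= paths G"
 unfolding path_scalar_def by (rule subset_trans[OF keys_sum]) (auto split: if_splits)

lemma (in wf_digraph) path_times_closed:
 assumes "keys f <= paths G" "keys g <= paths G"
 shows "keys (path_times G f g) <= paths G"
proof
 fix r assume "r \<in> keys (path_times G f g)"
 with keys_path_times[of f g] obtain p q where
  "r = (fst q, snd q @ snd p)" "p \<in> keys f" "q \<in> keys g" "fst p = path_end G q" by blast
 moreover from this assms have "p \<in> paths G" "q \<in> paths G" by auto
 ultimately show "r \<in> paths G" by (cases p, cases q) (simp add: paths_append)
qed

lemma (in fin_digraph) ring_path_algebra: "ring (path_algebra G :: ('a, 'b, 'k::field) path_elem ring)"
proof (rule ringI)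
 show "abelian_group (path_algebra G :: ('a, 'b, 'k) path_elem ring)"
 proof (rule abelian_groupI)
  fix x :: "('a, 'b, 'k) path_elem" assume "x \<in> carrier (path_algebra G)"
  then show "\<exists>y\<in>carrier (path_algebra G). y \<oplus>\<^bsub>path_algebra G\<^esub> x = \<zero>\<^bsub>path_algebra G\<^esub>"
   by (intro bexI[of _ "- x"]) (auto simp: in_keys_iff)
 next
  fix x y :: "('a, 'b, 'k) path_elem" assume "x \<in> carrier (path_algebra G)" "y \<in> carrier (path_algebra G)"
  then show "x \<oplus>\<^bsub>path_algebra G\<^esub> y \<in> carrier (path_algebra G)"
   using keys_add[of x y] by auto
 qed (auto simp: algebra_simps)
 show "monoid (path_algebra G :: ('a, 'b, 'k) path_elem ring)"
  by (rule monoidI)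
   (auto simp: path_times_assoc path_scalar_times sum_singles keys_path_scalar[THEN subsetD]
    dest: path_times_closed[THEN subsetD, rotated 2])
qed (auto simp: path_times_add_left path_times_add_right)

lemma (in fin_digraph) a_inv_path_algebra:
 assumes "keys f <= paths G"
 shows "\<ominus>\<^bsub>path_algebra G\<^esub> f = - f"
proof -
 interpret ring "path_algebra G" by (rule ring_path_algebra)
 show ?thesis by (rule minus_equality) (use assms in "auto simp: in_keys_iff")
qed

definition monomial_span :: "('v, 'e) pre_digraph => ('e \<times> 'e) set => ('v, 'e, 'k::field) path_elem set" where
 "monomial_span Q F = {f. keys f <= paths Q & (\<forall>p\<in>keys f. \<not> successively (%a b. (a, b) ~: F) (snd p))}"

lemma not_successivelyE:
 assumes "\<not> successively P xs"
 obtains as a b bs where "xs = as @ [a, b] @ bs" "\<not> P a b"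
proof -
 have "\<exists>as a b bs. xs = as @ [a, b] @ bs & \<not> P a b" using assms
 proof (induction P xs rule: successively.induct)
  case (3 P x y xs)
  show ?case
  proof (cases "P x y")
   case True
   with 3 obtain as a b bs where "y # xs = as @ [a, b] @ bs & \<not> P a b" by auto
   then show ?thesis by (intro exI[of _ "x # as"] exI) auto
  next
   case False
   then show ?thesis by (intro exI[of _ "[]"] exI[of _ x] exI[of _ y] exI[of _ xs]) auto
  qed
 qed auto
 then show ?thesis using that by blast
qed

lemma (in fin_digraph) ideal_monomial_span:
 "ideal (monomial_span G F :: ('a, 'b, 'k::field) path_elem set) (path_algebra G)"
proof (rule idealI)
 show "ring (path_algebra G :: ('a, 'b, 'k) path_elem ring)" by (rule ring_path_algebra)
 then interpret ring "path_algebra G :: ('a, 'b, 'k) path_elem ring" .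
 show "subgroup (monomial_span G F :: ('a, 'b, 'k) path_elem set) (add_monoid (path_algebra G))"
 proof
  show "x \<otimes>\<^bsub>add_monoid (path_algebra G)\<^esub> y \<in> monomial_span G F"
   if "x \<in> monomial_span G F" "y \<in> monomial_span G F" for x y :: "('a, 'b, 'k) path_elem"
   using that keys_add[of x y] by (auto simp: monomial_span_def)
  show "inv\<^bsub>add_monoid (path_algebra G)\<^esub> x \<in> monomial_span G F" if "x \<in> monomial_span G F" for x :: "('a, 'b, 'k) path_elem"
  proof -
   have "inv\<^bsub>add_monoid (path_algebra G)\<^esub> x = - x"
    using that a_inv_path_algebra[of x] by (simp add: a_inv_def monomial_span_def)
   with that show ?thesis by (auto simp: monomial_span_def in_keys_iff)
  qed
 qed (auto simp: monomial_span_def)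
 fix a x :: "('a, 'b, 'k) path_elem" assume a: "a \<in> monomial_span G F" and x: "x \<in> carrier (path_algebra G)"
 have bad: "\<not> successively P (xs @ ys)" if "\<not> successively P xs \<or> \<not> successively P ys" for P and xs ys :: "'b list"
  using that by (auto simp: successively_append_iff)
 have *: "path_times G f g \<in> monomial_span G F"
  if fg: "keys f <= paths G" "keys g <= paths G" "f \<in> monomial_span G F \<or> g \<in> monomial_span G F"
  for f g :: "('a, 'b, 'k) path_elem"
  unfolding monomial_span_def mem_Collect_eq
 proof (intro conjI ballI)
  show "keys (path_times G f g) <= paths G" by (rule path_times_closed) fact+
  fix r assume "r \<in> keys (path_times G f g)"
  with keys_path_times[of f g] obtain p q where
   "r = (fst q, snd q @ snd p)" "p \<in> keys f" "q \<in> keys g" by blast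
  with fg(3) show "\<not> successively (%a b. (a, b) ~: F) (snd r)"
   by (auto simp: monomial_span_def intro!: bad)
 qed
 from a x show "x \<otimes>\<^bsub>path_algebra G\<^esub> a \<in> monomial_span G F"
  using *[of x a] by (simp add: monomial_span_def)
 from a x show "a \<otimes>\<^bsub>path_algebra G\<^esub> x \<in> monomial_span G F"
  using *[of a x] by (simp add: monomial_span_def)
qed

text \<open>
 The ideal generated by paths of length two consists of the combinations of paths that contain one of
 them: these combinations form an ideal, and each such path is a multiple of a generator.
\<close>
lemma (in fin_digraph) genideal_monomial:
 assumes F: "!!a b. (a, b) \<in> F ==> a \<in> arcs G & b \<in> arcs G & head G a = tail G b"
 shows "Idl\<^bsub>(path_algebra G :: ('a, 'b, 'k::field) path_elem ring)\<^esub> {path_basis (tail G a, [a, b]) | a b. (a, b) \<in> F} =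
  monomial_span G F"
  (is "Idl\<^bsub>?R\<^esub> ?S = ?M")
proof
 interpret ring ?R by (rule ring_path_algebra)
 have S: "?S <= ?M"
  using F by (auto simp: path_basis_def monomial_span_def)
 then show "Idl\<^bsub>?R\<^esub> ?S <= ?M" by (rule genideal_minimal[OF ideal_monomial_span])
 have "?S <= carrier ?R" using S by (auto simp: monomial_span_def)
 from genideal_ideal[OF this] interpret I: ideal "Idl\<^bsub>?R\<^esub> ?S" ?R .
 have self: "?S <= Idl\<^bsub>?R\<^esub> ?S" by (rule genideal_self) fact
 show "?M <= Idl\<^bsub>?R\<^esub> ?S"
 proof
  fix f :: "('a, 'b, 'k) path_elem" assume f: "f \<in> ?M"
  show "f \<in> Idl\<^bsub>?R\<^esub> ?S"
  proof (rule additive_ext)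
   show "0 \<in> Idl\<^bsub>?R\<^esub> ?S" using I.zero_closed by simp
   show "f + g \<in> Idl\<^bsub>?R\<^esub> ?S" if "f \<in> Idl\<^bsub>?R\<^esub> ?S" "g \<in> Idl\<^bsub>?R\<^esub> ?S" for f g
    using I.a_closed[OF that] by simp
   fix p c assume p: "p \<in> keys f"
   obtain u xs where pu: "p = (u, xs)" by (cases p)
   from p f have "\<not> successively (%a b. (a, b) ~: F) (snd p)" by (auto simp: monomial_span_def)
   then obtain r a b s where xs: "xs = r @ [a, b] @ s" and ab: "(a, b) \<in> F"
    unfolding pu snd_conv by (elim not_successivelyE) auto
   have "(u, xs) \<in> paths G" using p f by (auto simp: monomial_span_def pu)
   then have r: "(u, r) \<in> paths G" "path_end G (u, r) = tail G a" "(head G b, s) \<in> paths G"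
    unfolding xs by (auto simp: paths_append path_end_simp)
   have "path_basis (tail G a, [a, b]) \<in> Idl\<^bsub>?R\<^esub> ?S" using self ab by blast
   with r have "single (head G b, s) c \<otimes>\<^bsub>?R\<^esub> (path_basis (tail G a, [a, b]) \<otimes>\<^bsub>?R\<^esub> single (u, r) 1) \<in> Idl\<^bsub>?R\<^esub> ?S"
    by (intro I.I_l_closed I.I_r_closed) auto
   then show "single p c \<in> Idl\<^bsub>?R\<^esub> ?S"
    using r by (simp add: path_basis_def path_times_single path_end_simp pu xs split: if_splits)
  qed
 qed
qed

text \<open>
 The algebra \<open>kQ/J\<close> with \<open>J\<close> generated by the paths \<open>b a\<close>, first \<open>a\<close> and then \<open>b\<close>, for \<open>(a, b)\<close> in \<open>F\<close>.  A
 chain of members of \<open>F\<close> is a nonzero path of the quadratic dual, so the bound says that the dual is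
 finite-dimensional.
\<close>
locale monomial_quotient = fin_digraph Q for Q :: "('v, 'e) pre_digraph" +
 fixes J :: "('v, 'e, 'k::field) path_elem set" and F :: "('e \<times> 'e) set"
 assumes F_arcs: "!!a b. (a, b) \<in> F ==> a \<in> arcs Q & b \<in> arcs Q & head Q a = tail Q b"
  and J_eq: "J = monomial_span Q F"
  and F_bounded: "\<exists>m. \<forall>as. set as <= arcs Q --> successively (%a b. (a, b) \<in> F) as --> length as \<le> m"
begin

abbreviation "A \<equiv> bq_algebra Q J"
abbreviation "cls \<equiv> bq_class Q J"

definition KQ :: "('v, 'e, 'k) path_elem set" where "KQ = {f. keys f <= paths Q}"

definition good :: "('v, 'e) path set" where
 "good = {p \<in> paths Q. successively (%a b. (a, b) ~: F) (snd p)}"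

definition GQ :: "('v, 'e, 'k) path_elem set" where "GQ = {f. keys f <= good}"

lemma GQ_KQ: "f \<in> GQ ==> f \<in> KQ" by (auto simp: GQ_def KQ_def good_def)
lemma good_paths: "p \<in> good ==> p \<in> paths Q" by (auto simp: good_def)

lemma KQ_add: "f \<in> KQ ==> g \<in> KQ ==> f + g \<in> KQ"
 using keys_add[of f g] by (auto simp: KQ_def)
lemma KQ_zero [simp]: "0 \<in> KQ" by (simp add: KQ_def)
lemma KQ_sum: "(!!i. i \<in> S ==> f i \<in> KQ) ==> (\<Sum>i\<in>S. f i) \<in> KQ"
 by (induction S rule: infinite_finite_induct) (auto intro: KQ_add)
lemma KQ_times: "f \<in> KQ ==> g \<in> KQ ==> path_times Q f g \<in> KQ"
 unfolding KQ_def mem_Collect_eq by (rule path_times_closed)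
lemma KQ_single [simp]: "p \<in> paths Q ==> single p c \<in> KQ" by (auto simp: KQ_def)
lemma KQ_scalar [simp]: "path_scalar Q c \<in> KQ" using keys_path_scalar by (auto simp: KQ_def)
lemma KQ_carrier: "KQ = carrier (path_algebra Q)" by (simp add: KQ_def)

lemma ideal_J: "ideal J (path_algebra Q)"
 unfolding J_eq by (rule ideal_monomial_span)

lemma ring_A: "ring A"
 unfolding bq_algebra_def by (rule ideal.quotient_is_ring[OF ideal_J])

sublocale A: ring A by (rule ring_A)

lemma cls_add: "f \<in> KQ ==> g \<in> KQ ==> cls (f + g) = cls f \<oplus>\<^bsub>A\<^esub> cls g"
 using ring_hom_add[OF ideal.rcos_ring_hom[OF ideal_J], of f g]
 by (simp add: bq_class_def bq_algebra_def KQ_carrier)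

lemma cls_mult: "f \<in> KQ ==> g \<in> KQ ==> cls (path_times Q f g) = cls f \<otimes>\<^bsub>A\<^esub> cls g"
 using ring_hom_mult[OF ideal.rcos_ring_hom[OF ideal_J], of f g]
 by (simp add: bq_class_def bq_algebra_def KQ_carrier)

lemma cls_one: "cls (path_scalar Q 1) = \<one>\<^bsub>A\<^esub>"
 using ring_hom_one[OF ideal.rcos_ring_hom[OF ideal_J]]
 by (simp add: bq_class_def bq_algebra_def)

lemma cls_closed: "f \<in> KQ ==> cls f \<in> carrier A"
 using ring_hom_closed[OF ideal.rcos_ring_hom[OF ideal_J], of f]
 by (simp add: bq_class_def bq_algebra_def KQ_carrier)

lemma carrier_A: "carrier A = cls ` KQ"
 by (auto simp: bq_algebra_def FactRing_def A_RCOSETS_def' KQ_carrier bq_class_def)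

lemma cls_zero: "cls 0 = \<zero>\<^bsub>A\<^esub>"
 using ring_hom_zero[OF ideal.rcos_ring_hom[OF ideal_J] ring_path_algebra] ring_A
 by (simp add: bq_class_def bq_algebra_def)

lemma KQ_diff: "f \<in> KQ ==> g \<in> KQ ==> f - g \<in> KQ"
 by (auto simp: KQ_def in_keys_iff lookup_minus subset_iff) metis

text \<open>
 The nonzero paths form a basis of the quotient.
\<close>
lemma cls_eq_iff: "f \<in> KQ ==> g \<in> KQ ==> cls f = cls g \<longleftrightarrow> (\<forall>p\<in>good. lookup f p = lookup g p)"
proof -
 assume fg: "f \<in> KQ" "g \<in> KQ"
 interpret R: ring "path_algebra Q" by (rule ring_path_algebra)
 have "f \<ominus>\<^bsub>path_algebra Q\<^esub> g = f - g"
  using fg by (simp add: a_minus_def a_inv_path_algebra KQ_def)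
 then have "cls f = cls g \<longleftrightarrow> f - g \<in> J"
  using R.quotient_eq_iff_same_a_r_cos[OF ideal_J, of f g] fg by (simp add: bq_class_def KQ_carrier)
 also have "... \<longleftrightarrow> (\<forall>p\<in>keys (f - g). p ~: good)"
  using KQ_diff[OF fg] by (auto simp: J_eq monomial_span_def KQ_def good_def)
 also have "... \<longleftrightarrow> (\<forall>p\<in>good. lookup f p = lookup g p)"
  by (auto simp: in_keys_iff lookup_minus)
 finally show ?thesis .
qed

definition red :: "('v, 'e, 'k) path_elem => ('v, 'e, 'k) path_elem" where
 "red f = (\<Sum>p\<in>keys f \<inter> good. single p (lookup f p))"

lemma lookup_red: "lookup (red f) p = (if p \<in> good then lookup f p else 0)"
proof -
 have "lookup (red f) p = (\<Sum>q\<in>keys f \<inter> good. if q = p then lookup f p else 0)"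
  unfolding red_def lookup_sum by (intro sum.cong) (auto simp: lookup_single when_def)
 then show ?thesis by (auto simp: in_keys_iff)
qed

lemma red_GQ: "red f \<in> GQ"
 by (auto simp: GQ_def in_keys_iff lookup_red split: if_splits)

lemma cls_red: "f \<in> KQ ==> cls (red f) = cls f"
 by (subst cls_eq_iff) (auto simp: red_GQ GQ_KQ lookup_red)

lemma GQ_lookup: "f \<in> GQ ==> p ~: good ==> lookup f p = 0"
 by (auto simp: GQ_def in_keys_iff)

lemma cls_inj: "f \<in> GQ ==> g \<in> GQ ==> cls f = cls g ==> f = g"
proof (rule poly_mapping_eqI)
 fix p assume fg: "f \<in> GQ" "g \<in> GQ" "cls f = cls g"
 then have "\<forall>p\<in>good. lookup f p = lookup g p" by (simp add: cls_eq_iff GQ_KQ)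
 then show "lookup f p = lookup g p" using fg(1,2) by (cases "p \<in> good") (simp_all add: GQ_lookup)
qed

lemma carrier_A_GQ: "carrier A = cls ` GQ"
proof -
 have "cls f \<in> cls ` GQ" if "f \<in> KQ" for f
  using cls_red[OF that] red_GQ[of f] by (metis imageI)
 then show ?thesis unfolding carrier_A using GQ_KQ by blast
qed

lemma cls_sum: "finite S ==> (!!i. i \<in> S ==> f i \<in> KQ) ==> cls (\<Sum>i\<in>S. f i) = (\<Oplus>\<^bsub>A\<^esub>i\<in>S. cls (f i))"
proof (induction S rule: finite_induct)
 case (insert x S)
 then show ?case by (simp add: cls_add KQ_sum A.finsum_insert cls_closed Pi_def)
qed (simp add: cls_zero)

end

section \<open>Graded modules and their degree truncations\<close>

lemma left_module_finsum_r:
 assumes "left_module R M" "a \<in> carrier R" "f \<in> S \<rightarrow> carrier M"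
 shows "a \<odot>\<^bsub>M\<^esub> (\<Oplus>\<^bsub>M\<^esub>i\<in>S. f i) = (\<Oplus>\<^bsub>M\<^esub>i\<in>S. a \<odot>\<^bsub>M\<^esub> f i)"
proof -
 interpret left_module R M by fact
 have z: "a \<odot>\<^bsub>M\<^esub> \<zero>\<^bsub>M\<^esub> = \<zero>\<^bsub>M\<^esub>"
  using smult_r_distr[OF assms(2) M.zero_closed M.zero_closed] smult_closed[OF assms(2) M.zero_closed]
  by (metis M.l_zero M.zero_closed M.add.right_cancel)
 from assms(3) show ?thesis
 proof (induction S rule: infinite_finite_induct)
  case (insert x S)
  then have "f \<in> S \<rightarrow> carrier M" "f x \<in> carrier M" by auto
  with insert show ?case
   by (simp add: smult_r_distr[OF assms(2)] smult_closed[OF assms(2)] Pi_def)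
 qed (auto simp: z)
qed

text \<open>
 Everything that \<^const>\<open>gr_module\<close> asks for apart from finite-dimensional components; the sums of
 projectives and of injectives are used only through these properties.
\<close>
definition gr_pre :: "('v, 'e) pre_digraph => ('v, 'e, 'k::field) path_elem set
  => (('v, 'e, 'k) bq_elem, 'm) graded_module => bool" where
 "gr_pre Q J M \<longleftrightarrow> left_module (bq_algebra Q J) M &
   (\<forall>n. additive_subgroup (hcomp M n) M) &
   (\<forall>x\<in>carrier M. \<exists>!c. (\<forall>n. c n \<in> hcomp M n) & finite {n. c n ~= \<zero>\<^bsub>M\<^esub>} &
    x = (\<Oplus>\<^bsub>M\<^esub>n\<in>{n. c n ~= \<zero>\<^bsub>M\<^esub>}. c n)) &
   (\<forall>i n. \<forall>a\<in>bq_degree Q J i. \<forall>x\<in>hcomp M n. a \<odot>\<^bsub>M\<^esub> x \<in> hcomp M (n + int i))"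

lemma gr_module_iff: "gr_module Q J M \<longleftrightarrow> gr_pre Q J M & (\<forall>n. fin_dim Q J M (hcomp M n))"
 by (auto simp: gr_module_def gr_pre_def)

lemma sub_finsum:
 assumes "abelian_group R" "abelian_group N" "carrier N <= carrier R" "add N = add R" "zero N = zero R"
  and "f \<in> S \<rightarrow> carrier N"
 shows "finsum N f S = finsum R f S"
proof -
 interpret R: abelian_group R by fact
 interpret N: abelian_group N by fact
 from assms(6) show ?thesis
 proof (induction S rule: infinite_finite_induct)
  case (insert x S)
  then have "f \<in> S \<rightarrow> carrier N" "f x \<in> carrier N" by auto
  with insert assms(3) show ?case
   by (subst N.finsum_insert, simp_all, subst R.finsum_insert) (auto simp: assms(4))
 qed (simp_all add: assms(5))
qed

locale graded_pre = monomial_quotient Q J F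
 for Q :: "('v, 'e) pre_digraph" and J :: "('v, 'e, 'k::field) path_elem set" and F +
 fixes M :: "(('v, 'e, 'k) bq_elem, 'm) graded_module" (structure)
 assumes gr: "gr_pre Q J M"
begin

lemma lm: "left_module A M" using gr by (simp add: gr_pre_def)

sublocale ag: abelian_group M using lm by (simp add: left_module_def)

definition ev :: "('v, 'e, 'k) path_elem => 'm => 'm" where "ev f x = cls f \<odot> x"

lemma ev_closed [simp]: "f \<in> KQ ==> x \<in> carrier M ==> ev f x \<in> carrier M"
 by (simp add: ev_def left_module.smult_closed[OF lm] cls_closed)

lemma ev_add_left: "f \<in> KQ ==> g \<in> KQ ==> x \<in> carrier M ==> ev (f + g) x = ev f x \<oplus> ev g x"
 by (simp add: ev_def left_module.smult_l_distr[OF lm] cls_closed cls_add)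

lemma ev_add_right: "f \<in> KQ ==> x \<in> carrier M ==> y \<in> carrier M ==> ev f (x \<oplus> y) = ev f x \<oplus> ev f y"
 by (simp add: ev_def left_module.smult_r_distr[OF lm] cls_closed)

lemma ev_times: "f \<in> KQ ==> g \<in> KQ ==> x \<in> carrier M ==> ev (path_times Q f g) x = ev f (ev g x)"
 by (simp add: ev_def left_module.smult_assoc[OF lm] cls_closed cls_mult)


lemma self_double_zero: "x \<in> carrier M ==> x \<oplus> x = x ==> x = \<zero>"
 by (metis ag.l_zero ag.zero_closed ag.add.right_cancel)

lemma ev_zero_right [simp]: "f \<in> KQ ==> ev f \<zero> = \<zero>"
 using ev_add_right[of f "\<zero>" "\<zero>"] by (intro self_double_zero) auto

lemma ev_zero_left [simp]: "x \<in> carrier M ==> ev 0 x = \<zero>"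
 using ev_add_left[of 0 0 x] by (intro self_double_zero) auto

lemma ev_minus: "f \<in> KQ ==> x \<in> carrier M ==> ev f (\<ominus> x) = \<ominus> ev f x"
 using ev_add_right[of f "\<ominus> x" x] by (intro ag.minus_equality[symmetric]) (auto simp: ag.l_neg)

lemma ev_finsum_right: "f \<in> KQ ==> g \<in> S \<rightarrow> carrier M ==>
  ev f (\<Oplus>i\<in>S. g i) = (\<Oplus>i\<in>S. ev f (g i))"
 unfolding ev_def by (rule left_module_finsum_r[OF lm]) (auto simp: cls_closed)

lemma ev_sum_left: "finite S ==> (!!i. i \<in> S ==> f i \<in> KQ) ==> x \<in> carrier M ==>
  ev (\<Sum>i\<in>S. f i) x = (\<Oplus>i\<in>S. ev (f i) x)"
proof (induction S rule: finite_induct)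
 case (insert i S)
 then show ?case by (simp add: ev_add_left KQ_sum Pi_def)
qed simp

lemma ev_red: "f \<in> KQ ==> ev (red f) x = ev f x"
 by (simp add: ev_def cls_red)

subsection \<open>Homogeneous components\<close>

lemma hc_subgroup: "additive_subgroup (hcomp M n) M" using gr by (simp add: gr_pre_def)
lemma hc_carrier: "x \<in> hcomp M n ==> x \<in> carrier M"
 using additive_subgroup.a_Hcarr[OF hc_subgroup] by blast
lemma hc_zero [simp]: "\<zero> \<in> hcomp M n"
 using additive_subgroup.zero_closed[OF hc_subgroup] .
lemma hc_add: "x \<in> hcomp M n ==> y \<in> hcomp M n ==> x \<oplus> y \<in> hcomp M n"
 using additive_subgroup.a_closed[OF hc_subgroup] .
lemma hc_minus: "x \<in> hcomp M n ==> \<ominus> x \<in> hcomp M n"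
 by (rule additive_subgroup.a_inv_closed[OF hc_subgroup])
lemma hc_finsum: "(!!i. i \<in> S ==> f i \<in> hcomp M n) ==> (\<Oplus>i\<in>S. f i) \<in> hcomp M n"
proof (induction S rule: infinite_finite_induct)
 case (insert x S)
 then have "f \<in> S \<rightarrow> carrier M" "f x \<in> carrier M" using hc_carrier by blast+
 with insert show ?case by (simp add: hc_add)
qed auto

definition HQ :: "nat => ('v, 'e, 'k) path_elem set" where
 "HQ i = {f \<in> KQ. \<forall>p\<in>keys f. length (snd p) = i}"

lemma HQ_KQ: "f \<in> HQ i ==> f \<in> KQ" by (simp add: HQ_def)

lemma HQ_single: "p \<in> paths Q ==> single p c \<in> HQ (length (snd p))" by (auto simp: HQ_def)

lemma ev_hc:
 assumes "f \<in> HQ i" "x \<in> hcomp M n"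
 shows "ev f x \<in> hcomp M (n + int i)"
proof -
 have "cls f \<in> bq_degree Q J i" using assms(1) by (auto simp: bq_degree_def HQ_def KQ_def)
 with gr assms(2) show ?thesis unfolding ev_def gr_pre_def by blast
qed

definition hp :: "'m => int => 'm" where
 "hp x = (THE c. (\<forall>n. c n \<in> hcomp M n) & finite {n. c n ~= \<zero>} &
    x = (\<Oplus>n\<in>{n. c n ~= \<zero>}. c n))"

lemma hp_ex1: "x \<in> carrier M ==> \<exists>!c. (\<forall>n. c n \<in> hcomp M n) & finite {n. c n ~= \<zero>} &
    x = (\<Oplus>n\<in>{n. c n ~= \<zero>}. c n)"
 using gr by (simp add: gr_pre_def)

lemma hp_props:
 assumes "x \<in> carrier M"
 shows hp_hc: "hp x n \<in> hcomp M n" and hp_fin: "finite {n. hp x n ~= \<zero>}"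
  and hp_sum0: "x = (\<Oplus>n\<in>{n. hp x n ~= \<zero>}. hp x n)"
 using theI'[OF hp_ex1[OF assms]] unfolding hp_def[symmetric] by blast+

lemma hp_carrier [simp]: "x \<in> carrier M ==> hp x n \<in> carrier M"
 using hp_hc hc_carrier by blast

lemma finsum_support:
 assumes "finite S" "!!n. c n ~= \<zero> ==> n \<in> S" "!!n. c n \<in> carrier M"
 shows "(\<Oplus>n\<in>{n. c n ~= \<zero>}. c n) = (\<Oplus>n\<in>S. c n)"
 by (rule ag.add.finprod_mono_neutral_cong_left) (use assms in auto)

lemma hp_sum: "x \<in> carrier M ==> finite S ==> (!!n. hp x n ~= \<zero> ==> n \<in> S) ==>
  (\<Oplus>n\<in>S. hp x n) = x"
 using finsum_support[of S "hp x"] hp_sum0[of x] by simp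

lemma hp_eqI:
 assumes "finite S" "!!n. n \<in> S ==> c n \<in> hcomp M n" "x = (\<Oplus>n\<in>S. c n)"
 shows "hp x n = (if n \<in> S then c n else \<zero>)"
proof -
 define c' where "c' n = (if n \<in> S then c n else \<zero>)" for n
 have c': "c' n \<in> hcomp M n" for n using assms(2) by (simp add: c'_def)
 have S: "n \<in> S" if "c' n ~= \<zero>" for n using that by (simp add: c'_def split: if_splits)
 have x: "x \<in> carrier M"
  unfolding assms(3) using assms(2) hc_carrier by (intro ag.finsum_closed) blast
 have "c n \<in> carrier M" if "n \<in> S" for n using assms(2)[OF that] by (rule hc_carrier)
 then have "x = (\<Oplus>n\<in>S. c' n)"
  unfolding assms(3) by (intro ag.finsum_cong') (auto simp: c'_def)
 also have "... = (\<Oplus>n\<in>{n. c' n ~= \<zero>}. c' n)"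
  by (rule finsum_support[symmetric]) (use assms(1) S c' hc_carrier in auto)
 finally have "x = (\<Oplus>n\<in>{n. c' n ~= \<zero>}. c' n)" .
 moreover have "finite {n. c' n ~= \<zero>}" using S assms(1) by (auto intro: finite_subset)
 ultimately have "hp x = c'"
  unfolding hp_def using c' by (intro the1_equality[OF hp_ex1[OF x]]) auto
 then show ?thesis by (simp add: c'_def)
qed

lemma hp_hom: "x \<in> hcomp M n ==> hp x m = (if m = n then x else \<zero>)"
 using hp_eqI[of "{n}" "%_. x" x m] hc_carrier[of x n] by simp

lemma hp_zero [simp]: "hp \<zero> m = \<zero>"
 using hp_hom[of "\<zero>" m m] by simp

lemma hp_ext:
 assumes "x \<in> carrier M" "y \<in> carrier M" "!!n. hp x n = hp y n"
 shows "x = y"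
 using hp_sum0[OF assms(1)] hp_sum0[OF assms(2)] assms(3) by simp

lemma hp_add:
 assumes x: "x \<in> carrier M" and y: "y \<in> carrier M"
 shows "hp (x \<oplus> y) n = hp x n \<oplus> hp y n"
proof -
 let ?S = "{n. hp x n ~= \<zero>} \<union> {n. hp y n ~= \<zero>}"
 have S: "finite ?S" using hp_fin x y by simp
 have "x \<oplus> y = (\<Oplus>n\<in>?S. hp x n) \<oplus> (\<Oplus>n\<in>?S. hp y n)"
  using hp_sum[OF x S] hp_sum[OF y S] by simp
 also have "... = (\<Oplus>n\<in>?S. hp x n \<oplus> hp y n)"
  using x y by (intro ag.finsum_addf[symmetric]) auto
 finally show ?thesis
  using hp_eqI[OF S, of "%n. hp x n \<oplus> hp y n" "x \<oplus> y" n] x y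
  by (auto simp: hp_hc hc_add)
qed

lemma hp_minus: "x \<in> carrier M ==> hp (\<ominus> x) n = \<ominus> hp x n"
 using hp_add[of "\<ominus> x" x n] by (intro ag.minus_equality[symmetric]) (auto simp: ag.l_neg)

lemma hp_finsum:
 assumes "f \<in> S \<rightarrow> carrier M"
 shows "hp (\<Oplus>i\<in>S. f i) n = (\<Oplus>i\<in>S. hp (f i) n)"
 using assms
proof (induction S rule: infinite_finite_induct)
 case (insert x S)
 then have "f \<in> S \<rightarrow> carrier M" "f x \<in> carrier M" by auto
 with insert show ?case by (simp add: hp_add Pi_def)
qed auto

lemma hp_ev:
 assumes f: "f \<in> HQ i" and x: "x \<in> carrier M"
 shows "hp (ev f x) n = ev f (hp x (n - int i))"
proof -
 let ?S = "{n. hp x n ~= \<zero>}"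
 have S: "finite ?S" by (rule hp_fin[OF x])
 note fK = HQ_KQ[OF f]
 have "hp (ev f x) n = hp (ev f (\<Oplus>m\<in>?S. hp x m)) n" using hp_sum0[OF x] by simp
 also have "... = (\<Oplus>m\<in>?S. hp (ev f (hp x m)) n)"
  using x fK by (subst ev_finsum_right) (auto simp: hp_finsum)
 also have "... = (\<Oplus>m\<in>?S. if n - int i = m then ev f (hp x (n - int i)) else \<zero>)"
  using x fK hp_hom[OF ev_hc[OF f hp_hc[OF x]]] by (intro ag.finsum_cong') auto
 also have "... = ev f (hp x (n - int i))"
 proof (cases "n - int i \<in> ?S")
  case True
  show ?thesis
   by (rule ag.finsum_singleton[OF True S]) (use x fK in auto)
 next
  case False
  then have "(\<Oplus>m\<in>?S. if n - int i = m then ev f (hp x (n - int i)) else \<zero>) = \<zero>"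
   by (intro ag.add.finprod_one_eqI) auto
  then show ?thesis using False fK by simp
 qed
 finally show ?thesis .
qed

subsection \<open>Restriction to a set of degrees\<close>

definition cut :: "int set => 'm => 'm" where
 "cut D x = (\<Oplus>n\<in>{n \<in> D. hp x n ~= \<zero>}. hp x n)"

lemma cut_closed [simp]: "x \<in> carrier M ==> cut D x \<in> carrier M"
 unfolding cut_def by (intro ag.finsum_closed) auto

lemma hp_cut: "x \<in> carrier M ==> hp (cut D x) n = (if n \<in> D then hp x n else \<zero>)"
 using hp_eqI[of "{n \<in> D. hp x n ~= \<zero>}" "hp x" "cut D x" n] hp_fin[of x]
 by (auto simp: cut_def hp_hc)

lemma cut_add: "x \<in> carrier M ==> y \<in> carrier M ==> cut D (x \<oplus> y) = cut D x \<oplus> cut D y"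
 by (rule hp_ext) (auto simp: hp_cut hp_add)

lemma cut_id: "x \<in> carrier M ==> (!!n. n ~: D ==> hp x n = \<zero>) ==> cut D x = x"
 by (rule hp_ext) (auto simp: hp_cut)

lemma cut_zero [simp]: "cut D \<zero> = \<zero>"
 by (rule cut_id) auto

text \<open>
 The component outside \<open>D\<close> of a product is discarded.  If \<open>D\<close> is closed upwards, this gives a submodule, if
 it is closed downwards, a quotient module, realised on a subset of the same module; both truncations
 thus have elements of the original type.
\<close>
definition trunc :: "int set => (('v, 'e, 'k) bq_elem, 'm) graded_module" where
 "trunc D = M\<lparr>carrier := {x \<in> carrier M. \<forall>n. n ~: D --> hp x n = \<zero>},
   smult := (%a x. cut D (a \<odot> x)), hcomp := (%n. if n \<in> D then hcomp M n else {\<zero>})\<rparr>"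

lemma trunc_simps [simp]:
 "carrier (trunc D) = {x \<in> carrier M. \<forall>n. n ~: D --> hp x n = \<zero>}"
 "add (trunc D) = add M" "zero (trunc D) = zero M"
 "smult (trunc D) = (%a x. cut D (a \<odot> x))"
 "hcomp (trunc D) = (%n. if n \<in> D then hcomp M n else {\<zero>})"
 by (simp_all add: trunc_def)

text \<open>A set of degrees is convex here if it contains every degree between two of its members.\<close>
definition convex :: "int set => bool" where
 "convex D \<longleftrightarrow> (\<forall>a b c. a \<le> b --> b \<le> c --> a \<in> D --> c \<in> D --> b \<in> D)"

lemma cut_ev_cut:
 assumes f: "f \<in> KQ" and y: "y \<in> carrier M"
  and D: "!!n i. n \<in> D ==> n - int i ~: D ==> hp y (n - int i) = \<zero>"
 shows "cut D (ev f (cut D y)) = cut D (ev f y)"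
proof -
 have "f \<in> KQ --> cut D (ev f (cut D y)) = cut D (ev f y)"
 proof (induction f rule: additive_ext[where P = "%f. f \<in> KQ & cut D (ev f (cut D y)) = cut D (ev f y)", THEN conjunct2, THEN impI])
  case (3 p c)
  then have p: "p \<in> paths Q" using f by (auto simp: KQ_def)
  note h = HQ_single[OF p, of c]
  have "cut D (ev (single p c) (cut D y)) = cut D (ev (single p c) y)"
  proof (rule hp_ext)
   fix n
   show "hp (cut D (ev (single p c) (cut D y))) n = hp (cut D (ev (single p c) y)) n"
    using y p D[of n "length (snd p)"] by (auto simp: hp_cut hp_ev[OF h])
  qed (use y p in auto)
  with p show ?case by simp
 qed (use y in "auto simp: ev_add_left cut_add KQ_add")
 with f show ?thesis by simp
qed

lemma trunc_abelian_group: "abelian_group (trunc D)"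
proof (rule abelian_groupI)
 fix x assume "x \<in> carrier (trunc D)"
 then show "\<exists>y\<in>carrier (trunc D). y \<oplus>\<^bsub>trunc D\<^esub> x = \<zero>\<^bsub>trunc D\<^esub>"
  by (intro bexI[of _ "\<ominus> x"]) (auto simp: ag.l_neg hp_minus)
qed (auto simp: hp_add ag.a_ac)

lemma trunc_finsum:
 "f \<in> S \<rightarrow> carrier (trunc D) ==> finsum (trunc D) f S = finsum M f S"
proof (induction S rule: infinite_finite_induct)
 case (insert x S)
 interpret T: abelian_group "trunc D" by (rule trunc_abelian_group)
 have "finsum (trunc D) f (insert x S) = f x \<oplus>\<^bsub>trunc D\<^esub> finsum (trunc D) f S"
  by (rule T.finsum_insert) (use insert in auto)
 also have "... = finsum M f (insert x S)"
  using insert by (subst ag.finsum_insert) (auto simp: Pi_def)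
 finally show ?case .
next
 interpret T: abelian_group "trunc D" by (rule trunc_abelian_group)
 case empty show ?case by (simp only: T.finsum_empty ag.finsum_empty trunc_simps)
next
 interpret T: abelian_group "trunc D" by (rule trunc_abelian_group)
 case (infinite S)
 show ?case unfolding T.finsum_infinite[OF infinite(1)] ag.finsum_infinite[OF infinite(1)] by simp
qed

lemma trunc_left_module:
 assumes D: "convex D"
 shows "left_module A (trunc D)"
proof -
 have "cut D (ev (path_times Q f g) x) = cut D (ev f (cut D (ev g x)))"
  if f: "f \<in> KQ" and g: "g \<in> KQ" and x: "x \<in> carrier (trunc D)" for f g x
 proof -
  have xM: "x \<in> carrier M" using x by simp
  have P: "f \<in> KQ --> True" by simp
  have "cut D (ev f (cut D (ev g x))) = cut D (ev f (ev g x))"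
  proof (rule additive_ext[where f = g and P = "%g. g \<in> KQ & cut D (ev f (cut D (ev g x))) = cut D (ev f (ev g x))", THEN conjunct2])
   fix p c assume "p \<in> keys g"
   then have p: "p \<in> paths Q" using g by (auto simp: KQ_def)
   have "cut D (ev f (cut D (ev (single p c) x))) = cut D (ev f (ev (single p c) x))"
   proof (rule cut_ev_cut[OF f])
    fix n i assume n: "n \<in> D" "n - int i ~: D"
    have "n - int i - int (length (snd p)) ~: D"
    proof
     assume "n - int i - int (length (snd p)) \<in> D"
     with n(1) D have "n - int i \<in> D" unfolding convex_def by (elim allE[of _ "n - int i - int (length (snd p))"] allE[of _ "n - int i"] allE[of _ n]) auto
     with n(2) show False by simp
    qed
    then show "hp (ev (single p c) x) (n - int i) = \<zero>"
     using x p by (simp add: hp_ev[OF HQ_single[OF p] xM])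
   qed (use p xM in auto)
   with p show "single p c \<in> KQ & cut D (ev f (cut D (ev (single p c) x))) = cut D (ev f (ev (single p c) x))"
    by simp
  qed (use f xM in "auto simp: ev_add_left ev_add_right cut_add KQ_add")
  then show ?thesis using f g xM by (simp add: ev_times)
 qed note assoc = this
 show ?thesis
  unfolding left_module_def left_module_axioms_def
 proof (intro conjI allI impI)
  show "ring A" by (rule ring_A)
  show "abelian_group (trunc D)" by (rule trunc_abelian_group)
 next
  fix a x assume a: "a \<in> carrier A" and x: "x \<in> carrier (trunc D)"
  then show "a \<odot>\<^bsub>trunc D\<^esub> x \<in> carrier (trunc D)"
   using left_module.smult_closed[OF lm, of a x] by (auto simp: hp_cut)
 next
  fix a b x assume "a \<in> carrier A" "b \<in> carrier A" "x \<in> carrier (trunc D)"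
  then show "(a \<oplus>\<^bsub>A\<^esub> b) \<odot>\<^bsub>trunc D\<^esub> x = a \<odot>\<^bsub>trunc D\<^esub> x \<oplus>\<^bsub>trunc D\<^esub> b \<odot>\<^bsub>trunc D\<^esub> x"
   using left_module.smult_l_distr[OF lm, of a b x] left_module.smult_closed[OF lm, of _ x]
   by (auto simp: cut_add)
 next
  fix a x y assume "a \<in> carrier A" "x \<in> carrier (trunc D)" "y \<in> carrier (trunc D)"
  then show "a \<odot>\<^bsub>trunc D\<^esub> (x \<oplus>\<^bsub>trunc D\<^esub> y) = a \<odot>\<^bsub>trunc D\<^esub> x \<oplus>\<^bsub>trunc D\<^esub> a \<odot>\<^bsub>trunc D\<^esub> y"
   using left_module.smult_r_distr[OF lm, of a x y] left_module.smult_closed[OF lm, of a]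
   by (auto simp: cut_add)
 next
  fix a b x assume ab: "a \<in> carrier A" "b \<in> carrier A" and x: "x \<in> carrier (trunc D)"
  then obtain f g where fg: "a = cls f" "b = cls g" "f \<in> KQ" "g \<in> KQ" by (auto simp: carrier_A)
  from assoc[OF fg(3,4) x]
  show "(a \<otimes>\<^bsub>A\<^esub> b) \<odot>\<^bsub>trunc D\<^esub> x = a \<odot>\<^bsub>trunc D\<^esub> (b \<odot>\<^bsub>trunc D\<^esub> x)"
   by (simp add: fg(1,2) ev_def cls_mult[OF fg(3,4)])
 next
  fix x assume "x \<in> carrier (trunc D)"
  then show "\<one>\<^bsub>A\<^esub> \<odot>\<^bsub>trunc D\<^esub> x = x"
   using left_module.smult_one[OF lm, of x] by (auto simp: cut_id)
 qed
qed

lemma hc_trunc_sub: "n \<in> D ==> x \<in> hcomp M n ==> x \<in> carrier (trunc D)"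
 using hc_carrier hp_hom by auto

lemma scalar_HQ: "path_scalar Q c \<in> HQ 0"
proof -
 have "length (snd p) = 0" if p: "p \<in> keys (path_scalar Q c)" for p
 proof -
  from p keys_sum[of "%v. single (v, []) c" "verts Q"]
  obtain v where "p \<in> keys (single (v, [] :: 'e list) c)" unfolding path_scalar_def by blast
  then show ?thesis by (auto split: if_splits)
 qed
 then show ?thesis by (auto simp: HQ_def)
qed


lemma scalar_trunc:
 assumes x: "x \<in> carrier (trunc D)"
 shows "bq_scalar Q J c \<odot>\<^bsub>trunc D\<^esub> x = bq_scalar Q J c \<odot> x" "bq_scalar Q J c \<odot> x \<in> carrier (trunc D)"
proof -
 have "hp (ev (path_scalar Q c) x) n = \<zero>" if "n ~: D" for n
  using x that by (simp add: hp_ev[OF scalar_HQ])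
 moreover have "ev (path_scalar Q c) x \<in> carrier M" using x by simp
 ultimately show "bq_scalar Q J c \<odot>\<^bsub>trunc D\<^esub> x = bq_scalar Q J c \<odot> x" "bq_scalar Q J c \<odot> x \<in> carrier (trunc D)"
  by (auto simp: cut_id ev_def bq_scalar_def)
qed

lemma fin_dim_trunc:
 assumes "fin_dim Q J M U" "U <= carrier (trunc D)"
 shows "fin_dim Q J (trunc D) U"
proof -
 from assms(1) obtain B where B: "finite B" "B <= U"
  "\<forall>u\<in>U. \<exists>c. u = (\<Oplus>b\<in>B. bq_scalar Q J (c b) \<odot> b)" unfolding fin_dim_def by blast
 have "(\<Oplus>\<^bsub>trunc D\<^esub>b\<in>B. bq_scalar Q J (c b) \<odot>\<^bsub>trunc D\<^esub> b) = (\<Oplus>b\<in>B. bq_scalar Q J (c b) \<odot> b)" for c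
 proof -
  have BD: "b \<in> carrier (trunc D)" if "b \<in> B" for b using that B(2) assms(2) by blast
  have "(\<Oplus>\<^bsub>trunc D\<^esub>b\<in>B. bq_scalar Q J (c b) \<odot>\<^bsub>trunc D\<^esub> b) = (\<Oplus>b\<in>B. bq_scalar Q J (c b) \<odot>\<^bsub>trunc D\<^esub> b)"
   by (rule trunc_finsum, rule Pi_I, subst scalar_trunc(1)[OF BD]) (simp_all only: scalar_trunc(2)[OF BD])
  also have "... = (\<Oplus>b\<in>B. bq_scalar Q J (c b) \<odot> b)"
   by (rule ag.finsum_cong') (use scalar_trunc[OF BD] in auto)
  finally show ?thesis .
 qed
 note eq = this
 show ?thesis unfolding fin_dim_def
 proof (intro exI[of _ B] conjI ballI)
  fix u assume "u \<in> U"
  with B(3) show "\<exists>c. u = (\<Oplus>\<^bsub>trunc D\<^esub>b\<in>B. bq_scalar Q J (c b) \<odot>\<^bsub>trunc D\<^esub> b)" unfolding eq by blast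
 qed (use B in auto)
qed

lemma trunc_gr_pre:
 assumes D: "convex D"
 shows "gr_pre Q J (trunc D)"
 unfolding gr_pre_def
proof (intro conjI allI ballI)
 show "left_module A (trunc D)" by (rule trunc_left_module[OF D])
 interpret T: abelian_group "trunc D" by (rule trunc_abelian_group)
 fix n
 have sub: "hcomp (trunc D) n <= carrier (trunc D)"
  using hc_trunc_sub by auto
 show "additive_subgroup (hcomp (trunc D) n) (trunc D)"
 proof
  show "hcomp (trunc D) n <= carrier (add_monoid (trunc D))" using sub by simp
  show "x \<otimes>\<^bsub>add_monoid (trunc D)\<^esub> y \<in> hcomp (trunc D) n"
   if "x \<in> hcomp (trunc D) n" "y \<in> hcomp (trunc D) n" for x y
   using that by (auto simp: hc_add split: if_splits)
  show "\<one>\<^bsub>add_monoid (trunc D)\<^esub> \<in> hcomp (trunc D) n" by simp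
  show "inv\<^bsub>add_monoid (trunc D)\<^esub> x \<in> hcomp (trunc D) n" if x: "x \<in> hcomp (trunc D) n" for x
  proof -
   have xM: "x \<in> carrier (trunc D)" using x sub by blast
   have "\<ominus>\<^bsub>trunc D\<^esub> x = \<ominus> x"
    using xM by (intro T.minus_equality) (auto simp: ag.l_neg hp_minus)
   then have inv: "inv\<^bsub>add_monoid (trunc D)\<^esub> x = \<ominus> x" unfolding a_inv_def .
   show ?thesis unfolding inv using x by (auto simp: hc_minus split: if_splits)
  qed
 qed
next
 fix x assume x: "x \<in> carrier (trunc D)"
 then have xM: "x \<in> carrier M" by simp
 have eq: "(\<Oplus>\<^bsub>trunc D\<^esub>n\<in>S. c n) = (\<Oplus>n\<in>S. c n)" if "!!n. c n \<in> hcomp (trunc D) n" for c :: "int => 'm" and S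
 proof (rule trunc_finsum, rule Pi_I)
  fix n
  show "c n \<in> carrier (trunc D)" using that[of n] hc_trunc_sub[of n D "c n"] by (cases "n \<in> D") auto
 qed
 have hpD: "hp x n \<in> hcomp (trunc D) n" for n
  using x hp_hc[OF xM] by simp
 show "\<exists>!c. (\<forall>n. c n \<in> hcomp (trunc D) n) & finite {n. c n ~= \<zero>\<^bsub>trunc D\<^esub>} &
   x = (\<Oplus>\<^bsub>trunc D\<^esub>n\<in>{n. c n ~= \<zero>\<^bsub>trunc D\<^esub>}. c n)"
 proof (rule ex1I[of _ "hp x"])
  show "(\<forall>n. hp x n \<in> hcomp (trunc D) n) & finite {n. hp x n ~= \<zero>\<^bsub>trunc D\<^esub>} &
   x = (\<Oplus>\<^bsub>trunc D\<^esub>n\<in>{n. hp x n ~= \<zero>\<^bsub>trunc D\<^esub>}. hp x n)"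
   using hpD hp_fin[OF xM] hp_sum0[OF xM] eq[OF hpD] by simp
 next
  fix c assume c: "(\<forall>n. c n \<in> hcomp (trunc D) n) & finite {n. c n ~= \<zero>\<^bsub>trunc D\<^esub>} &
   x = (\<Oplus>\<^bsub>trunc D\<^esub>n\<in>{n. c n ~= \<zero>\<^bsub>trunc D\<^esub>}. c n)"
  then have cM: "c n \<in> hcomp M n" for n by (cases "n \<in> D") (auto dest: spec[of _ n])
  have "x = (\<Oplus>n\<in>{n. c n ~= \<zero>}. c n)" using c eq[of c] by simp
  from hp_eqI[OF _ cM this] c show "c = hp x" by (auto simp: fun_eq_iff)
 qed
next
 have "a \<odot>\<^bsub>trunc D\<^esub> x \<in> hcomp (trunc D) (n + int i)"
  if a: "a \<in> bq_degree Q J i" and x: "x \<in> hcomp (trunc D) n" for i n a x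
 proof -
  from a obtain f where f: "a = cls f" "f \<in> HQ i" by (auto simp: bq_degree_def HQ_def KQ_def)
  have xM: "x \<in> hcomp M n" using x by (auto split: if_splits)
  have e: "ev f x \<in> hcomp M (n + int i)" by (rule ev_hc[OF f(2) xM])
  have "cut D (ev f x) = (if n + int i \<in> D then ev f x else \<zero>)"
  proof (rule hp_ext)
   fix m show "hp (cut D (ev f x)) m = hp (if n + int i \<in> D then ev f x else \<zero>) m"
    by (cases "m = n + int i") (simp_all add: hp_cut[OF hc_carrier[OF e]] hp_hom[OF e])
  qed (simp_all add: hc_carrier[OF e])
  with e show ?thesis by (simp add: f(1) ev_def)
 qed
 then show "!!i n a x. a \<in> bq_degree Q J i ==> x \<in> hcomp (trunc D) n ==>
   a \<odot>\<^bsub>trunc D\<^esub> x \<in> hcomp (trunc D) (n + int i)" .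
qed

lemma fin_dim_add:
 assumes U: "fin_dim Q J M U" "U <= W" and V: "fin_dim Q J M V" "V <= W" and W: "W <= carrier M"
  and dec: "!!w. w \<in> W ==> \<exists>u\<in>U. \<exists>v\<in>V. w = u \<oplus> v"
 shows "fin_dim Q J M W"
proof -
 from U(1) obtain B where B: "finite B" "B <= U"
  "\<forall>u\<in>U. \<exists>c. u = (\<Oplus>b\<in>B. bq_scalar Q J (c b) \<odot> b)" unfolding fin_dim_def by blast
 from V(1) obtain C where C: "finite C" "C <= V"
  "\<forall>u\<in>V. \<exists>c. u = (\<Oplus>b\<in>C. bq_scalar Q J (c b) \<odot> b)" unfolding fin_dim_def by blast
 have BC: "x \<in> carrier M" if "x \<in> B \<union> C" for x using that B C U V W by blast
 have ext: "(\<Oplus>b\<in>X. bq_scalar Q J (c b) \<odot> b) =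
   (\<Oplus>b\<in>B \<union> C. ev (path_scalar Q (if b \<in> X then c b else 0)) b)" if X: "X <= B \<union> C" for X c
 proof -
  define g where "g b = ev (path_scalar Q (if b \<in> X then c b else 0)) b" for b
  have z: "path_scalar Q (0::'k) = 0" by (simp add: path_scalar_def)
  have 1: "g b = \<zero>" if "b \<in> B \<union> C - X" for b using that BC by (auto simp: g_def z)
  have 2: "g b \<in> carrier M" if "b \<in> B \<union> C" for b using BC[OF that] by (simp add: g_def)
  have 3: "bq_scalar Q J (c b) \<odot> b = g b" if "b \<in> X" for b
   using that by (simp add: g_def ev_def bq_scalar_def)
  have "(\<Oplus>b\<in>X. bq_scalar Q J (c b) \<odot> b) = (\<Oplus>b\<in>B \<union> C. g b)"
   by (rule ag.add.finprod_mono_neutral_cong_left) (use 1 2 3 X B C in auto)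
  then show ?thesis unfolding g_def .
 qed
 have sc: "path_scalar Q (s + t) = path_scalar Q s + path_scalar Q (t::'k)" for s t
  by (simp add: path_scalar_def single_add sum.distrib)
 show ?thesis unfolding fin_dim_def
 proof (intro exI[of _ "B \<union> C"] conjI ballI)
  fix w assume "w \<in> W"
  then obtain u v where uv: "u \<in> U" "v \<in> V" "w = u \<oplus> v" using dec by blast
  obtain c where c: "u = (\<Oplus>b\<in>B. bq_scalar Q J (c b) \<odot> b)" using B uv by blast
  obtain d where d: "v = (\<Oplus>b\<in>C. bq_scalar Q J (d b) \<odot> b)" using C uv by blast
  have "w = (\<Oplus>b\<in>B \<union> C. ev (path_scalar Q (if b \<in> B then c b else 0)) b \<oplus> ev (path_scalar Q (if b \<in> C then d b else 0)) b)"
   unfolding uv(3) c d ext[OF Un_upper1] ext[OF Un_upper2]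
   using BC by (intro ag.finsum_addf[symmetric]) auto
  also have "... = (\<Oplus>b\<in>B \<union> C. bq_scalar Q J ((if b \<in> B then c b else 0) + (if b \<in> C then d b else 0)) \<odot> b)"
  proof (rule ag.finsum_cong')
   fix b assume "b \<in> B \<union> C"
   from BC[OF this] ev_add_left[OF KQ_scalar KQ_scalar BC[OF this]]
   show "ev (path_scalar Q (if b \<in> B then c b else 0)) b \<oplus> ev (path_scalar Q (if b \<in> C then d b else 0)) b =
     bq_scalar Q J ((if b \<in> B then c b else 0) + (if b \<in> C then d b else 0)) \<odot> b"
    unfolding bq_scalar_def ev_def[symmetric] sc by simp
  next
   show "(%b. bq_scalar Q J ((if b \<in> B then c b else 0) + (if b \<in> C then d b else 0)) \<odot> b) \<in> B \<union> C \<rightarrow> carrier M"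
    unfolding bq_scalar_def ev_def[symmetric] using BC by auto
  qed simp
  finally show "\<exists>c. w = (\<Oplus>b\<in>B \<union> C. bq_scalar Q J (c b) \<odot> b)"
   by (intro exI[of _ "%b. (if b \<in> B then c b else 0) + (if b \<in> C then d b else 0)"])
 qed (use B C U V in auto)
qed

end

locale graded_mod = graded_pre Q J F M
 for Q :: "('v, 'e) pre_digraph" and J :: "('v, 'e, 'k::field) path_elem set" and F
  and M :: "(('v, 'e, 'k) bq_elem, 'm) graded_module" (structure) +
 assumes fd: "!!n. fin_dim Q J M (hcomp M n)"
begin

lemma hc_fin_dim: "fin_dim Q J M (hcomp M n)" by (rule fd)

lemma trunc_gr_module:
 assumes D: "convex D"
 shows "gr_module Q J (trunc D)"
 unfolding gr_module_iff
proof (intro conjI allI)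
 show "gr_pre Q J (trunc D)" by (rule trunc_gr_pre[OF D])
 fix n
 have sub: "hcomp (trunc D) n <= carrier (trunc D)"
  using hc_trunc_sub by auto
 show "fin_dim Q J (trunc D) (hcomp (trunc D) n)"
 proof (cases "n \<in> D")
  case True
  then show ?thesis using fin_dim_trunc[OF hc_fin_dim] sub by simp
 next
  case False
  interpret T: abelian_group "trunc D" by (rule trunc_abelian_group)
  have "\<exists>c. \<zero> = (\<Oplus>\<^bsub>trunc D\<^esub>b\<in>{}. bq_scalar Q J (c b) \<odot>\<^bsub>trunc D\<^esub> b)"
   unfolding T.finsum_empty by simp
  with False show ?thesis unfolding fin_dim_def by (intro exI[of _ "{}"]) simp
 qed
qed

lemma fin_dim_bounded: "fin_dim Q J M (carrier (trunc {l..<l + int n}))"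
proof (induction n)
 case 0
 have "carrier (trunc {l..<l + int 0}) <= {\<zero>}"
  by (auto intro: hp_ext)
 then show ?case unfolding fin_dim_def by (intro exI[of _ "{}"]) auto
next
 case (Suc n)
 show ?case
 proof (rule fin_dim_add[OF Suc _ hc_fin_dim[of "l + int n"]])
  show "hcomp M (l + int n) <= carrier (trunc {l..<l + int (Suc n)})"
   using hc_trunc_sub[of "l + int n" "{l..<l + int (Suc n)}"] by auto
  fix w assume w: "w \<in> carrier (trunc {l..<l + int (Suc n)})"
  then have wM: "w \<in> carrier M" by simp
  have "w = cut {l..<l + int n} w \<oplus> hp w (l + int n)"
  proof (rule hp_ext)
   fix m show "hp w m = hp (cut {l..<l + int n} w \<oplus> hp w (l + int n)) m"
    using w wM hp_hom[OF hp_hc[OF wM]]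
    by (cases "m = l + int n") (auto simp: hp_add hp_cut)
  qed (use wM in auto)
  moreover have "cut {l..<l + int n} w \<in> carrier (trunc {l..<l + int n})"
   using wM by (auto simp: hp_cut)
  ultimately show "\<exists>u\<in>carrier (trunc {l..<l + int n}). \<exists>v\<in>hcomp M (l + int n). w = u \<oplus> v"
   using hp_hc[OF wM] by blast
 qed auto
qed

lemma trunc_gmod:
 assumes "convex D" "carrier (trunc D) = carrier (trunc {l..<u})"
 shows "trunc D \<in> gmod Q J"
proof -
 have "{l..<u} = {l..<l + int (nat (u - l))}" by auto
 then have "fin_dim Q J M (carrier (trunc D))"
  using assms(2) fin_dim_bounded[of l "nat (u - l)"] by simp
 then have "fin_dim Q J (trunc D) (carrier (trunc D))" by (rule fin_dim_trunc) simp
 with trunc_gr_module[OF assms(1)] show ?thesis by (simp add: gmod_def)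
qed

end

section \<open>Homomorphisms, shifts and direct sums of graded modules\<close>

locale graded_hom = monomial_quotient Q J F + dom: graded_pre Q J F M + cod: graded_pre Q J F N
 for Q :: "('v, 'e) pre_digraph" and J :: "('v, 'e, 'k::field) path_elem set" and F
  and M :: "(('v, 'e, 'k) bq_elem, 'm) graded_module" and N :: "(('v, 'e, 'k) bq_elem, 'n) graded_module" +
 fixes f
 assumes hom: "f \<in> gr_hom Q J M N"
begin

lemma f_closed [simp]: "x \<in> carrier M ==> f x \<in> carrier N"
 using hom by (auto simp: gr_hom_def)
lemma f_add: "x \<in> carrier M ==> y \<in> carrier M ==> f (x \<oplus>\<^bsub>M\<^esub> y) = f x \<oplus>\<^bsub>N\<^esub> f y"
 using hom by (auto simp: gr_hom_def)
lemma f_ev: "g \<in> KQ ==> x \<in> carrier M ==> f (dom.ev g x) = cod.ev g (f x)"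
 using hom by (auto simp: gr_hom_def dom.ev_def cod.ev_def cls_closed)
lemma f_hc: "x \<in> hcomp M n ==> f x \<in> hcomp N n"
 using hom unfolding gr_hom_def by blast
lemma f_zero [simp]: "f \<zero>\<^bsub>M\<^esub> = \<zero>\<^bsub>N\<^esub>"
 using f_add[of "\<zero>\<^bsub>M\<^esub>" "\<zero>\<^bsub>M\<^esub>"] by (intro cod.self_double_zero) auto
lemma f_minus: "x \<in> carrier M ==> f (\<ominus>\<^bsub>M\<^esub> x) = \<ominus>\<^bsub>N\<^esub> f x"
 using f_add[of "\<ominus>\<^bsub>M\<^esub> x" x] by (intro cod.ag.minus_equality[symmetric]) (auto simp: dom.ag.l_neg)
lemma f_finsum: "g \<in> S \<rightarrow> carrier M ==> f (\<Oplus>\<^bsub>M\<^esub>i\<in>S. g i) = (\<Oplus>\<^bsub>N\<^esub>i\<in>S. f (g i))"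
proof (induction S rule: infinite_finite_induct)
 case (insert x S)
 then have "g \<in> S \<rightarrow> carrier M" "g x \<in> carrier M" by auto
 with insert show ?case by (simp add: f_add Pi_def)
qed auto
lemma f_hp:
 assumes x: "x \<in> carrier M"
 shows "cod.hp (f x) n = f (dom.hp x n)"
proof -
 let ?S = "{n. dom.hp x n ~= \<zero>\<^bsub>M\<^esub>}"
 have "f x = f (\<Oplus>\<^bsub>M\<^esub>n\<in>?S. dom.hp x n)" using dom.hp_sum0[OF x] by simp
 also have "... = (\<Oplus>\<^bsub>N\<^esub>n\<in>?S. f (dom.hp x n))" by (rule f_finsum) (use x in auto)
 finally show ?thesis
  using cod.hp_eqI[OF dom.hp_fin[OF x], of "%n. f (dom.hp x n)" "f x" n] f_hc[OF dom.hp_hc[OF x]] by auto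
qed

end

context monomial_quotient
begin

definition arr :: "'e => ('v, 'e, 'k) path_elem" where "arr a = single (tail Q a, [a]) 1"
definition vtx :: "'v => ('v, 'e, 'k) path_elem" where "vtx v = single (v, []) 1"

lemma arr_KQ [simp]: "a \<in> arcs Q ==> arr a \<in> KQ" by (simp add: arr_def)
lemma vtx_KQ [simp]: "v \<in> verts Q ==> vtx v \<in> KQ" by (simp add: vtx_def)
lemma arr_times_vtx: "path_times Q (arr a) (vtx (tail Q a)) = arr a"
 by (simp add: arr_def vtx_def path_times_single path_end_simp)
lemma vtx_times_arr: "path_times Q (vtx (head Q a)) (arr a) = arr a"
 by (simp add: arr_def vtx_def path_times_single path_end_simp)
lemma vtx_times_vtx: "path_times Q (vtx v) (vtx w) = (if v = w then vtx w else 0)"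
 by (simp add: vtx_def path_times_single path_end_simp)
lemma arr_times_arr_F: "(a, b) \<in> F ==> cls (path_times Q (arr b) (arr a)) = \<zero>\<^bsub>A\<^esub>"
proof -
 assume ab: "(a, b) \<in> F"
 note F = F_arcs[OF ab]
 have eq: "path_times Q (arr b) (arr a) = single (tail Q a, [a, b]) 1"
  using F by (simp add: arr_def path_times_single path_end_simp)
 have "cls (single (tail Q a, [a, b]) 1) = cls 0"
  using F ab by (subst cls_eq_iff) (auto simp: lookup_single when_def good_def)
 then show ?thesis by (simp add: eq cls_zero)
qed

lemma graded_preI: "gr_pre Q J M ==> graded_pre Q J F M"
 by (intro graded_pre.intro graded_pre_axioms.intro monomial_quotient_axioms)

lemma graded_homI: "graded_pre Q J F M ==> graded_pre Q J F N ==> f \<in> gr_hom Q J M N ==> graded_hom Q J F M N f"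
 by (intro graded_hom.intro graded_hom_axioms.intro monomial_quotient_axioms)

end

context graded_pre
begin

lemma arr_hc: "a \<in> arcs Q ==> x \<in> hcomp M n ==> ev (arr a) x \<in> hcomp M (n + 1)"
 using ev_hc[OF HQ_single[of "(tail Q a, [a])" 1], of x n] by (simp add: arr_def)

lemma vtx_hc: "v \<in> verts Q ==> x \<in> hcomp M n ==> ev (vtx v) x \<in> hcomp M n"
 using ev_hc[OF HQ_single[of "(v, [])" 1], of x n] by (simp add: vtx_def)

lemma ev_arr_F: "(a, b) \<in> F ==> x \<in> carrier M ==> ev (arr b) (ev (arr a) x) = \<zero>"
 using F_arcs[of a b] ev_times[of "arr b" "arr a" x, symmetric] arr_times_arr_F[of a b] ev_zero_left[of x]
 by (simp add: ev_def cls_zero)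

text \<open>Degree \<open>m + 1\<close> is spanned by the images of the arrows on degree \<open>m\<close>.\<close>
definition gen_at :: "int => bool" where
 "gen_at m \<longleftrightarrow> (\<forall>x\<in>hcomp M (m + 1). \<exists>u. (\<forall>a\<in>arcs Q. u a \<in> hcomp M m) &
   x = (\<Oplus>a\<in>arcs Q. ev (arr a) (u a)))"

text \<open>
 Every relation \<open>\<Sum> a u\<^sub>a = 0\<close> between elements of degree \<open>m\<close> comes from the quadratic relations
 \<open>a b = 0\<close> of the algebra.
\<close>
definition rel_at :: "int => bool" where
 "rel_at m \<longleftrightarrow> (\<forall>u. (\<forall>a\<in>arcs Q. u a \<in> hcomp M m & ev (vtx (tail Q a)) (u a) = u a) -->
   (\<Oplus>a\<in>arcs Q. ev (arr a) (u a)) = \<zero> -->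
   (\<exists>t. (\<forall>a\<in>arcs Q. \<forall>b\<in>arcs Q. t a b \<in> hcomp M (m - 1)) &
    (\<forall>a\<in>arcs Q. u a = (\<Oplus>b\<in>{b. (b, a) \<in> F}. ev (arr b) (t a b)))))"

text \<open>The duals of the two preceding conditions.\<close>
definition cogen_at :: "int => bool" where
 "cogen_at m \<longleftrightarrow> (\<forall>x\<in>hcomp M m. (\<forall>a\<in>arcs Q. ev (arr a) x = \<zero>) --> x = \<zero>)"

definition corel_at :: "int => bool" where
 "corel_at m \<longleftrightarrow> (\<forall>y. (\<forall>a\<in>arcs Q. y a \<in> hcomp M (m + 1) & ev (vtx (head Q a)) (y a) = y a) -->
   (\<forall>a b. (a, b) \<in> F --> ev (arr b) (y a) = \<zero>) -->
   (\<exists>x\<in>hcomp M m. \<forall>a\<in>arcs Q. ev (arr a) x = y a))"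

lemma rel_atD:
 assumes "rel_at m" "!!a. a \<in> arcs Q ==> u a \<in> hcomp M m" "!!a. a \<in> arcs Q ==> ev (vtx (tail Q a)) (u a) = u a"
  "(\<Oplus>a\<in>arcs Q. ev (arr a) (u a)) = \<zero>"
 shows "\<exists>t. (\<forall>a\<in>arcs Q. \<forall>b\<in>arcs Q. t a b \<in> hcomp M (m - 1)) &
    (\<forall>a\<in>arcs Q. u a = (\<Oplus>b\<in>{b. (b, a) \<in> F}. ev (arr b) (t a b)))"
 using assms(1)[unfolded rel_at_def, THEN spec, of u] assms(2-4) by simp

lemma corel_atD:
 assumes "corel_at m" "!!a. a \<in> arcs Q ==> y a \<in> hcomp M (m + 1)" "!!a. a \<in> arcs Q ==> ev (vtx (head Q a)) (y a) = y a"
  "!!a b. (a, b) \<in> F ==> ev (arr b) (y a) = \<zero>"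
 shows "\<exists>x\<in>hcomp M m. \<forall>a\<in>arcs Q. ev (arr a) x = y a"
 using assms(1)[unfolded corel_at_def, THEN spec, of y] assms(2-4) by simp

lemma finite_F_into [simp]: "finite {b. (b, a) \<in> F}"
 by (rule finite_subset[of _ "arcs Q"]) (use F_arcs in auto)

lemma gen_at_tail:
 assumes "gen_at m" "x \<in> hcomp M (m + 1)"
 obtains u where "!!a. a \<in> arcs Q ==> u a \<in> hcomp M m" "!!a. a \<in> arcs Q ==> ev (vtx (tail Q a)) (u a) = u a"
  "x = (\<Oplus>a\<in>arcs Q. ev (arr a) (u a))"
proof -
 from assms obtain u where u: "\<forall>a\<in>arcs Q. u a \<in> hcomp M m" "x = (\<Oplus>a\<in>arcs Q. ev (arr a) (u a))"
  unfolding gen_at_def by blast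
 define u' where "u' a = ev (vtx (tail Q a)) (u a)" for a
 have c: "u a \<in> carrier M" if "a \<in> arcs Q" for a using u that hc_carrier by blast
 have 1: "u' a \<in> hcomp M m" if "a \<in> arcs Q" for a
  unfolding u'_def using u that by (intro vtx_hc) auto
 have 2: "ev (vtx (tail Q a)) (u' a) = u' a" if "a \<in> arcs Q" for a
  unfolding u'_def using that c by (simp flip: ev_times add: vtx_times_vtx)
 have 3: "ev (arr a) (u' a) = ev (arr a) (u a)" if "a \<in> arcs Q" for a
  unfolding u'_def using that c by (simp flip: ev_times add: arr_times_vtx)
 have "x = (\<Oplus>a\<in>arcs Q. ev (arr a) (u' a))"
  unfolding u(2) by (rule ag.finsum_cong') (use 3 c in auto)
 from that[OF 1 2 this] show thesis by simp
qed

lemma shift_pre: "gr_pre Q J (gr_shift i M)"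
proof -
 have s: "carrier (gr_shift i M) = carrier M" "add (gr_shift i M) = add M" "zero (gr_shift i M) = zero M"
  "smult (gr_shift i M) = smult M" "hcomp (gr_shift i M) = (%n. hcomp M (n - i))"
  by (simp_all add: gr_shift_def)
 have am: "add_monoid (gr_shift i M) = add_monoid M" by (simp add: s)
 have ab: "abelian_group (gr_shift i M)"
  by (rule abelian_groupI) (use ag.add.inv_closed in \<open>auto simp: s ag.a_ac intro!: bexI[of _ "\<ominus> _"] ag.l_neg\<close>)
 have fs: "finsum (gr_shift i M) f S = finsum M f S" for f :: "int => 'm" and S by (simp add: finsum_def am)
 show ?thesis unfolding gr_pre_def s fs
 proof (intro conjI allI ballI)
  have "left_module_axioms A M" using lm by (simp only: left_module_def)
  then have "left_module_axioms A (gr_shift i M)" unfolding left_module_axioms_def s .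
  with ab ring_A show "left_module A (gr_shift i M)" by (simp only: left_module_def)
  show "additive_subgroup (hcomp M (n - i)) (gr_shift i M)" for n
   using hc_subgroup[of "n - i"] by (simp add: additive_subgroup_def am)
  show "a \<odot> x \<in> hcomp M (n + int j - i)" if "a \<in> bq_degree Q J j" "x \<in> hcomp M (n - i)" for a x n j
  proof -
   have "a \<odot> x \<in> hcomp M ((n - i) + int j)" using gr that unfolding gr_pre_def by blast
   then show ?thesis by (simp add: algebra_simps)
  qed
  fix x assume x: "x \<in> carrier M"
  have im: "{n. c (n - i) ~= \<zero>} = (%n. n + i) ` {n. c n ~= \<zero>}" for c :: "int => 'm"
  proof -
   have "n \<in> (%n. n + i) ` X \<longleftrightarrow> n - i \<in> X" for n X by (auto simp: image_iff intro!: bexI[of _ "n - i"])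
   then show ?thesis by auto
  qed
  have re: "(\<Oplus>n\<in>{n. c (n - i) ~= \<zero>}. c (n - i)) = (\<Oplus>n\<in>{n. c n ~= \<zero>}. c n)"
   if "!!n. c n \<in> hcomp M n" for c
   unfolding im by (subst ag.finsum_reindex) (use that hc_carrier in "auto simp: inj_on_def")
  show "\<exists>!c. (\<forall>n. c n \<in> hcomp M (n - i)) & finite {n. c n ~= \<zero>} & x = (\<Oplus>n\<in>{n. c n ~= \<zero>}. c n)"
  proof (rule ex1I[of _ "%n. hp x (n - i)"])
   show "(\<forall>n. hp x (n - i) \<in> hcomp M (n - i)) & finite {n. hp x (n - i) ~= \<zero>} &
     x = (\<Oplus>n\<in>{n. hp x (n - i) ~= \<zero>}. hp x (n - i))"
    unfolding re[OF hp_hc[OF x]] unfolding im using hp_hc[OF x] hp_fin[OF x] hp_sum0[OF x] by simp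
  next
   fix c assume c: "(\<forall>n. c n \<in> hcomp M (n - i)) & finite {n. c n ~= \<zero>} & x = (\<Oplus>n\<in>{n. c n ~= \<zero>}. c n)"
   define c' where "c' n = c (n + i)" for n
   have cc: "c = (%n. c' (n - i))" by (simp add: c'_def)
   have h: "c' n \<in> hcomp M n" for n using c[THEN conjunct1, rule_format, of "n + i"] by (simp add: c'_def)
   have fin: "finite {n. c' n ~= \<zero>}"
    using c im[of c'] by (auto simp: cc dest: finite_imageD simp: inj_on_def)
   have "x = (\<Oplus>n\<in>{n. c' n ~= \<zero>}. c' n)" using c re[OF h] by (simp add: cc)
   from hp_eqI[OF fin h this] have "hp x = c'" by (auto simp: fun_eq_iff)
   then show "c = (%n. hp x (n - i))" by (simp add: cc)
  qed
 qed
qed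

lemma shift_eqs:
 shows shift_ev: "graded_pre.ev Q J (gr_shift i M) = ev"
  and shift_gen: "graded_pre.gen_at Q J (gr_shift i M) m \<longleftrightarrow> gen_at (m - i)"
  and shift_rel: "graded_pre.rel_at Q J F (gr_shift i M) m \<longleftrightarrow> rel_at (m - i)"
  and shift_cogen: "graded_pre.cogen_at Q J (gr_shift i M) m \<longleftrightarrow> cogen_at (m - i)"
  and shift_corel: "graded_pre.corel_at Q J F (gr_shift i M) m \<longleftrightarrow> corel_at (m - i)"
proof -
 interpret S: graded_pre Q J F "gr_shift i M" by (rule graded_preI[OF shift_pre])
 have s: "carrier (gr_shift i M) = carrier M" "add (gr_shift i M) = add M" "zero (gr_shift i M) = zero M"
  "smult (gr_shift i M) = smult M" "hcomp (gr_shift i M) = (%n. hcomp M (n - i))"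
  by (simp_all add: gr_shift_def)
 have am: "add_monoid (gr_shift i M) = add_monoid M" by (simp add: s)
 have fs: "finsum (gr_shift i M) f S = finsum M f S" for f :: "'e => 'm" and S by (simp add: finsum_def am)
 show e: "S.ev = ev" by (simp add: fun_eq_iff S.ev_def ev_def s)
 have "m + 1 - i = m - i + 1" "m - 1 - i = m - i - 1" by simp_all
 note n = this
 show "S.gen_at m \<longleftrightarrow> gen_at (m - i)" unfolding S.gen_at_def gen_at_def e s fs n ..
 show "S.rel_at m \<longleftrightarrow> rel_at (m - i)" unfolding S.rel_at_def rel_at_def e s fs n ..
 show "S.cogen_at m \<longleftrightarrow> cogen_at (m - i)" unfolding S.cogen_at_def cogen_at_def e s fs n ..
 show "S.corel_at m \<longleftrightarrow> corel_at (m - i)" unfolding S.corel_at_def corel_at_def e s fs n ..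
qed

end

lemma dsum_simps:
 "carrier (gr_dsum Ms) = (\<Pi>\<^sub>E j\<in>{..<length Ms}. carrier (Ms ! j))"
 "zero (gr_dsum Ms) = (\<lambda>j\<in>{..<length Ms}. \<zero>\<^bsub>Ms ! j\<^esub>)"
 "add (gr_dsum Ms) = (%f g. \<lambda>j\<in>{..<length Ms}. f j \<oplus>\<^bsub>Ms ! j\<^esub> g j)"
 "smult (gr_dsum Ms) = (%a f. \<lambda>j\<in>{..<length Ms}. a \<odot>\<^bsub>Ms ! j\<^esub> f j)"
 "hcomp (gr_dsum Ms) = (%n. \<Pi>\<^sub>E j\<in>{..<length Ms}. hcomp (Ms ! j) n)"
 by (simp_all add: gr_dsum_def)

lemma dsum_abelian_group:
 assumes "!!j. j < length Ms ==> abelian_group (Ms ! j)"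
 shows "abelian_group (gr_dsum Ms)"
proof -
 note ax = abelian_groupE[OF assms]
 have amc: "j < length Ms ==> x \<in> carrier (Ms ! j) ==> \<ominus>\<^bsub>Ms ! j\<^esub> x \<in> carrier (Ms ! j)" for j x
  by (rule abelian_group.a_inv_closed[OF assms])
 have aml: "j < length Ms ==> x \<in> carrier (Ms ! j) ==> (\<ominus>\<^bsub>Ms ! j\<^esub> x) \<oplus>\<^bsub>Ms ! j\<^esub> x = \<zero>\<^bsub>Ms ! j\<^esub>" for j x
  by (rule abelian_group.l_neg[OF assms])
 show ?thesis
 proof (rule abelian_groupI, unfold dsum_simps)
  fix x assume x: "x \<in> (\<Pi>\<^sub>E j\<in>{..<length Ms}. carrier (Ms ! j))"
  show "\<exists>y\<in>\<Pi>\<^sub>E j\<in>{..<length Ms}. carrier (Ms ! j). (\<lambda>j\<in>{..<length Ms}. y j \<oplus>\<^bsub>Ms ! j\<^esub> x j) = (\<lambda>j\<in>{..<length Ms}. \<zero>\<^bsub>Ms ! j\<^esub>)"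
   by (rule bexI[of _ "\<lambda>j\<in>{..<length Ms}. \<ominus>\<^bsub>Ms ! j\<^esub> x j"]) (use x in "auto simp: fun_eq_iff PiE_iff amc aml")
  show "(\<lambda>j\<in>{..<length Ms}. (\<lambda>j\<in>{..<length Ms}. \<zero>\<^bsub>Ms ! j\<^esub>) j \<oplus>\<^bsub>Ms ! j\<^esub> x j) = x"
   using x by (auto simp: fun_eq_iff PiE_iff ax(5) extensional_def)
 next
  fix x y z assume "x \<in> (\<Pi>\<^sub>E j\<in>{..<length Ms}. carrier (Ms ! j))" "y \<in> (\<Pi>\<^sub>E j\<in>{..<length Ms}. carrier (Ms ! j))"
   "z \<in> (\<Pi>\<^sub>E j\<in>{..<length Ms}. carrier (Ms ! j))"
  then show "(\<lambda>j\<in>{..<length Ms}. (\<lambda>j\<in>{..<length Ms}. x j \<oplus>\<^bsub>Ms ! j\<^esub> y j) j \<oplus>\<^bsub>Ms ! j\<^esub> z j) =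
   (\<lambda>j\<in>{..<length Ms}. x j \<oplus>\<^bsub>Ms ! j\<^esub> (\<lambda>j\<in>{..<length Ms}. y j \<oplus>\<^bsub>Ms ! j\<^esub> z j) j)"
   by (auto simp: fun_eq_iff PiE_iff ax(3))
 next
  fix x y assume "x \<in> (\<Pi>\<^sub>E j\<in>{..<length Ms}. carrier (Ms ! j))" "y \<in> (\<Pi>\<^sub>E j\<in>{..<length Ms}. carrier (Ms ! j))"
  then show "(\<lambda>j\<in>{..<length Ms}. x j \<oplus>\<^bsub>Ms ! j\<^esub> y j) = (\<lambda>j\<in>{..<length Ms}. y j \<oplus>\<^bsub>Ms ! j\<^esub> x j)"
   "(\<lambda>j\<in>{..<length Ms}. x j \<oplus>\<^bsub>Ms ! j\<^esub> y j) \<in> (\<Pi>\<^sub>E j\<in>{..<length Ms}. carrier (Ms ! j))"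
   by (auto simp: fun_eq_iff PiE_iff ax(1) intro: ax(4))
 qed (auto simp: ax(2))
qed

lemma dsum_finsum:
 assumes "!!j. j < length Ms ==> abelian_group (Ms ! j)" and "f \<in> S \<rightarrow> carrier (gr_dsum Ms)"
 shows "finsum (gr_dsum Ms) f S = (\<lambda>j\<in>{..<length Ms}. finsum (Ms ! j) (%i. f i j) S)"
proof -
 interpret D: abelian_group "gr_dsum Ms" by (rule dsum_abelian_group) fact
 note am = abelian_group.axioms(1)[OF assms(1)]
 from assms(2) show ?thesis
 proof (induction S rule: infinite_finite_induct)
  case (infinite S)
  then show ?case unfolding D.finsum_infinite[OF infinite(1)]
   using abelian_monoid.finsum_infinite[OF am infinite(1)] by (auto simp: dsum_simps fun_eq_iff)
 next
  case empty
  show ?case unfolding D.finsum_empty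
   by (auto simp: dsum_simps fun_eq_iff abelian_monoid.finsum_empty[OF am])
 next
  case (insert x S)
  then have m: "f \<in> S \<rightarrow> carrier (gr_dsum Ms)" "f x \<in> carrier (gr_dsum Ms)" by auto
  have c: "finsum (Ms ! j) (%i. f i j) (insert x S) = f x j \<oplus>\<^bsub>Ms ! j\<^esub> finsum (Ms ! j) (%i. f i j) S"
   if "j < length Ms" for j
   by (rule abelian_monoid.finsum_insert[OF am]) (use that m insert.hyps in "auto simp: dsum_simps PiE_iff Pi_iff")
  have "finsum (gr_dsum Ms) f (insert x S) = f x \<oplus>\<^bsub>gr_dsum Ms\<^esub> finsum (gr_dsum Ms) f S"
   by (rule D.finsum_insert) (use insert m in auto)
  with insert.IH[OF m(1)] c show ?case by (auto simp: dsum_simps(3) fun_eq_iff)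
 qed
qed

context monomial_quotient
begin

context
 fixes Ms :: "(('v, 'e, 'k) bq_elem, 'm) graded_module list"
 assumes pre: "!!j. j < length Ms ==> gr_pre Q J (Ms ! j)"
begin

lemma gp: "j < length Ms ==> graded_pre Q J F (Ms ! j)"
 using pre by (intro graded_preI)

lemma gp_ab: "j < length Ms ==> abelian_group (Ms ! j)"
 using pre by (auto simp: gr_pre_def left_module_def)

lemma dsum_finsum': "f \<in> S \<rightarrow> carrier (gr_dsum Ms) ==>
  finsum (gr_dsum Ms) f S = (\<lambda>j\<in>{..<length Ms}. finsum (Ms ! j) (%i. f i j) S)"
 by (rule dsum_finsum) (rule gp_ab)

lemma dsum_hc_carrier: "x \<in> hcomp (gr_dsum Ms) n ==> x \<in> carrier (gr_dsum Ms)"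
 using graded_pre.hc_carrier[OF gp] by (auto simp: dsum_simps PiE_iff)

lemma dsum_pre: "gr_pre Q J (gr_dsum Ms)"
 unfolding gr_pre_def
proof (intro conjI allI ballI)
 have D: "abelian_group (gr_dsum Ms)" by (rule dsum_abelian_group) (rule gp_ab)
 then interpret D: abelian_group "gr_dsum Ms" .
 note lms = graded_pre.lm[OF gp]
 note ax = left_module.smult_closed[OF lms] left_module.smult_l_distr[OF lms] left_module.smult_r_distr[OF lms]
  left_module.smult_assoc[OF lms] left_module.smult_one[OF lms]
 show "left_module A (gr_dsum Ms)"
  unfolding left_module_def left_module_axioms_def
 proof (intro conjI allI impI ring_A D)
  fix a x assume "a \<in> carrier A" "x \<in> carrier (gr_dsum Ms)"
  then show "a \<odot>\<^bsub>gr_dsum Ms\<^esub> x \<in> carrier (gr_dsum Ms)"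
   by (auto simp: dsum_simps PiE_iff ax(1))
 next
  fix a b x assume "a \<in> carrier A" "b \<in> carrier A" "x \<in> carrier (gr_dsum Ms)"
  then show "(a \<oplus>\<^bsub>A\<^esub> b) \<odot>\<^bsub>gr_dsum Ms\<^esub> x = a \<odot>\<^bsub>gr_dsum Ms\<^esub> x \<oplus>\<^bsub>gr_dsum Ms\<^esub> b \<odot>\<^bsub>gr_dsum Ms\<^esub> x"
   by (auto simp: dsum_simps PiE_iff ax(2) fun_eq_iff)
 next
  fix a x y assume "a \<in> carrier A" "x \<in> carrier (gr_dsum Ms)" "y \<in> carrier (gr_dsum Ms)"
  then show "a \<odot>\<^bsub>gr_dsum Ms\<^esub> (x \<oplus>\<^bsub>gr_dsum Ms\<^esub> y) = a \<odot>\<^bsub>gr_dsum Ms\<^esub> x \<oplus>\<^bsub>gr_dsum Ms\<^esub> a \<odot>\<^bsub>gr_dsum Ms\<^esub> y"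
   by (auto simp: dsum_simps PiE_iff ax(3) fun_eq_iff)
 next
  fix a b x assume "a \<in> carrier A" "b \<in> carrier A" "x \<in> carrier (gr_dsum Ms)"
  then show "(a \<otimes>\<^bsub>A\<^esub> b) \<odot>\<^bsub>gr_dsum Ms\<^esub> x = a \<odot>\<^bsub>gr_dsum Ms\<^esub> (b \<odot>\<^bsub>gr_dsum Ms\<^esub> x)"
   by (auto simp: dsum_simps PiE_iff ax(4) fun_eq_iff)
 next
  fix x assume "x \<in> carrier (gr_dsum Ms)"
  then show "\<one>\<^bsub>A\<^esub> \<odot>\<^bsub>gr_dsum Ms\<^esub> x = x"
   by (auto simp: dsum_simps PiE_iff ax(5) fun_eq_iff extensional_def)
 qed
 show "additive_subgroup (hcomp (gr_dsum Ms) n) (gr_dsum Ms)" for n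
 proof
  show "hcomp (gr_dsum Ms) n <= carrier (add_monoid (gr_dsum Ms))" using dsum_hc_carrier by auto
  show "x \<otimes>\<^bsub>add_monoid (gr_dsum Ms)\<^esub> y \<in> hcomp (gr_dsum Ms) n"
   if "x \<in> hcomp (gr_dsum Ms) n" "y \<in> hcomp (gr_dsum Ms) n" for x y
   using that by (auto simp: dsum_simps PiE_iff graded_pre.hc_add[OF gp])
  show "\<one>\<^bsub>add_monoid (gr_dsum Ms)\<^esub> \<in> hcomp (gr_dsum Ms) n"
   by (auto simp: dsum_simps PiE_iff graded_pre.hc_zero[OF gp])
  show "inv\<^bsub>add_monoid (gr_dsum Ms)\<^esub> x \<in> hcomp (gr_dsum Ms) n" if x: "x \<in> hcomp (gr_dsum Ms) n" for x
  proof -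
   let ?y = "\<lambda>j\<in>{..<length Ms}. \<ominus>\<^bsub>Ms ! j\<^esub> x j"
   have xc: "x \<in> carrier (gr_dsum Ms)" by (rule dsum_hc_carrier[OF x])
   have y: "?y \<in> hcomp (gr_dsum Ms) n"
    using x by (auto simp: dsum_simps PiE_iff graded_pre.hc_minus[OF gp])
   have "?y \<oplus>\<^bsub>gr_dsum Ms\<^esub> x = \<zero>\<^bsub>gr_dsum Ms\<^esub>"
    using xc by (auto simp: dsum_simps PiE_iff fun_eq_iff abelian_group.l_neg[OF gp_ab])
   from D.minus_equality[OF this xc dsum_hc_carrier[OF y]] y show ?thesis by (simp only: a_inv_def)
  qed
 qed
 show "a \<odot>\<^bsub>gr_dsum Ms\<^esub> x \<in> hcomp (gr_dsum Ms) (n + int i)"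
  if a: "a \<in> bq_degree Q J i" and x: "x \<in> hcomp (gr_dsum Ms) n" for a x n i
  using x pre a unfolding gr_pre_def dsum_simps by (auto simp: PiE_iff)
 fix x assume x: "x \<in> carrier (gr_dsum Ms)"
 then have xj: "x j \<in> carrier (Ms ! j)" if "j < length Ms" for j using that by (auto simp: dsum_simps)
 define c where "c n = (\<lambda>j\<in>{..<length Ms}. graded_pre.hp (Ms ! j) (x j) n)" for n
 have ch: "c n \<in> hcomp (gr_dsum Ms) n" for n
  using graded_pre.hp_hc[OF gp] xj by (auto simp: c_def dsum_simps)
 have sub: "{n. c n ~= \<zero>\<^bsub>gr_dsum Ms\<^esub>} <= (\<Union>j<length Ms. {n. graded_pre.hp (Ms ! j) (x j) n ~= \<zero>\<^bsub>Ms ! j\<^esub>})"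
  by (auto simp: c_def dsum_simps fun_eq_iff)
 have fin: "finite {n. c n ~= \<zero>\<^bsub>gr_dsum Ms\<^esub>}"
  by (rule finite_subset[OF sub]) (use graded_pre.hp_fin[OF gp xj] in auto)
 have supp: "n \<in> {n. c n ~= \<zero>\<^bsub>gr_dsum Ms\<^esub>}"
  if j: "j < length Ms" and nz: "graded_pre.hp (Ms ! j) (x j) n ~= \<zero>\<^bsub>Ms ! j\<^esub>" for j n
 proof -
  have "c n j ~= \<zero>\<^bsub>gr_dsum Ms\<^esub> j" using j nz by (simp add: c_def dsum_simps)
  then show ?thesis by auto
 qed
 have "(\<Oplus>\<^bsub>gr_dsum Ms\<^esub>n\<in>{n. c n ~= \<zero>\<^bsub>gr_dsum Ms\<^esub>}. c n) = x"
 proof (subst dsum_finsum')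
  show "c \<in> {n. c n ~= \<zero>\<^bsub>gr_dsum Ms\<^esub>} \<rightarrow> carrier (gr_dsum Ms)" using ch dsum_hc_carrier by blast
  show "(\<lambda>j\<in>{..<length Ms}. \<Oplus>\<^bsub>Ms ! j\<^esub>n\<in>{n. c n ~= \<zero>\<^bsub>gr_dsum Ms\<^esub>}. c n j) = x"
  proof
   fix j
   show "(\<lambda>j\<in>{..<length Ms}. \<Oplus>\<^bsub>Ms ! j\<^esub>n\<in>{n. c n ~= \<zero>\<^bsub>gr_dsum Ms\<^esub>}. c n j) j = x j"
   proof (cases "j < length Ms")
    case True
    have "(%n. c n j) = graded_pre.hp (Ms ! j) (x j)" using True by (simp add: c_def fun_eq_iff)
    then show ?thesis using True graded_pre.hp_sum[OF gp[OF True] xj[OF True] fin supp[OF True]] by simp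
   next
    case False
    then show ?thesis using x by (auto simp: dsum_simps PiE_iff extensional_def)
   qed
  qed
 qed
 note csum = this
 show "\<exists>!c. (\<forall>n. c n \<in> hcomp (gr_dsum Ms) n) & finite {n. c n ~= \<zero>\<^bsub>gr_dsum Ms\<^esub>} &
   x = (\<Oplus>\<^bsub>gr_dsum Ms\<^esub>n\<in>{n. c n ~= \<zero>\<^bsub>gr_dsum Ms\<^esub>}. c n)"
 proof (rule ex1I[of _ c])
  show "(\<forall>n. c n \<in> hcomp (gr_dsum Ms) n) & finite {n. c n ~= \<zero>\<^bsub>gr_dsum Ms\<^esub>} &
   x = (\<Oplus>\<^bsub>gr_dsum Ms\<^esub>n\<in>{n. c n ~= \<zero>\<^bsub>gr_dsum Ms\<^esub>}. c n)" using ch fin csum by simp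
 next
  fix d assume d: "(\<forall>n. d n \<in> hcomp (gr_dsum Ms) n) & finite {n. d n ~= \<zero>\<^bsub>gr_dsum Ms\<^esub>} &
   x = (\<Oplus>\<^bsub>gr_dsum Ms\<^esub>n\<in>{n. d n ~= \<zero>\<^bsub>gr_dsum Ms\<^esub>}. d n)"
  have dh: "d n \<in> hcomp (gr_dsum Ms) n" for n using d by blast
  have dc: "d \<in> {n. d n ~= \<zero>\<^bsub>gr_dsum Ms\<^esub>} \<rightarrow> carrier (gr_dsum Ms)" using dh dsum_hc_carrier by blast
  have eq: "d n j = c n j" if j: "j < length Ms" for n j
  proof -
   have "x j = (\<Oplus>\<^bsub>Ms ! j\<^esub>n\<in>{n. d n ~= \<zero>\<^bsub>gr_dsum Ms\<^esub>}. d n j)"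
   proof -
    from d have xe: "x = (\<Oplus>\<^bsub>gr_dsum Ms\<^esub>n\<in>{n. d n ~= \<zero>\<^bsub>gr_dsum Ms\<^esub>}. d n)" by blast
    show ?thesis by (subst xe) (simp add: dsum_finsum'[OF dc] j)
   qed
   moreover have "d n j \<in> hcomp (Ms ! j) n" for n using dh[of n] j by (auto simp: dsum_simps)
   ultimately have "graded_pre.hp (Ms ! j) (x j) n = (if n \<in> {n. d n ~= \<zero>\<^bsub>gr_dsum Ms\<^esub>} then d n j else \<zero>\<^bsub>Ms ! j\<^esub>)"
    using graded_pre.hp_eqI[OF gp[OF j], of "{n. d n ~= \<zero>\<^bsub>gr_dsum Ms\<^esub>}" "%n. d n j" "x j" n] d by blast
   then show ?thesis using j by (auto simp: c_def dsum_simps split: if_splits)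
  qed
  show "d = c"
  proof (rule ext)
   fix n show "d n = c n"
    by (rule PiE_ext[of _ "{..<length Ms}" "%j. hcomp (Ms ! j) n"]) (use dh[of n] ch[of n] eq in "auto simp: dsum_simps")
  qed
 qed
qed

interpretation D: graded_pre Q J F "gr_dsum Ms" by (rule graded_preI[OF dsum_pre])

lemma dsum_ev: "j < length Ms ==> D.ev f x j = graded_pre.ev Q J (Ms ! j) f (x j)"
 by (simp add: D.ev_def graded_pre.ev_def[OF gp] dsum_simps)

lemma dsum_ext:
 "x \<in> carrier (gr_dsum Ms) ==> y \<in> carrier (gr_dsum Ms) ==> (!!j. j < length Ms ==> x j = y j) ==> x = y"
 unfolding dsum_simps by (rule PiE_ext) auto

lemma dsum_finsum_ev:
 assumes "!!a. a \<in> S ==> f a \<in> KQ" "!!a. a \<in> S ==> u a \<in> carrier (gr_dsum Ms)" "j < length Ms"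
 shows "(\<Oplus>\<^bsub>gr_dsum Ms\<^esub>a\<in>S. D.ev (f a) (u a)) j = (\<Oplus>\<^bsub>Ms ! j\<^esub>a\<in>S. graded_pre.ev Q J (Ms ! j) (f a) (u a j))"
 using assms by (subst dsum_finsum') (auto simp: dsum_ev)

lemma dsum_gen:
 assumes "!!j. j < length Ms ==> graded_pre.gen_at Q J (Ms ! j) m"
 shows "D.gen_at m"
 unfolding D.gen_at_def
proof
 fix x assume x: "x \<in> hcomp (gr_dsum Ms) (m + 1)"
 have "\<forall>j. \<exists>u. j < length Ms --> (\<forall>a\<in>arcs Q. u a \<in> hcomp (Ms ! j) m) &
   x j = (\<Oplus>\<^bsub>Ms ! j\<^esub>a\<in>arcs Q. graded_pre.ev Q J (Ms ! j) (arr a) (u a))"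
  using assms x unfolding graded_pre.gen_at_def[OF gp] by (auto simp: graded_pre.gen_at_def[OF gp] dsum_simps)
 from choice[OF this] obtain u where "\<forall>j. j < length Ms --> (\<forall>a\<in>arcs Q. u j a \<in> hcomp (Ms ! j) m) &
   x j = (\<Oplus>\<^bsub>Ms ! j\<^esub>a\<in>arcs Q. graded_pre.ev Q J (Ms ! j) (arr a) (u j a))" ..
 note u = this[THEN spec, THEN mp]
 define v where "v a = (\<lambda>j\<in>{..<length Ms}. u j a)" for a
 have v: "v a \<in> hcomp (gr_dsum Ms) m" if "a \<in> arcs Q" for a
  using u that by (auto simp: v_def dsum_simps)
 have vc: "v a \<in> carrier (gr_dsum Ms)" if "a \<in> arcs Q" for a by (rule dsum_hc_carrier[OF v[OF that]])
 have "x = (\<Oplus>\<^bsub>gr_dsum Ms\<^esub>a\<in>arcs Q. D.ev (arr a) (v a))"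
 proof (rule dsum_ext)
  fix j assume j: "j < length Ms"
  have "(\<Oplus>\<^bsub>gr_dsum Ms\<^esub>a\<in>arcs Q. D.ev (arr a) (v a)) j = (\<Oplus>\<^bsub>Ms ! j\<^esub>a\<in>arcs Q. graded_pre.ev Q J (Ms ! j) (arr a) (v a j))"
   by (rule dsum_finsum_ev) (use vc j in auto)
  with u[OF j] j show "x j = (\<Oplus>\<^bsub>gr_dsum Ms\<^esub>a\<in>arcs Q. D.ev (arr a) (v a)) j" by (simp add: v_def)
 qed (use dsum_hc_carrier[OF x] vc in "auto intro!: D.ag.finsum_closed")
 with v show "\<exists>u. (\<forall>a\<in>arcs Q. u a \<in> hcomp (gr_dsum Ms) m) & x = (\<Oplus>\<^bsub>gr_dsum Ms\<^esub>a\<in>arcs Q. D.ev (arr a) (u a))" by blast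
qed

lemma dsum_rel:
 assumes "!!j. j < length Ms ==> graded_pre.rel_at Q J F (Ms ! j) m"
 shows "D.rel_at m"
 unfolding D.rel_at_def
proof (intro allI impI)
 fix u assume u: "\<forall>a\<in>arcs Q. u a \<in> hcomp (gr_dsum Ms) m & D.ev (vtx (tail Q a)) (u a) = u a"
  and z: "(\<Oplus>\<^bsub>gr_dsum Ms\<^esub>a\<in>arcs Q. D.ev (arr a) (u a)) = \<zero>\<^bsub>gr_dsum Ms\<^esub>"
 have uc: "u a \<in> carrier (gr_dsum Ms)" if "a \<in> arcs Q" for a using u that dsum_hc_carrier by blast
 have "\<forall>j. \<exists>t. j < length Ms --> (\<forall>a\<in>arcs Q. \<forall>b\<in>arcs Q. t a b \<in> hcomp (Ms ! j) (m - 1)) &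
   (\<forall>a\<in>arcs Q. u a j = (\<Oplus>\<^bsub>Ms ! j\<^esub>b\<in>{b. (b, a) \<in> F}. graded_pre.ev Q J (Ms ! j) (arr b) (t a b)))"
 proof
  fix j
  show "\<exists>t. j < length Ms --> (\<forall>a\<in>arcs Q. \<forall>b\<in>arcs Q. t a b \<in> hcomp (Ms ! j) (m - 1)) &
   (\<forall>a\<in>arcs Q. u a j = (\<Oplus>\<^bsub>Ms ! j\<^esub>b\<in>{b. (b, a) \<in> F}. graded_pre.ev Q J (Ms ! j) (arr b) (t a b)))"
  proof (cases "j < length Ms")
   case True
   have 1: "\<forall>a\<in>arcs Q. u a j \<in> hcomp (Ms ! j) m & graded_pre.ev Q J (Ms ! j) (vtx (tail Q a)) (u a j) = u a j"
   proof
    fix a assume "a \<in> arcs Q"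
    then have "u a \<in> hcomp (gr_dsum Ms) m" "D.ev (vtx (tail Q a)) (u a) = u a" using u by auto
    then show "u a j \<in> hcomp (Ms ! j) m & graded_pre.ev Q J (Ms ! j) (vtx (tail Q a)) (u a j) = u a j"
     using True dsum_ev[OF True, of "vtx (tail Q a)" "u a"] by (auto simp: dsum_simps)
   qed
   have "(\<Oplus>\<^bsub>Ms ! j\<^esub>a\<in>arcs Q. graded_pre.ev Q J (Ms ! j) (arr a) (u a j)) = (\<Oplus>\<^bsub>gr_dsum Ms\<^esub>a\<in>arcs Q. D.ev (arr a) (u a)) j"
    by (rule dsum_finsum_ev[symmetric]) (use uc True in auto)
   also have "... = \<zero>\<^bsub>Ms ! j\<^esub>" using True by (simp add: z dsum_simps)
   finally show ?thesis using graded_pre.rel_atD[OF gp[OF True] assms[OF True], of "%a. u a j"] 1 by blast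
  qed simp
 qed
 from choice[OF this] obtain t where "\<forall>j. j < length Ms --> (\<forall>a\<in>arcs Q. \<forall>b\<in>arcs Q. t j a b \<in> hcomp (Ms ! j) (m - 1)) &
   (\<forall>a\<in>arcs Q. u a j = (\<Oplus>\<^bsub>Ms ! j\<^esub>b\<in>{b. (b, a) \<in> F}. graded_pre.ev Q J (Ms ! j) (arr b) (t j a b)))" ..
 note t = this[THEN spec, THEN mp]
 define v where "v a b = (\<lambda>j\<in>{..<length Ms}. t j a b)" for a b
 have v: "v a b \<in> hcomp (gr_dsum Ms) (m - 1)" if "a \<in> arcs Q" "b \<in> arcs Q" for a b
  using t that by (auto simp: v_def dsum_simps)
 have vc: "v a b \<in> carrier (gr_dsum Ms)" if "a \<in> arcs Q" "b \<in> arcs Q" for a b by (rule dsum_hc_carrier[OF v[OF that]])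
 have "u a = (\<Oplus>\<^bsub>gr_dsum Ms\<^esub>b\<in>{b. (b, a) \<in> F}. D.ev (arr b) (v a b))" if a: "a \<in> arcs Q" for a
 proof (rule dsum_ext)
  fix j assume j: "j < length Ms"
  have "(\<Oplus>\<^bsub>gr_dsum Ms\<^esub>b\<in>{b. (b, a) \<in> F}. D.ev (arr b) (v a b)) j =
    (\<Oplus>\<^bsub>Ms ! j\<^esub>b\<in>{b. (b, a) \<in> F}. graded_pre.ev Q J (Ms ! j) (arr b) (v a b j))"
   by (rule dsum_finsum_ev) (use vc[OF a] j F_arcs in auto)
  with t[OF j] a j show "u a j = (\<Oplus>\<^bsub>gr_dsum Ms\<^esub>b\<in>{b. (b, a) \<in> F}. D.ev (arr b) (v a b)) j" by (simp add: v_def)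
 qed (use uc[OF a] vc[OF a] F_arcs in "auto intro!: D.ag.finsum_closed")
 with v show "\<exists>t. (\<forall>a\<in>arcs Q. \<forall>b\<in>arcs Q. t a b \<in> hcomp (gr_dsum Ms) (m - 1)) &
    (\<forall>a\<in>arcs Q. u a = (\<Oplus>\<^bsub>gr_dsum Ms\<^esub>b\<in>{b. (b, a) \<in> F}. D.ev (arr b) (t a b)))" by blast
qed

lemma dsum_cogen:
 assumes "!!j. j < length Ms ==> graded_pre.cogen_at Q J (Ms ! j) m"
 shows "D.cogen_at m"
 unfolding D.cogen_at_def
proof (intro ballI impI)
 fix x assume x: "x \<in> hcomp (gr_dsum Ms) m" and z: "\<forall>a\<in>arcs Q. D.ev (arr a) x = \<zero>\<^bsub>gr_dsum Ms\<^esub>"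
 show "x = \<zero>\<^bsub>gr_dsum Ms\<^esub>"
 proof (rule dsum_ext[OF dsum_hc_carrier[OF x] D.ag.zero_closed])
  fix j assume j: "j < length Ms"
  have "graded_pre.ev Q J (Ms ! j) (arr a) (x j) = \<zero>\<^bsub>Ms ! j\<^esub>" if "a \<in> arcs Q" for a
   using dsum_ev[OF j, of "arr a" x] z that j by (simp add: dsum_simps)
  moreover have "x j \<in> hcomp (Ms ! j) m" using x j by (auto simp: dsum_simps)
  ultimately have "x j = \<zero>\<^bsub>Ms ! j\<^esub>"
   using assms[OF j] unfolding graded_pre.cogen_at_def[OF gp[OF j]] by blast
  then show "x j = \<zero>\<^bsub>gr_dsum Ms\<^esub> j" using j by (simp add: dsum_simps)
 qed
qed

lemma dsum_corel:
 assumes "!!j. j < length Ms ==> graded_pre.corel_at Q J F (Ms ! j) m"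
 shows "D.corel_at m"
 unfolding D.corel_at_def
proof (intro allI impI)
 fix y assume y: "\<forall>a\<in>arcs Q. y a \<in> hcomp (gr_dsum Ms) (m + 1) & D.ev (vtx (head Q a)) (y a) = y a"
  and z: "\<forall>a b. (a, b) \<in> F --> D.ev (arr b) (y a) = \<zero>\<^bsub>gr_dsum Ms\<^esub>"
 have "\<exists>x\<in>hcomp (Ms ! j) m. \<forall>a\<in>arcs Q. graded_pre.ev Q J (Ms ! j) (arr a) x = y a j" if j: "j < length Ms" for j
 proof -
  have 1: "\<forall>a\<in>arcs Q. y a j \<in> hcomp (Ms ! j) (m + 1) & graded_pre.ev Q J (Ms ! j) (vtx (head Q a)) (y a j) = y a j"
  proof
   fix a assume "a \<in> arcs Q"
   then have "y a \<in> hcomp (gr_dsum Ms) (m + 1)" "D.ev (vtx (head Q a)) (y a) = y a" using y by auto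
   then show "y a j \<in> hcomp (Ms ! j) (m + 1) & graded_pre.ev Q J (Ms ! j) (vtx (head Q a)) (y a j) = y a j"
    using j dsum_ev[OF j, of "vtx (head Q a)" "y a"] by (auto simp: dsum_simps)
  qed
  have "\<forall>a b. (a, b) \<in> F --> graded_pre.ev Q J (Ms ! j) (arr b) (y a j) = \<zero>\<^bsub>Ms ! j\<^esub>"
  proof (intro allI impI)
   fix a b assume "(a, b) \<in> F"
   then show "graded_pre.ev Q J (Ms ! j) (arr b) (y a j) = \<zero>\<^bsub>Ms ! j\<^esub>"
    using dsum_ev[OF j, of "arr b" "y a"] z j by (simp add: dsum_simps)
  qed
  then show ?thesis using graded_pre.corel_atD[OF gp[OF j] assms[OF j], of "%a. y a j"] 1 by blast
 qed
 then have "\<forall>j. \<exists>x. j < length Ms --> x \<in> hcomp (Ms ! j) m & (\<forall>a\<in>arcs Q. graded_pre.ev Q J (Ms ! j) (arr a) x = y a j)"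
  by blast
 from choice[OF this] obtain w where w0: "\<forall>j. j < length Ms --> w j \<in> hcomp (Ms ! j) m &
  (\<forall>a\<in>arcs Q. graded_pre.ev Q J (Ms ! j) (arr a) (w j) = y a j)" ..
 have w: "w j \<in> hcomp (Ms ! j) m" "!!a. a \<in> arcs Q ==> graded_pre.ev Q J (Ms ! j) (arr a) (w j) = y a j"
  if "j < length Ms" for j using w0 that by blast+
 define x where "x = (\<lambda>j\<in>{..<length Ms}. w j)"
 have x: "x \<in> hcomp (gr_dsum Ms) m" using w by (auto simp: x_def dsum_simps)
 moreover have "D.ev (arr a) x = y a" if a: "a \<in> arcs Q" for a
 proof (rule dsum_ext)
  show "D.ev (arr a) x j = y a j" if "j < length Ms" for j
   using w(2)[OF that a] that by (simp add: dsum_ev x_def)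
 qed (use a y dsum_hc_carrier x in auto)
 ultimately show "\<exists>x\<in>hcomp (gr_dsum Ms) m. \<forall>a\<in>arcs Q. D.ev (arr a) x = y a" by blast
qed

end

end

section \<open>Indecomposable projectives and injectives\<close>

context monomial_quotient
begin

definition strip :: "'e => ('v, 'e, 'k) path_elem => ('v, 'e, 'k) path_elem" where
 "strip a f = (\<Sum>p\<in>keys f. if snd p ~= [] & last (snd p) = a
   then single (fst p, butlast (snd p)) (lookup f p) else 0)"

lemma keys_strip: "keys (strip a f) <= {(fst p, butlast (snd p)) | p. p \<in> keys f & snd p ~= [] & last (snd p) = a}"
 unfolding strip_def by (rule subset_trans[OF keys_sum]) (auto split: if_splits)

lemma good_butlast: "p \<in> good ==> (fst p, butlast (snd p)) \<in> good"
proof -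
 assume p: "p \<in> good"
 obtain u xs where pu: "p = (u, xs)" by (cases p)
 show ?thesis
 proof (cases xs rule: rev_cases)
  case (snoc ys y)
  with p show ?thesis by (auto simp: good_def pu paths_append successively_append_iff)
 qed (use p in "simp add: pu")
qed

lemma good_tl: "(u, a # p) \<in> good ==> (head Q a, p) \<in> good"
 by (cases p) (auto simp: good_def)


lemma good_Cons: "(u, a # p) \<in> good \<longleftrightarrow> a \<in> arcs Q & tail Q a = u & (head Q a, p) \<in> good & (p = [] \<or> (a, hd p) ~: F)"
 by (cases p) (auto simp: good_def)

lemma good_Nil: "(u, []) \<in> good \<longleftrightarrow> u \<in> verts Q" by (auto simp: good_def)

lemma good_snoc: "(u, p @ [a]) \<in> good \<longleftrightarrow>
  (u, p) \<in> good & a \<in> arcs Q & path_end Q (u, p) = tail Q a & (p = [] \<or> (last p, a) ~: F)"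
 by (auto simp: good_def paths_append successively_append_iff)

lemma strip_GQ: "f \<in> GQ ==> strip a f \<in> GQ"
 using keys_strip[of a f] good_butlast unfolding GQ_def by fastforce

text \<open>
 \<open>strip a f\<close> is the part of \<open>f\<close> consisting of the paths that end with the arrow \<open>a\<close>, divided by \<open>a\<close>.
\<close>
lemma arr_times_strip:
 assumes "f \<in> KQ"
 shows "path_times Q (arr a) (strip a f) = (\<Sum>p\<in>keys f. if snd p ~= [] & last (snd p) = a then single p (lookup f p) else 0)"
 unfolding strip_def path_times_sum_right
proof (rule sum.cong[OF refl])
 fix p assume "p \<in> keys f"
 then have p: "p \<in> paths Q" using assms by (auto simp: KQ_def)
 obtain u xs where pu: "p = (u, xs)" by (cases p)
 show "path_times Q (arr a) (if snd p ~= [] & last (snd p) = a then single (fst p, butlast (snd p)) (lookup f p) else 0) =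
  (if snd p ~= [] & last (snd p) = a then single p (lookup f p) else 0)"
 proof (cases xs rule: rev_cases)
  case (snoc ys y)
  with p show ?thesis by (auto simp: pu arr_def path_times_single paths_append)
 qed (simp add: pu)
qed

lemma strip_sum:
 assumes f: "f \<in> KQ" and B: "finite B" and ne: "!!p. p \<in> keys f ==> snd p ~= [] & last (snd p) \<in> B"
 shows "(\<Sum>a\<in>B. path_times Q (arr a) (strip a f)) = f"
proof -
 have "(\<Sum>a\<in>B. path_times Q (arr a) (strip a f)) =
   (\<Sum>p\<in>keys f. \<Sum>a\<in>B. if snd p ~= [] & last (snd p) = a then single p (lookup f p) else 0)"
  unfolding arr_times_strip[OF f] by (rule sum.swap)
 also have "... = (\<Sum>p\<in>keys f. single p (lookup f p))"
  using ne B by (intro sum.cong refl) simp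
 also have "... = f" by (simp add: sum_singles)
 finally show ?thesis .
qed

lemma lookup_arr_times:
 "lookup (path_times Q (arr a) f) (u, r) =
  (if r ~= [] & last r = a & path_end Q (u, butlast r) = tail Q a then lookup f (u, butlast r) else 0)"
proof (induction f rule: additive_ext)
 case (3 p c)
 show ?case
  by (cases p; cases r rule: rev_cases)
   (auto simp: arr_def path_times_single lookup_single when_def)
qed (auto simp: path_times_add_right lookup_add)

definition part :: "int => ('v, 'e, 'k) path_elem => ('v, 'e, 'k) path_elem" where
 "part n f = (\<Sum>p\<in>keys f. if int (length (snd p)) = n then single p (lookup f p) else 0)"

lemma lookup_part: "lookup (part n f) p = (if int (length (snd p)) = n then lookup f p else 0)"
proof -
 have "lookup (part n f) p = (\<Sum>q\<in>keys f. if q = p then (if int (length (snd p)) = n then lookup f p else 0) else 0)"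
  unfolding part_def lookup_sum by (intro sum.cong) (auto simp: lookup_single when_def)
 then show ?thesis by (auto simp: in_keys_iff)
qed

definition SQ :: "'v => ('v, 'e, 'k) path_elem set" where
 "SQ x = {f \<in> GQ. \<forall>p\<in>keys f. fst p = x}"

lemma SQ_GQ: "f \<in> SQ x ==> f \<in> GQ" and SQ_KQ: "f \<in> SQ x ==> f \<in> KQ"
 by (auto simp: SQ_def GQ_KQ)

lemma SQ_add: "f \<in> SQ x ==> g \<in> SQ x ==> f + g \<in> SQ x"
 using keys_add[of f g] by (auto simp: SQ_def GQ_def)

lemma SQ_zero [simp]: "0 \<in> SQ x" by (simp add: SQ_def GQ_def)

lemma SQ_sum: "(!!i. i \<in> S ==> f i \<in> SQ x) ==> (\<Sum>i\<in>S. f i) \<in> SQ x"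
 by (induction S rule: infinite_finite_induct) (auto intro: SQ_add)

lemma SQ_uminus: "f \<in> SQ x ==> - f \<in> SQ x"
 by (auto simp: SQ_def GQ_def in_keys_iff)

lemma keys_red: "keys (red f) <= keys f"
 by (auto simp: in_keys_iff lookup_red split: if_splits)

lemma red_times_SQ: "g \<in> SQ x ==> red (path_times Q f g) \<in> SQ x"
 using keys_red[of "path_times Q f g"] keys_path_times[of f g] red_GQ[of "path_times Q f g"]
 unfolding SQ_def by fastforce

lemma part_SQ: "f \<in> SQ x ==> part n f \<in> SQ x"
 by (auto simp: SQ_def GQ_def in_keys_iff lookup_part split: if_splits)

lemma strip_SQ: "f \<in> SQ x ==> strip a f \<in> SQ x"
 using strip_GQ[of f a] keys_strip[of a f] unfolding SQ_def by fastforce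

lemma times_vtx: "(!!p. p \<in> keys f ==> fst p = x) ==> path_times Q f (vtx x) = f"
proof (rule additive_ext[where P = "%f. path_times Q f (vtx x) = f"])
 fix p and c :: 'k assume "!!p. p \<in> keys f ==> fst p = x" "p \<in> keys f"
 then show "path_times Q (single p c) (vtx x) = single p c"
  by (cases p) (auto simp: vtx_def path_times_single path_end_simp)
qed (auto simp: path_times_add_left)

lemma bq_idem_vtx: "bq_idem Q J x = cls (vtx x)"
 by (simp add: bq_idem_def vtx_def path_basis_def)

lemma proj_simps:
 "add (gr_proj Q J x) = add A" "zero (gr_proj Q J x) = \<zero>\<^bsub>A\<^esub>" "smult (gr_proj Q J x) = mult A"
 by (simp_all add: gr_proj_def Let_def)

lemma proj_carrier:
 assumes x: "x \<in> verts Q"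
 shows "carrier (gr_proj Q J x) = cls ` SQ x"
proof -
 have "cls f \<otimes>\<^bsub>A\<^esub> cls (vtx x) \<in> cls ` SQ x" if f: "f \<in> GQ" for f
 proof -
  have "vtx x \<in> SQ x" using x by (auto simp: SQ_def GQ_def vtx_def good_Nil)
  then have "red (path_times Q f (vtx x)) \<in> SQ x" by (rule red_times_SQ)
  moreover have "cls f \<otimes>\<^bsub>A\<^esub> cls (vtx x) = cls (red (path_times Q f (vtx x)))"
   using f x by (simp add: cls_mult[symmetric] cls_red KQ_times GQ_KQ)
  ultimately show ?thesis by blast
 qed
 note 1 = this
 have 2: "cls f = cls f \<otimes>\<^bsub>A\<^esub> cls (vtx x)" if "f \<in> SQ x" for f
 proof -
  have "path_times Q f (vtx x) = f" by (rule times_vtx) (use that in "auto simp: SQ_def")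
  then show ?thesis using cls_mult[OF SQ_KQ[OF that] vtx_KQ[OF x]] by simp
 qed
 have 3: "carrier (gr_proj Q J x) = {a \<otimes>\<^bsub>A\<^esub> cls (vtx x) | a. a \<in> carrier A}"
  by (simp add: gr_proj_def Let_def bq_idem_vtx)
 show ?thesis unfolding 3
 proof (intro equalityI subsetI)
  fix y assume "y \<in> {a \<otimes>\<^bsub>A\<^esub> cls (vtx x) | a. a \<in> carrier A}"
  then obtain f where "y = cls f \<otimes>\<^bsub>A\<^esub> cls (vtx x)" "f \<in> GQ" unfolding carrier_A_GQ by blast
  then show "y \<in> cls ` SQ x" using 1 by simp
 next
  fix y assume "y \<in> cls ` SQ x"
  then obtain f where f: "y = cls f" "f \<in> SQ x" by blast
  from 2[OF f(2)] cls_closed[OF SQ_KQ[OF f(2)]]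
  show "y \<in> {a \<otimes>\<^bsub>A\<^esub> cls (vtx x) | a. a \<in> carrier A}" unfolding f(1) by blast
 qed
qed

lemma bq_degree_GQ:
 assumes f: "f \<in> GQ"
 shows "cls f \<in> bq_degree Q J i \<longleftrightarrow> (\<forall>p\<in>keys f. length (snd p) = i)"
proof
 assume "cls f \<in> bq_degree Q J i"
 then obtain g where g: "g \<in> KQ" "\<forall>p\<in>keys g. length (snd p) = i" "cls f = cls g"
  by (auto simp: bq_degree_def KQ_def)
 then have "\<forall>p\<in>good. lookup f p = lookup g p" using f by (simp add: cls_eq_iff GQ_KQ)
 moreover have "p \<in> good" if "p \<in> keys f" for p using f that by (auto simp: GQ_def)
 ultimately show "\<forall>p\<in>keys f. length (snd p) = i"
  using g(2) by (metis in_keys_iff)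
next
 assume "\<forall>p\<in>keys f. length (snd p) = i"
 then show "cls f \<in> bq_degree Q J i" using GQ_KQ[OF f] by (auto simp: bq_degree_def KQ_def)
qed

lemma proj_hcomp:
 assumes x: "x \<in> verts Q"
 shows "hcomp (gr_proj Q J x) n = cls ` {f \<in> SQ x. \<forall>p\<in>keys f. int (length (snd p)) = n}"
proof -
 have h: "hcomp (gr_proj Q J x) n =
   (if 0 \<le> n then carrier (gr_proj Q J x) \<inter> bq_degree Q J (nat n) else {\<zero>\<^bsub>A\<^esub>})"
  by (simp add: gr_proj_def Let_def)
 show ?thesis
 proof (cases "0 \<le> n")
  case True
  then have "int l = n \<longleftrightarrow> l = nat n" for l by auto
  then show ?thesis unfolding h proj_carrier[OF x] using True bq_degree_GQ SQ_GQ by auto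
 next
  case False
  have "{f \<in> SQ x. \<forall>p\<in>keys f. int (length (snd p)) = n} = {0}"
  proof (intro equalityI subsetI)
   fix f assume "f \<in> {f \<in> SQ x. \<forall>p\<in>keys f. int (length (snd p)) = n}"
   then have *: "int (length (snd p)) = n" if "p \<in> keys f" for p using that by blast
   have "p ~: keys f" for p using *[of p] False by auto
   then have "lookup f p = 0" for p by (simp add: in_keys_iff)
   then show "f \<in> {0}" by (auto intro: poly_mapping_eqI)
  qed simp
  then show ?thesis unfolding h using False by (simp add: cls_zero)
 qed
qed

lemma cls_uminus_add: "f \<in> KQ ==> cls (- f) \<oplus>\<^bsub>A\<^esub> cls f = \<zero>\<^bsub>A\<^esub>"
proof -
 assume f: "f \<in> KQ"
 then have "- f \<in> KQ" by (auto simp: KQ_def in_keys_iff)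
 from cls_add[OF this f] show ?thesis by (simp add: cls_zero)
qed

lemma proj_pre:
 assumes x: "x \<in> verts Q"
 shows "gr_pre Q J (gr_proj Q J x)"
 unfolding gr_pre_def
proof (intro conjI allI ballI)
 note c = proj_carrier[OF x] and h = proj_hcomp[OF x]
 have sub: "carrier (gr_proj Q J x) <= carrier A" unfolding c carrier_A using SQ_KQ by blast
 have ab: "abelian_group (gr_proj Q J x)"
 proof (rule abelian_groupI, unfold proj_simps)
  fix a b assume "a \<in> carrier (gr_proj Q J x)" "b \<in> carrier (gr_proj Q J x)"
  then obtain f g where fg: "a = cls f" "b = cls g" "f \<in> SQ x" "g \<in> SQ x" by (auto simp: c)
  then have "a \<oplus>\<^bsub>A\<^esub> b = cls (f + g)" by (simp add: cls_add SQ_KQ)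
  then show "a \<oplus>\<^bsub>A\<^esub> b \<in> carrier (gr_proj Q J x)" unfolding c using SQ_add[OF fg(3,4)] by blast
 next
  show "\<zero>\<^bsub>A\<^esub> \<in> carrier (gr_proj Q J x)" unfolding c cls_zero[symmetric] by simp
 next
  fix a assume "a \<in> carrier (gr_proj Q J x)"
  then obtain f where f: "a = cls f" "f \<in> SQ x" by (auto simp: c)
  from cls_uminus_add[OF SQ_KQ[OF f(2)]] SQ_uminus[OF f(2)]
  show "\<exists>b\<in>carrier (gr_proj Q J x). b \<oplus>\<^bsub>A\<^esub> a = \<zero>\<^bsub>A\<^esub>" unfolding c f(1) by blast
 next
  fix a b d assume "a \<in> carrier (gr_proj Q J x)" "b \<in> carrier (gr_proj Q J x)" "d \<in> carrier (gr_proj Q J x)"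
  then have "a \<in> carrier A" "b \<in> carrier A" "d \<in> carrier A" using sub by blast+
  then show "a \<oplus>\<^bsub>A\<^esub> b \<oplus>\<^bsub>A\<^esub> d = a \<oplus>\<^bsub>A\<^esub> (b \<oplus>\<^bsub>A\<^esub> d)" by (rule A.a_assoc)
 next
  fix a b assume "a \<in> carrier (gr_proj Q J x)" "b \<in> carrier (gr_proj Q J x)"
  then have "a \<in> carrier A" "b \<in> carrier A" using sub by blast+
  then show "a \<oplus>\<^bsub>A\<^esub> b = b \<oplus>\<^bsub>A\<^esub> a" by (rule A.a_comm)
 qed (use sub in auto)
 then interpret P: abelian_group "gr_proj Q J x" .
 show "left_module A (gr_proj Q J x)"
  unfolding left_module_def left_module_axioms_def proj_simps
 proof (intro conjI allI impI ring_A ab)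
  fix a y assume a: "a \<in> carrier A" and y: "y \<in> carrier (gr_proj Q J x)"
  obtain f where f: "a = cls f" "f \<in> KQ" using a by (auto simp: carrier_A)
  obtain g where g: "y = cls g" "g \<in> SQ x" using y by (auto simp: c)
  have "a \<otimes>\<^bsub>A\<^esub> y = cls (red (path_times Q f g))"
   using f g by (simp add: cls_mult[symmetric] cls_red KQ_times SQ_KQ)
  then show "a \<otimes>\<^bsub>A\<^esub> y \<in> carrier (gr_proj Q J x)" using red_times_SQ[OF g(2)] by (simp add: c)
 qed (use subsetD[OF sub] in "simp_all add: A.l_distr A.r_distr A.m_assoc")
 have hsub: "hcomp (gr_proj Q J x) n <= carrier (gr_proj Q J x)" for n unfolding h c by blast
 show "additive_subgroup (hcomp (gr_proj Q J x) n) (gr_proj Q J x)" for n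
 proof
  show "hcomp (gr_proj Q J x) n <= carrier (add_monoid (gr_proj Q J x))" using hsub by simp
  show "a \<otimes>\<^bsub>add_monoid (gr_proj Q J x)\<^esub> b \<in> hcomp (gr_proj Q J x) n"
   if "a \<in> hcomp (gr_proj Q J x) n" "b \<in> hcomp (gr_proj Q J x) n" for a b
  proof -
   from that obtain f g where fg: "a = cls f" "b = cls g" "f \<in> SQ x" "g \<in> SQ x"
    "\<forall>p\<in>keys f. int (length (snd p)) = n" "\<forall>p\<in>keys g. int (length (snd p)) = n" by (auto simp: h)
   then have "\<forall>p\<in>keys (f + g). int (length (snd p)) = n" using keys_add[of f g] by auto
   moreover have "a \<oplus>\<^bsub>A\<^esub> b = cls (f + g)" using fg by (simp add: cls_add SQ_KQ)
   ultimately show ?thesis using SQ_add[OF fg(3,4)] by (auto simp: h proj_simps)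
  qed
  show "\<one>\<^bsub>add_monoid (gr_proj Q J x)\<^esub> \<in> hcomp (gr_proj Q J x) n"
   by (auto simp: h proj_simps cls_zero[symmetric] intro!: imageI)
  show "inv\<^bsub>add_monoid (gr_proj Q J x)\<^esub> a \<in> hcomp (gr_proj Q J x) n" if a: "a \<in> hcomp (gr_proj Q J x) n" for a
  proof -
   from a obtain f where f: "a = cls f" "f \<in> SQ x" "\<forall>p\<in>keys f. int (length (snd p)) = n" by (auto simp: h)
   then have m: "cls (- f) \<in> hcomp (gr_proj Q J x) n"
    using SQ_uminus by (auto simp: h in_keys_iff)
   have "cls (- f) \<oplus>\<^bsub>gr_proj Q J x\<^esub> a = \<zero>\<^bsub>gr_proj Q J x\<^esub>" using f by (simp add: proj_simps cls_uminus_add SQ_KQ)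
   from P.minus_equality[OF this subsetD[OF hsub a] subsetD[OF hsub m], unfolded a_inv_def] m
   show ?thesis by simp
  qed
 qed
 show "a \<odot>\<^bsub>gr_proj Q J x\<^esub> y \<in> hcomp (gr_proj Q J x) (n + int i)"
  if a: "a \<in> bq_degree Q J i" and y: "y \<in> hcomp (gr_proj Q J x) n" for a y n i
 proof -
  from a obtain f where f: "a = cls f" "f \<in> KQ" "\<forall>p\<in>keys f. length (snd p) = i" by (auto simp: bq_degree_def KQ_def)
  from y obtain g where g: "y = cls g" "g \<in> SQ x" "\<forall>p\<in>keys g. int (length (snd p)) = n" by (auto simp: h)
  have "a \<otimes>\<^bsub>A\<^esub> y = cls (red (path_times Q f g))"
   using f g by (simp add: cls_mult[symmetric] cls_red KQ_times SQ_KQ)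
  moreover have "\<forall>p\<in>keys (red (path_times Q f g)). int (length (snd p)) = n + int i"
   using keys_red[of "path_times Q f g"] keys_path_times[of f g] f(3) g(3) by fastforce
  ultimately show ?thesis using red_times_SQ[OF g(2)] by (auto simp: h proj_simps)
 qed
 fix z assume "z \<in> carrier (gr_proj Q J x)"
 then obtain f where f: "z = cls f" "f \<in> SQ x" by (auto simp: c)
 have fs: "finsum (gr_proj Q J x) k S = finsum A k S" if "k \<in> S \<rightarrow> carrier (gr_proj Q J x)" for k :: "int => _" and S
  by (rule sub_finsum) (use A.abelian_group_axioms ab sub that in "simp_all add: proj_simps")
 define c0 where "c0 n = cls (part n f)" for n
 have c0h: "c0 n \<in> hcomp (gr_proj Q J x) n" for n
  using part_SQ[OF f(2)] by (auto simp: h c0_def in_keys_iff lookup_part split: if_splits)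
 define S where "S = (%p. int (length (snd p))) ` keys f"
 have S: "finite S" by (simp add: S_def)
 have c0S: "n \<in> S" if "c0 n ~= \<zero>\<^bsub>A\<^esub>" for n
 proof (rule ccontr)
  assume "n ~: S"
  then have "part n f = 0" by (intro poly_mapping_eqI) (auto simp: lookup_part S_def in_keys_iff)
  with that show False by (simp add: c0_def cls_zero)
 qed
 have partsum: "(\<Sum>n\<in>S. part n f) = f"
 proof (rule poly_mapping_eqI)
  fix p
  have "lookup (\<Sum>n\<in>S. part n f) p = (\<Sum>n\<in>S. if int (length (snd p)) = n then lookup f p else 0)"
   by (simp add: lookup_sum lookup_part)
  also have "... = lookup f p" using S by (auto simp: S_def in_keys_iff)
  finally show "lookup (\<Sum>n\<in>S. part n f) p = lookup f p" .
 qed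
 have c0A: "c0 n \<in> carrier A" for n using c0h hsub sub by blast
 have "(\<Oplus>\<^bsub>A\<^esub>n\<in>{n. c0 n ~= \<zero>\<^bsub>A\<^esub>}. c0 n) = (\<Oplus>\<^bsub>A\<^esub>n\<in>S. c0 n)"
  by (rule A.add.finprod_mono_neutral_cong_left) (use S c0S c0A in auto)
 also have "... = cls (\<Sum>n\<in>S. part n f)"
  unfolding c0_def using S part_SQ[OF f(2)] SQ_KQ by (intro cls_sum[symmetric]) auto
 finally have c0sum: "(\<Oplus>\<^bsub>A\<^esub>n\<in>{n. c0 n ~= \<zero>\<^bsub>A\<^esub>}. c0 n) = z" by (simp add: partsum f)
 show "\<exists>!c. (\<forall>n. c n \<in> hcomp (gr_proj Q J x) n) & finite {n. c n ~= \<zero>\<^bsub>gr_proj Q J x\<^esub>} &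
   z = (\<Oplus>\<^bsub>gr_proj Q J x\<^esub>n\<in>{n. c n ~= \<zero>\<^bsub>gr_proj Q J x\<^esub>}. c n)"
  unfolding proj_simps
 proof (rule ex1I[of _ c0])
  have "finite {n. c0 n ~= \<zero>\<^bsub>A\<^esub>}" by (rule finite_subset[OF _ S]) (use c0S in auto)
  moreover have "c0 \<in> T \<rightarrow> carrier (gr_proj Q J x)" for T using c0h hsub by blast
  ultimately show "(\<forall>n. c0 n \<in> hcomp (gr_proj Q J x) n) & finite {n. c0 n ~= \<zero>\<^bsub>A\<^esub>} &
   z = (\<Oplus>\<^bsub>gr_proj Q J x\<^esub>n\<in>{n. c0 n ~= \<zero>\<^bsub>A\<^esub>}. c0 n)" using c0h c0sum by (simp add: fs)
 next
  fix d assume d: "(\<forall>n. d n \<in> hcomp (gr_proj Q J x) n) & finite {n. d n ~= \<zero>\<^bsub>A\<^esub>} &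
   z = (\<Oplus>\<^bsub>gr_proj Q J x\<^esub>n\<in>{n. d n ~= \<zero>\<^bsub>A\<^esub>}. d n)"
  define T where "T = {n. d n ~= \<zero>\<^bsub>A\<^esub>}"
  have T: "finite T" using d by (simp add: T_def)
  have dP: "d \<in> T \<rightarrow> carrier (gr_proj Q J x)" using d hsub by blast
  have "\<forall>n. \<exists>g. g \<in> SQ x & (\<forall>p\<in>keys g. int (length (snd p)) = n) & d n = cls g"
   using d unfolding h by blast
  from choice[OF this] obtain g where "\<forall>n. g n \<in> SQ x & (\<forall>p\<in>keys (g n). int (length (snd p)) = n) & d n = cls (g n)" ..
  then have g: "g n \<in> SQ x" "!!p. p \<in> keys (g n) ==> int (length (snd p)) = n" "d n = cls (g n)" for n by blast+
  have "z = (\<Oplus>\<^bsub>A\<^esub>n\<in>T. d n)" using d fs[OF dP] by (simp add: T_def)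
  also have "... = cls (\<Sum>n\<in>T. g n)"
   unfolding g(3) using T g(1) SQ_KQ by (intro cls_sum[symmetric]) auto
  finally have fg: "f = (\<Sum>n\<in>T. g n)" using f SQ_sum[of T g x] g(1) SQ_GQ by (auto intro: cls_inj)
  show "d = c0"
  proof
   fix m
   have lk: "lookup (g n) p = (if int (length (snd p)) = n then lookup (g n) p else 0)" for n p
    using g(2)[of p n] by (auto simp: in_keys_iff)
   have "part m f = (if m \<in> T then g m else 0)"
   proof (rule poly_mapping_eqI)
    fix p
    have "lookup f p = (\<Sum>n\<in>T. if int (length (snd p)) = n then lookup (g n) p else 0)"
     unfolding fg lookup_sum by (rule sum.cong[OF refl]) (rule lk)
    also have "... = (if int (length (snd p)) \<in> T then lookup (g (int (length (snd p)))) p else 0)"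
     using T by (simp add: sum.delta')
    finally show "lookup (part m f) p = lookup (if m \<in> T then g m else 0) p"
     using lk[of m p] by (auto simp: lookup_part)
   qed
   then show "d m = c0 m" using g(3)[of m] by (auto simp: c0_def T_def cls_zero)
  qed
 qed
qed

lemma proj_ev: "x \<in> verts Q ==> graded_pre.ev Q J (gr_proj Q J x) f y = cls f \<otimes>\<^bsub>A\<^esub> y"
 by (simp add: graded_pre.ev_def[OF graded_preI[OF proj_pre]] proj_simps)

lemma proj_finsum:
 assumes x: "x \<in> verts Q" and k: "k \<in> S \<rightarrow> carrier (gr_proj Q J x)"
 shows "finsum (gr_proj Q J x) k S = finsum A k S"
proof (rule sub_finsum)
 show "abelian_group (gr_proj Q J x)" using proj_pre[OF x] by (simp add: gr_pre_def left_module_def)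
 show "carrier (gr_proj Q J x) <= carrier A" using SQ_KQ by (auto simp: proj_carrier[OF x] carrier_A)
qed (use A.abelian_group_axioms k in "simp_all add: proj_simps")

lemma proj_ev_sum:
 assumes x: "x \<in> verts Q" and S: "finite S" and f: "!!a. a \<in> S ==> f a \<in> KQ" and g: "!!a. a \<in> S ==> g a \<in> SQ x"
 shows "(\<Oplus>\<^bsub>gr_proj Q J x\<^esub>a\<in>S. graded_pre.ev Q J (gr_proj Q J x) (f a) (cls (g a))) = cls (\<Sum>a\<in>S. path_times Q (f a) (g a))"
proof -
 interpret P: graded_pre Q J F "gr_proj Q J x" by (rule graded_preI[OF proj_pre[OF x]])
 have "(\<Oplus>\<^bsub>gr_proj Q J x\<^esub>a\<in>S. P.ev (f a) (cls (g a))) = (\<Oplus>\<^bsub>A\<^esub>a\<in>S. P.ev (f a) (cls (g a)))"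
 proof (rule proj_finsum[OF x], rule Pi_I)
  fix a assume a: "a \<in> S"
  show "P.ev (f a) (cls (g a)) \<in> carrier (gr_proj Q J x)"
   by (rule P.ev_closed[OF f[OF a]]) (use g[OF a] in "auto simp: proj_carrier[OF x]")
 qed
 also have "... = (\<Oplus>\<^bsub>A\<^esub>a\<in>S. cls (path_times Q (f a) (g a)))"
 proof (rule A.finsum_cong'[OF refl])
  show "(%a. cls (path_times Q (f a) (g a))) \<in> S \<rightarrow> carrier A"
   using KQ_times[OF f SQ_KQ[OF g]] cls_closed by simp
  show "P.ev (f a) (cls (g a)) = cls (path_times Q (f a) (g a))" if "a \<in> S" for a
   using f[OF that] SQ_KQ[OF g[OF that]] by (simp add: proj_ev[OF x] cls_mult)
 qed
 also have "... = cls (\<Sum>a\<in>S. path_times Q (f a) (g a))"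
  using S by (intro cls_sum[symmetric] KQ_times f SQ_KQ[of _ x] g)
 finally show ?thesis .
qed

lemma proj_gen:
 assumes x: "x \<in> verts Q" and m: "0 \<le> m"
 shows "graded_pre.gen_at Q J (gr_proj Q J x) m"
proof -
 interpret P: graded_pre Q J F "gr_proj Q J x" by (rule graded_preI[OF proj_pre[OF x]])
 show ?thesis unfolding P.gen_at_def
 proof
  fix y assume "y \<in> hcomp (gr_proj Q J x) (m + 1)"
  then obtain f where f: "y = cls f" "f \<in> SQ x" "!!p. p \<in> keys f ==> int (length (snd p)) = m + 1"
   by (auto simp: proj_hcomp[OF x])
  have ne: "snd p ~= [] & last (snd p) \<in> arcs Q" if "p \<in> keys f" for p
  proof -
   have "p \<in> paths Q" using that SQ_GQ[OF f(2)] by (auto simp: GQ_def good_def)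
   then have "set (snd p) <= arcs Q" by (auto simp: paths_def awalk_def)
   moreover have "snd p ~= []" using f(3)[OF that] m by auto
   ultimately show ?thesis by auto
  qed
  have "cls (strip a f) \<in> hcomp (gr_proj Q J x) m" for a
  proof -
   have "int (length (snd p)) = m" if "p \<in> keys (strip a f)" for p
    using keys_strip[of a f] that f(3) m by fastforce
   then show ?thesis using strip_SQ[OF f(2), of a] by (auto simp: proj_hcomp[OF x])
  qed
  moreover have "y = (\<Oplus>\<^bsub>gr_proj Q J x\<^esub>a\<in>arcs Q. P.ev (arr a) (cls (strip a f)))"
   using strip_SQ[OF f(2)] SQ_KQ[OF f(2)] ne by (simp add: proj_ev_sum[OF x] strip_sum f(1))
  ultimately show "\<exists>u. (\<forall>a\<in>arcs Q. u a \<in> hcomp (gr_proj Q J x) m) & y = (\<Oplus>\<^bsub>gr_proj Q J x\<^esub>a\<in>arcs Q. P.ev (arr a) (u a))"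
   by (intro exI[of _ "%a. cls (strip a f)"]) blast
 qed
qed

text \<open>
 Different arrows on the left produce different paths, so a relation \<open>\<Sum> a u\<^sub>a = 0\<close> forces \<open>a u\<^sub>a = 0\<close>
 for each \<open>a\<close>; then every path in \<open>u\<^sub>a\<close> ends with an arrow \<open>b\<close> such that \<open>a b = 0\<close>.  Degree at least one is
 needed for the paths to have a last arrow.
\<close>
lemma proj_rel:
 assumes x: "x \<in> verts Q" and m: "1 \<le> m"
 shows "graded_pre.rel_at Q J F (gr_proj Q J x) m"
proof -
 interpret P: graded_pre Q J F "gr_proj Q J x" by (rule graded_preI[OF proj_pre[OF x]])
 show ?thesis unfolding P.rel_at_def
 proof (intro allI impI)
  fix u assume u: "\<forall>a\<in>arcs Q. u a \<in> hcomp (gr_proj Q J x) m & P.ev (vtx (tail Q a)) (u a) = u a"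
   and z: "(\<Oplus>\<^bsub>gr_proj Q J x\<^esub>a\<in>arcs Q. P.ev (arr a) (u a)) = \<zero>\<^bsub>gr_proj Q J x\<^esub>"
  have "\<forall>a. \<exists>g. a \<in> arcs Q --> g \<in> SQ x & (\<forall>p\<in>keys g. int (length (snd p)) = m) & u a = cls g"
   using u by (auto simp: proj_hcomp[OF x])
  from choice[OF this] obtain g where "\<forall>a. a \<in> arcs Q --> g a \<in> SQ x & (\<forall>p\<in>keys (g a). int (length (snd p)) = m) & u a = cls (g a)" ..
  then have g: "g a \<in> SQ x" "!!p. p \<in> keys (g a) ==> int (length (snd p)) = m" "u a = cls (g a)" if "a \<in> arcs Q" for a
   using that by blast+
  have pe: "path_end Q p = tail Q a" if a: "a \<in> arcs Q" and p: "p \<in> keys (g a)" for a p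
  proof -
   have "P.ev (vtx (tail Q a)) (u a) = u a" using u a by blast
   then have "cls (vtx (tail Q a)) \<otimes>\<^bsub>A\<^esub> cls (g a) = cls (g a)" by (simp only: g(3)[OF a] proj_ev[OF x])
   then have "cls (path_times Q (vtx (tail Q a)) (g a)) = cls (g a)"
    using a g(1)[OF a] by (simp add: cls_mult SQ_KQ)
   moreover have pg: "p \<in> good" using p SQ_GQ[OF g(1)[OF a]] by (auto simp: GQ_def)
   ultimately have "lookup (path_times Q (vtx (tail Q a)) (g a)) p = lookup (g a) p"
    using a g(1)[OF a] by (simp add: cls_eq_iff KQ_times SQ_KQ)
   then have "p \<in> keys (path_times Q (vtx (tail Q a)) (g a))" using p by (simp add: in_keys_iff)
   with keys_path_times[of "vtx (tail Q a)" "g a"] obtain r q where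
    "r \<in> keys (vtx (tail Q a) :: ('v, 'e, 'k) path_elem)" "p = (fst q, snd q @ snd r)" "fst r = path_end Q q" by blast
   then show ?thesis by (auto simp: vtx_def)
  qed
  have "(\<Oplus>\<^bsub>gr_proj Q J x\<^esub>a\<in>arcs Q. P.ev (arr a) (u a)) = (\<Oplus>\<^bsub>gr_proj Q J x\<^esub>a\<in>arcs Q. P.ev (arr a) (cls (g a)))"
  proof (rule P.ag.finsum_cong'[OF refl])
   show "(%a. P.ev (arr a) (cls (g a))) \<in> arcs Q \<rightarrow> carrier (gr_proj Q J x)"
    by (intro Pi_I P.ev_closed) (use g(1) in "auto simp: proj_carrier[OF x]")
  qed (simp add: g(3))
  also have "... = cls (\<Sum>a\<in>arcs Q. path_times Q (arr a) (g a))"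
   by (rule proj_ev_sum[OF x]) (use g in auto)
  finally have "cls (\<Sum>a\<in>arcs Q. path_times Q (arr a) (g a)) = cls 0"
   using z by (simp add: proj_simps cls_zero)
  then have zero: "lookup (\<Sum>a\<in>arcs Q. path_times Q (arr a) (g a)) p = 0" if "p \<in> good" for p
  proof -
   have "(\<Sum>a\<in>arcs Q. path_times Q (arr a) (g a)) \<in> KQ"
    by (intro KQ_sum KQ_times arr_KQ SQ_KQ[of _ x] g(1))
   from cls_eq_iff[OF this KQ_zero] \<open>cls (\<Sum>a\<in>arcs Q. path_times Q (arr a) (g a)) = cls 0\<close> that
   show ?thesis by simp
  qed
  have lastF: "snd p ~= [] & (last (snd p), a) \<in> F" if a: "a \<in> arcs Q" and p: "p \<in> keys (g a)" for a p
  proof -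
   obtain v r where pv: "p = (v, r)" by (cases p)
   have ne: "r ~= []" using g(2)[OF a p] m by (auto simp: pv)
   have pg: "(v, r) \<in> good" using p SQ_GQ[OF g(1)[OF a]] by (auto simp: GQ_def pv)
   have "(v, r @ [a]) ~: good"
   proof
    assume "(v, r @ [a]) \<in> good"
    from zero[OF this] have "(\<Sum>b\<in>arcs Q. lookup (path_times Q (arr b) (g b)) (v, r @ [a])) = 0"
     by (simp add: lookup_sum)
    moreover have "lookup (path_times Q (arr b) (g b)) (v, r @ [a]) = (if b = a then lookup (g a) (v, r) else 0)" for b
     using pe[OF a p] by (auto simp: lookup_arr_times pv)
    ultimately have "lookup (g a) (v, r) = 0" using a by simp
    then show False using a p by (simp add: pv in_keys_iff)
   qed
   then show ?thesis using pg ne a pe[OF a p] by (auto simp: good_snoc pv)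
  qed
  have "u a = (\<Oplus>\<^bsub>gr_proj Q J x\<^esub>b\<in>{b. (b, a) \<in> F}. P.ev (arr b) (cls (strip b (g a))))" if a: "a \<in> arcs Q" for a
  proof -
   have "(\<Oplus>\<^bsub>gr_proj Q J x\<^esub>b\<in>{b. (b, a) \<in> F}. P.ev (arr b) (cls (strip b (g a)))) =
     cls (\<Sum>b\<in>{b. (b, a) \<in> F}. path_times Q (arr b) (strip b (g a)))"
    by (rule proj_ev_sum[OF x]) (use g(1)[OF a] strip_SQ F_arcs in auto)
   also have "... = cls (g a)"
    by (subst strip_sum) (use g(1)[OF a] SQ_KQ lastF[OF a] in auto)
   finally show ?thesis using g(3)[OF a] by simp
  qed
  moreover have "cls (strip b (g a)) \<in> hcomp (gr_proj Q J x) (m - 1)" if a: "a \<in> arcs Q" for a b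
  proof -
   have "int (length (snd p)) = m - 1" if "p \<in> keys (strip b (g a))" for p
    using keys_strip[of b "g a"] that g(2)[OF a] m by fastforce
   then show ?thesis using strip_SQ[OF g(1)[OF a], of b] by (auto simp: proj_hcomp[OF x])
  qed
  ultimately show "\<exists>t. (\<forall>a\<in>arcs Q. \<forall>b\<in>arcs Q. t a b \<in> hcomp (gr_proj Q J x) (m - 1)) &
    (\<forall>a\<in>arcs Q. u a = (\<Oplus>\<^bsub>gr_proj Q J x\<^esub>b\<in>{b. (b, a) \<in> F}. P.ev (arr b) (t a b)))"
   by (intro exI[of _ "%a b. cls (strip b (g a))"]) blast
 qed
qed

end

context monomial_quotient
begin

definition ES :: "'v => ('v, 'e, 'k) path_elem set" where
 "ES x = {f \<in> GQ. \<forall>p\<in>keys f. path_end Q p = x}"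

abbreviation "EI x \<equiv> bq_right_ideal Q J x"

lemma ES_GQ: "f \<in> ES x ==> f \<in> GQ" and ES_KQ: "f \<in> ES x ==> f \<in> KQ"
 by (auto simp: ES_def GQ_KQ)

lemma ES_add: "f \<in> ES x ==> g \<in> ES x ==> f + g \<in> ES x"
 using keys_add[of f g] by (auto simp: ES_def GQ_def)

lemma red_times_ES: "f \<in> ES x ==> red (path_times Q f g) \<in> ES x"
proof -
 assume f: "f \<in> ES x"
 have "path_end Q p = x" if p: "p \<in> keys (red (path_times Q f g))" for p
 proof -
  from p keys_red[of "path_times Q f g"] keys_path_times[of f g] obtain r q where
   "p = (fst q, snd q @ snd r)" "r \<in> keys f" "fst r = path_end Q q" by blast
  then have "path_end Q p = path_end Q (fst r, snd r)" by (simp add: path_end_append)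
  then show ?thesis using f \<open>r \<in> keys f\<close> by (auto simp: ES_def)
 qed
 then show ?thesis using red_GQ[of "path_times Q f g"] by (auto simp: ES_def)
qed

lemma vtx_times: "(!!p. p \<in> keys f ==> path_end Q p = x) ==> path_times Q (vtx x) f = f"
proof (rule additive_ext[where P = "%f. path_times Q (vtx x) f = f"])
 fix p and c :: 'k assume "!!p. p \<in> keys f ==> path_end Q p = x" "p \<in> keys f"
 then show "path_times Q (vtx x) (single p c) = single p c"
  by (cases p) (auto simp: vtx_def path_times_single)
qed (auto simp: path_times_add_right)

lemma EI_eq:
 assumes x: "x \<in> verts Q"
 shows "EI x = cls ` ES x"
proof -
 have v: "vtx x \<in> ES x" using x by (auto simp: ES_def GQ_def vtx_def good_Nil path_end_simp)
 show ?thesis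
 proof (intro equalityI subsetI)
  fix y assume "y \<in> EI x"
  then obtain f where f: "y = cls (vtx x) \<otimes>\<^bsub>A\<^esub> cls f" "f \<in> KQ"
   by (auto simp: bq_right_ideal_def bq_idem_vtx carrier_A)
  then have "y = cls (red (path_times Q (vtx x) f))"
   using x by (simp add: cls_mult[symmetric] cls_red KQ_times)
  then show "y \<in> cls ` ES x" using red_times_ES[OF v] by blast
 next
  fix y assume "y \<in> cls ` ES x"
  then obtain f where f: "y = cls f" "f \<in> ES x" by blast
  have "path_times Q (vtx x) f = f" by (rule vtx_times) (use f in "auto simp: ES_def")
  then have "y = cls (vtx x) \<otimes>\<^bsub>A\<^esub> cls f" using f x cls_mult[of "vtx x" f] by (simp add: ES_KQ)
  then show "y \<in> EI x" using cls_closed[OF ES_KQ[OF f(2)]] by (auto simp: bq_right_ideal_def bq_idem_vtx)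
 qed
qed

lemma EI_carrier: "x \<in> verts Q ==> b \<in> EI x ==> b \<in> carrier A"
 by (auto simp: EI_eq cls_closed ES_KQ)

lemma EI_add: "x \<in> verts Q ==> a \<in> EI x ==> b \<in> EI x ==> a \<oplus>\<^bsub>A\<^esub> b \<in> EI x"
proof -
 assume x: "x \<in> verts Q" and "a \<in> EI x" "b \<in> EI x"
 then obtain f g where fg: "a = cls f" "b = cls g" "f \<in> ES x" "g \<in> ES x" by (auto simp: EI_eq)
 then have "a \<oplus>\<^bsub>A\<^esub> b = cls (f + g)" by (simp add: cls_add ES_KQ)
 then show ?thesis using ES_add[OF fg(3,4)] by (simp add: EI_eq[OF x])
qed

lemma EI_times: "x \<in> verts Q ==> b \<in> EI x ==> a \<in> carrier A ==> b \<otimes>\<^bsub>A\<^esub> a \<in> EI x"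
proof -
 assume x: "x \<in> verts Q" and "b \<in> EI x" "a \<in> carrier A"
 then obtain f g where fg: "b = cls f" "a = cls g" "f \<in> ES x" "g \<in> KQ" by (auto simp: EI_eq carrier_A)
 then have "b \<otimes>\<^bsub>A\<^esub> a = cls (red (path_times Q f g))"
  by (simp add: cls_mult[symmetric] cls_red KQ_times ES_KQ)
 then show ?thesis using red_times_ES[OF fg(3)] by (simp add: EI_eq[OF x])
qed

definition pe :: "('v, 'e) path => ('v, 'e, 'k) bq_elem" where "pe p = cls (single p 1)"

definition gto :: "'v => ('v, 'e) path set" where "gto x = {p \<in> good. path_end Q p = x}"

lemma pe_EI: "x \<in> verts Q ==> p \<in> gto x ==> pe p \<in> EI x"
 by (auto simp: EI_eq pe_def gto_def ES_def GQ_def)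

lemma pe_degree: "p \<in> good ==> pe p \<in> bq_degree Q J (length (snd p))"
 unfolding pe_def by (subst bq_degree_GQ) (auto simp: GQ_def)

lemma scalar_cls:
 assumes "f \<in> KQ"
 shows "bq_scalar Q J c \<otimes>\<^bsub>A\<^esub> cls f = cls (\<Sum>p\<in>keys f. single p (c * lookup f p))"
 using assms path_scalar_times(1)[of f c] by (simp add: bq_scalar_def cls_mult[symmetric]) (simp add: KQ_def)

lemma scalar_pe: "p \<in> paths Q ==> bq_scalar Q J c \<otimes>\<^bsub>A\<^esub> pe p = cls (single p c)"
 unfolding pe_def by (subst scalar_cls) auto

lemma dualD:
 assumes "\<phi> \<in> graded_dual Q J x"
 shows "\<phi> \<in> extensional (EI x)" "!!a b. a \<in> EI x ==> b \<in> EI x ==> \<phi> (a \<oplus>\<^bsub>A\<^esub> b) = \<phi> a + \<phi> b"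
  "!!c a. a \<in> EI x ==> \<phi> (bq_scalar Q J c \<otimes>\<^bsub>A\<^esub> a) = c * \<phi> a"
  "finite {n. \<exists>a \<in> EI x \<inter> bq_degree Q J n. \<phi> a ~= 0}"
 using assms by (simp_all add: graded_dual_def Let_def)

lemma dual_zero:
 assumes x: "x \<in> verts Q" and \<phi>: "\<phi> \<in> graded_dual Q J x"
 shows "\<phi> (cls 0) = 0"
proof -
 have z: "cls 0 \<in> EI x" by (auto simp: EI_eq[OF x] ES_def GQ_def)
 have "cls 0 \<oplus>\<^bsub>A\<^esub> cls 0 = cls 0" by (simp add: cls_add[symmetric])
 with dualD(2)[OF \<phi> z z] have "\<phi> (cls 0) + \<phi> (cls 0) = \<phi> (cls 0) + 0" by simp
 then show ?thesis by (simp only: add_left_cancel)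
qed

lemma dual_values:
 assumes x: "x \<in> verts Q" and \<phi>: "\<phi> \<in> graded_dual Q J x" and f: "f \<in> ES x"
 shows "\<phi> (cls f) = (\<Sum>p\<in>keys f. lookup f p * \<phi> (pe p))"
proof -
 have gto: "p \<in> gto x" if "p \<in> keys f" for p using f that by (auto simp: ES_def GQ_def gto_def)
 have "\<phi> (cls (\<Sum>p\<in>S. single p (lookup f p))) = (\<Sum>p\<in>S. lookup f p * \<phi> (pe p))"
  if "finite S" "S <= keys f" for S using that
 proof (induction S rule: finite_induct)
  case empty
  show ?case by (simp add: dual_zero[OF x \<phi>])
 next
  case (insert p S)
  then have p: "p \<in> gto x" using gto by auto
  have s: "single q (lookup f q) \<in> ES x" if "q \<in> keys f" for q
   using gto[OF that] by (auto simp: ES_def GQ_def gto_def)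
  have "(\<Sum>q\<in>S. single q (lookup f q)) \<in> ES x"
   using insert.hyps(1) insert.prems by (induction S rule: finite_induct) (auto simp: ES_add s, simp add: ES_def GQ_def)
  then have 1: "cls (\<Sum>q\<in>S. single q (lookup f q)) \<in> EI x" "(\<Sum>q\<in>S. single q (lookup f q)) \<in> KQ"
   using ES_KQ by (auto simp: EI_eq[OF x])
  have 2: "cls (single p (lookup f p)) \<in> EI x" "single p (lookup f p) \<in> KQ"
   using s[of p] insert.prems ES_KQ by (auto simp: EI_eq[OF x])
  have "cls (single p (lookup f p)) = bq_scalar Q J (lookup f p) \<otimes>\<^bsub>A\<^esub> pe p"
   using p by (simp add: scalar_pe gto_def good_paths)
  then have "\<phi> (cls (single p (lookup f p))) = lookup f p * \<phi> (pe p)"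
   using dualD(3)[OF \<phi> pe_EI[OF x p]] by simp
  then show ?case using insert 1 2 by (simp add: cls_add dualD(2)[OF \<phi>])
 qed
 from this[of "keys f"] show ?thesis by (simp add: sum_singles)
qed

lemma dual_ext:
 assumes x: "x \<in> verts Q" and "\<phi> \<in> graded_dual Q J x" "\<psi> \<in> graded_dual Q J x"
  and "!!p. p \<in> gto x ==> \<phi> (pe p) = \<psi> (pe p)"
 shows "\<phi> = \<psi>"
proof (rule extensionalityI)
 show "\<phi> \<in> extensional (EI x)" "\<psi> \<in> extensional (EI x)" using assms dualD(1) by auto
 fix b assume "b \<in> EI x"
 then obtain f where f: "b = cls f" "f \<in> ES x" by (auto simp: EI_eq[OF x])
 have "p \<in> gto x" if "p \<in> keys f" for p using f that by (auto simp: ES_def GQ_def gto_def)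
 then show "\<phi> b = \<psi> b" using assms(4) by (simp add: f(1) dual_values[OF x _ f(2)] assms(2,3))
qed

text \<open>
 The functional with prescribed values on the nonzero paths that end in \<open>x\<close>.
\<close>
definition mkd :: "'v => (('v, 'e) path => 'k) => ('v, 'e, 'k) bq_elem => 'k" where
 "mkd x V = (\<lambda>b\<in>EI x. let f = (THE f. f \<in> GQ & cls f = b) in \<Sum>p\<in>keys f. lookup f p * V p)"

lemma mkd_cls:
 assumes x: "x \<in> verts Q" and f: "f \<in> ES x"
 shows "mkd x V (cls f) = (\<Sum>p\<in>keys f. lookup f p * V p)"
proof -
 have "(THE g. g \<in> GQ & cls g = cls f) = f"
  using ES_GQ[OF f] by (intro the_equality) (auto intro: cls_inj)
 moreover have "cls f \<in> EI x" using f by (simp add: EI_eq[OF x])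
 ultimately show ?thesis by (simp add: mkd_def Let_def)
qed

lemma mkd_pe: "x \<in> verts Q ==> p \<in> gto x ==> mkd x V (pe p) = V p"
 unfolding pe_def by (subst mkd_cls) (auto simp: gto_def ES_def GQ_def)

lemma mkd_dual:
 assumes x: "x \<in> verts Q" and V: "finite {n. \<exists>p\<in>gto x. length (snd p) = n & V p ~= 0}"
 shows "mkd x V \<in> graded_dual Q J x"
proof -
 have sup: "(\<Sum>p\<in>keys f. lookup f p * V p) = (\<Sum>p\<in>S. lookup f p * V p)" if "keys f <= S" "finite S" for f S
  using that by (intro sum.mono_neutral_left) (auto simp: in_keys_iff)
 have "mkd x V (a \<oplus>\<^bsub>A\<^esub> b) = mkd x V a + mkd x V b" if "a \<in> EI x" "b \<in> EI x" for a b
 proof -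
  from that obtain f g where fg: "a = cls f" "b = cls g" "f \<in> ES x" "g \<in> ES x" by (auto simp: EI_eq[OF x])
  then have ab: "a \<oplus>\<^bsub>A\<^esub> b = cls (f + g)" by (simp add: cls_add ES_KQ)
  define S where "S = keys f \<union> keys g \<union> keys (f + g)"
  have S: "finite S" "keys f <= S" "keys g <= S" "keys (f + g) <= S" by (auto simp: S_def)
  show ?thesis unfolding ab unfolding fg(1,2) mkd_cls[OF x ES_add[OF fg(3,4)]] mkd_cls[OF x fg(3)] mkd_cls[OF x fg(4)]
    sup[OF S(2,1)] sup[OF S(3,1)] sup[OF S(4,1)] by (simp add: lookup_add algebra_simps sum.distrib)
 qed
 moreover have "mkd x V (bq_scalar Q J c \<otimes>\<^bsub>A\<^esub> a) = c * mkd x V a" if "a \<in> EI x" for c a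
 proof -
  from that obtain f where f: "a = cls f" "f \<in> ES x" by (auto simp: EI_eq[OF x])
  define g where "g = (\<Sum>p\<in>keys f. single p (c * lookup f p))"
  have lg: "lookup g p = c * lookup f p" for p
  proof -
   have "lookup g p = (\<Sum>q\<in>keys f. if q = p then c * lookup f p else 0)"
    unfolding g_def lookup_sum by (intro sum.cong) (auto simp: lookup_single when_def)
   then show ?thesis by (auto simp: in_keys_iff)
  qed
  then have kg: "keys g <= keys f" by (auto simp: in_keys_iff)
  then have "g \<in> ES x" using f(2) by (auto simp: ES_def GQ_def)
  moreover have "bq_scalar Q J c \<otimes>\<^bsub>A\<^esub> a = cls g" unfolding f(1) g_def by (rule scalar_cls[OF ES_KQ[OF f(2)]])
  ultimately have "mkd x V (bq_scalar Q J c \<otimes>\<^bsub>A\<^esub> a) = (\<Sum>p\<in>keys g. lookup g p * V p)"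
   by (simp only: mkd_cls[OF x])
  also have "... = (\<Sum>p\<in>keys f. lookup g p * V p)" by (rule sup[OF kg]) simp
  also have "... = c * mkd x V a" by (simp only: lg sum_distrib_left mult.assoc f(1) mkd_cls[OF x f(2)])
  finally show ?thesis .
 qed
 moreover have "{n. \<exists>a\<in>EI x \<inter> bq_degree Q J n. mkd x V a ~= 0} <= {n. \<exists>p\<in>gto x. length (snd p) = n & V p ~= 0}"
 proof
  fix n assume "n \<in> {n. \<exists>a\<in>EI x \<inter> bq_degree Q J n. mkd x V a ~= 0}"
  then obtain a where a: "a \<in> EI x" "a \<in> bq_degree Q J n" "mkd x V a ~= 0" by blast
  then obtain f where f: "a = cls f" "f \<in> ES x" by (auto simp: EI_eq[OF x])
  have "(\<Sum>p\<in>keys f. lookup f p * V p) ~= 0" using a(3) by (simp add: f mkd_cls[OF x])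
  from sum.not_neutral_contains_not_neutral[OF this] obtain p where "p \<in> keys f" "lookup f p * V p ~= 0" by blast
  then have p: "p \<in> keys f" "V p ~= 0" by simp_all
  have "length (snd p) = n" using a(2) p(1) by (simp add: f(1) bq_degree_GQ[OF ES_GQ[OF f(2)]])
  moreover have "p \<in> gto x" using p f(2) by (auto simp: ES_def GQ_def gto_def)
  ultimately show "n \<in> {n. \<exists>p\<in>gto x. length (snd p) = n & V p ~= 0}" using p(2) by blast
 qed
 ultimately show ?thesis
  using finite_subset[OF _ V] by (simp add: graded_dual_def Let_def mkd_def)
qed

lemma inj_simps:
 "carrier (gr_inj Q J x) = graded_dual Q J x" "zero (gr_inj Q J x) = (\<lambda>b\<in>EI x. 0)"
 "add (gr_inj Q J x) = (%\<phi> \<psi>. \<lambda>b\<in>EI x. \<phi> b + \<psi> b)"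
 "smult (gr_inj Q J x) = (%a \<phi>. \<lambda>b\<in>EI x. \<phi> (b \<otimes>\<^bsub>A\<^esub> a))"
 "hcomp (gr_inj Q J x) = (%m. {\<phi> \<in> graded_dual Q J x.
   \<forall>n. int n ~= - m --> (\<forall>b \<in> EI x \<inter> bq_degree Q J n. \<phi> b = 0)})"
 by (simp_all add: gr_inj_def Let_def)

lemma dualI:
 assumes "\<phi> \<in> extensional (EI x)" "!!a b. a \<in> EI x ==> b \<in> EI x ==> \<phi> (a \<oplus>\<^bsub>A\<^esub> b) = \<phi> a + \<phi> b"
  "!!c a. a \<in> EI x ==> \<phi> (bq_scalar Q J c \<otimes>\<^bsub>A\<^esub> a) = c * \<phi> a"
  "finite {n. \<exists>a \<in> EI x \<inter> bq_degree Q J n. \<phi> a ~= 0}"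
 shows "\<phi> \<in> graded_dual Q J x"
 using assms by (simp add: graded_dual_def Let_def)

lemma scalar_closed: "bq_scalar Q J c \<in> carrier A" by (simp add: bq_scalar_def cls_closed)

lemma EI_scalar:
 assumes x: "x \<in> verts Q" and a: "a \<in> EI x"
 shows "bq_scalar Q J c \<otimes>\<^bsub>A\<^esub> a \<in> EI x"
proof -
 obtain f where f: "a = cls f" "f \<in> ES x" using a by (auto simp: EI_eq[OF x])
 have "keys (\<Sum>p\<in>keys f. single p (c * lookup f p)) <= keys f"
  by (rule subset_trans[OF keys_sum]) (auto split: if_splits)
 then have "(\<Sum>p\<in>keys f. single p (c * lookup f p)) \<in> ES x" using f(2) by (auto simp: ES_def GQ_def)
 then show ?thesis using scalar_cls[OF ES_KQ[OF f(2)], of c] by (simp add: f(1) EI_eq[OF x])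
qed

lemma inj_add_closed:
 assumes x: "x \<in> verts Q" and \<phi>: "\<phi> \<in> graded_dual Q J x" and \<psi>: "\<psi> \<in> graded_dual Q J x"
 shows "(\<lambda>b\<in>EI x. \<phi> b + \<psi> b) \<in> graded_dual Q J x"
proof (rule dualI)
 have "{n. \<exists>a\<in>EI x \<inter> bq_degree Q J n. (\<lambda>b\<in>EI x. \<phi> b + \<psi> b) a ~= 0} <=
  {n. \<exists>a \<in> EI x \<inter> bq_degree Q J n. \<phi> a ~= 0} \<union> {n. \<exists>a \<in> EI x \<inter> bq_degree Q J n. \<psi> a ~= 0}" by auto
 then show "finite {n. \<exists>a\<in>EI x \<inter> bq_degree Q J n. (\<lambda>b\<in>EI x. \<phi> b + \<psi> b) a ~= 0}"
  by (rule finite_subset) (use dualD(4)[OF \<phi>] dualD(4)[OF \<psi>] in simp)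
qed (auto simp: EI_add[OF x] EI_scalar[OF x] dualD(2,3)[OF \<phi>] dualD(2,3)[OF \<psi>] algebra_simps)

lemma inj_uminus_closed:
 assumes x: "x \<in> verts Q" and \<phi>: "\<phi> \<in> graded_dual Q J x"
 shows "(\<lambda>b\<in>EI x. - \<phi> b) \<in> graded_dual Q J x"
proof (rule dualI)
 have "{n. \<exists>a\<in>EI x \<inter> bq_degree Q J n. (\<lambda>b\<in>EI x. - \<phi> b) a ~= 0} <=
  {n. \<exists>a \<in> EI x \<inter> bq_degree Q J n. \<phi> a ~= 0}" by auto
 then show "finite {n. \<exists>a\<in>EI x \<inter> bq_degree Q J n. (\<lambda>b\<in>EI x. - \<phi> b) a ~= 0}"
  by (rule finite_subset) (use dualD(4)[OF \<phi>] in simp)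
qed (auto simp: EI_add[OF x] EI_scalar[OF x] dualD(2,3)[OF \<phi>])

lemma inj_zero_closed: "x \<in> verts Q ==> (\<lambda>b\<in>EI x. 0) \<in> graded_dual Q J x"
 by (rule dualI) (auto simp: EI_add EI_scalar)

lemma bq_degree_times:
 assumes "b \<in> bq_degree Q J n" "a \<in> bq_degree Q J i"
 shows "b \<otimes>\<^bsub>A\<^esub> a \<in> bq_degree Q J (n + i)"
proof -
 from assms obtain f g where fg: "b = cls f" "f \<in> KQ" "\<forall>p\<in>keys f. length (snd p) = n"
  "a = cls g" "g \<in> KQ" "\<forall>p\<in>keys g. length (snd p) = i" by (auto simp: bq_degree_def KQ_def)
 have "length (snd p) = n + i" if "p \<in> keys (path_times Q f g)" for p
 proof -
  from that keys_path_times[of f g] obtain r q where "p = (fst q, snd q @ snd r)" "r \<in> keys f" "q \<in> keys g" by blast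
  with fg(3,6) show ?thesis by simp
 qed
 moreover have "b \<otimes>\<^bsub>A\<^esub> a = cls (path_times Q f g)" using fg by (simp add: cls_mult)
 ultimately show ?thesis using KQ_times[OF fg(2,5)] by (auto simp: bq_degree_def KQ_def)
qed

lemma inj_smult_closed:
 assumes x: "x \<in> verts Q" and a: "a \<in> carrier A" and \<phi>: "\<phi> \<in> graded_dual Q J x"
 shows "(\<lambda>b\<in>EI x. \<phi> (b \<otimes>\<^bsub>A\<^esub> a)) \<in> graded_dual Q J x"
proof (rule dualI)
 show "(\<lambda>b\<in>EI x. \<phi> (b \<otimes>\<^bsub>A\<^esub> a)) \<in> extensional (EI x)" by simp
 show "(\<lambda>b\<in>EI x. \<phi> (b \<otimes>\<^bsub>A\<^esub> a)) (b \<oplus>\<^bsub>A\<^esub> c) = (\<lambda>b\<in>EI x. \<phi> (b \<otimes>\<^bsub>A\<^esub> a)) b + (\<lambda>b\<in>EI x. \<phi> (b \<otimes>\<^bsub>A\<^esub> a)) c"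
  if "b \<in> EI x" "c \<in> EI x" for b c
  using that a by (simp add: EI_add[OF x] A.l_distr EI_carrier[OF x] EI_times[OF x] dualD(2)[OF \<phi>])
 show "(\<lambda>b\<in>EI x. \<phi> (b \<otimes>\<^bsub>A\<^esub> a)) (bq_scalar Q J c \<otimes>\<^bsub>A\<^esub> b) = c * (\<lambda>b\<in>EI x. \<phi> (b \<otimes>\<^bsub>A\<^esub> a)) b"
  if "b \<in> EI x" for b c
  using that a by (simp add: EI_scalar[OF x] A.m_assoc EI_carrier[OF x] scalar_closed EI_times[OF x] dualD(3)[OF \<phi>])
 obtain g where g: "a = cls g" "g \<in> KQ" using a by (auto simp: carrier_A)
 define D where "D = {n. \<exists>a \<in> EI x \<inter> bq_degree Q J n. \<phi> a ~= 0}"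
 have D: "finite D" using dualD(4)[OF \<phi>] by (simp add: D_def)
 have "finite {n. \<exists>b\<in>EI x \<inter> bq_degree Q J n. \<phi> (b \<otimes>\<^bsub>A\<^esub> cls g) ~= 0}"
 proof (rule additive_ext[where f = g and P = "%g. g \<in> KQ & finite {n. \<exists>b\<in>EI x \<inter> bq_degree Q J n. \<phi> (b \<otimes>\<^bsub>A\<^esub> cls g) ~= 0}", THEN conjunct2])
  note dual_zero[OF x \<phi>]
  moreover have "b \<otimes>\<^bsub>A\<^esub> cls 0 = cls 0" if "b \<in> EI x" for b using EI_carrier[OF x that] by (simp add: cls_zero)
  ultimately have "{n. \<exists>b\<in>EI x \<inter> bq_degree Q J n. \<phi> (b \<otimes>\<^bsub>A\<^esub> cls 0) ~= 0} = {}" by auto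
  then show "0 \<in> KQ & finite {n. \<exists>b\<in>EI x \<inter> bq_degree Q J n. \<phi> (b \<otimes>\<^bsub>A\<^esub> cls 0) ~= 0}"
   by (simp only: finite.emptyI KQ_zero simp_thms)
 next
  fix g h assume g: "g \<in> KQ & finite {n. \<exists>b\<in>EI x \<inter> bq_degree Q J n. \<phi> (b \<otimes>\<^bsub>A\<^esub> cls g) ~= 0}"
   and h: "h \<in> KQ & finite {n. \<exists>b\<in>EI x \<inter> bq_degree Q J n. \<phi> (b \<otimes>\<^bsub>A\<^esub> cls h) ~= 0}"
  have s: "\<phi> (b \<otimes>\<^bsub>A\<^esub> cls (g + h)) = \<phi> (b \<otimes>\<^bsub>A\<^esub> cls g) + \<phi> (b \<otimes>\<^bsub>A\<^esub> cls h)" if "b \<in> EI x" for b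
   using that g h by (simp add: cls_add A.r_distr EI_carrier[OF x] cls_closed dualD(2)[OF \<phi>] EI_times[OF x])
  have "{n. \<exists>b\<in>EI x \<inter> bq_degree Q J n. \<phi> (b \<otimes>\<^bsub>A\<^esub> cls (g + h)) ~= 0} <=
   {n. \<exists>b\<in>EI x \<inter> bq_degree Q J n. \<phi> (b \<otimes>\<^bsub>A\<^esub> cls g) ~= 0} \<union> {n. \<exists>b\<in>EI x \<inter> bq_degree Q J n. \<phi> (b \<otimes>\<^bsub>A\<^esub> cls h) ~= 0}"
  proof
   fix n assume "n \<in> {n. \<exists>b\<in>EI x \<inter> bq_degree Q J n. \<phi> (b \<otimes>\<^bsub>A\<^esub> cls (g + h)) ~= 0}"
   then obtain b where b: "b \<in> EI x" "b \<in> bq_degree Q J n" "\<phi> (b \<otimes>\<^bsub>A\<^esub> cls (g + h)) ~= 0" by blast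
   then have "\<phi> (b \<otimes>\<^bsub>A\<^esub> cls g) ~= 0 \<or> \<phi> (b \<otimes>\<^bsub>A\<^esub> cls h) ~= 0" using s[OF b(1)] by auto
   with b show "n \<in> {n. \<exists>b\<in>EI x \<inter> bq_degree Q J n. \<phi> (b \<otimes>\<^bsub>A\<^esub> cls g) ~= 0} \<union> {n. \<exists>b\<in>EI x \<inter> bq_degree Q J n. \<phi> (b \<otimes>\<^bsub>A\<^esub> cls h) ~= 0}"
    by blast
  qed
  then show "g + h \<in> KQ & finite {n. \<exists>b\<in>EI x \<inter> bq_degree Q J n. \<phi> (b \<otimes>\<^bsub>A\<^esub> cls (g + h)) ~= 0}"
   using g h KQ_add by (auto intro: finite_subset)
 next
  fix p c assume "p \<in> keys g"
  then have p: "p \<in> paths Q" using g(2) by (auto simp: KQ_def)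
  have pd: "cls (single p c) \<in> bq_degree Q J (length (snd p))"
   using p by (auto simp: bq_degree_def)
  have "{n. \<exists>b\<in>EI x \<inter> bq_degree Q J n. \<phi> (b \<otimes>\<^bsub>A\<^esub> cls (single p c)) ~= 0} <= {n. n + length (snd p) \<in> D}"
  proof
   fix n assume "n \<in> {n. \<exists>b\<in>EI x \<inter> bq_degree Q J n. \<phi> (b \<otimes>\<^bsub>A\<^esub> cls (single p c)) ~= 0}"
   then obtain b where b: "b \<in> EI x" "b \<in> bq_degree Q J n" "\<phi> (b \<otimes>\<^bsub>A\<^esub> cls (single p c)) ~= 0" by blast
   have "b \<otimes>\<^bsub>A\<^esub> cls (single p c) \<in> EI x" using b(1) p by (intro EI_times[OF x] cls_closed) auto
   with b(3) bq_degree_times[OF b(2) pd] show "n \<in> {n. n + length (snd p) \<in> D}" by (auto simp: D_def)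
  qed
  moreover have "finite {n. n + length (snd p) \<in> D}"
   using finite_vimageI[OF D, of "%n. n + length (snd p)"] by (simp add: vimage_def inj_def)
  ultimately show "single p c \<in> KQ & finite {n. \<exists>b\<in>EI x \<inter> bq_degree Q J n. \<phi> (b \<otimes>\<^bsub>A\<^esub> cls (single p c)) ~= 0}"
   using p finite_subset by auto
 qed
 moreover have "{n. \<exists>b\<in>EI x \<inter> bq_degree Q J n. (\<lambda>b\<in>EI x. \<phi> (b \<otimes>\<^bsub>A\<^esub> a)) b ~= 0} = {n. \<exists>b\<in>EI x \<inter> bq_degree Q J n. \<phi> (b \<otimes>\<^bsub>A\<^esub> cls g) ~= 0}"
  by (auto simp: g(1))
 ultimately show "finite {n. \<exists>b\<in>EI x \<inter> bq_degree Q J n. (\<lambda>b\<in>EI x. \<phi> (b \<otimes>\<^bsub>A\<^esub> a)) b ~= 0}" by simp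
qed

lemma inj_abelian_group:
 assumes x: "x \<in> verts Q"
 shows "abelian_group (gr_inj Q J x)"
proof (rule abelian_groupI, unfold inj_simps)
 fix \<phi> assume p: "\<phi> \<in> graded_dual Q J x"
 show "\<exists>\<psi>\<in>graded_dual Q J x. (\<lambda>b\<in>EI x. \<psi> b + \<phi> b) = (\<lambda>b\<in>EI x. 0)"
  by (rule bexI[OF _ inj_uminus_closed[OF x p]]) (auto simp: fun_eq_iff)
 show "(\<lambda>b\<in>EI x. (\<lambda>b\<in>EI x. 0) b + \<phi> b) = \<phi>"
  using dualD(1)[OF p] by (auto simp: fun_eq_iff extensional_def)
qed (auto simp: inj_add_closed[OF x] inj_zero_closed[OF x] fun_eq_iff algebra_simps)

lemma inj_finsum:
 assumes x: "x \<in> verts Q" and f: "f \<in> S \<rightarrow> graded_dual Q J x"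
 shows "finsum (gr_inj Q J x) f S = (\<lambda>b\<in>EI x. \<Sum>i\<in>S. f i b)"
proof -
 interpret I: abelian_group "gr_inj Q J x" by (rule inj_abelian_group[OF x])
 from f show ?thesis
 proof (induction S rule: infinite_finite_induct)
  case (infinite S)
  then show ?case unfolding I.finsum_infinite[OF infinite(1)] by (simp add: inj_simps)
 next
  case empty
  show ?case unfolding I.finsum_empty by (simp add: inj_simps)
 next
  case (insert i S)
  then have m: "f \<in> S \<rightarrow> graded_dual Q J x" "f i \<in> graded_dual Q J x" by auto
  have "finsum (gr_inj Q J x) f (insert i S) = f i \<oplus>\<^bsub>gr_inj Q J x\<^esub> finsum (gr_inj Q J x) f S"
   by (rule I.finsum_insert) (use insert m in "auto simp: inj_simps")
  with insert.IH[OF m(1)] insert.hyps show ?case by (auto simp: inj_simps fun_eq_iff)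
 qed
qed

lemma inj_hc_pe:
 assumes x: "x \<in> verts Q" and "\<phi> \<in> hcomp (gr_inj Q J x) m" "p \<in> gto x" "int (length (snd p)) ~= - m"
 shows "\<phi> (pe p) = 0"
proof -
 have "pe p \<in> EI x \<inter> bq_degree Q J (length (snd p))"
  using pe_EI[OF x assms(3)] pe_degree assms(3) by (auto simp: gto_def)
 with assms(2,4) show ?thesis by (auto simp: inj_simps)
qed

lemma inj_hcI:
 assumes x: "x \<in> verts Q" and \<phi>: "\<phi> \<in> graded_dual Q J x"
  and "!!p. p \<in> gto x ==> int (length (snd p)) ~= - m ==> \<phi> (pe p) = 0"
 shows "\<phi> \<in> hcomp (gr_inj Q J x) m"
proof -
 have "\<phi> b = 0" if n: "int n ~= - m" and b: "b \<in> EI x" "b \<in> bq_degree Q J n" for n b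
 proof -
  from b(1) obtain f where f: "b = cls f" "f \<in> ES x" by (auto simp: EI_eq[OF x])
  have "\<phi> (pe p) = 0" if "p \<in> keys f" for p
   using that f b(2) n by (intro assms(3)) (auto simp: bq_degree_GQ[OF ES_GQ[OF f(2)]] gto_def ES_def GQ_def)
  then show ?thesis by (simp add: f(1) dual_values[OF x \<phi> f(2)])
 qed
 with \<phi> show ?thesis by (auto simp: inj_simps)
qed

lemma inj_pre:
 assumes x: "x \<in> verts Q"
 shows "gr_pre Q J (gr_inj Q J x)"
 unfolding gr_pre_def
proof (intro conjI allI ballI)
 have ab: "abelian_group (gr_inj Q J x)" by (rule inj_abelian_group[OF x])
 then interpret I: abelian_group "gr_inj Q J x" .
 show "left_module A (gr_inj Q J x)"
  unfolding left_module_def left_module_axioms_def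
 proof (intro conjI allI impI ring_A ab)
  fix a \<phi> assume "a \<in> carrier A" "\<phi> \<in> carrier (gr_inj Q J x)"
  then show "a \<odot>\<^bsub>gr_inj Q J x\<^esub> \<phi> \<in> carrier (gr_inj Q J x)"
   unfolding inj_simps by (rule inj_smult_closed[OF x])
 next
  fix a b \<phi> assume "a \<in> carrier A" "b \<in> carrier A" "\<phi> \<in> carrier (gr_inj Q J x)"
  then show "(a \<oplus>\<^bsub>A\<^esub> b) \<odot>\<^bsub>gr_inj Q J x\<^esub> \<phi> = a \<odot>\<^bsub>gr_inj Q J x\<^esub> \<phi> \<oplus>\<^bsub>gr_inj Q J x\<^esub> b \<odot>\<^bsub>gr_inj Q J x\<^esub> \<phi>"
   by (auto simp: inj_simps fun_eq_iff A.r_distr EI_carrier[OF x] EI_times[OF x] dualD(2))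
 next
  fix a \<phi> \<psi> assume "a \<in> carrier A" "\<phi> \<in> carrier (gr_inj Q J x)" "\<psi> \<in> carrier (gr_inj Q J x)"
  then show "a \<odot>\<^bsub>gr_inj Q J x\<^esub> (\<phi> \<oplus>\<^bsub>gr_inj Q J x\<^esub> \<psi>) = a \<odot>\<^bsub>gr_inj Q J x\<^esub> \<phi> \<oplus>\<^bsub>gr_inj Q J x\<^esub> a \<odot>\<^bsub>gr_inj Q J x\<^esub> \<psi>"
   by (auto simp: inj_simps fun_eq_iff EI_times[OF x])
 next
  fix a b \<phi> assume "a \<in> carrier A" "b \<in> carrier A" "\<phi> \<in> carrier (gr_inj Q J x)"
  then show "(a \<otimes>\<^bsub>A\<^esub> b) \<odot>\<^bsub>gr_inj Q J x\<^esub> \<phi> = a \<odot>\<^bsub>gr_inj Q J x\<^esub> (b \<odot>\<^bsub>gr_inj Q J x\<^esub> \<phi>)"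
   by (auto simp: inj_simps fun_eq_iff EI_times[OF x] A.m_assoc EI_carrier[OF x])
 next
  fix \<phi> assume "\<phi> \<in> carrier (gr_inj Q J x)"
  then show "\<one>\<^bsub>A\<^esub> \<odot>\<^bsub>gr_inj Q J x\<^esub> \<phi> = \<phi>"
   using dualD(1)[of \<phi> x] by (auto simp: inj_simps fun_eq_iff EI_carrier[OF x] extensional_def)
 qed
 have hsub: "hcomp (gr_inj Q J x) n <= graded_dual Q J x" for n by (auto simp: inj_simps)
 show "additive_subgroup (hcomp (gr_inj Q J x) n) (gr_inj Q J x)" for n
 proof
  show "hcomp (gr_inj Q J x) n <= carrier (add_monoid (gr_inj Q J x))" using hsub by (simp add: inj_simps(1))
  show "a \<otimes>\<^bsub>add_monoid (gr_inj Q J x)\<^esub> b \<in> hcomp (gr_inj Q J x) n"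
   if "a \<in> hcomp (gr_inj Q J x) n" "b \<in> hcomp (gr_inj Q J x) n" for a b
   using that by (auto simp: inj_simps inj_add_closed[OF x])
  show "\<one>\<^bsub>add_monoid (gr_inj Q J x)\<^esub> \<in> hcomp (gr_inj Q J x) n"
   by (auto simp: inj_simps inj_zero_closed[OF x])
  show "inv\<^bsub>add_monoid (gr_inj Q J x)\<^esub> a \<in> hcomp (gr_inj Q J x) n" if a: "a \<in> hcomp (gr_inj Q J x) n" for a
  proof -
   have aG: "a \<in> graded_dual Q J x" using a hsub by blast
   have m: "(\<lambda>b\<in>EI x. - a b) \<in> hcomp (gr_inj Q J x) n"
    using a inj_uminus_closed[OF x aG] by (auto simp: inj_simps)
   have z: "(\<lambda>b\<in>EI x. - a b) \<oplus>\<^bsub>gr_inj Q J x\<^esub> a = \<zero>\<^bsub>gr_inj Q J x\<^esub>" by (auto simp: inj_simps fun_eq_iff)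
   have "\<ominus>\<^bsub>gr_inj Q J x\<^esub> a = (\<lambda>b\<in>EI x. - a b)"
    by (rule I.minus_equality[OF z]) (use aG inj_uminus_closed[OF x aG] in "simp_all add: inj_simps")
   with m show ?thesis unfolding a_inv_def by simp
  qed
 qed
 show "a \<odot>\<^bsub>gr_inj Q J x\<^esub> y \<in> hcomp (gr_inj Q J x) (n + int i)"
  if a: "a \<in> bq_degree Q J i" and y: "y \<in> hcomp (gr_inj Q J x) n" for a y n i
 proof -
  have aA: "a \<in> carrier A" using a by (auto simp: bq_degree_def intro!: cls_closed simp: KQ_def)
  have yG: "y \<in> graded_dual Q J x" using y hsub by blast
  have "y (b \<otimes>\<^bsub>A\<^esub> a) = 0" if b: "b \<in> EI x" "b \<in> bq_degree Q J j" and j: "int j ~= - (n + int i)" for b j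
  proof -
   have "int (j + i) ~= - n" using j by simp
   moreover have "b \<otimes>\<^bsub>A\<^esub> a \<in> EI x \<inter> bq_degree Q J (j + i)" using EI_times[OF x b(1) aA] bq_degree_times[OF b(2) a] by blast
   ultimately show ?thesis using y unfolding inj_simps by blast
  qed
  then show ?thesis using inj_smult_closed[OF x aA yG] by (auto simp: inj_simps)
 qed
 fix \<phi> assume "\<phi> \<in> carrier (gr_inj Q J x)"
 then have \<phi>: "\<phi> \<in> graded_dual Q J x" by (simp add: inj_simps)
 define D where "D = {n. \<exists>a \<in> EI x \<inter> bq_degree Q J n. \<phi> a ~= 0}"
 have D: "finite D" using dualD(4)[OF \<phi>] by (simp add: D_def)
 have lenD: "length (snd p) \<in> D" if "p \<in> gto x" "\<phi> (pe p) ~= 0" for p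
  using that pe_EI[OF x that(1)] pe_degree[of p] by (auto simp: D_def gto_def)
 define c0 where "c0 m = mkd x (%p. if int (length (snd p)) = - m then \<phi> (pe p) else 0)" for m
 have c0pe: "c0 m (pe p) = (if int (length (snd p)) = - m then \<phi> (pe p) else 0)" if "p \<in> gto x" for m p
  unfolding c0_def by (rule mkd_pe[OF x that])
 have c0G: "c0 m \<in> graded_dual Q J x" for m
  unfolding c0_def
 proof (rule mkd_dual[OF x], rule finite_subset[OF _ D], rule subsetI)
  fix n assume "n \<in> {n. \<exists>p\<in>gto x. length (snd p) = n & (if int (length (snd p)) = - m then \<phi> (pe p) else 0) ~= 0}"
  then obtain p where "p \<in> gto x" "length (snd p) = n" "\<phi> (pe p) ~= 0" by (auto split: if_splits)
  then show "n \<in> D" using lenD by blast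
 qed
 have c0h: "c0 m \<in> hcomp (gr_inj Q J x) m" for m
  by (rule inj_hcI[OF x c0G]) (simp add: c0pe)
 have fin0: "finite {m. c0 m ~= \<zero>\<^bsub>gr_inj Q J x\<^esub>}"
 proof (rule finite_subset)
  show "{m. c0 m ~= \<zero>\<^bsub>gr_inj Q J x\<^esub>} <= (%n. - int n) ` D"
  proof
   fix m assume "m \<in> {m. c0 m ~= \<zero>\<^bsub>gr_inj Q J x\<^esub>}"
   then have "c0 m ~= (\<lambda>b\<in>EI x. 0)" by (simp add: inj_simps)
   then obtain p where p: "p \<in> gto x" "c0 m (pe p) ~= 0"
    using dual_ext[OF x c0G inj_zero_closed[OF x], of m] pe_EI[OF x] by auto
   then have "m = - int (length (snd p))" "\<phi> (pe p) ~= 0" by (auto simp: c0pe[OF p(1)] split: if_splits)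
   then show "m \<in> (%n. - int n) ` D" using lenD[OF p(1)] by blast
  qed
 qed (use D in simp)
 have sumpe: "finsum (gr_inj Q J x) d S (pe p) = (if - int (length (snd p)) \<in> S then d (- int (length (snd p))) (pe p) else 0)"
  if d: "!!m. d m \<in> hcomp (gr_inj Q J x) m" and S: "finite S" and p: "p \<in> gto x" for d S p
 proof -
  have "d \<in> S \<rightarrow> graded_dual Q J x" using d hsub by blast
  then have "finsum (gr_inj Q J x) d S (pe p) = (\<Sum>m\<in>S. d m (pe p))"
   by (simp add: inj_finsum[OF x] pe_EI[OF x p])
  also have "... = (\<Sum>m\<in>S. if - int (length (snd p)) = m then d (- int (length (snd p))) (pe p) else 0)"
   using inj_hc_pe[OF x d p] by (intro sum.cong) auto
  finally show ?thesis using S by simp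
 qed
 have sumG: "finsum (gr_inj Q J x) d S \<in> graded_dual Q J x" if d: "!!m. d m \<in> hcomp (gr_inj Q J x) m" for d and S :: "int set"
  using I.finsum_closed[of d S] d hsub by (auto simp: inj_simps(1))
 show "\<exists>!c. (\<forall>n. c n \<in> hcomp (gr_inj Q J x) n) & finite {n. c n ~= \<zero>\<^bsub>gr_inj Q J x\<^esub>} &
   \<phi> = (\<Oplus>\<^bsub>gr_inj Q J x\<^esub>n\<in>{n. c n ~= \<zero>\<^bsub>gr_inj Q J x\<^esub>}. c n)"
 proof (rule ex1I[of _ c0])
  have "\<phi> = (\<Oplus>\<^bsub>gr_inj Q J x\<^esub>n\<in>{n. c0 n ~= \<zero>\<^bsub>gr_inj Q J x\<^esub>}. c0 n)"
  proof (rule dual_ext[OF x \<phi> sumG[OF c0h]])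
   fix p assume p: "p \<in> gto x"
   have e: "c0 (- int (length (snd p))) (pe p) = \<phi> (pe p)" by (simp add: c0pe[OF p])
   show "\<phi> (pe p) = (\<Oplus>\<^bsub>gr_inj Q J x\<^esub>n\<in>{n. c0 n ~= \<zero>\<^bsub>gr_inj Q J x\<^esub>}. c0 n) (pe p)"
   proof (cases "c0 (- int (length (snd p))) = \<zero>\<^bsub>gr_inj Q J x\<^esub>")
    case True
    then have "c0 (- int (length (snd p))) (pe p) = 0" using pe_EI[OF x p] by (simp only: inj_simps restrict_apply')
    then have "\<phi> (pe p) = 0" using e by simp
    then show ?thesis using sumpe[OF c0h fin0 p] True by simp
   next
    case False
    then show ?thesis using sumpe[OF c0h fin0 p] e by simp
   qed
  qed
  then show "(\<forall>n. c0 n \<in> hcomp (gr_inj Q J x) n) & finite {n. c0 n ~= \<zero>\<^bsub>gr_inj Q J x\<^esub>} &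
   \<phi> = (\<Oplus>\<^bsub>gr_inj Q J x\<^esub>n\<in>{n. c0 n ~= \<zero>\<^bsub>gr_inj Q J x\<^esub>}. c0 n)" using c0h fin0 by blast
 next
  fix d assume d: "(\<forall>n. d n \<in> hcomp (gr_inj Q J x) n) & finite {n. d n ~= \<zero>\<^bsub>gr_inj Q J x\<^esub>} &
   \<phi> = (\<Oplus>\<^bsub>gr_inj Q J x\<^esub>n\<in>{n. d n ~= \<zero>\<^bsub>gr_inj Q J x\<^esub>}. d n)"
  then have dh: "d n \<in> hcomp (gr_inj Q J x) n" and dfin: "finite {n. d n ~= \<zero>\<^bsub>gr_inj Q J x\<^esub>}"
   and \<phi>d: "\<phi> = (\<Oplus>\<^bsub>gr_inj Q J x\<^esub>n\<in>{n. d n ~= \<zero>\<^bsub>gr_inj Q J x\<^esub>}. d n)" for n by blast+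
  show "d = c0"
  proof
   fix m
   show "d m = c0 m"
   proof (rule dual_ext[OF x _ c0G])
    show "d m \<in> graded_dual Q J x" using dh hsub by blast
    fix p assume p: "p \<in> gto x"
    have z: "d (- int (length (snd p))) (pe p) = 0" if "d (- int (length (snd p))) = \<zero>\<^bsub>gr_inj Q J x\<^esub>"
     using that pe_EI[OF x p] by (simp add: inj_simps)
    have "\<phi> (pe p) = d (- int (length (snd p))) (pe p)"
     unfolding \<phi>d sumpe[OF dh dfin p] using z by auto
    then show "d m (pe p) = c0 m (pe p)" using inj_hc_pe[OF x dh p, of m] by (auto simp: c0pe[OF p])
   qed
  qed
 qed
qed

lemma inj_ev: "x \<in> verts Q ==> graded_pre.ev Q J (gr_inj Q J x) f \<phi> = (\<lambda>b\<in>EI x. \<phi> (b \<otimes>\<^bsub>A\<^esub> cls f))"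
 by (simp add: graded_pre.ev_def[OF graded_preI[OF inj_pre]] inj_simps)

lemma inj_ev_arr:
 assumes x: "x \<in> verts Q" and \<phi>: "\<phi> \<in> graded_dual Q J x" and a: "a \<in> arcs Q" and p: "(w, q) \<in> gto x"
 shows "graded_pre.ev Q J (gr_inj Q J x) (arr a) \<phi> (pe (w, q)) =
  (if w = head Q a & (tail Q a, a # q) \<in> good then \<phi> (pe (tail Q a, a # q)) else 0)"
proof -
 note \<phi>0 = dual_zero[OF x \<phi>]
 have wq: "(w, q) \<in> paths Q" using p by (simp add: gto_def good_paths)
 have "graded_pre.ev Q J (gr_inj Q J x) (arr a) \<phi> (pe (w, q)) = \<phi> (cls (path_times Q (single (w, q) 1) (arr a)))"
  using a wq pe_EI[OF x p] by (simp add: inj_ev[OF x] pe_def cls_mult)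
 also have "path_times Q (single (w, q) 1) (arr a) = (if w = head Q a then single (tail Q a, a # q) 1 else 0)"
  by (simp add: arr_def path_times_single path_end_simp)
 also have "cls (if w = head Q a then single (tail Q a, a # q) 1 else 0) =
   (if w = head Q a & (tail Q a, a # q) \<in> good then pe (tail Q a, a # q) else cls 0)"
 proof (cases "w = head Q a & (tail Q a, a # q) ~: good")
  case True
  then have "cls (single (tail Q a, a # q) 1) = cls 0"
   using a wq by (subst cls_eq_iff) (auto simp: lookup_single when_def)
  then show ?thesis using True by simp
 qed (auto simp: pe_def)
 finally show ?thesis using \<phi>0 by simp
qed

text \<open>
 The value at the path \<open>q a\<close>, which starts with the arrow \<open>a\<close>, is a value of \<open>a \<phi>\<close>; only the value at the
 trivial path, in degree \<open>0\<close>, escapes.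
\<close>
lemma inj_cogen:
 assumes x: "x \<in> verts Q" and m: "m < 0"
 shows "graded_pre.cogen_at Q J (gr_inj Q J x) m"
proof -
 interpret I: graded_pre Q J F "gr_inj Q J x" by (rule graded_preI[OF inj_pre[OF x]])
 show ?thesis unfolding I.cogen_at_def
 proof (intro ballI impI)
  fix \<phi> assume h: "\<phi> \<in> hcomp (gr_inj Q J x) m" and z: "\<forall>a\<in>arcs Q. I.ev (arr a) \<phi> = \<zero>\<^bsub>gr_inj Q J x\<^esub>"
  then have \<phi>: "\<phi> \<in> graded_dual Q J x" by (simp add: inj_simps)
  have "\<phi> = (\<lambda>b\<in>EI x. 0)"
  proof (rule dual_ext[OF x \<phi> inj_zero_closed[OF x]])
   fix p assume p: "p \<in> gto x"
   have "\<phi> (pe p) = 0"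
   proof (cases "int (length (snd p)) = - m")
    case True
    with m obtain u a q where pq: "p = (u, a # q)" by (cases p; cases "snd p") auto
    then have g: "(u, a # q) \<in> good" and e: "path_end Q (u, a # q) = x" using p by (auto simp: gto_def)
    have a: "a \<in> arcs Q" "tail Q a = u" using g by (auto simp: good_Cons)
    have q: "(head Q a, q) \<in> gto x" using g e by (auto simp: gto_def good_Cons path_end_simp split: if_splits)
    have "I.ev (arr a) \<phi> (pe (head Q a, q)) = \<phi> (pe (u, a # q))"
     using inj_ev_arr[OF x \<phi> a(1) q] g a by simp
    moreover have "I.ev (arr a) \<phi> (pe (head Q a, q)) = 0" using z a(1) pe_EI[OF x q] by (simp add: inj_simps)
    ultimately show ?thesis by (simp add: pq)
   qed (rule inj_hc_pe[OF x h p])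
   then show "\<phi> (pe p) = (\<lambda>b\<in>EI x. 0) (pe p)" using pe_EI[OF x p] by simp
  qed
  then show "\<phi> = \<zero>\<^bsub>gr_inj Q J x\<^esub>" by (simp add: inj_simps)
 qed
qed

text \<open>
 Dually to the projectives: \<open>a \<phi> = y\<^sub>a\<close> prescribes the value of \<open>\<phi>\<close> at each nonzero path that starts
 with \<open>a\<close>, different arrows concern different paths, and the values of \<open>y\<^sub>a\<close> at the other paths vanish by
 hypothesis.
\<close>
lemma inj_corel:
 assumes x: "x \<in> verts Q" and m: "m < 0"
 shows "graded_pre.corel_at Q J F (gr_inj Q J x) m"
proof -
 interpret I: graded_pre Q J F "gr_inj Q J x" by (rule graded_preI[OF inj_pre[OF x]])
 show ?thesis unfolding I.corel_at_def
 proof (intro allI impI)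
  fix y assume y: "\<forall>a\<in>arcs Q. y a \<in> hcomp (gr_inj Q J x) (m + 1) & I.ev (vtx (head Q a)) (y a) = y a"
   and z: "\<forall>a b. (a, b) \<in> F --> I.ev (arr b) (y a) = \<zero>\<^bsub>gr_inj Q J x\<^esub>"
  define V where "V p = (case snd p of [] => 0 | a # q => if int (length (snd p)) = - m then y a (pe (head Q a, q)) else 0)" for p :: "('v, 'e) path"
  define \<phi> where "\<phi> = mkd x V"
  have V0: "V p = 0" if "int (length (snd p)) ~= - m" for p
   using that by (auto simp: V_def split: list.splits)
  have \<phi>: "\<phi> \<in> graded_dual Q J x" unfolding \<phi>_def
   by (rule mkd_dual[OF x], rule finite_subset[of _ "{nat (- m)}"]) (use V0 in force, simp)
  have \<phi>pe: "\<phi> (pe p) = V p" if "p \<in> gto x" for p unfolding \<phi>_def by (rule mkd_pe[OF x that])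
  have h: "\<phi> \<in> hcomp (gr_inj Q J x) m"
   by (rule inj_hcI[OF x \<phi>]) (simp add: \<phi>pe V0)
  have "I.ev (arr a) \<phi> = y a" if a: "a \<in> arcs Q" for a
  proof (rule dual_ext[OF x])
   have ya: "y a \<in> hcomp (gr_inj Q J x) (m + 1)" and yv: "I.ev (vtx (head Q a)) (y a) = y a" using y a by auto
   show yG: "y a \<in> graded_dual Q J x" using ya by (simp add: inj_simps)
   show "I.ev (arr a) \<phi> \<in> graded_dual Q J x" using I.ev_closed[of "arr a" \<phi>] a \<phi> by (simp add: inj_simps(1))
   fix p assume p: "p \<in> gto x"
   obtain w q where pw: "p = (w, q)" by (cases p)
   note p' = p[unfolded pw]
   have wq: "(w, q) \<in> paths Q" "(w, q) \<in> good" using p' by (auto simp: gto_def good_paths)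
   have ev: "I.ev (arr a) \<phi> (pe (w, q)) = (if w = head Q a & (tail Q a, a # q) \<in> good then \<phi> (pe (tail Q a, a # q)) else 0)"
    by (rule inj_ev_arr[OF x \<phi> a p'])
   show "I.ev (arr a) \<phi> (pe p) = y a (pe p)"
   proof (cases "w = head Q a")
    case False
    note y0 = dual_zero[OF x yG]
    have "y a (pe (w, q)) = I.ev (vtx (head Q a)) (y a) (pe (w, q))" by (simp add: yv)
    also have "... = y a (cls (path_times Q (single (w, q) 1) (vtx (head Q a))))"
     using a wq pe_EI[OF x p'] by (simp add: inj_ev[OF x] pe_def cls_mult)
    also have "path_times Q (single (w, q) 1) (vtx (head Q a)) = 0"
     using False by (simp add: vtx_def path_times_single path_end_simp)
    finally show ?thesis using False ev y0 by (simp add: pw)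
   next
    case True
    show ?thesis
    proof (cases "(tail Q a, a # q) \<in> good")
     case g: True
     have "(tail Q a, a # q) \<in> gto x"
      using g p' True by (auto simp: gto_def path_end_simp split: if_splits)
     then have "I.ev (arr a) \<phi> (pe (w, q)) = V (tail Q a, a # q)" using ev True g by (simp add: \<phi>pe)
     also have "... = y a (pe (w, q))"
      using inj_hc_pe[OF x ya p'] True by (auto simp: V_def)
     finally show ?thesis by (simp add: pw)
    next
     case g: False
     then obtain b q' where q: "q = b # q'" and ab: "(a, b) \<in> F"
      using wq(2) a True by (cases q) (auto simp: good_Cons)
     have q': "(head Q b, q') \<in> gto x"
      using p' by (auto simp: q gto_def good_Cons path_end_simp split: if_splits)
     have b: "b \<in> arcs Q" "tail Q b = w" using wq(2) by (auto simp: q good_Cons)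
     have "I.ev (arr b) (y a) (pe (head Q b, q')) = y a (pe (w, q))"
      using inj_ev_arr[OF x yG b(1) q'] wq(2) b by (simp add: q)
     moreover have "I.ev (arr b) (y a) (pe (head Q b, q')) = 0"
      using z ab pe_EI[OF x q'] by (simp add: inj_simps)
     ultimately show ?thesis using ev g by (simp add: pw)
    qed
   qed
  qed
  with h show "\<exists>\<phi>\<in>hcomp (gr_inj Q J x) m. \<forall>a\<in>arcs Q. I.ev (arr a) \<phi> = y a" by blast
 qed
qed

end

section \<open>Linear complexes of projectives\<close>

lemma (in abelian_group) finsum_swap:
 assumes "finite S" "finite T" "!!i j. i \<in> S ==> j \<in> T ==> f i j \<in> carrier G"
 shows "(\<Oplus>i\<in>S. \<Oplus>j\<in>T. f i j) = (\<Oplus>j\<in>T. \<Oplus>i\<in>S. f i j)"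
 using assms(1,3)
proof (induction S rule: finite_induct)
 case (insert x S)
 have c: "(%i. \<Oplus>j\<in>T. f i j) \<in> S \<rightarrow> carrier G" "(\<Oplus>j\<in>T. f x j) \<in> carrier G"
  using insert.prems by (auto intro!: finsum_closed)
 have "(\<Oplus>i\<in>insert x S. \<Oplus>j\<in>T. f i j) = (\<Oplus>j\<in>T. f x j) \<oplus> (\<Oplus>j\<in>T. \<Oplus>i\<in>S. f i j)"
  using insert c by (simp add: finsum_insert)
 also have "... = (\<Oplus>j\<in>T. f x j \<oplus> (\<Oplus>i\<in>S. f i j))"
  using insert.prems by (intro finsum_addf[symmetric]) (auto intro!: finsum_closed)
 also have "... = (\<Oplus>j\<in>T. \<Oplus>i\<in>insert x S. f i j)"
 proof (rule finsum_cong'[OF refl])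
  show "(%j. \<Oplus>i\<in>insert x S. f i j) \<in> T \<rightarrow> carrier G"
   using insert.prems by (auto intro!: finsum_closed)
  fix j assume j: "j \<in> T"
  show "f x j \<oplus> (\<Oplus>i\<in>S. f i j) = (\<Oplus>i\<in>insert x S. f i j)"
   by (rule finsum_insert[symmetric]) (use insert j in auto)
 qed
 finally show ?case .
qed simp

context monomial_quotient
begin

lemma monomial_relations_left: "monomial_relations (arcs Q) (tail Q) (head Q) (%a b. (a, b) \<in> F)"
 by unfold_locales (use F_arcs F_bounded in auto)

lemma monomial_relations_right: "monomial_relations (arcs Q) (head Q) (tail Q) (%a b. (b, a) \<in> F)"
proof unfold_locales
 show "finite (arcs Q)" by simp
 show "tail Q a = head Q b" if "(b, a) \<in> F" for a b using F_arcs[OF that] by simp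
 obtain m where m: "!!as. set as <= arcs Q ==> successively (%a b. (a, b) \<in> F) as ==> length as \<le> m"
  using F_bounded by blast
 show "\<exists>m. \<forall>as. set as <= arcs Q --> successively (%a b. (b, a) \<in> F) as --> length as \<le> m"
 proof (intro exI[of _ m] allI impI)
  fix as assume as: "set as <= arcs Q" "successively (%a b. (b, a) \<in> F) as"
  then have "successively (%a b. (a, b) \<in> F) (rev as)" by (simp add: successively_rev)
  from m[OF _ this] as(1) show "length as \<le> m" by simp
 qed
qed

sublocale L: monomial_relations "arcs Q" "tail Q" "head Q" "%a b. (a, b) \<in> F"
 by (rule monomial_relations_left)

definition cf :: "('v, 'e, 'k) bq_elem => ('v, 'e, 'k) path_elem" where
 "cf a = (THE f. f \<in> GQ & cls f = a)"

lemma cf_GQ: "f \<in> GQ ==> cf (cls f) = f"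
 unfolding cf_def by (intro the_equality) (auto intro: cls_inj)

lemma cf_KQ: "f \<in> KQ ==> cf (cls f) = red f"
 using cf_GQ[OF red_GQ[of f]] by (simp add: cls_red)

lemma SQ_lookup: "f \<in> SQ x ==> fst p ~= x ==> lookup f p = 0"
 using in_keys_iff[of p f] unfolding SQ_def by blast

definition lin :: "'v list => nat => ('v \<times> int) list" where
 "lin xs n = map (%x. (x, int n)) xs"

abbreviation "PS xs \<equiv> proj_sum Q J xs"

context
 fixes xs :: "('v \<times> int) list"
 assumes xs: "set xs <= verts Q \<times> UNIV"
begin

lemma xs_nth: "j < length xs ==> fst (xs ! j) \<in> verts Q"
 using xs nth_mem by fastforce

lemma psum_nth: "j < length xs ==> map (%(x, i). gr_shift i (gr_proj Q J x)) xs ! j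
  = gr_shift (snd (xs ! j)) (gr_proj Q J (fst (xs ! j)))"
 by (simp add: case_prod_unfold)

lemma shift_proj_pre: "j < length xs ==> gr_pre Q J (gr_shift (snd (xs ! j)) (gr_proj Q J (fst (xs ! j))))"
 by (rule graded_pre.shift_pre[OF graded_preI[OF proj_pre[OF xs_nth]]])

lemma psum_pre': "j < length (map (%(x, i). gr_shift i (gr_proj Q J x)) xs) ==>
  gr_pre Q J (map (%(x, i). gr_shift i (gr_proj Q J x)) xs ! j)"
 using shift_proj_pre psum_nth by simp

lemma psum_pre: "gr_pre Q J (PS xs)"
 unfolding proj_sum_def by (rule dsum_pre) (rule psum_pre')

lemma psum_gen:
 assumes "!!x i. (x, i) \<in> set xs ==> i \<le> m"
 shows "graded_pre.gen_at Q J (PS xs) m"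
 unfolding proj_sum_def
proof (rule dsum_gen, rule psum_pre', assumption)
 fix j assume "j < length (map (%(x, i). gr_shift i (gr_proj Q J x)) xs)"
 then have j: "j < length xs" by simp
 have "snd (xs ! j) \<le> m" using assms[of "fst (xs ! j)" "snd (xs ! j)"] nth_mem[OF j] by simp
 then show "graded_pre.gen_at Q J (map (%(x, i). gr_shift i (gr_proj Q J x)) xs ! j) m"
  unfolding psum_nth[OF j] graded_pre.shift_gen[OF graded_preI[OF proj_pre[OF xs_nth[OF j]]]]
  by (intro proj_gen xs_nth j) simp
qed

lemma psum_rel:
 assumes "!!x i. (x, i) \<in> set xs ==> i + 1 \<le> m"
 shows "graded_pre.rel_at Q J F (PS xs) m"
 unfolding proj_sum_def
proof (rule dsum_rel, rule psum_pre', assumption)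
 fix j assume "j < length (map (%(x, i). gr_shift i (gr_proj Q J x)) xs)"
 then have j: "j < length xs" by simp
 have "snd (xs ! j) + 1 \<le> m" using assms[of "fst (xs ! j)" "snd (xs ! j)"] nth_mem[OF j] by simp
 then show "graded_pre.rel_at Q J F (map (%(x, i). gr_shift i (gr_proj Q J x)) xs ! j) m"
  unfolding psum_nth[OF j] graded_pre.shift_rel[OF graded_preI[OF proj_pre[OF xs_nth[OF j]]]]
  by (intro proj_rel xs_nth j) simp
qed

lemma shift_simps [simp]:
 "carrier (gr_shift i M) = carrier M" "add (gr_shift i M) = add M" "zero (gr_shift i M) = zero M"
 "smult (gr_shift i M) = smult M" "hcomp (gr_shift i M) = (%n. hcomp M (n - i))"
 by (simp_all add: gr_shift_def)

lemma psum_carrier: "z \<in> carrier (PS xs) \<longleftrightarrow> z \<in> extensional {..<length xs} & (\<forall>j<length xs. z j \<in> cls ` SQ (fst (xs ! j)))"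
 unfolding proj_sum_def dsum_simps PiE_iff length_map
 using psum_nth proj_carrier[OF xs_nth] by auto

lemma psum_hcomp: "z \<in> hcomp (PS xs) m \<longleftrightarrow> z \<in> extensional {..<length xs} &
  (\<forall>j<length xs. z j \<in> cls ` {f \<in> SQ (fst (xs ! j)). \<forall>p\<in>keys f. int (length (snd p)) = m - snd (xs ! j)})"
 unfolding proj_sum_def dsum_simps PiE_iff length_map
 using psum_nth proj_hcomp[OF xs_nth] by auto

lemma psum_add: "x \<oplus>\<^bsub>PS xs\<^esub> y = (\<lambda>j\<in>{..<length xs}. x j \<oplus>\<^bsub>A\<^esub> y j)"
 unfolding proj_sum_def dsum_simps length_map by (rule restrict_ext) (simp add: case_prod_unfold proj_simps)

lemma psum_smult: "a \<odot>\<^bsub>PS xs\<^esub> y = (\<lambda>j\<in>{..<length xs}. a \<otimes>\<^bsub>A\<^esub> y j)"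
 unfolding proj_sum_def dsum_simps length_map by (rule restrict_ext) (simp add: case_prod_unfold proj_simps)

lemma psum_zero: "\<zero>\<^bsub>PS xs\<^esub> = (\<lambda>j\<in>{..<length xs}. \<zero>\<^bsub>A\<^esub>)"
 unfolding proj_sum_def dsum_simps length_map by (rule restrict_ext) (simp add: case_prod_unfold proj_simps)

lemma psum_cf:
 assumes "z \<in> carrier (PS xs)" "j < length xs"
 shows "cf (z j) \<in> SQ (fst (xs ! j))" "z j = cls (cf (z j))"
proof -
 obtain f where f: "f \<in> SQ (fst (xs ! j))" "z j = cls f" using assms psum_carrier by blast
 then show "cf (z j) \<in> SQ (fst (xs ! j))" "z j = cls (cf (z j))"
  by (simp_all add: cf_GQ[OF SQ_GQ[OF f(1)]])
qed

lemma psum_A: "z \<in> carrier (PS xs) ==> j < length xs ==> z j \<in> carrier A"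
 using psum_cf[of z j] cls_closed[OF SQ_KQ[of "cf (z j)"]] by simp

lemma psum_ext:
 assumes z: "z \<in> carrier (PS xs)" and w: "w \<in> carrier (PS xs)"
  and eq: "!!j p. j < length xs ==> p \<in> good ==> fst p = fst (xs ! j) ==> lookup (cf (z j)) p = lookup (cf (w j)) p"
 shows "z = w"
proof (rule extensionalityI)
 show "z \<in> extensional {..<length xs}" "w \<in> extensional {..<length xs}" using z w psum_carrier by blast+
 fix j assume "j \<in> {..<length xs}"
 then have j: "j < length xs" by simp
 note c = psum_cf[OF z j] psum_cf[OF w j]
 have "cf (z j) = cf (w j)"
 proof (rule poly_mapping_eqI)
  fix p
  show "lookup (cf (z j)) p = lookup (cf (w j)) p"
  proof (cases "p \<in> good & fst p = fst (xs ! j)")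
   case True
   then show ?thesis using eq[OF j] by blast
  next
   case False
   then have "p ~: keys (cf (z j))" "p ~: keys (cf (w j))" using c(1,3) by (auto simp: SQ_def GQ_def)
   then show ?thesis by (simp add: in_keys_iff)
  qed
 qed
 with c(2,4) show "z j = w j" by simp
qed

end

lemma lin_simps [simp]: "length (lin xs n) = length xs" "j < length xs ==> lin xs n ! j = (xs ! j, int n)"
 by (simp_all add: lin_def)

lemma lin_verts: "set xs <= verts Q ==> set (lin xs n) <= verts Q \<times> UNIV"
 by (auto simp: lin_def)

end

context graded_pre
begin

definition phom :: "('v \<times> int) list => (nat => 'm) => (nat => ('v, 'e, 'k) bq_elem) => 'm" where
 "phom xs b = (\<lambda>z\<in>carrier (PS xs). \<Oplus>j\<in>{..<length xs}. z j \<odot> b j)"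

lemma phom_hom:
 assumes xs: "set xs <= verts Q \<times> UNIV" and b: "!!j. j < length xs ==> b j \<in> hcomp M (snd (xs ! j))"
 shows "phom xs b \<in> gr_hom Q J (PS xs) M"
proof -
 have bc: "b j \<in> carrier M" if "j < length xs" for j using b[OF that] by (rule hc_carrier)
 note lmr = left_module.smult_closed[OF lm] left_module.smult_l_distr[OF lm] left_module.smult_assoc[OF lm]
 have cl: "z j \<odot> b j \<in> carrier M" if "z \<in> carrier (PS xs)" "j < length xs" for z j
  by (rule lmr(1)[OF psum_A[OF xs that] bc[OF that(2)]])
 interpret P: graded_pre Q J F "PS xs" by (rule graded_preI[OF psum_pre[OF xs]])
 show ?thesis
  unfolding gr_hom_def mem_Collect_eq
 proof (intro conjI ballI allI subsetI)
  show "phom xs b \<in> carrier (PS xs) \<rightarrow>\<^sub>E carrier M"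
   unfolding phom_def by (intro restrict_PiE_iff[THEN iffD2] ballI ag.finsum_closed Pi_I) (auto intro: cl)
 next
  fix x y assume x: "x \<in> carrier (PS xs)" and y: "y \<in> carrier (PS xs)"
  have xy: "x \<oplus>\<^bsub>PS xs\<^esub> y \<in> carrier (PS xs)" using x y by (rule P.ag.a_closed)
  have "phom xs b (x \<oplus>\<^bsub>PS xs\<^esub> y) = (\<Oplus>j\<in>{..<length xs}. (x \<oplus>\<^bsub>PS xs\<^esub> y) j \<odot> b j)"
   using xy by (simp add: phom_def)
  also have "... = (\<Oplus>j\<in>{..<length xs}. x j \<odot> b j \<oplus> y j \<odot> b j)"
   by (rule ag.finsum_cong'[OF refl])
    (auto simp: psum_add[OF xs] lmr(2) psum_A[OF xs x] psum_A[OF xs y] bc intro!: cl x y)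
  also have "... = phom xs b x \<oplus> phom xs b y"
   using x y cl by (simp add: phom_def ag.finsum_addf Pi_def)
  finally show "phom xs b (x \<oplus>\<^bsub>PS xs\<^esub> y) = phom xs b x \<oplus> phom xs b y" .
 next
  fix a x assume a: "a \<in> carrier A" and x: "x \<in> carrier (PS xs)"
  have ax: "a \<odot>\<^bsub>PS xs\<^esub> x \<in> carrier (PS xs)" using left_module.smult_closed[OF P.lm a x] .
  have "phom xs b (a \<odot>\<^bsub>PS xs\<^esub> x) = (\<Oplus>j\<in>{..<length xs}. (a \<odot>\<^bsub>PS xs\<^esub> x) j \<odot> b j)"
   using ax by (simp add: phom_def)
  also have "... = (\<Oplus>j\<in>{..<length xs}. a \<odot> (x j \<odot> b j))"
   by (rule ag.finsum_cong'[OF refl])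
    (auto simp: psum_smult[OF xs] lmr(3)[OF a] psum_A[OF xs x] bc intro!: cl x lmr(1)[OF a])
  also have "... = a \<odot> phom xs b x"
   using x cl by (simp add: phom_def left_module_finsum_r[OF lm a] Pi_def)
  finally show "phom xs b (a \<odot>\<^bsub>PS xs\<^esub> x) = a \<odot> phom xs b x" .
 next
  fix n y assume "y \<in> phom xs b ` hcomp (PS xs) n"
  then obtain z where z: "z \<in> hcomp (PS xs) n" "y = phom xs b z" by blast
  have "z j \<odot> b j \<in> hcomp M n" if j: "j < length xs" for j
  proof -
   obtain f where f: "z j = cls f" "f \<in> SQ (fst (xs ! j))" "!!p. p \<in> keys f ==> int (length (snd p)) = n - snd (xs ! j)"
    using z(1) j unfolding psum_hcomp[OF xs] by blast
   show ?thesis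
   proof (cases "keys f = {}")
    case True
    then have "f = 0" by simp
    then show ?thesis using bc[OF j] ev_zero_left[of "b j"] by (simp add: f(1) ev_def)
   next
    case False
    then obtain p0 where "p0 \<in> keys f" by blast
    then have n: "n - snd (xs ! j) = int (length (snd p0))" using f(3) by simp
    have "f \<in> HQ (length (snd p0))" using SQ_KQ[OF f(2)] f(3) by (auto simp: HQ_def n)
    from ev_hc[OF this b[OF j]] n show ?thesis by (simp add: f(1) ev_def algebra_simps)
   qed
  qed
  then show "y \<in> hcomp M n"
   using P.hc_carrier[OF z(1)] by (auto simp: z(2) phom_def intro!: hc_finsum)
 qed
qed

end

context monomial_quotient
begin

definition theta :: "('v \<times> (nat \<times> 'e => 'k)) list => nat => nat => ('v, 'e, 'k) path_elem" where
 "theta bs j i = (\<Sum>a\<in>arcs Q. single (tail Q a, [a]) (snd (bs ! j) (i, a)))"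

lemma lookup_arcsum:
 "lookup (\<Sum>a\<in>arcs Q. single (tail Q a, [a]) (r a)) (u, p) =
  (case p of [a] => if a \<in> arcs Q & tail Q a = u then r a else 0 | _ => (0::'k))"
proof -
 have "lookup (\<Sum>a\<in>arcs Q. single (tail Q a, [a]) (r a)) (u, p) = (\<Sum>a\<in>arcs Q. if p = [a] & tail Q a = u then r a else 0)"
  unfolding lookup_sum by (intro sum.cong) (auto simp: lookup_single when_def)
 also have "... = (case p of [a] => if a \<in> arcs Q & tail Q a = u then r a else 0 | _ => 0)"
 proof (cases "\<exists>a. p = [a]")
  case True
  then obtain a where p: "p = [a]" by blast
  have "(\<Sum>b\<in>arcs Q. if p = [b] & tail Q b = u then r b else 0) = (\<Sum>b\<in>arcs Q. if b = a then (if tail Q a = u then r a else 0) else 0)"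
   by (intro sum.cong) (auto simp: p)
  then show ?thesis by (simp add: p)
 next
  case False
  then show ?thesis by (auto split: list.splits)
 qed
 finally show ?thesis .
qed

lemma arcsum_SQ:
 assumes "!!a. a \<in> arcs Q ==> r a ~= 0 ==> tail Q a = x"
 shows "(\<Sum>a\<in>arcs Q. single (tail Q a, [a]) (r a)) \<in> SQ x"
proof (rule SQ_sum)
 fix a assume "a \<in> arcs Q"
 then show "single (tail Q a, [a]) (r a) \<in> SQ x"
  using assms[of a] by (auto simp: SQ_def GQ_def good_def)
qed

lemma arcsum_KQ: "(\<Sum>a\<in>arcs Q. single (tail Q a, [a]) (r a)) \<in> KQ"
 by (intro KQ_sum KQ_single) simp

lemma keys_arcsum: "p \<in> keys (\<Sum>a\<in>arcs Q. single (tail Q a, [a]) (r a :: 'k)) ==> length (snd p) = 1"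
 by (cases p) (auto simp: in_keys_iff lookup_arcsum split: list.splits)

lemma lookup_times_arc:
 "lookup (path_times Q w (single (tail Q a, [a]) c)) (u, r) =
  (case r of [] => 0 | b # p => if b = a & u = tail Q a then lookup w (head Q a, p) * c else 0)"
proof (induction w rule: additive_ext)
 case (3 q d)
 show ?case
  by (cases q) (auto simp: path_times_single path_end_simp lookup_single when_def split: list.splits)
qed (auto simp: path_times_add_left lookup_add distrib_right split: list.splits)

lemma lookup_times_theta:
 "lookup (path_times Q w (theta bs j i)) (u, r) =
  (case r of [] => 0 | a # p => if a \<in> arcs Q & u = tail Q a then lookup w (head Q a, p) * snd (bs ! j) (i, a) else 0)"
proof -
 have "lookup (path_times Q w (theta bs j i)) (u, r) =
  (\<Sum>a\<in>arcs Q. case r of [] => 0 | b # p => if b = a & u = tail Q a then lookup w (head Q a, p) * snd (bs ! j) (i, a) else 0)"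
  unfolding theta_def path_times_sum_right lookup_sum by (simp add: lookup_times_arc)
 also have "... = (case r of [] => 0 | a # p => if a \<in> arcs Q & u = tail Q a then lookup w (head Q a, p) * snd (bs ! j) (i, a) else 0)"
 proof (cases r)
  case (Cons b p)
  have "(\<Sum>a\<in>arcs Q. if b = a & u = tail Q a then lookup w (head Q a, p) * snd (bs ! j) (i, a) else 0) =
   (\<Sum>a\<in>arcs Q. if b = a then (if u = tail Q b then lookup w (head Q b, p) * snd (bs ! j) (i, b) else 0) else 0)"
   by (intro sum.cong) auto
  then show ?thesis by (simp add: Cons)
 qed simp
 finally show ?thesis .
qed

text \<open>
 The matrix of a list \<open>bs\<close> of vectors defines a map between sums of projectives: the generator with
 number \<open>j\<close> goes to \<open>\<Sum> bs\<^sub>j(i, a) a e\<^sub>i\<close>.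
\<close>
definition dmap :: "nat => 'v list => ('v \<times> (nat \<times> 'e => 'k)) list =>
  (nat => ('v, 'e, 'k) bq_elem) => nat => ('v, 'e, 'k) bq_elem" where
 "dmap n xs bs = graded_pre.phom Q J (PS (lin xs n)) (lin (map fst bs) (Suc n))
   (%j. \<lambda>i\<in>{..<length xs}. cls (theta bs j i))"

context
 fixes xs :: "'v list" and R :: "(nat \<times> 'e => 'k) set" and bs :: "('v \<times> (nat \<times> 'e => 'k)) list"
 assumes vs: "set xs <= verts Q" and st: "L.starts_at xs R" and sb: "L.step_basis R bs"
begin

lemma bs_st: "j < length bs ==> snd (bs ! j) (i, a) ~= 0 ==> i < length xs & a \<in> arcs Q & tail Q a = xs ! i"
 using L.step_basis_mem[OF sb, of j] st unfolding L.starts_at_def by blast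

lemma bs_verts: "set (map fst bs) <= verts Q"
proof
 fix v assume "v \<in> set (map fst bs)"
 then obtain j where j: "j < length bs" "v = fst (bs ! j)" by (auto simp: in_set_conv_nth)
 from L.step_basis_nz[OF sb j(1)] obtain i a where nz: "snd (bs ! j) (i, a) ~= 0" by blast
 have "a \<in> arcs Q" using bs_st[OF j(1) nz] by simp
 moreover have "head Q a = v" using L.step_basis_tgt[OF sb j(1) nz] j by simp
 ultimately show "v \<in> verts Q" by auto
qed

lemma theta_SQ: "j < length bs ==> theta bs j i \<in> SQ (xs ! i)"
 unfolding theta_def by (rule arcsum_SQ) (use bs_st in blast)

lemma theta_KQ: "theta bs j i \<in> KQ" unfolding theta_def by (rule arcsum_KQ)

lemma dmap_hom: "dmap n xs bs \<in> gr_hom Q J (PS (lin (map fst bs) (Suc n))) (PS (lin xs n))"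
 unfolding dmap_def
proof (rule graded_pre.phom_hom[OF graded_preI[OF psum_pre[OF lin_verts[OF vs]]] lin_verts[OF bs_verts]])
 fix j assume "j < length (lin (map fst bs) (Suc n))"
 then have j: "j < length bs" by simp
 have "cls (theta bs j i) \<in> cls ` {f \<in> SQ (xs ! i). \<forall>p\<in>keys f. int (length (snd p)) = int (Suc n) - int n}" for i
  using theta_SQ[OF j, of i] keys_arcsum unfolding theta_def by fastforce
 then show "(\<lambda>i\<in>{..<length xs}. cls (theta bs j i)) \<in> hcomp (PS (lin xs n)) (snd (lin (map fst bs) (Suc n) ! j))"
  unfolding psum_hcomp[OF lin_verts[OF vs]] using j by simp
qed

lemma dmap_nth:
 assumes z: "z \<in> carrier (PS (lin (map fst bs) (Suc n)))" and i: "i < length xs"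
 shows "dmap n xs bs z i = cls (\<Sum>j<length bs. path_times Q (cf (z j)) (theta bs j i))"
proof -
 interpret P: graded_pre Q J F "PS (lin xs n)" by (rule graded_preI[OF psum_pre[OF lin_verts[OF vs]]])
 let ?b = "%j. \<lambda>i\<in>{..<length xs}. cls (theta bs j i)"
 have zc: "cf (z j) \<in> KQ" "z j = cls (cf (z j))" if "j < length bs" for j
  using psum_cf[OF lin_verts[OF bs_verts] z, of j] that SQ_KQ by auto
 have bC: "?b j \<in> carrier (PS (lin xs n))" if "j < length bs" for j
  unfolding psum_carrier[OF lin_verts[OF vs]] using theta_SQ[OF that] by simp
 have "dmap n xs bs z = (\<Oplus>\<^bsub>PS (lin xs n)\<^esub>j\<in>{..<length bs}. z j \<odot>\<^bsub>PS (lin xs n)\<^esub> ?b j)"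
  using z by (simp add: dmap_def P.phom_def)
 also have "... = (\<lambda>i\<in>{..<length (lin xs n)}. finsum (gr_proj Q J (xs ! i)) (%j. (z j \<odot>\<^bsub>PS (lin xs n)\<^esub> ?b j) i) {..<length bs})"
 proof -
  have c: "(%j. z j \<odot>\<^bsub>PS (lin xs n)\<^esub> ?b j) \<in> {..<length bs} \<rightarrow> carrier (PS (lin xs n))"
   using left_module.smult_closed[OF P.lm] bC zc cls_closed by (metis (no_types, lifting) Pi_I lessThan_iff)
  let ?Ms = "map (%(x, i). gr_shift i (gr_proj Q J x)) (lin xs n)"
  have am: "add_monoid (gr_shift k N) = add_monoid N" for k and N :: "(('v, 'e, 'k) bq_elem, ('v, 'e, 'k) bq_elem) graded_module"
   by (simp add: gr_shift_def)
  have "finsum (gr_dsum ?Ms) (%j. z j \<odot>\<^bsub>PS (lin xs n)\<^esub> ?b j) {..<length bs} =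
   (\<lambda>i\<in>{..<length ?Ms}. finsum (?Ms ! i) (%j. (z j \<odot>\<^bsub>PS (lin xs n)\<^esub> ?b j) i) {..<length bs})"
   by (rule dsum_finsum') (use psum_pre'[OF lin_verts[OF vs]] c in "auto simp: proj_sum_def")
  also have "... = (\<lambda>i\<in>{..<length (lin xs n)}. finsum (gr_proj Q J (xs ! i)) (%j. (z j \<odot>\<^bsub>PS (lin xs n)\<^esub> ?b j) i) {..<length bs})"
   by (auto simp: fun_eq_iff finsum_def am)
  finally show ?thesis unfolding proj_sum_def .
 qed
 finally have "dmap n xs bs z i = finsum (gr_proj Q J (xs ! i)) (%j. (z j \<odot>\<^bsub>PS (lin xs n)\<^esub> ?b j) i) {..<length bs}"
  using i by simp
 also have "... = finsum (gr_proj Q J (xs ! i)) (%j. graded_pre.ev Q J (gr_proj Q J (xs ! i)) (cf (z j)) (cls (theta bs j i))) {..<length bs}"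
 proof -
  have x: "xs ! i \<in> verts Q" using vs i nth_mem by blast
  interpret X: graded_pre Q J F "gr_proj Q J (xs ! i)" by (rule graded_preI[OF proj_pre[OF x]])
  show ?thesis
  proof (rule X.ag.finsum_cong'[OF refl])
   show "(%j. X.ev (cf (z j)) (cls (theta bs j i))) \<in> {..<length bs} \<rightarrow> carrier (gr_proj Q J (xs ! i))"
    by (intro Pi_I X.ev_closed) (use zc theta_SQ in "auto simp: proj_carrier[OF x]")
   fix j assume "j \<in> {..<length bs}"
   then show "(z j \<odot>\<^bsub>PS (lin xs n)\<^esub> ?b j) i = X.ev (cf (z j)) (cls (theta bs j i))"
    using zc(2)[of j] i by (simp add: psum_smult[OF lin_verts[OF vs]] proj_ev[OF x])
  qed
 qed
 also have "... = cls (\<Sum>j<length bs. path_times Q (cf (z j)) (theta bs j i))"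
  by (rule proj_ev_sum) (use vs i zc theta_SQ in auto)
 finally show ?thesis .
qed

lemma dmap_coef:
 assumes z: "z \<in> carrier (PS (lin (map fst bs) (Suc n)))" and i: "i < length xs" and p: "(u, r) \<in> good"
 shows "lookup (cf (dmap n xs bs z i)) (u, r) =
  (case r of [] => 0 | a # p => \<Sum>j<length bs. lookup (cf (z j)) (head Q a, p) * snd (bs ! j) (i, a))"
proof -
 have zc: "cf (z j) \<in> KQ" if "j < length bs" for j
  using psum_cf[OF lin_verts[OF bs_verts] z, of j] that SQ_KQ by auto
 have "(\<Sum>j<length bs. path_times Q (cf (z j)) (theta bs j i)) \<in> KQ"
  by (intro KQ_sum KQ_times theta_KQ zc) simp
 then have "lookup (cf (dmap n xs bs z i)) (u, r) = (\<Sum>j<length bs. lookup (path_times Q (cf (z j)) (theta bs j i)) (u, r))"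
  using p by (simp add: dmap_nth[OF z i] cf_KQ lookup_red lookup_sum)
 then show ?thesis using p by (cases r) (simp_all add: lookup_times_theta good_Cons)
qed

end

text \<open>
 The coefficients of an element of the kernel are sorted by the path that follows the first arrow; each of
 these groups is a relation with a single arrow, so \<^term>\<open>L.syzygies bs\<close> generates the kernel.
\<close>
lemma dmap_exact:
 assumes vs: "set xs <= verts Q" and st: "L.starts_at xs R" and sb: "L.step_basis R bs"
  and sc: "L.step_basis (L.syzygies bs) cs"
 shows "gr_im (PS (lin (map fst cs) (Suc (Suc n)))) (dmap (Suc n) (map fst bs) cs) =
  gr_ker (PS (lin (map fst bs) (Suc n))) (PS (lin xs n)) (dmap n xs bs)"
proof -
 let ?ys = "map fst bs" and ?zs = "map fst cs"
 note vb = bs_verts[OF vs st sb]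
 note sts = L.starts_at_syzygies[of bs]
 note vc = bs_verts[OF vb sts sc]
 note d1 = dmap_hom[OF vs st sb, of n] and d2 = dmap_hom[OF vb sts sc, of "Suc n"]
 let ?P2 = "PS (lin ?zs (Suc (Suc n)))" and ?P1 = "PS (lin ?ys (Suc n))" and ?P0 = "PS (lin xs n)"
 interpret H1: graded_hom Q J F ?P1 ?P0 "dmap n xs bs"
  by (intro graded_homI graded_preI psum_pre lin_verts vb vs d1)
 interpret H2: graded_hom Q J F ?P2 ?P1 "dmap (Suc n) ?ys cs"
  by (intro graded_homI graded_preI psum_pre lin_verts vb vc d2)
 have cs_syz: "snd (cs ! l) \<in> L.syzygies bs" if "l < length cs" for l by (rule L.step_basis_mem[OF sc that])
 have zeroP0: "lookup (cf (\<zero>\<^bsub>?P0\<^esub> i)) p = 0" if "i < length xs" for i p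
  using that by (simp add: psum_zero[OF lin_verts[OF vs]] cls_zero[symmetric] cf_GQ GQ_def)
 show ?thesis
 proof (intro equalityI subsetI)
  fix y assume "y \<in> gr_im ?P2 (dmap (Suc n) ?ys cs)"
  then obtain z where z: "z \<in> carrier ?P2" "y = dmap (Suc n) ?ys cs z" by (auto simp: gr_im_def)
  have yC: "y \<in> carrier ?P1" using z by simp
  have "dmap n xs bs y = \<zero>\<^bsub>?P0\<^esub>"
  proof (rule psum_ext[OF lin_verts[OF vs]])
   fix i p assume i: "i < length (lin xs n)" and p: "p \<in> good"
   then have i': "i < length xs" by simp
   obtain u r where pu: "p = (u, r)" by (cases p)
   have "lookup (cf (dmap n xs bs y i)) (u, r) = 0"
   proof (cases r)
    case Nil
    then show ?thesis using dmap_coef[OF vs st sb yC i' p[unfolded pu]] by simp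
   next
    case (Cons a q)
    have g: "(u, a # q) \<in> good" using p by (simp add: pu Cons)
    then have gq: "(head Q a, q) \<in> good" by (rule good_tl)
    have "(\<Sum>j<length bs. lookup (cf (y j)) (head Q a, q) * snd (bs ! j) (i, a)) = 0"
    proof (cases q)
     case Nil
     then show ?thesis using dmap_coef[OF vb sts sc z(1) _ gq] by (simp add: z(2))
    next
     case q: (Cons b s)
     have ab: "a \<in> arcs Q" "b \<in> arcs Q" "head Q a = tail Q b" "(a, b) ~: F"
      using g by (auto simp: q good_Cons)
     have "(\<Sum>j<length bs. lookup (cf (y j)) (head Q a, q) * snd (bs ! j) (i, a)) =
      (\<Sum>j<length bs. \<Sum>l<length cs. lookup (cf (z l)) (head Q b, s) * (snd (bs ! j) (i, a) * snd (cs ! l) (j, b)))"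
     proof (rule sum.cong[OF refl])
      fix j assume "j \<in> {..<length bs}"
      then have e: "lookup (cf (y j)) (head Q a, q) = (\<Sum>l<length cs. lookup (cf (z l)) (head Q b, s) * snd (cs ! l) (j, b))"
       using dmap_coef[OF vb sts sc z(1) _ gq, of j] by (simp add: z(2) q)
      show "lookup (cf (y j)) (head Q a, q) * snd (bs ! j) (i, a) =
        (\<Sum>l<length cs. lookup (cf (z l)) (head Q b, s) * (snd (bs ! j) (i, a) * snd (cs ! l) (j, b)))"
       unfolding e sum_distrib_right by (intro sum.cong refl) (simp only: mult_ac)
     qed
     also have "... = (\<Sum>l<length cs. lookup (cf (z l)) (head Q b, s) * (\<Sum>j<length bs. snd (bs ! j) (i, a) * snd (cs ! l) (j, b)))"
      by (subst sum.swap) (simp only: sum_distrib_left)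
     also have "... = 0"
     proof (intro sum.neutral ballI)
      fix l assume "l \<in> {..<length cs}"
      then have "(\<Sum>j<length bs. snd (bs ! j) (i, a) * snd (cs ! l) (j, b)) = 0"
       using cs_syz[of l] ab by (simp add: L.syzygies_def)
      then show "lookup (cf (z l)) (head Q b, s) * (\<Sum>j<length bs. snd (bs ! j) (i, a) * snd (cs ! l) (j, b)) = 0" by simp
     qed
     finally show ?thesis .
    qed
    then show ?thesis using dmap_coef[OF vs st sb yC i' p[unfolded pu]] by (simp add: Cons)
   qed
   then show "lookup (cf (dmap n xs bs y i)) p = lookup (cf (\<zero>\<^bsub>?P0\<^esub> i)) p" using zeroP0[OF i'] by (simp add: pu)
  qed (use yC in auto)
  then show "y \<in> gr_ker ?P1 ?P0 (dmap n xs bs)" using yC by (simp add: gr_ker_def)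
 next
  fix w assume "w \<in> gr_ker ?P1 ?P0 (dmap n xs bs)"
  then have w: "w \<in> carrier ?P1" and dw: "dmap n xs bs w = \<zero>\<^bsub>?P0\<^esub>" by (auto simp: gr_ker_def)
  have wSQ: "cf (w j) \<in> SQ (fst (bs ! j))" if "j < length bs" for j
   using psum_cf(1)[OF lin_verts[OF vb] w, of j] that by simp
  have dz: "(case r of [] => 0 | a # p => \<Sum>j<length bs. lookup (cf (w j)) (head Q a, p) * snd (bs ! j) (i, a)) = 0"
   if "(u, r) \<in> good" "i < length xs" for u r i
   using dmap_coef[OF vs st sb w that(2,1)] zeroP0[OF that(2)] by (simp add: dw)
  have dz': "(\<Sum>j<length bs. lookup (cf (w j)) (head Q a, p) * snd (bs ! j) (i, a)) = 0"
   if "(tail Q a, a # p) \<in> good" for a p i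
  proof (cases "i < length xs")
   case True
   then show ?thesis using dz[OF that True] by simp
  next
   case False
   then show ?thesis using bs_st[OF vs st sb] by (intro sum.neutral) auto
  qed
  \<comment> \<open>the trivial paths do not occur, as the vectors are linearly independent\<close>
  have nil: "lookup (cf (w j)) (v, []) = 0" if j: "j < length bs" for j v
  proof -
   have "(\<Sum>j<length bs. lookup (cf (w j)) (fst (bs ! j), []) * snd (bs ! j) (i, a)) = 0" for i a
   proof (cases "a \<in> arcs Q")
    case True
    then have "(tail Q a, [a]) \<in> good" by (auto simp: good_def)
    from dz'[OF this, of i] show ?thesis
    proof (rule trans[rotated], intro sum.cong refl)
     fix j assume "j \<in> {..<length bs}"
     then show "lookup (cf (w j)) (fst (bs ! j), []) * snd (bs ! j) (i, a) = lookup (cf (w j)) (head Q a, []) * snd (bs ! j) (i, a)"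
      using L.step_basis_tgt[OF sb, of j i a] by (cases "snd (bs ! j) (i, a) = 0") simp_all
    qed
   next
    case False
    then show ?thesis using bs_st[OF vs st sb] by (intro sum.neutral) auto
   qed
   from L.step_basis_indep[OF sb this j] have "lookup (cf (w j)) (fst (bs ! j), []) = 0" .
   moreover have "lookup (cf (w j)) (v, []) = 0" if "v ~= fst (bs ! j)"
    using SQ_lookup[OF wSQ[OF j], of "(v, [])"] that by simp
   ultimately show ?thesis by blast
  qed
  define T where "T b q = (SOME t. \<forall>j a. (\<Sum>l<length cs. snd (cs ! l) (j, a) * t l) =
    (if a = b & j < length bs then lookup (cf (w j)) (tail Q b, b # q) else 0))" for b q
  have T: "(\<Sum>l<length cs. snd (cs ! l) (j, a) * T b q l) =
    (if a = b & j < length bs then lookup (cf (w j)) (tail Q b, b # q) else 0)" if b: "b \<in> arcs Q" for b q j a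
  proof -
   have "\<exists>t. \<forall>j a. (\<Sum>l<length cs. snd (cs ! l) (j, a) * t l) =
    (if a = b & j < length bs then lookup (cf (w j)) (tail Q b, b # q) else 0)"
   proof (rule L.syzygy_combination[OF sc b])
    fix j assume j: "j < length bs" and "lookup (cf (w j)) (tail Q b, b # q) ~= 0"
    then show "fst (bs ! j) = tail Q b" using SQ_lookup[OF wSQ[OF j], of "(tail Q b, b # q)"] by fastforce
   next
    fix i a assume a: "a \<in> arcs Q" "head Q a = tail Q b" "(a, b) ~: F"
    show "(\<Sum>j<length bs. snd (bs ! j) (i, a) * lookup (cf (w j)) (tail Q b, b # q)) = 0"
    proof (cases "(tail Q b, b # q) \<in> good")
     case True
     then have "(tail Q a, a # b # q) \<in> good" using a by (simp add: good_Cons)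
     from dz'[OF this, of i] a show ?thesis by (simp add: mult.commute)
    next
     case False
     have "lookup (cf (w j)) (tail Q b, b # q) = 0" if "j < length bs" for j
      using GQ_lookup[OF SQ_GQ[OF wSQ[OF that]] False] .
     then show ?thesis by (intro sum.neutral) simp
    qed
   qed
   from someI_ex[OF this, folded T_def] show ?thesis by blast
  qed
  define S where "S = (\<Union>j<length bs. (%p. (head Q (hd (snd p)), tl (snd p))) ` keys (cf (w j))) \<inter> good"
  have S: "finite S" by (simp add: S_def)
  define B where "B p = {b \<in> arcs Q. (tail Q b, b # snd p) \<in> good & head Q b = fst p}" for p :: "('v, 'e) path"
  have finB: "finite (B p)" for p by (simp add: B_def)
  define g where "g l = (\<Sum>p\<in>{p \<in> S. fst p = fst (cs ! l)}. single p (\<Sum>b\<in>B p. T b (snd p) l))" for l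
  have lg: "lookup (g l) p = (if p \<in> S & fst p = fst (cs ! l) then \<Sum>b\<in>B p. T b (snd p) l else 0)" for l p
  proof -
   have "lookup (g l) p = (\<Sum>q\<in>{p \<in> S. fst p = fst (cs ! l)}. if q = p then \<Sum>b\<in>B p. T b (snd p) l else 0)"
    unfolding g_def lookup_sum by (intro sum.cong) (auto simp: lookup_single when_def)
   then show ?thesis using S by simp
  qed
  have gSQ: "g l \<in> SQ (fst (cs ! l))" for l
   by (auto simp: SQ_def GQ_def in_keys_iff lg S_def split: if_splits)
  define z where "z = (\<lambda>l\<in>{..<length cs}. cls (g l))"
  have zC: "z \<in> carrier ?P2" unfolding psum_carrier[OF lin_verts[OF vc]] z_def using gSQ by simp
  have cfz: "cf (z l) = g l" if "l < length cs" for l using that by (simp add: z_def cf_GQ[OF SQ_GQ[OF gSQ]])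
  have "dmap (Suc n) ?ys cs z = w"
  proof (rule psum_ext[OF lin_verts[OF vb]])
   fix j p assume "j < length (lin ?ys (Suc n))" and p: "p \<in> good"
   then have j: "j < length bs" "j < length ?ys" by simp_all
   obtain u r where pu: "p = (u, r)" by (cases p)
   have "lookup (cf (dmap (Suc n) ?ys cs z j)) (u, r) = lookup (cf (w j)) (u, r)"
   proof (cases r)
    case Nil
    then show ?thesis using dmap_coef[OF vb sts sc zC j(2) p[unfolded pu]] nil[OF j(1)] by simp
   next
    case (Cons b q)
    have gb: "(tail Q b, b # q) \<in> good" "b \<in> arcs Q" "u = tail Q b" using p by (auto simp: pu Cons good_Cons)
    have "lookup (cf (dmap (Suc n) ?ys cs z j)) (u, r) = (\<Sum>l<length cs. lookup (g l) (head Q b, q) * snd (cs ! l) (j, b))"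
     using dmap_coef[OF vb sts sc zC j(2) p[unfolded pu]] by (simp add: Cons cfz)
    also have "... = lookup (cf (w j)) (u, r)"
    proof (cases "(head Q b, q) \<in> S")
     case False
     have "(tail Q b, b # q) ~: keys (cf (w j))"
     proof
      assume k: "(tail Q b, b # q) \<in> keys (cf (w j))"
      have "(head Q b, q) \<in> (%p. (head Q (hd (snd p)), tl (snd p))) ` keys (cf (w j))"
       by (rule image_eqI[OF _ k]) simp
      then have "(head Q b, q) \<in> S" using j(1) good_tl[OF gb(1)] by (auto simp: S_def)
      with False show False by simp
     qed
     then have "lookup (cf (w j)) (u, r) = 0" by (simp add: gb(3) Cons in_keys_iff)
     with False show ?thesis by (simp add: lg)
    next
     case True
     have "(\<Sum>l<length cs. lookup (g l) (head Q b, q) * snd (cs ! l) (j, b)) =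
       (\<Sum>l<length cs. \<Sum>b'\<in>B (head Q b, q). snd (cs ! l) (j, b) * T b' q l)"
     proof (rule sum.cong[OF refl])
      fix l assume l: "l \<in> {..<length cs}"
      show "lookup (g l) (head Q b, q) * snd (cs ! l) (j, b) = (\<Sum>b'\<in>B (head Q b, q). snd (cs ! l) (j, b) * T b' q l)"
      proof (cases "snd (cs ! l) (j, b) = 0")
       case nz: False
       then have "fst (cs ! l) = head Q b" using L.step_basis_tgt[OF sc, of l j b] l by simp
       then have lgl: "lookup (g l) (head Q b, q) = (\<Sum>b'\<in>B (head Q b, q). T b' q l)"
        using True by (simp add: lg)
       show ?thesis unfolding lgl sum_distrib_right by (simp only: mult.commute)
      qed simp
     qed
     also have "... = (\<Sum>b'\<in>B (head Q b, q). \<Sum>l<length cs. snd (cs ! l) (j, b) * T b' q l)" by (rule sum.swap)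
     also have "... = (\<Sum>b'\<in>B (head Q b, q). if b = b' then lookup (cf (w j)) (tail Q b, b # q) else 0)"
      using j(1) by (intro sum.cong refl) (auto simp: T B_def)
     also have "... = lookup (cf (w j)) (tail Q b, b # q)"
      using finB gb by (simp add: B_def)
     finally show ?thesis by (simp add: gb(3) Cons)
    qed
    finally show ?thesis .
   qed
   then show "lookup (cf (dmap (Suc n) ?ys cs z j)) p = lookup (cf (w j)) p" by (simp add: pu)
  qed (use zC w in auto)
  then show "w \<in> gr_im ?P2 (dmap (Suc n) ?ys cs)" using zC by (auto simp: gr_im_def)
 qed
qed

end

section \<open>Modules with quadratic presentation are Koszul\<close>

context graded_mod
begin

text \<open>
 A spanning set of the component, multiplied by the idempotents, contains a basis of elements each of
 which sits at one vertex.
\<close>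
lemma homogeneous_basis:
 "\<exists>bs. (\<forall>(v, b)\<in>set bs. v \<in> verts Q & b \<in> hcomp M n & ev (vtx v) b = b) &
   (\<forall>t. (\<Oplus>j\<in>{..<length bs}. ev (single (fst (bs ! j), []) (t j)) (snd (bs ! j))) = \<zero> --> (\<forall>j<length bs. t j = 0)) &
   (\<forall>x\<in>hcomp M n. \<exists>t. x = (\<Oplus>j\<in>{..<length bs}. ev (single (fst (bs ! j), []) (t j)) (snd (bs ! j))))"
proof -
 from hc_fin_dim[of n] obtain B where B: "finite B" "B <= hcomp M n"
  "\<forall>x\<in>hcomp M n. \<exists>c. x = (\<Oplus>b\<in>B. bq_scalar Q J (c b) \<odot> b)" unfolding fin_dim_def by blast
 have BM: "b \<in> carrier M" if "b \<in> B" for b using that B(2) hc_carrier by blast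
 define T where "T = verts Q \<times> B"
 have T: "finite T" using B(1) by (simp add: T_def)
 define el where "el t s = ev (single (fst s, []) (t s)) (snd s)" for t :: "'v \<times> 'm => 'k" and s
 have elM: "el t s \<in> carrier M" if "s \<in> T" for t s using that BM by (auto simp: T_def el_def)
 define comb where "comb S t = (\<Oplus>s\<in>S. el t s)" for S t
 have combM: "comb S t \<in> carrier M" if "S <= T" for S t unfolding comb_def using that elM by (auto intro!: ag.finsum_closed)
 have comb_add: "comb S (%s. t s + t' s) = comb S t \<oplus> comb S t'" if S: "S <= T" for S t t'
 proof -
  have "el (%s. t s + t' s) s = el t s \<oplus> el t' s" if "s \<in> S" for s
  proof -
   have "fst s \<in> verts Q" "snd s \<in> carrier M" using that S BM by (auto simp: T_def)
   then show ?thesis by (simp add: el_def single_add ev_add_left)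
  qed
  then have "comb S (%s. t s + t' s) = (\<Oplus>s\<in>S. el t s \<oplus> el t' s)"
   unfolding comb_def using S elM by (intro ag.finsum_cong') auto
  also have "... = comb S t \<oplus> comb S t'" unfolding comb_def using S elM by (intro ag.finsum_addf) auto
  finally show ?thesis .
 qed
 have comb_scale: "ev (path_scalar Q c) (comb S t) = comb S (%s. c * t s)" if S: "S <= T" for S t c
 proof -
  have "ev (path_scalar Q c) (el t s) = el (%s. c * t s) s" if "s \<in> S" for s
  proof -
   have s: "fst s \<in> verts Q" "snd s \<in> carrier M" using that S BM by (auto simp: T_def)
   have "path_times Q (path_scalar Q c) (single (fst s, []) (t s)) = single (fst s, [] :: 'e list) (c * t s)"
    using path_scalar_times(1)[of "single (fst s, []) (t s)" c] s by auto
   then show ?thesis using s by (simp add: el_def ev_times[symmetric])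
  qed
  then have "(\<Oplus>s\<in>S. ev (path_scalar Q c) (el t s)) = comb S (%s. c * t s)"
   unfolding comb_def using S elM by (intro ag.finsum_cong') auto
  then show ?thesis unfolding comb_def using S elM by (subst ev_finsum_right) auto
 qed
 define spans where "spans S \<longleftrightarrow> S <= T & (\<forall>x\<in>hcomp M n. \<exists>t. x = comb S t)" for S
 have "spans T"
  unfolding spans_def
 proof (intro conjI ballI subset_refl)
  have single_b: "\<exists>t. ev (path_scalar Q c) b = comb T t" if b: "b \<in> B" for c b
  proof -
   have "ev (path_scalar Q c) b = (\<Oplus>v\<in>verts Q. ev (single (v, []) c) b)"
    unfolding path_scalar_def using BM[OF b] by (intro ev_sum_left) auto
   also have "... = (\<Oplus>s\<in>(%v. (v, b)) ` verts Q. el (%s. if snd s = b then c else 0) s)"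
    using BM[OF b] by (subst ag.finsum_reindex) (auto simp: el_def inj_on_def)
   also have "... = comb T (%s. if snd s = b then c else 0)"
    unfolding comb_def
   proof (rule ag.add.finprod_mono_neutral_cong_left)
    show "(%v. (v, b)) ` verts Q <= T" using b by (auto simp: T_def)
    fix s assume "s \<in> T - (%v. (v, b)) ` verts Q"
    then have "snd s ~= b" "snd s \<in> carrier M" using BM by (auto simp: T_def image_iff)
    then show "el (%s. if snd s = b then c else 0) s = \<zero>" by (simp add: el_def)
   qed (use T elM in auto)
   finally show ?thesis by blast
  qed
  fix x assume "x \<in> hcomp M n"
  then obtain c where x: "x = (\<Oplus>b\<in>B. bq_scalar Q J (c b) \<odot> b)" using B(3) by blast
  have "\<exists>t. (\<Oplus>b\<in>B'. bq_scalar Q J (c b) \<odot> b) = comb T t" if "finite B'" "B' <= B" for B'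
   using that
  proof (induction B' rule: finite_induct)
   case empty
   have "comb T (%_. 0) = \<zero>"
    unfolding comb_def using BM by (intro ag.add.finprod_one_eqI) (auto simp: el_def T_def)
   then show ?case by (intro exI[of _ "%_. 0"]) simp
  next
   case (insert b B')
   then obtain t where t: "(\<Oplus>b\<in>B'. bq_scalar Q J (c b) \<odot> b) = comb T t" by auto
   have b: "b \<in> B" using insert.prems by simp
   obtain t' where t': "ev (path_scalar Q (c b)) b = comb T t'" using single_b[OF b] by blast
   have cM: "bq_scalar Q J (c b) \<odot> b \<in> carrier M" if "b \<in> B" for b
    using left_module.smult_closed[OF lm scalar_closed BM[OF that]] .
   have "(\<Oplus>b\<in>insert b B'. bq_scalar Q J (c b) \<odot> b) = bq_scalar Q J (c b) \<odot> b \<oplus> comb T t"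
    unfolding t[symmetric] using insert cM by (intro ag.finsum_insert) auto
   also have "... = comb T (%s. t' s + t s)"
    using t' by (simp add: comb_add ev_def bq_scalar_def)
   finally show ?case by blast
  qed
  from this[OF B(1) subset_refl] show "\<exists>t. x = comb T t" unfolding x .
 qed
 then obtain S where S: "spans S" and min: "!!S'. spans S' ==> card S \<le> card S'"
  using ex_has_least_nat[of spans T card] by blast
 then have ST: "S <= T" and Ssp: "!!x. x \<in> hcomp M n ==> \<exists>t. x = comb S t" by (auto simp: spans_def)
 have finS: "finite S" using ST T by (rule finite_subset)
 have ind: "t s = 0" if z: "comb S t = \<zero>" and s: "s \<in> S" for t s
 proof (rule ccontr)
  assume nz: "t s ~= 0"
  have "spans (S - {s})"
   unfolding spans_def
  proof (intro conjI ballI)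
   fix x assume "x \<in> hcomp M n"
   then obtain c where c: "x = comb S c" using Ssp by blast
   define r where "r = c s / t s"
   define d where "d u = c u - r * t u" for u
   have "comb S c = comb S (%u. d u + r * t u)" by (simp add: d_def)
   also have "... = comb S d \<oplus> ev (path_scalar Q r) (comb S t)" by (simp add: comb_add[OF ST] comb_scale[OF ST])
   also have "... = comb S d" using combM[OF ST] by (simp add: z)
   also have "... = comb (S - {s}) d"
    unfolding comb_def
   proof (rule ag.add.finprod_mono_neutral_cong_right)
    fix u assume "u \<in> S - (S - {s})"
    then have "u = s" by blast
    moreover have "d s = 0" using nz by (simp add: d_def r_def)
    moreover have "snd s \<in> carrier M" using s ST BM by (auto simp: T_def)
    ultimately show "el d u = \<zero>" by (simp add: el_def)
   qed (use finS ST elM in auto)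
   finally show "\<exists>t. x = comb (S - {s}) t" using c by blast
  qed (use ST in auto)
  from min[OF this] finS s show False by (metis card_Diff1_less not_le)
 qed
 obtain l where l: "set l = S" "distinct l" using finite_distinct_list[OF finS] by blast
 have inj: "inj_on ((!) l) {..<length l}" using l(2) by (auto simp: inj_on_def nth_eq_iff_index_eq)
 have im: "(!) l ` {..<length l} = S" using l(1) by (auto simp: set_conv_nth)
 define bs where "bs = map (%s. (fst s, ev (vtx (fst s)) (snd s))) l"
 have trm: "ev (single (fst (bs ! j), []) (t j)) (snd (bs ! j)) = ev (single (fst (l ! j), []) (t j)) (snd (l ! j))"
  if "j < length l" for t :: "nat => 'k" and j
 proof -
  have "l ! j \<in> T" using that l(1) ST nth_mem by blast
  then have s: "fst (l ! j) \<in> verts Q" "snd (l ! j) \<in> carrier M" using BM by (auto simp: T_def)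
  have "path_times Q (single (fst (l ! j), []) (t j)) (vtx (fst (l ! j))) = single (fst (l ! j), []) (t j)"
   by (simp add: vtx_def path_times_single path_end_simp)
  then show ?thesis using that s by (simp add: bs_def ev_times[symmetric])
 qed
 have comb_list: "(\<Oplus>j\<in>{..<length bs}. ev (single (fst (bs ! j), []) (t j)) (snd (bs ! j))) =
   comb S (%s. t (inv_into {..<length l} ((!) l) s))" for t
 proof -
  have "comb S (%s. t (inv_into {..<length l} ((!) l) s)) =
   (\<Oplus>j\<in>{..<length l}. el (%s. t (inv_into {..<length l} ((!) l) s)) (l ! j))"
   unfolding comb_def im[symmetric] using elM ST l(1) im by (intro ag.finsum_reindex[OF _ inj] Pi_I) blast
  also have "... = (\<Oplus>j\<in>{..<length bs}. ev (single (fst (bs ! j), []) (t j)) (snd (bs ! j)))"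
  proof (rule ag.finsum_cong')
   show "{..<length l} = {..<length bs}" by (simp add: bs_def)
   fix j assume "j \<in> {..<length bs}"
   then have j: "j < length l" by (simp add: bs_def)
   then show "el (%s. t (inv_into {..<length l} ((!) l) s)) (l ! j) = ev (single (fst (bs ! j), []) (t j)) (snd (bs ! j))"
    using inv_into_f_f[OF inj, of j] by (simp add: el_def trm[OF j])
  next
   show "(%j. ev (single (fst (bs ! j), []) (t j)) (snd (bs ! j))) \<in> {..<length bs} \<rightarrow> carrier M"
   proof (rule Pi_I)
    fix j assume "j \<in> {..<length bs}"
    then have j: "j < length l" by (simp add: bs_def)
    have "l ! j \<in> T" using j l(1) ST nth_mem by blast
    then show "ev (single (fst (bs ! j), []) (t j)) (snd (bs ! j)) \<in> carrier M"
     unfolding trm[OF j] using BM by (auto simp: T_def)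
   qed
  qed
  finally show ?thesis by simp
 qed
 show ?thesis
 proof (intro exI[of _ bs] conjI ballI allI impI)
  fix p assume "p \<in> set bs"
  then obtain s where s: "s \<in> S" "p = (fst s, ev (vtx (fst s)) (snd s))" using l(1) by (auto simp: bs_def)
  then have "s \<in> T" using ST by blast
  then have v: "fst s \<in> verts Q" "snd s \<in> hcomp M n" using B(2) by (auto simp: T_def)
  then show "case p of (v, b) => v \<in> verts Q & b \<in> hcomp M n & ev (vtx v) b = b"
   using hc_carrier[OF v(2)] by (simp add: s(2) vtx_hc ev_times[symmetric] vtx_times_vtx)
 next
  fix t j assume z: "(\<Oplus>j\<in>{..<length bs}. ev (single (fst (bs ! j), []) (t j)) (snd (bs ! j))) = \<zero>"
   and "j < length bs"
  then have j: "j < length l" by (simp add: bs_def)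
  have "t (inv_into {..<length l} ((!) l) (l ! j)) = 0"
   using ind[of "%s. t (inv_into {..<length l} ((!) l) s)" "l ! j"] z nth_mem[OF j] l(1) unfolding comb_list by simp
  then show "t j = 0" using inv_into_f_f[OF inj, of j] j by simp
 next
  fix x assume "x \<in> hcomp M n"
  then obtain t where t: "x = comb S t" using Ssp by blast
  have "comb S t = comb S (%s. (%j. t (l ! j)) (inv_into {..<length l} ((!) l) s))"
   unfolding comb_def
  proof (rule ag.finsum_cong'[OF refl])
   fix s assume "s \<in> S"
   then have "l ! inv_into {..<length l} ((!) l) s = s" using f_inv_into_f[of s "(!) l" "{..<length l}"] im by simp
   then show "el t s = el (%s. (%j. t (l ! j)) (inv_into {..<length l} ((!) l) s)) s" by (simp add: el_def)
  qed (use elM ST in auto)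
  then show "\<exists>t. x = (\<Oplus>j\<in>{..<length bs}. ev (single (fst (bs ! j), []) (t j)) (snd (bs ! j)))"
   using t comb_list[of "%j. t (l ! j)"] by (intro exI[of _ "%j. t (l ! j)"]) simp
 qed
qed

end

lemma (in graded_pre) gen_atD:
 assumes "gen_at m" "x \<in> hcomp M (m + 1)"
 shows "\<exists>u. (\<forall>a\<in>arcs Q. u a \<in> hcomp M m & ev (vtx (tail Q a)) (u a) = u a) &
  x = (\<Oplus>a\<in>arcs Q. ev (arr a) (u a))"
proof (rule gen_at_tail[OF assms])
 fix u assume "!!a. a \<in> arcs Q ==> u a \<in> hcomp M m" "!!a. a \<in> arcs Q ==> ev (vtx (tail Q a)) (u a) = u a"
  "x = (\<Oplus>a\<in>arcs Q. ev (arr a) (u a))"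
 then show ?thesis by (intro exI[of _ u] conjI ballI)
qed

lemma (in graded_hom) surj_from_homogeneous:
 assumes "!!m y. y \<in> hcomp N m ==> \<exists>x\<in>carrier M. f x = y"
 shows "gr_im M f = carrier N"
proof (intro equalityI subsetI)
 fix y assume y: "y \<in> carrier N"
 have "\<forall>m. \<exists>x. x \<in> carrier M & f x = cod.hp y m" using assms cod.hp_hc[OF y] by blast
 from choice[OF this] obtain x where "\<forall>m. x m \<in> carrier M & f (x m) = cod.hp y m" ..
 then have x: "x m \<in> carrier M" "f (x m) = cod.hp y m" for m by blast+
 let ?S = "{n. cod.hp y n ~= \<zero>\<^bsub>N\<^esub>}"
 have "f (\<Oplus>\<^bsub>M\<^esub>m\<in>?S. x m) = (\<Oplus>\<^bsub>N\<^esub>m\<in>?S. f (x m))" using x by (intro f_finsum) auto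
 also have "... = y" unfolding x using cod.hp_sum0[OF y] by simp
 finally show "y \<in> gr_im M f" using x unfolding gr_im_def by (auto intro!: image_eqI[OF sym] dom.ag.finsum_closed)
qed (auto simp: gr_im_def)

lemma exact_from_homogeneous:
 assumes "graded_hom Q J F P M e" "graded_hom Q J F P1 P d"
  and comp: "!!y. y \<in> carrier P1 ==> e (d y) = \<zero>\<^bsub>M\<^esub>"
  and lift: "!!m x. x \<in> hcomp P m ==> e x = \<zero>\<^bsub>M\<^esub> ==> \<exists>y\<in>carrier P1. d y = x"
 shows "gr_im P1 d = gr_ker P M e"
proof -
 interpret e: graded_hom Q J F P M e by fact
 interpret d: graded_hom Q J F P1 P d by fact
 show ?thesis
 proof (intro equalityI subsetI)
  fix x assume "x \<in> gr_ker P M e"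
  then have x: "x \<in> carrier P" "e x = \<zero>\<^bsub>M\<^esub>" by (auto simp: gr_ker_def)
  have "e (e.dom.hp x m) = \<zero>\<^bsub>M\<^esub>" for m using e.f_hp[OF x(1), of m] x(2) by simp
  then have "\<forall>m. \<exists>y. y \<in> carrier P1 & d y = e.dom.hp x m" using lift e.dom.hp_hc[OF x(1)] by blast
  from choice[OF this] obtain y where "\<forall>m. y m \<in> carrier P1 & d (y m) = e.dom.hp x m" ..
  then have y: "y m \<in> carrier P1" "d (y m) = e.dom.hp x m" for m by blast+
  let ?S = "{n. e.dom.hp x n ~= \<zero>\<^bsub>P\<^esub>}"
  have "d (\<Oplus>\<^bsub>P1\<^esub>m\<in>?S. y m) = (\<Oplus>\<^bsub>P\<^esub>m\<in>?S. d (y m))" using y by (intro d.f_finsum) auto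
  also have "... = x" unfolding y using e.dom.hp_sum0[OF x(1)] by simp
  finally show "x \<in> gr_im P1 d" using y unfolding gr_im_def by (auto intro!: image_eqI[OF sym] d.dom.ag.finsum_closed)
 next
  fix x assume "x \<in> gr_im P1 d"
  then show "x \<in> gr_ker P M e" using comp by (auto simp: gr_im_def gr_ker_def)
 qed
qed

text \<open>
 The kernel of a projective cover by generators of degree \<open>0\<close> is generated in degree \<open>1\<close> when the module
 has quadratic relations.  If \<open>x = \<Sum> a u\<^sub>a\<close> is in the kernel, the images of the \<open>u\<^sub>a\<close> satisfy a relation
 in the module, which is quadratic; subtracting lifts of the elements that witness this changes
 \<open>u\<^sub>a\<close> by a multiple killed by \<open>a\<close> and moves \<open>u\<^sub>a\<close> into the kernel, one degree lower.
\<close>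
lemma kernel_lift:
 assumes he: "graded_hom Q J F P M e" and hd: "graded_hom Q J F P1 P d"
  and gen: "!!m. 0 \<le> m ==> graded_pre.gen_at Q J P m"
  and rel: "!!m. 1 \<le> m ==> graded_pre.rel_at Q J F M m"
  and surj: "!!m y. 0 \<le> m ==> y \<in> hcomp M m ==> \<exists>x\<in>hcomp P m. e x = y"
  and base: "!!x. x \<in> hcomp P 1 ==> e x = \<zero>\<^bsub>M\<^esub> ==> \<exists>y\<in>hcomp P1 1. d y = x"
 shows "x \<in> hcomp P (int (Suc n)) ==> e x = \<zero>\<^bsub>M\<^esub> ==> \<exists>y\<in>hcomp P1 (int (Suc n)). d y = x"
proof (induction n arbitrary: x)
 case 0
 then show ?case using base by simp
next
 case (Suc n)
 interpret e: graded_hom Q J F P M e by fact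
 interpret d: graded_hom Q J F P1 P d by fact
 define m where "m = int (Suc n)"
 have m: "1 \<le> m" "int (Suc (Suc n)) = m + 1" by (simp_all add: m_def)
 have x: "x \<in> hcomp P (m + 1)" "e x = \<zero>\<^bsub>M\<^esub>" using Suc.prems unfolding m(2) by auto
 from m(1) gen[of m] have g: "e.dom.gen_at m" by simp
 from e.dom.gen_atD[OF g x(1)] obtain u where
  u: "!!a. a \<in> arcs Q ==> u a \<in> hcomp P m" "!!a. a \<in> arcs Q ==> e.dom.ev (e.vtx (tail Q a)) (u a) = u a"
   "x = (\<Oplus>\<^bsub>P\<^esub>a\<in>arcs Q. e.dom.ev (e.arr a) (u a))" by blast
 have uC: "u a \<in> carrier P" if "a \<in> arcs Q" for a using u(1)[OF that] by (rule e.dom.hc_carrier)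
 have "(\<Oplus>\<^bsub>M\<^esub>a\<in>arcs Q. e.cod.ev (e.arr a) (e (u a))) = (\<Oplus>\<^bsub>M\<^esub>a\<in>arcs Q. e (e.dom.ev (e.arr a) (u a)))"
  using uC by (intro e.cod.ag.finsum_cong') (auto simp: e.f_ev)
 also have "... = e x" unfolding u(3) using uC by (intro e.f_finsum[symmetric]) auto
 finally have z: "(\<Oplus>\<^bsub>M\<^esub>a\<in>arcs Q. e.cod.ev (e.arr a) (e (u a))) = \<zero>\<^bsub>M\<^esub>" using x(2) by simp
 have ve: "e.cod.ev (e.vtx (tail Q a)) (e (u a)) = e (u a)" if "a \<in> arcs Q" for a
  using u(2)[OF that] uC[OF that] that e.f_ev[of "e.vtx (tail Q a)" "u a"] by simp
 from e.cod.rel_atD[OF rel[OF m(1)] e.f_hc[OF u(1)] ve z] obtain t where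
  t: "!!a b. a \<in> arcs Q ==> b \<in> arcs Q ==> t a b \<in> hcomp M (m - 1)"
   "!!a. a \<in> arcs Q ==> e (u a) = (\<Oplus>\<^bsub>M\<^esub>b\<in>{b. (b, a) \<in> F}. e.cod.ev (e.arr b) (t a b))" by blast
 define v where "v a b = (SOME z. z \<in> hcomp P (m - 1) & e z = t a b)" for a b
 have v: "v a b \<in> hcomp P (m - 1)" "e (v a b) = t a b" if "a \<in> arcs Q" "b \<in> arcs Q" for a b
 proof -
  have "\<exists>z. z \<in> hcomp P (m - 1) & e z = t a b" using surj[of "m - 1" "t a b"] m(1) t(1)[OF that] by auto
  from someI_ex[OF this, folded v_def] show "v a b \<in> hcomp P (m - 1)" "e (v a b) = t a b" by blast+
 qed
 have vC: "v a b \<in> carrier P" if "a \<in> arcs Q" "b \<in> arcs Q" for a b using v(1)[OF that] by (rule e.dom.hc_carrier)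
 define k where "k a = (\<Oplus>\<^bsub>P\<^esub>b\<in>{b. (b, a) \<in> F}. e.dom.ev (e.arr b) (v a b))" for a
 have kh: "k a \<in> hcomp P m" if a: "a \<in> arcs Q" for a
  unfolding k_def
 proof (rule e.dom.hc_finsum)
  fix b assume "b \<in> {b. (b, a) \<in> F}"
  then have b: "b \<in> arcs Q" using e.F_arcs by blast
  show "e.dom.ev (e.arr b) (v a b) \<in> hcomp P m" using e.dom.arr_hc[OF b v(1)[OF a b]] by simp
 qed
 have kC: "k a \<in> carrier P" if "a \<in> arcs Q" for a using kh[OF that] by (rule e.dom.hc_carrier)
 have ek: "e (k a) = e (u a)" if a: "a \<in> arcs Q" for a
 proof -
  have bA: "b \<in> arcs Q" if "b \<in> {b. (b, a) \<in> F}" for b using that e.F_arcs by blast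
  have "e (k a) = (\<Oplus>\<^bsub>M\<^esub>b\<in>{b. (b, a) \<in> F}. e (e.dom.ev (e.arr b) (v a b)))"
   unfolding k_def using vC[OF a bA] bA by (intro e.f_finsum) auto
  also have "... = (\<Oplus>\<^bsub>M\<^esub>b\<in>{b. (b, a) \<in> F}. e.cod.ev (e.arr b) (t a b))"
  proof (rule e.cod.ag.finsum_cong'[OF refl])
   show "(%b. e.cod.ev (e.arr b) (t a b)) \<in> {b. (b, a) \<in> F} \<rightarrow> carrier M"
    using t(1)[OF a bA] bA e.cod.hc_carrier by (intro Pi_I e.cod.ev_closed) auto
   fix b assume "b \<in> {b. (b, a) \<in> F}"
   from bA[OF this] show "e (e.dom.ev (e.arr b) (v a b)) = e.cod.ev (e.arr b) (t a b)"
    using vC[OF a] v(2)[OF a] by (simp add: e.f_ev)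
  qed
  also have "... = e (u a)" by (rule t(2)[OF a, symmetric])
  finally show ?thesis .
 qed
 define w where "w a = u a \<oplus>\<^bsub>P\<^esub> (\<ominus>\<^bsub>P\<^esub> k a)" for a
 have wh: "w a \<in> hcomp P (int (Suc n))" if "a \<in> arcs Q" for a
  unfolding w_def m_def[symmetric] using u(1)[OF that] kh[OF that] by (intro e.dom.hc_add e.dom.hc_minus)
 have we: "e (w a) = \<zero>\<^bsub>M\<^esub>" if "a \<in> arcs Q" for a
  using uC[OF that] kC[OF that] ek[OF that] by (simp add: w_def e.f_add e.f_minus e.cod.ag.r_neg)
 have "\<forall>a. \<exists>y. a \<in> arcs Q --> y \<in> hcomp P1 (int (Suc n)) & d y = w a" using Suc.IH[OF wh we] by blast
 from choice[OF this] obtain y where "\<forall>a. a \<in> arcs Q --> y a \<in> hcomp P1 (int (Suc n)) & d (y a) = w a" ..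
 then have y: "y a \<in> hcomp P1 m" "d (y a) = w a" if "a \<in> arcs Q" for a using that by (auto simp: m_def)
 have yC: "y a \<in> carrier P1" if "a \<in> arcs Q" for a using y(1)[OF that] by (rule d.dom.hc_carrier)
 have kz: "e.dom.ev (e.arr a) (k a) = \<zero>\<^bsub>P\<^esub>" if a: "a \<in> arcs Q" for a
 proof -
  have bA: "b \<in> arcs Q" if "b \<in> {b. (b, a) \<in> F}" for b using that e.F_arcs by blast
  have "e.dom.ev (e.arr a) (k a) = (\<Oplus>\<^bsub>P\<^esub>b\<in>{b. (b, a) \<in> F}. e.dom.ev (e.arr a) (e.dom.ev (e.arr b) (v a b)))"
   unfolding k_def using a vC[OF a bA] bA by (intro e.dom.ev_finsum_right) auto
  also have "... = \<zero>\<^bsub>P\<^esub>"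
   using vC[OF a bA] by (intro e.dom.ag.add.finprod_one_eqI) (auto simp: e.dom.ev_arr_F)
  finally show ?thesis .
 qed
 have aw: "e.dom.ev (e.arr a) (w a) = e.dom.ev (e.arr a) (u a)" if a: "a \<in> arcs Q" for a
  using a uC[OF a] kC[OF a] kz[OF a] by (simp add: w_def e.dom.ev_add_right e.dom.ev_minus)
 define Y where "Y = (\<Oplus>\<^bsub>P1\<^esub>a\<in>arcs Q. d.dom.ev (e.arr a) (y a))"
 have "Y \<in> hcomp P1 (m + 1)" unfolding Y_def
  by (rule d.dom.hc_finsum) (use y(1) d.dom.arr_hc in blast)
 moreover have "d Y = x"
 proof -
  have "d Y = (\<Oplus>\<^bsub>P\<^esub>a\<in>arcs Q. d (d.dom.ev (e.arr a) (y a)))"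
   unfolding Y_def using yC by (intro d.f_finsum) auto
  also have "... = (\<Oplus>\<^bsub>P\<^esub>a\<in>arcs Q. e.dom.ev (e.arr a) (u a))"
   using uC yC y(2) aw by (intro e.dom.ag.finsum_cong') (auto simp: d.f_ev)
  finally show ?thesis using u(3) by simp
 qed
 ultimately show ?case unfolding m(2) by blast
qed

context graded_mod
begin

text \<open>
 A basis of degree \<open>0\<close> gives a projective cover, and the linear relations among the basis elements
 generate its kernel.  From there on the resolution is the one of \<^term>\<open>L.linear_resolution\<close>, since
 syzygies over a quadratic monomial algebra stay linear.
\<close>
theorem koszul_if_quadratic:
 assumes neg: "!!m x. m < 0 ==> x \<in> hcomp M m ==> x = \<zero>"
  and gen: "!!m. 0 \<le> m ==> gen_at m" and rel: "!!m. 1 \<le> m ==> rel_at m"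
 shows "koszul Q J M"
proof -
 obtain hb where hb: "\<forall>(v, b)\<in>set hb. v \<in> verts Q & b \<in> hcomp M 0 & ev (vtx v) b = b"
  "\<forall>t. (\<Oplus>j\<in>{..<length hb}. ev (single (fst (hb ! j), []) (t j)) (snd (hb ! j))) = \<zero> --> (\<forall>j<length hb. t j = 0)"
  "\<forall>x\<in>hcomp M 0. \<exists>t. x = (\<Oplus>j\<in>{..<length hb}. ev (single (fst (hb ! j), []) (t j)) (snd (hb ! j)))"
  using homogeneous_basis[of 0] by (elim exE conjE)
 define xs where "xs = map fst hb"
 define b where "b j = snd (hb ! j)" for j
 have len: "length hb = length xs" by (simp add: xs_def)
 have xs_nth: "fst (hb ! j) = xs ! j" if "j < length xs" for j using that by (simp add: xs_def)
 have bh: "xs ! j \<in> verts Q" "b j \<in> hcomp M 0" if "j < length xs" for j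
  using bspec[OF hb(1) nth_mem[of j hb]] that len xs_nth[OF that] by (auto simp: b_def case_prod_unfold)
 have vs: "set xs <= verts Q" using bh(1) by (auto simp: in_set_conv_nth)
 have bC: "b j \<in> carrier M" if "j < length xs" for j using bh(2)[OF that] by (rule hc_carrier)
 have indep: "t j = 0" if "(\<Oplus>j\<in>{..<length xs}. ev (single (xs ! j, []) (t j)) (b j)) = \<zero>" "j < length xs" for t j
 proof -
  have "(\<Oplus>j\<in>{..<length hb}. ev (single (fst (hb ! j), []) (t j)) (snd (hb ! j))) = (\<Oplus>j\<in>{..<length xs}. ev (single (xs ! j, []) (t j)) (b j))"
   by (rule ag.finsum_cong') (use bh bC len xs_nth in "auto simp: b_def")
  with that hb(2) len show ?thesis by simp
 qed
 have span: "\<exists>t. x = (\<Oplus>j\<in>{..<length xs}. ev (single (xs ! j, []) (t j)) (b j))" if "x \<in> hcomp M 0" for x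
 proof -
  from bspec[OF hb(3) that] obtain t where
   "x = (\<Oplus>j\<in>{..<length hb}. ev (single (fst (hb ! j), []) (t j)) (snd (hb ! j)))" ..
  also have "... = (\<Oplus>j\<in>{..<length xs}. ev (single (xs ! j, []) (t j)) (b j))"
   by (rule ag.finsum_cong') (use bh bC len xs_nth in "auto simp: b_def")
  finally show ?thesis by blast
 qed
 define P where "P = PS (lin xs 0)"
 define e where "e = phom (lin xs 0) b"
 have lv: "set (lin xs 0) <= verts Q \<times> UNIV" by (rule lin_verts[OF vs])
 have e_hom: "e \<in> gr_hom Q J P M" unfolding e_def P_def by (rule phom_hom[OF lv]) (use bh in simp)
 interpret e: graded_hom Q J F P M e
  by (intro graded_homI graded_pre_axioms e_hom)
   (unfold P_def, rule graded_preI[OF psum_pre[OF lv]])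
 have cfz: "cf (z i) \<in> SQ (xs ! i)" "z i = cls (cf (z i))" if "z \<in> carrier P" "i < length xs" for z i
  using psum_cf[OF lv that(1)[unfolded P_def], of i] that(2) by simp_all
 have e_ev: "e z = (\<Oplus>i\<in>{..<length xs}. ev (cf (z i)) (b i))" if z: "z \<in> carrier P" for z
 proof -
  have "e z = (\<Oplus>i\<in>{..<length xs}. z i \<odot> b i)" using z by (simp add: e_def phom_def P_def)
  also have "... = (\<Oplus>i\<in>{..<length xs}. ev (cf (z i)) (b i))"
  proof (rule ag.finsum_cong'[OF refl])
   show "(%i. ev (cf (z i)) (b i)) \<in> {..<length xs} \<rightarrow> carrier M"
    using bC SQ_KQ[OF cfz(1)[OF z]] by (intro Pi_I ev_closed) auto
  qed (use cfz(2)[OF z] in "simp add: ev_def")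
  finally show ?thesis .
 qed
 have mkC: "(\<lambda>j\<in>{..<length xs}. cls (f j)) \<in> carrier P" if "!!j. j < length xs ==> f j \<in> SQ (xs ! j)" for f
  unfolding P_def psum_carrier[OF lv] using that by simp
 \<comment> \<open>the coordinates of a homogeneous element\<close>
 have hdeg: "int (length (snd p)) = m" if z: "z \<in> hcomp P m" and i: "i < length xs" and p: "p \<in> keys (cf (z i))" for z m i p
 proof -
  from z i obtain f where f: "f \<in> SQ (xs ! i)" "\<forall>p\<in>keys f. int (length (snd p)) = m" "z i = cls f"
   unfolding P_def psum_hcomp[OF lv] by auto
  then have "cf (z i) = f" by (simp add: cf_GQ[OF SQ_GQ[OF f(1)]])
  with f(2) p show ?thesis by simp
 qed
 have zeroI: "z = \<zero>\<^bsub>P\<^esub>" if z: "z \<in> carrier P" and n: "!!i p. i < length xs ==> p ~: keys (cf (z i))" for z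
  unfolding P_def
 proof (rule psum_ext[OF lv])
  show "z \<in> carrier (PS (lin xs 0))" "\<zero>\<^bsub>PS (lin xs 0)\<^esub> \<in> carrier (PS (lin xs 0))"
   using z e.dom.ag.zero_closed by (simp_all add: P_def)
  fix i p assume "i < length (lin xs 0)"
  then have i: "i < length xs" by simp
  have "\<zero>\<^bsub>PS (lin xs 0)\<^esub> i = cls 0" using i by (simp add: psum_zero[OF lv] cls_zero)
  then show "lookup (cf (z i)) p = lookup (cf (\<zero>\<^bsub>PS (lin xs 0)\<^esub> i)) p"
   using n[OF i, of p] by (simp add: in_keys_iff cf_GQ GQ_def)
 qed
 have base0: "z = \<zero>\<^bsub>P\<^esub>" if z: "z \<in> hcomp P 0" and ez: "e z = \<zero>" for z
 proof (rule zeroI)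
  show zC: "z \<in> carrier P" using z by (rule e.dom.hc_carrier)
  define t where "t i = lookup (cf (z i)) (xs ! i, [])" for i
  have f: "cf (z i) = single (xs ! i, []) (t i)" if i: "i < length xs" for i
  proof (rule poly_mapping_eqI)
   fix p
   have "p = (xs ! i, [])" if "p \<in> keys (cf (z i))"
    using hdeg[OF z i that] cfz(1)[OF zC i] that by (cases p) (auto simp: SQ_def)
   then show "lookup (cf (z i)) p = lookup (single (xs ! i, []) (t i)) p"
    by (cases "p = (xs ! i, [])") (auto simp: t_def lookup_single when_def in_keys_iff)
  qed
  have "(\<Oplus>i\<in>{..<length xs}. ev (single (xs ! i, []) (t i)) (b i)) = e z"
   unfolding e_ev[OF zC] by (rule ag.finsum_cong') (use f bC bh SQ_KQ[OF cfz(1)[OF zC]] in auto)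
  then have "t i = 0" if "i < length xs" for i using indep[of t i] ez that by simp
  then show "p ~: keys (cf (z i))" if "i < length xs" for i p using f[OF that] that by simp
 qed
 have surj_nat: "\<forall>y\<in>hcomp M (int m). \<exists>x\<in>hcomp P (int m). e x = y" for m
 proof (induction m)
  case 0
  show ?case
  proof
   fix y assume "y \<in> hcomp M (int 0)"
   then obtain t where t: "y = (\<Oplus>j\<in>{..<length xs}. ev (single (xs ! j, []) (t j)) (b j))" using span by auto
   have s: "single (xs ! j, []) (t j) \<in> SQ (xs ! j)" if "j < length xs" for j
    using bh(1)[OF that] by (auto simp: SQ_def GQ_def good_Nil)
   define z where "z = (\<lambda>j\<in>{..<length xs}. cls (single (xs ! j, []) (t j)))"
   have zC: "z \<in> carrier P" unfolding z_def by (rule mkC[OF s])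
   have "e z = (\<Oplus>i\<in>{..<length xs}. ev (cf (z i)) (b i))" by (rule e_ev[OF zC])
   also have "... = y" unfolding t
    by (rule ag.finsum_cong') (use bC bh in "auto simp: z_def cf_GQ[OF SQ_GQ[OF s]]")
   finally have "e z = y" .
   moreover have "z \<in> hcomp P (int 0)" unfolding P_def psum_hcomp[OF lv] z_def
    using s by (auto intro!: imageI)
   ultimately show "\<exists>x\<in>hcomp P (int 0). e x = y" by blast
  qed
 next
  case (Suc m)
  show ?case
  proof
   fix y assume "y \<in> hcomp M (int (Suc m))"
   then have y: "y \<in> hcomp M (int m + 1)" by (simp add: add.commute)
   have g: "gen_at (int m)" by (rule gen) simp
   from gen_atD[OF g y] obtain u where u: "!!a. a \<in> arcs Q ==> u a \<in> hcomp M (int m)"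
    "!!a. a \<in> arcs Q ==> ev (vtx (tail Q a)) (u a) = u a" "y = (\<Oplus>a\<in>arcs Q. ev (arr a) (u a))"
    by blast
   have "\<forall>a. \<exists>x. a \<in> arcs Q --> x \<in> hcomp P (int m) & e x = u a" using Suc.IH u(1) by blast
   from choice[OF this] obtain z where "\<forall>a. a \<in> arcs Q --> z a \<in> hcomp P (int m) & e (z a) = u a" ..
   then have z: "z a \<in> hcomp P (int m)" "e (z a) = u a" if "a \<in> arcs Q" for a using that by blast+
   have zC: "z a \<in> carrier P" if "a \<in> arcs Q" for a using z(1)[OF that] by (rule e.dom.hc_carrier)
   have uC: "u a \<in> carrier M" if "a \<in> arcs Q" for a using u(1)[OF that] by (rule hc_carrier)
   define Z where "Z = (\<Oplus>\<^bsub>P\<^esub>a\<in>arcs Q. e.dom.ev (arr a) (z a))"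
   have "Z \<in> hcomp P (int m + 1)" unfolding Z_def
    by (rule e.dom.hc_finsum) (use z(1) e.dom.arr_hc in blast)
   moreover have "e Z = y"
   proof -
    have "e Z = (\<Oplus>a\<in>arcs Q. e (e.dom.ev (arr a) (z a)))"
     unfolding Z_def using zC by (intro e.f_finsum) auto
    also have "... = y" unfolding u(3)
     using zC z(2) uC by (intro ag.finsum_cong') (auto simp: e.f_ev)
    finally show ?thesis .
   qed
   ultimately show "\<exists>x\<in>hcomp P (int (Suc m)). e x = y" by (auto simp: add.commute)
  qed
 qed
 have surj: "\<exists>x\<in>hcomp P m. e x = y" if "0 \<le> m" "y \<in> hcomp M m" for m y
  using bspec[OF surj_nat[of "nat m"], of y] that by simp
 \<comment> \<open>the linear relations between the generators\<close>
 define R where "R = {r :: nat \<times> 'e => 'k. (\<forall>i a. r (i, a) ~= 0 --> i < length xs & a \<in> arcs Q & tail Q a = xs ! i) &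
  (\<Oplus>i\<in>{..<length xs}. ev (\<Sum>a\<in>arcs Q. single (tail Q a, [a]) (r (i, a))) (b i)) = \<zero>}"
 have stR: "L.starts_at xs R" unfolding L.starts_at_def R_def by blast
 have restr: "(%(i, a). if head Q a = v then r (i, a) else 0) \<in> R" if r: "r \<in> R" for r v
 proof -
  have z: "(\<Oplus>i\<in>{..<length xs}. ev (\<Sum>a\<in>arcs Q. single (tail Q a, [a]) (r (i, a))) (b i)) = \<zero>"
   using r by (simp add: R_def)
  have "(\<Oplus>i\<in>{..<length xs}. ev (\<Sum>a\<in>arcs Q. single (tail Q a, [a]) (if head Q a = v then r (i, a) else 0)) (b i)) = \<zero>"
  proof (cases "v \<in> verts Q")
   case True
   have pt: "path_times Q (vtx v) (\<Sum>a\<in>arcs Q. single (tail Q a, [a]) (r (i, a))) =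
     (\<Sum>a\<in>arcs Q. single (tail Q a, [a]) (if head Q a = v then r (i, a) else 0))" for i
    unfolding path_times_sum_right by (intro sum.cong) (auto simp: vtx_def path_times_single path_end_simp)
   have "(\<Oplus>i\<in>{..<length xs}. ev (\<Sum>a\<in>arcs Q. single (tail Q a, [a]) (if head Q a = v then r (i, a) else 0)) (b i)) =
     (\<Oplus>i\<in>{..<length xs}. ev (vtx v) (ev (\<Sum>a\<in>arcs Q. single (tail Q a, [a]) (r (i, a))) (b i)))"
   proof (rule ag.finsum_cong'[OF refl])
    show "(%i. ev (vtx v) (ev (\<Sum>a\<in>arcs Q. single (tail Q a, [a]) (r (i, a))) (b i))) \<in> {..<length xs} \<rightarrow> carrier M"
     using True bC arcsum_KQ by (intro Pi_I ev_closed) auto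
    fix i assume "i \<in> {..<length xs}"
    then show "ev (\<Sum>a\<in>arcs Q. single (tail Q a, [a]) (if head Q a = v then r (i, a) else 0)) (b i) =
      ev (vtx v) (ev (\<Sum>a\<in>arcs Q. single (tail Q a, [a]) (r (i, a))) (b i))"
     using True bC arcsum_KQ by (simp add: ev_times[symmetric] pt)
   qed
   also have "... = ev (vtx v) (\<Oplus>i\<in>{..<length xs}. ev (\<Sum>a\<in>arcs Q. single (tail Q a, [a]) (r (i, a))) (b i))"
    using True bC arcsum_KQ by (intro ev_finsum_right[symmetric] Pi_I ev_closed) auto
   finally show ?thesis using True by (simp add: z)
  next
   case False
   have "(\<Sum>a\<in>arcs Q. single (tail Q a, [a]) (if head Q a = v then r (i, a) else 0)) = 0" for i
    using False by (intro sum.neutral) auto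
   then show ?thesis using bC by (intro ag.add.finprod_one_eqI) simp
  qed
  then show ?thesis using r unfolding R_def by auto
 qed
 from L.linear_resolution_exists[OF stR restr] obtain bs where bs: "L.linear_resolution xs R bs" .
 then have sb0: "L.step_basis R (bs 0)" and sbS: "!!n. L.step_basis (L.syzygies (bs n)) (bs (Suc n))"
  unfolding L.linear_resolution_def by blast+
 obtain l where l: "!!n. l \<le> n ==> bs n = []" using bs unfolding L.linear_resolution_def by blast
 define X where "X n = (case n of 0 => xs | Suc n => map fst (bs n))" for n
 define RR where "RR n = (case n of 0 => R | Suc n => L.syzygies (bs n))" for n
 have stn: "L.starts_at (X n) (RR n)" for n
  using stR L.starts_at_syzygies by (cases n) (simp_all add: X_def RR_def)
 have sbn: "L.step_basis (RR n) (bs n)" for n using sb0 sbS by (cases n) (simp_all add: RR_def)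
 have vX: "set (X n) <= verts Q" for n
 proof (induction n)
  case 0
  then show ?case using vs by (simp add: X_def)
 next
  case (Suc n)
  have "set (map fst (bs n)) <= verts Q" by (rule bs_verts[OF Suc stn sbn])
  then show ?case by (simp add: X_def)
 qed
 define d where "d n = dmap n (X n) (bs n)" for n
 have XS: "X (Suc n) = map fst (bs n)" for n by (simp add: X_def)
 have X0: "X 0 = xs" by (simp add: X_def)
 have dh: "d n \<in> gr_hom Q J (PS (lin (X (Suc n)) (Suc n))) (PS (lin (X n) n))" for n
  unfolding d_def XS by (rule dmap_hom[OF vX stn sbn])
 have dex: "gr_im (PS (lin (X (Suc (Suc n))) (Suc (Suc n)))) (d (Suc n)) =
   gr_ker (PS (lin (X (Suc n)) (Suc n))) (PS (lin (X n) n)) (d n)" for n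
  unfolding d_def XS by (rule dmap_exact[OF vX stn sbn sbS])
 define P1 where "P1 = PS (lin (X 1) 1)"
 have d0h: "d 0 \<in> gr_hom Q J P1 P" using dh[of 0] by (simp add: P1_def P_def X0)
 have hd: "graded_hom Q J F P1 P (d 0)"
  by (intro graded_homI e.dom.graded_pre_axioms d0h)
   (unfold P1_def, rule graded_preI[OF psum_pre[OF lin_verts[OF vX]]])
 then interpret d: graded_hom Q J F P1 P "d 0" .
 have P1': "P1 = PS (lin (map fst (bs 0)) (Suc 0))" by (simp add: P1_def X_def)
 have d0: "d 0 = dmap 0 xs (bs 0)" by (simp add: d_def X0)
 have bv: "set (map fst (bs 0)) <= verts Q" using vX[of 1] by (simp add: X_def)
 have comp: "e (d 0 y) = \<zero>" if y: "y \<in> carrier P1" for y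
 proof -
  have yc: "cf (y j) \<in> KQ" if "j < length (bs 0)" for j
   using psum_cf(1)[OF lin_verts[OF bv] y[unfolded P1'], of j] that SQ_KQ by auto
  have dyC: "d 0 y \<in> carrier P" using y by simp
  have tK: "theta (bs 0) j i \<in> KQ" for j i by (simp add: theta_def arcsum_KQ)
  have sK: "(\<Sum>j<length (bs 0). path_times Q (cf (y j)) (theta (bs 0) j i)) \<in> KQ" for i
   by (intro KQ_sum KQ_times tK yc) simp
  have trm: "ev (cf (d 0 y i)) (b i) = (\<Oplus>j\<in>{..<length (bs 0)}. ev (cf (y j)) (ev (theta (bs 0) j i) (b i)))"
   if i: "i < length xs" for i
  proof -
   have "d 0 y i = cls (\<Sum>j<length (bs 0). path_times Q (cf (y j)) (theta (bs 0) j i))"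
    unfolding d0 by (rule dmap_nth[OF vs stR sb0 y[unfolded P1'] i])
   then have "ev (cf (d 0 y i)) (b i) = ev (\<Sum>j<length (bs 0). path_times Q (cf (y j)) (theta (bs 0) j i)) (b i)"
    using sK by (simp add: cf_KQ ev_red)
   also have "... = (\<Oplus>j\<in>{..<length (bs 0)}. ev (path_times Q (cf (y j)) (theta (bs 0) j i)) (b i))"
    using bC[OF i] yc tK by (intro ev_sum_left) (auto intro!: KQ_times)
   also have "... = (\<Oplus>j\<in>{..<length (bs 0)}. ev (cf (y j)) (ev (theta (bs 0) j i) (b i)))"
    using bC[OF i] yc tK by (intro ag.finsum_cong') (auto simp: ev_times)
   finally show ?thesis .
  qed
  have "e (d 0 y) = (\<Oplus>i\<in>{..<length xs}. \<Oplus>j\<in>{..<length (bs 0)}. ev (cf (y j)) (ev (theta (bs 0) j i) (b i)))"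
   unfolding e_ev[OF dyC] using trm bC yc tK by (intro ag.finsum_cong') (auto intro!: ag.finsum_closed)
  also have "... = (\<Oplus>j\<in>{..<length (bs 0)}. \<Oplus>i\<in>{..<length xs}. ev (cf (y j)) (ev (theta (bs 0) j i) (b i)))"
   using bC yc tK by (intro ag.finsum_swap) auto
  also have "... = \<zero>"
  proof (rule ag.add.finprod_one_eqI)
   fix j assume "j \<in> {..<length (bs 0)}"
   then have j: "j < length (bs 0)" by simp
   have "snd (bs 0 ! j) \<in> R" by (rule L.step_basis_mem[OF sb0 j])
   then have "(\<Oplus>i\<in>{..<length xs}. ev (theta (bs 0) j i) (b i)) = \<zero>" by (simp add: R_def theta_def)
   moreover have "(\<Oplus>i\<in>{..<length xs}. ev (cf (y j)) (ev (theta (bs 0) j i) (b i))) =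
     ev (cf (y j)) (\<Oplus>i\<in>{..<length xs}. ev (theta (bs 0) j i) (b i))"
    using bC yc[OF j] tK by (intro ev_finsum_right[symmetric]) auto
   ultimately show "(\<Oplus>i\<in>{..<length xs}. ev (cf (y j)) (ev (theta (bs 0) j i) (b i))) = \<zero>"
    using yc[OF j] by simp
  qed
  finally show ?thesis .
 qed
 have base1: "\<exists>y\<in>hcomp P1 1. d 0 y = x" if x: "x \<in> hcomp P 1" and ex: "e x = \<zero>" for x
 proof -
  have xC: "x \<in> carrier P" using x by (rule e.dom.hc_carrier)
  define r where "r = (%(i, a). if i < length xs & a \<in> arcs Q & tail Q a = xs ! i then lookup (cf (x i)) (tail Q a, [a]) else 0)"
  have long: "lookup (cf (x i)) (u, p) = 0" if "i < length xs" "length p ~= 1" for i u p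
   using hdeg[OF x that(1), of "(u, p)"] that(2) by (auto simp: in_keys_iff)
  have f: "cf (x i) = (\<Sum>a\<in>arcs Q. single (tail Q a, [a]) (r (i, a)))" if i: "i < length xs" for i
  proof (rule poly_mapping_eqI)
   fix q :: "('v, 'e) path"
   obtain u p where q: "q = (u, p)" by (cases q)
   show "lookup (cf (x i)) q = lookup (\<Sum>a\<in>arcs Q. single (tail Q a, [a]) (r (i, a))) q"
   proof (cases "length p = 1")
    case True
    then obtain a where p: "p = [a]" by (cases p) auto
    show ?thesis
    proof (cases "a \<in> arcs Q & tail Q a = u & u = xs ! i")
     case True
     then show ?thesis using i by (simp add: q p lookup_arcsum r_def)
    next
     case False
     have "lookup (cf (x i)) (u, [a]) = 0"
     proof (cases "u = xs ! i")
      case True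
      with False have "(u, [a]) ~: good" by (auto simp: good_Cons)
      then show ?thesis by (rule GQ_lookup[OF SQ_GQ[OF cfz(1)[OF xC i]]])
     qed (use SQ_lookup[OF cfz(1)[OF xC i], of "(u, [a])"] in simp)
     with False show ?thesis by (auto simp: q p lookup_arcsum r_def)
    qed
   next
    case False
    then have "(case p of [a] => if a \<in> arcs Q & tail Q a = u then r (i, a) else 0 | _ => 0) = 0"
     by (auto split: list.splits)
    with long[OF i False] show ?thesis by (simp add: q lookup_arcsum)
   qed
  qed
  have "(\<Oplus>i\<in>{..<length xs}. ev (\<Sum>a\<in>arcs Q. single (tail Q a, [a]) (r (i, a))) (b i)) = e x"
   unfolding e_ev[OF xC]
  proof (rule ag.finsum_cong'[OF refl])
   show "(%i. ev (cf (x i)) (b i)) \<in> {..<length xs} \<rightarrow> carrier M"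
    using bC SQ_KQ[OF cfz(1)[OF xC]] by (intro Pi_I ev_closed) auto
  qed (use f in simp)
  then have "r \<in> R" using ex by (auto simp: R_def r_def)
  from L.step_basis_span[OF sb0 this] obtain t where
   t: "!!i a. r (i, a) = (\<Sum>l<length (bs 0). t l * snd (bs 0 ! l) (i, a))" by blast
  define y where "y = (\<lambda>j\<in>{..<length (bs 0)}. cls (single (fst (bs 0 ! j), []) (t j)))"
  have s: "single (fst (bs 0 ! j), []) (t j) \<in> SQ (fst (bs 0 ! j))" if j: "j < length (bs 0)" for j
  proof -
   have "fst (bs 0 ! j) \<in> verts Q" using bv j by (auto simp: subset_iff)
   then show ?thesis by (auto simp: SQ_def GQ_def good_Nil)
  qed
  have yh: "y \<in> hcomp P1 1" unfolding P1' psum_hcomp[OF lin_verts[OF bv]] y_def using s by (auto intro!: imageI)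
  have yC: "y \<in> carrier P1" using yh by (rule d.dom.hc_carrier)
  have cy: "cf (y j) = single (fst (bs 0 ! j), []) (t j)" if "j < length (bs 0)" for j
   using that s[OF that] by (simp add: y_def cf_GQ[OF SQ_GQ])
  have "d 0 y = x"
  proof -
   have "d 0 y \<in> carrier (PS (lin xs 0))" using d.f_closed[OF yC] by (simp add: P_def)
   then show ?thesis
   proof (rule psum_ext[OF lv _ xC[unfolded P_def]])
    fix i p assume "i < length (lin xs 0)" and p: "p \<in> good" and fp: "fst p = fst (lin xs 0 ! i)"
    then have i: "i < length xs" by simp
    obtain u q where pu: "p = (u, q)" by (cases p)
    have u: "u = xs ! i" using fp i by (simp add: pu)
    note co = dmap_coef[OF vs stR sb0 yC[unfolded P1'] i p[unfolded pu], folded d0]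
    show "lookup (cf (d 0 y i)) p = lookup (cf (x i)) p"
    proof (cases q)
     case Nil
     then show ?thesis using co long[OF i, of "[]" u] by (simp add: pu)
    next
     case (Cons a q')
     have a: "a \<in> arcs Q" "tail Q a = u" using p by (auto simp: pu Cons good_Cons)
     have sum: "lookup (cf (d 0 y i)) (u, q) = (\<Sum>j<length (bs 0). lookup (single (fst (bs 0 ! j), []) (t j)) (head Q a, q') * snd (bs 0 ! j) (i, a))"
      using co by (simp add: Cons cy)
     show ?thesis
     proof (cases q')
      case q': Nil
      have "lookup (cf (d 0 y i)) (u, q) = (\<Sum>j<length (bs 0). t j * snd (bs 0 ! j) (i, a))"
       unfolding sum
      proof (rule sum.cong[OF refl])
       fix j assume "j \<in> {..<length (bs 0)}"
       then show "lookup (single (fst (bs 0 ! j), []) (t j)) (head Q a, q') * snd (bs 0 ! j) (i, a) = t j * snd (bs 0 ! j) (i, a)"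
        using L.step_basis_tgt[OF sb0, of j i a] by (cases "snd (bs 0 ! j) (i, a) = 0") (simp_all add: q')
      qed
      also have "... = r (i, a)" by (simp add: t)
      finally show ?thesis using a i u by (simp add: pu Cons q' r_def)
     next
      case q': (Cons c q'')
      have "lookup (cf (d 0 y i)) (u, q) = 0" unfolding sum by (intro sum.neutral) (simp add: q' lookup_single)
      then show ?thesis using long[OF i, of q u] by (simp add: pu Cons q')
     qed
    qed
   qed
  qed
  with yh show ?thesis by blast
 qed
 have lift: "\<exists>y\<in>carrier P1. d 0 y = x" if x: "x \<in> hcomp P m" and ex: "e x = \<zero>" for m x
 proof -
  have xC: "x \<in> carrier P" using x by (rule e.dom.hc_carrier)
  consider "m < 0" | "m = 0" | "0 < m" by linarith
  then show ?thesis
  proof cases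
   case 1
   have "x = \<zero>\<^bsub>P\<^esub>" by (rule zeroI[OF xC]) (use hdeg[OF x] 1 in force)
   then show ?thesis by (intro bexI[of _ "\<zero>\<^bsub>P1\<^esub>"]) auto
  next
   case 2
   have "x = \<zero>\<^bsub>P\<^esub>" by (rule base0) (use x ex 2 in auto)
   then show ?thesis by (intro bexI[of _ "\<zero>\<^bsub>P1\<^esub>"]) auto
  next
   case 3
   then have m: "int (Suc (nat (m - 1))) = m" by simp
   have genP: "graded_pre.gen_at Q J P k" if "0 \<le> k" for k
    unfolding P_def by (rule psum_gen[OF lv]) (use that in "auto simp: lin_def")
   have "\<exists>y\<in>hcomp P1 (int (Suc (nat (m - 1)))). d 0 y = x"
    by (rule kernel_lift[OF e.graded_hom_axioms hd genP rel surj base1]) (use x ex m in simp_all)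
   then show ?thesis using d.dom.hc_carrier by blast
  qed
 qed
 have ex0: "gr_im P1 (d 0) = gr_ker P M e"
  by (rule exact_from_homogeneous[OF e.graded_hom_axioms hd comp lift])
 have im0: "gr_im P e = carrier M"
 proof (rule e.surj_from_homogeneous)
  fix m y assume y: "y \<in> hcomp M m"
  show "\<exists>x\<in>carrier P. e x = y"
  proof (cases "0 \<le> m")
   case True
   then show ?thesis using surj[OF True y] e.dom.hc_carrier by blast
  next
   case False
   then have "y = \<zero>" using neg[OF _ y] by simp
   then show ?thesis by (intro bexI[of _ "\<zero>\<^bsub>P\<^esub>"]) auto
  qed
 qed
 have gm: "gr_module Q J M" using gr fd by (simp add: gr_module_iff)
 show ?thesis
  unfolding koszul_def Let_def lin_def[symmetric]
 proof (intro conjI exI[of _ X] exI[of _ d] exI[of _ e] allI)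
  show "\<exists>l. \<forall>n>l. X n = []"
  proof (intro exI[of _ l] allI impI)
   fix n assume "l < n"
   then obtain k where "n = Suc k" "l \<le> k" by (cases n) auto
   then show "X n = []" using l[of k] by (simp add: X_def)
  qed
  show "gr_im (PS (lin (X 1) 1)) (d 0) = gr_ker (PS (lin (X 0) 0)) M e"
   using ex0 by (simp add: P1_def P_def X0)
 qed (use gm vX e_hom dh im0 dex in "simp_all add: P_def X0")
qed

end

section \<open>Linear complexes of injectives\<close>

context monomial_quotient
begin

sublocale R: monomial_relations "arcs Q" "head Q" "tail Q" "%a b. (b, a) \<in> F"
 by (rule monomial_relations_right)

abbreviation "IS xs \<equiv> inj_sum Q J xs"

definition colin :: "'v list => nat => ('v \<times> int) list" where
 "colin xs n = map (%x. (x, - int n)) xs"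

lemma colin_simps [simp]: "length (colin xs n) = length xs" "j < length xs ==> colin xs n ! j = (xs ! j, - int n)"
 by (simp_all add: colin_def)

lemma colin_verts: "set xs <= verts Q ==> set (colin xs n) <= verts Q \<times> UNIV"
 by (auto simp: colin_def)

context
 fixes xs :: "('v \<times> int) list"
 assumes xs: "set xs <= verts Q \<times> UNIV"
begin

lemma isum_nth: "j < length xs ==> map (%(x, i). gr_shift i (gr_inj Q J x)) xs ! j
  = gr_shift (snd (xs ! j)) (gr_inj Q J (fst (xs ! j)))"
 by (simp add: case_prod_unfold)

lemma isum_pre': "j < length (map (%(x, i). gr_shift i (gr_inj Q J x)) xs) ==>
  gr_pre Q J (map (%(x, i). gr_shift i (gr_inj Q J x)) xs ! j)"
 using graded_pre.shift_pre[OF graded_preI[OF inj_pre[OF xs_nth[OF xs]]]] isum_nth by simp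

lemma isum_pre: "gr_pre Q J (IS xs)"
 unfolding inj_sum_def by (rule dsum_pre) (rule isum_pre')

lemma isum_cogen:
 assumes "!!x i. (x, i) \<in> set xs ==> m < i"
 shows "graded_pre.cogen_at Q J (IS xs) m"
 unfolding inj_sum_def
proof (rule dsum_cogen, rule isum_pre', assumption)
 fix j assume "j < length (map (%(x, i). gr_shift i (gr_inj Q J x)) xs)"
 then have j: "j < length xs" by simp
 have "m < snd (xs ! j)" using assms[of "fst (xs ! j)" "snd (xs ! j)"] nth_mem[OF j] by simp
 then show "graded_pre.cogen_at Q J (map (%(x, i). gr_shift i (gr_inj Q J x)) xs ! j) m"
  unfolding isum_nth[OF j] graded_pre.shift_cogen[OF graded_preI[OF inj_pre[OF xs_nth[OF xs j]]]]
  by (intro inj_cogen xs_nth[OF xs] j) simp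
qed

lemma isum_corel:
 assumes "!!x i. (x, i) \<in> set xs ==> m < i"
 shows "graded_pre.corel_at Q J F (IS xs) m"
 unfolding inj_sum_def
proof (rule dsum_corel, rule isum_pre', assumption)
 fix j assume "j < length (map (%(x, i). gr_shift i (gr_inj Q J x)) xs)"
 then have j: "j < length xs" by simp
 have "m < snd (xs ! j)" using assms[of "fst (xs ! j)" "snd (xs ! j)"] nth_mem[OF j] by simp
 then show "graded_pre.corel_at Q J F (map (%(x, i). gr_shift i (gr_inj Q J x)) xs ! j) m"
  unfolding isum_nth[OF j] graded_pre.shift_corel[OF graded_preI[OF inj_pre[OF xs_nth[OF xs j]]]]
  by (intro inj_corel xs_nth[OF xs] j) simp
qed

lemma isum_carrier: "z \<in> carrier (IS xs) \<longleftrightarrow> z \<in> extensional {..<length xs} &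
  (\<forall>j<length xs. z j \<in> graded_dual Q J (fst (xs ! j)))"
 unfolding inj_sum_def dsum_simps PiE_iff length_map
 using isum_nth by (auto simp: inj_simps(1) gr_shift_def)

lemma isum_hcomp: "z \<in> hcomp (IS xs) m \<longleftrightarrow> z \<in> extensional {..<length xs} &
  (\<forall>j<length xs. z j \<in> hcomp (gr_inj Q J (fst (xs ! j))) (m - snd (xs ! j)))"
 unfolding inj_sum_def dsum_simps PiE_iff length_map
 using isum_nth by (auto simp: gr_shift_def)

lemma isum_add: "x \<oplus>\<^bsub>IS xs\<^esub> y = (\<lambda>j\<in>{..<length xs}. \<lambda>b\<in>EI (fst (xs ! j)). x j b + y j b)"
 unfolding inj_sum_def dsum_simps length_map by (rule restrict_ext) (simp add: case_prod_unfold inj_simps gr_shift_def)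

lemma isum_smult: "a \<odot>\<^bsub>IS xs\<^esub> y = (\<lambda>j\<in>{..<length xs}. \<lambda>b\<in>EI (fst (xs ! j)). y j (b \<otimes>\<^bsub>A\<^esub> a))"
 unfolding inj_sum_def dsum_simps length_map by (rule restrict_ext) (simp add: case_prod_unfold inj_simps gr_shift_def)

lemma isum_zero: "\<zero>\<^bsub>IS xs\<^esub> = (\<lambda>j\<in>{..<length xs}. \<lambda>b\<in>EI (fst (xs ! j)). 0)"
 unfolding inj_sum_def dsum_simps length_map by (rule restrict_ext) (simp add: case_prod_unfold inj_simps gr_shift_def)

lemma isum_ext:
 assumes z: "z \<in> carrier (IS xs)" and w: "w \<in> carrier (IS xs)"
  and eq: "!!j p. j < length xs ==> p \<in> gto (fst (xs ! j)) ==> z j (pe p) = w j (pe p)"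
 shows "z = w"
proof (rule extensionalityI)
 show "z \<in> extensional {..<length xs}" "w \<in> extensional {..<length xs}" using z w isum_carrier by blast+
 fix j assume "j \<in> {..<length xs}"
 then have j: "j < length xs" by simp
 show "z j = w j"
  by (rule dual_ext[OF xs_nth[OF xs j]]) (use z w j eq isum_carrier in auto)
qed

end

end

context graded_pre
begin

text \<open>A linear functional that lives on the component of degree \<open>i\<close>.\<close>
definition functional :: "int => ('m => 'k) => bool" where
 "functional i l \<longleftrightarrow> (\<forall>x\<in>carrier M. \<forall>y\<in>carrier M. l (x \<oplus> y) = l x + l y) &
   (\<forall>c. \<forall>x\<in>carrier M. l (ev (path_scalar Q c) x) = c * l x) &
   (\<forall>m x. x \<in> hcomp M m --> m ~= i --> l x = 0)"

lemma functional_add: "functional i l ==> x \<in> carrier M ==> y \<in> carrier M ==> l (x \<oplus> y) = l x + l y"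
 and functional_scalar: "functional i l ==> x \<in> carrier M ==> l (ev (path_scalar Q c) x) = c * l x"
 and functional_hc: "functional i l ==> x \<in> hcomp M m ==> m ~= i ==> l x = 0"
 by (simp_all add: functional_def)

lemma functional_zero: "functional i l ==> l \<zero> = 0"
 using functional_hc[of i l "\<zero>" "i + 1"] by simp

lemma functional_finsum:
 assumes l: "functional i l" and f: "f \<in> S \<rightarrow> carrier M" and S: "finite S"
 shows "l (\<Oplus>s\<in>S. f s) = (\<Sum>s\<in>S. l (f s))"
 using S f
proof (induction S rule: finite_induct)
 case (insert x S)
 then have "f \<in> S \<rightarrow> carrier M" "f x \<in> carrier M" by auto
 with insert show ?case by (simp add: functional_add[OF l] Pi_def)
qed (simp add: functional_zero[OF l])

lemma functional_hp:
 assumes l: "functional i l" and x: "x \<in> carrier M"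
 shows "l x = l (hp x i)"
proof -
 let ?S = "{n. hp x n ~= \<zero>} \<union> {i}"
 have S: "finite ?S" using hp_fin[OF x] by simp
 have "l x = l (\<Oplus>n\<in>?S. hp x n)" using hp_sum[OF x S] by simp
 also have "... = (\<Sum>n\<in>?S. l (hp x n))" by (rule functional_finsum[OF l _ S]) (use x in auto)
 also have "... = (\<Sum>n\<in>?S. if n = i then l (hp x i) else 0)"
  using functional_hc[OF l hp_hc[OF x]] by (intro sum.cong) auto
 also have "... = l (hp x i)" using S by simp
 finally show ?thesis .
qed

text \<open>
 A morphism into a cofree module is determined by functionals: \<open>x\<close> goes to the functional
 \<open>b \<mapsto> l(b x)\<close>.
\<close>
definition ihom :: "('v \<times> int) list => (nat => 'm => 'k) => 'm => nat => ('v, 'e, 'k) bq_elem => 'k" where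
 "ihom xs l = (\<lambda>x\<in>carrier M. \<lambda>j\<in>{..<length xs}. \<lambda>b\<in>EI (fst (xs ! j)). l j (b \<odot> x))"

lemma ihom_hom:
 assumes xs: "set xs <= verts Q \<times> UNIV" and l: "!!j. j < length xs ==> functional (snd (xs ! j)) (l j)"
 shows "ihom xs l \<in> gr_hom Q J M (IS xs)"
proof -
 note lmr = left_module.smult_closed[OF lm] left_module.smult_l_distr[OF lm] left_module.smult_r_distr[OF lm]
  left_module.smult_assoc[OF lm]
 note v = xs_nth[OF xs]
 have bA: "b \<in> carrier A" if "j < length xs" "b \<in> EI (fst (xs ! j))" for j b by (rule EI_carrier[OF v[OF that(1)] that(2)])
 have val: "l j (b \<odot> x) = l j (b \<odot> hp x (snd (xs ! j) - int n))"
  if x: "x \<in> carrier M" and j: "j < length xs" and b: "b \<in> bq_degree Q J n" for x j b n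
 proof -
  from b obtain f where f: "b = cls f" "f \<in> HQ n" by (auto simp: bq_degree_def HQ_def KQ_def)
  have "l j (ev f x) = l j (hp (ev f x) (snd (xs ! j)))" using functional_hp[OF l[OF j]] x HQ_KQ[OF f(2)] by simp
  also have "... = l j (ev f (hp x (snd (xs ! j) - int n)))" by (simp add: hp_ev[OF f(2) x])
  finally show ?thesis by (simp add: f(1) ev_def)
 qed
 have dual: "(\<lambda>b\<in>EI (fst (xs ! j)). l j (b \<odot> x)) \<in> graded_dual Q J (fst (xs ! j))"
  if x: "x \<in> carrier M" and j: "j < length xs" for x j
 proof (rule dualI)
  show "(\<lambda>b\<in>EI (fst (xs ! j)). l j (b \<odot> x)) \<in> extensional (EI (fst (xs ! j)))" by simp
  fix a b assume "a \<in> EI (fst (xs ! j))" "b \<in> EI (fst (xs ! j))"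
  then show "(\<lambda>b\<in>EI (fst (xs ! j)). l j (b \<odot> x)) (a \<oplus>\<^bsub>A\<^esub> b) =
    (\<lambda>b\<in>EI (fst (xs ! j)). l j (b \<odot> x)) a + (\<lambda>b\<in>EI (fst (xs ! j)). l j (b \<odot> x)) b"
   using EI_add[OF v[OF j], of a b] bA[OF j, of a] bA[OF j, of b] x
   by (simp add: lmr(2) functional_add[OF l[OF j]] lmr(1))
 next
  fix c a assume a: "a \<in> EI (fst (xs ! j))"
  have "(bq_scalar Q J c \<otimes>\<^bsub>A\<^esub> a) \<odot> x = ev (path_scalar Q c) (a \<odot> x)"
   using lmr(4)[OF scalar_closed bA[OF j a] x] unfolding ev_def bq_scalar_def .
  then show "(\<lambda>b\<in>EI (fst (xs ! j)). l j (b \<odot> x)) (bq_scalar Q J c \<otimes>\<^bsub>A\<^esub> a) = c * (\<lambda>b\<in>EI (fst (xs ! j)). l j (b \<odot> x)) a"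
   using a EI_scalar[OF v[OF j] a] functional_scalar[OF l[OF j] lmr(1)[OF bA[OF j a] x]] by simp
 next
  have "{n. \<exists>a\<in>EI (fst (xs ! j)) \<inter> bq_degree Q J n. (\<lambda>b\<in>EI (fst (xs ! j)). l j (b \<odot> x)) a ~= 0} <=
   {n. hp x (snd (xs ! j) - int n) ~= \<zero>}"
  proof
   fix n assume "n \<in> {n. \<exists>a\<in>EI (fst (xs ! j)) \<inter> bq_degree Q J n. (\<lambda>b\<in>EI (fst (xs ! j)). l j (b \<odot> x)) a ~= 0}"
   then obtain a where a: "a \<in> EI (fst (xs ! j))" "a \<in> bq_degree Q J n" "l j (a \<odot> x) ~= 0" by auto
   obtain f where f: "a = cls f" "f \<in> KQ" using bA[OF j a(1)] by (auto simp: carrier_A)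
   have "a \<odot> \<zero> = \<zero>" using ev_zero_right[OF f(2)] by (simp add: f(1) ev_def)
   then show "n \<in> {n. hp x (snd (xs ! j) - int n) ~= \<zero>}"
    using a(3) val[OF x j a(2)] functional_zero[OF l[OF j]] by auto
  qed
  moreover have "finite {n. hp x (snd (xs ! j) - int n) ~= \<zero>}"
   using finite_vimageI[OF hp_fin[OF x], of "%n. snd (xs ! j) - int n"] by (simp add: vimage_def inj_def)
  ultimately show "finite {n. \<exists>a\<in>EI (fst (xs ! j)) \<inter> bq_degree Q J n. (\<lambda>b\<in>EI (fst (xs ! j)). l j (b \<odot> x)) a ~= 0}"
   by (rule finite_subset)
 qed
 have ap: "ihom xs l x = (\<lambda>j\<in>{..<length xs}. \<lambda>b\<in>EI (fst (xs ! j)). l j (b \<odot> x))" if "x \<in> carrier M" for x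
  using that by (simp add: ihom_def)
 have cl: "ihom xs l x \<in> carrier (IS xs)" if "x \<in> carrier M" for x
  unfolding isum_carrier[OF xs] ap[OF that] using dual[OF that] by simp
 show ?thesis
  unfolding gr_hom_def mem_Collect_eq
 proof (intro conjI ballI allI subsetI)
  show "ihom xs l \<in> carrier M \<rightarrow>\<^sub>E carrier (IS xs)"
   using cl unfolding ihom_def by (simp add: restrict_PiE_iff)
 next
  fix x y assume x: "x \<in> carrier M" and y: "y \<in> carrier M"
  show "ihom xs l (x \<oplus> y) = ihom xs l x \<oplus>\<^bsub>IS xs\<^esub> ihom xs l y"
   unfolding isum_add[OF xs] ap[OF x] ap[OF y] ap[OF ag.a_closed[OF x y]]
  proof (intro restrict_ext)
   fix j b assume "j \<in> {..<length xs}" and b: "b \<in> EI (fst (xs ! j))"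
   then have j: "j < length xs" by simp
   show "l j (b \<odot> (x \<oplus> y)) = (\<lambda>j\<in>{..<length xs}. \<lambda>b\<in>EI (fst (xs ! j)). l j (b \<odot> x)) j b +
     (\<lambda>j\<in>{..<length xs}. \<lambda>b\<in>EI (fst (xs ! j)). l j (b \<odot> y)) j b"
    using j b bA[OF j b] x y by (simp add: lmr(3) functional_add[OF l[OF j]] lmr(1))
  qed
 next
  fix a x assume a: "a \<in> carrier A" and x: "x \<in> carrier M"
  show "ihom xs l (a \<odot> x) = a \<odot>\<^bsub>IS xs\<^esub> ihom xs l x"
   unfolding isum_smult[OF xs] ap[OF x] ap[OF lmr(1)[OF a x]]
  proof (intro restrict_ext)
   fix j b assume "j \<in> {..<length xs}" and b: "b \<in> EI (fst (xs ! j))"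
   then have j: "j < length xs" by simp
   show "l j (b \<odot> (a \<odot> x)) = (\<lambda>j\<in>{..<length xs}. \<lambda>b\<in>EI (fst (xs ! j)). l j (b \<odot> x)) j (b \<otimes>\<^bsub>A\<^esub> a)"
    using j EI_times[OF v[OF j] b a] bA[OF j b] a x by (simp add: lmr(4))
  qed
 next
  fix m y assume "y \<in> ihom xs l ` hcomp M m"
  then obtain x where x: "x \<in> hcomp M m" "y = ihom xs l x" by blast
  have xC: "x \<in> carrier M" by (rule hc_carrier[OF x(1)])
  show "y \<in> hcomp (IS xs) m"
   unfolding isum_hcomp[OF xs] x(2) ap[OF xC]
  proof (intro conjI allI impI)
   fix j assume j: "j < length xs"
   have "l j (b \<odot> x) = 0" if n: "int n ~= - (m - snd (xs ! j))" and b: "b \<in> EI (fst (xs ! j))" "b \<in> bq_degree Q J n" for n b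
   proof -
    from b obtain f where f: "b = cls f" "f \<in> HQ n" by (auto simp: bq_degree_def HQ_def KQ_def)
    have "ev f x \<in> hcomp M (m + int n)" by (rule ev_hc[OF f(2) x(1)])
    from functional_hc[OF l[OF j] this] n show ?thesis by (simp add: f(1) ev_def)
   qed
   then show "(\<lambda>j\<in>{..<length xs}. \<lambda>b\<in>EI (fst (xs ! j)). l j (b \<odot> x)) j \<in> hcomp (gr_inj Q J (fst (xs ! j))) (m - snd (xs ! j))"
    using dual[OF xC j] j by (auto simp: inj_simps)
  qed simp
 qed
qed

lemma ihom_pe:
 assumes "set xs <= verts Q \<times> UNIV" "x \<in> carrier M" "j < length xs" "p \<in> gto (fst (xs ! j))"
 shows "ihom xs l x j (pe p) = l j (ev (single p 1) x)"
 using assms pe_EI[OF xs_nth[OF assms(1,3)] assms(4)] by (simp add: ihom_def ev_def pe_def)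

end

context monomial_quotient
begin

text \<open>
 The transpose of \<^const>\<open>dmap\<close>: for the path \<open>p\<close> into the vertex with number \<open>j\<close>, the value at \<open>p\<close>
 is \<open>\<Sum> bs\<^sub>j(i, a) \<phi>\<^sub>i(a p)\<close>.
\<close>
definition coval :: "'v list => ('v \<times> (nat \<times> 'e => 'k)) list => nat =>
  (nat => ('v, 'e, 'k) bq_elem => 'k) => 'k" where
 "coval xs bs j \<phi> = (\<Sum>i<length xs. \<Sum>a\<in>arcs Q. snd (bs ! j) (i, a) * \<phi> i (pe (tail Q a, [a])))"

definition imap :: "nat => 'v list => ('v \<times> (nat \<times> 'e => 'k)) list =>
  (nat => ('v, 'e, 'k) bq_elem => 'k) => nat => ('v, 'e, 'k) bq_elem => 'k" where
 "imap n xs bs = graded_pre.ihom Q J (IS (colin xs n)) (colin (map fst bs) (Suc n)) (coval xs bs)"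

lemma gto_arc: "a \<in> arcs Q ==> (tail Q a, [a]) \<in> gto (head Q a)"
 by (auto simp: gto_def good_Cons good_Nil path_end_simp)

context
 fixes xs :: "'v list" and R :: "(nat \<times> 'e => 'k) set" and bs :: "('v \<times> (nat \<times> 'e => 'k)) list"
 assumes vs: "set xs <= verts Q" and st: "R.starts_at xs R" and sb: "R.step_basis R bs"
begin

lemma cobs_st: "j < length bs ==> snd (bs ! j) (i, a) ~= 0 ==> i < length xs & a \<in> arcs Q & head Q a = xs ! i"
 using R.step_basis_mem[OF sb, of j] st unfolding R.starts_at_def by blast

lemma cobs_verts: "set (map fst bs) <= verts Q"
proof
 fix v assume "v \<in> set (map fst bs)"
 then obtain j where j: "j < length bs" "v = fst (bs ! j)" by (auto simp: in_set_conv_nth)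
 from R.step_basis_nz[OF sb j(1)] obtain i a where nz: "snd (bs ! j) (i, a) ~= 0" by blast
 have "a \<in> arcs Q" using cobs_st[OF j(1) nz] by simp
 moreover have "tail Q a = v" using R.step_basis_tgt[OF sb j(1) nz] j by simp
 ultimately show "v \<in> verts Q" by auto
qed

lemma coval_functional:
 assumes j: "j < length bs"
 shows "graded_pre.functional Q J (IS (colin xs n)) (- int (Suc n)) (coval xs bs j)"
proof -
 note cv = colin_verts[OF vs, of n]
 interpret I: graded_pre Q J F "IS (colin xs n)" by (rule graded_preI[OF isum_pre[OF cv]])
 have inEI: "pe (tail Q a, [a]) \<in> EI (xs ! i)" if "snd (bs ! j) (i, a) ~= 0" for i a
 proof -
  have s: "i < length xs" "a \<in> arcs Q" "head Q a = xs ! i" using cobs_st[OF j that] by auto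
  have "xs ! i \<in> verts Q" using vs nth_mem[OF s(1)] by blast
  then show ?thesis using pe_EI gto_arc[OF s(2)] s(3) by simp
 qed
 show ?thesis
  unfolding I.functional_def
 proof (intro conjI ballI allI impI)
  fix x y assume "x \<in> carrier (IS (colin xs n))" "y \<in> carrier (IS (colin xs n))"
  have "snd (bs ! j) (i, a) * (x \<oplus>\<^bsub>IS (colin xs n)\<^esub> y) i (pe (tail Q a, [a])) =
    snd (bs ! j) (i, a) * x i (pe (tail Q a, [a])) + snd (bs ! j) (i, a) * y i (pe (tail Q a, [a]))" if i: "i < length xs" for i a
   using i inEI[of i a] by (cases "snd (bs ! j) (i, a) = 0") (simp_all add: isum_add[OF cv] distrib_left)
  then show "coval xs bs j (x \<oplus>\<^bsub>IS (colin xs n)\<^esub> y) = coval xs bs j x + coval xs bs j y"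
   unfolding coval_def by (simp add: sum.distrib)
 next
  fix c x assume x: "x \<in> carrier (IS (colin xs n))"
  have "snd (bs ! j) (i, a) * I.ev (path_scalar Q c) x i (pe (tail Q a, [a])) = c * (snd (bs ! j) (i, a) * x i (pe (tail Q a, [a])))"
   if i: "i < length xs" for i a
  proof (cases "snd (bs ! j) (i, a) = 0")
   case False
   note e = inEI[OF False]
   have v: "xs ! i \<in> verts Q" using vs nth_mem[OF i] by blast
   have a: "a \<in> arcs Q" using cobs_st[OF j False] by blast
   have xi: "x i \<in> graded_dual Q J (xs ! i)" using x i unfolding isum_carrier[OF cv] by simp
   have "pe (tail Q a, [a]) \<otimes>\<^bsub>A\<^esub> cls (path_scalar Q c) = cls (path_times Q (single (tail Q a, [a]) 1) (path_scalar Q c))"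
    using a by (simp add: pe_def cls_mult)
   also have "path_times Q (single (tail Q a, [a]) 1) (path_scalar Q c) = single (tail Q a, [a]) c"
    using path_scalar_times(2)[of "single (tail Q a, [a]) 1" c] a by simp
   also have "cls (single (tail Q a, [a]) c) = bq_scalar Q J c \<otimes>\<^bsub>A\<^esub> pe (tail Q a, [a])"
    using a by (simp add: scalar_pe)
   finally have "I.ev (path_scalar Q c) x i (pe (tail Q a, [a])) = c * x i (pe (tail Q a, [a]))"
    using i e dualD(3)[OF xi e] by (simp add: I.ev_def isum_smult[OF cv])
   then show ?thesis by simp
  qed simp
  note key = this
  show "coval xs bs j (I.ev (path_scalar Q c) x) = c * coval xs bs j x"
   unfolding coval_def sum_distrib_left by (intro sum.cong refl, rule key) simp
 next
  fix m x assume x: "x \<in> hcomp (IS (colin xs n)) m" and m: "m ~= - int (Suc n)"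
  have "snd (bs ! j) (i, a) * x i (pe (tail Q a, [a])) = 0" if i: "i < length xs" for i a
  proof (cases "snd (bs ! j) (i, a) = 0")
   case False
   have a: "a \<in> arcs Q" "head Q a = xs ! i" using cobs_st[OF j False] by auto
   have v: "xs ! i \<in> verts Q" using vs nth_mem[OF i] by blast
   have "x i \<in> hcomp (gr_inj Q J (xs ! i)) (m + int n)" using x i unfolding isum_hcomp[OF cv] by simp
   from inj_hc_pe[OF v this, of "(tail Q a, [a])"] gto_arc[OF a(1)] a(2) m show ?thesis by simp
  qed simp
  then show "coval xs bs j x = 0" unfolding coval_def by (intro sum.neutral ballI) simp
 qed
qed

lemma imap_hom: "imap n xs bs \<in> gr_hom Q J (IS (colin xs n)) (IS (colin (map fst bs) (Suc n)))"
 unfolding imap_def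
 by (rule graded_pre.ihom_hom[OF graded_preI[OF isum_pre[OF colin_verts[OF vs]]] colin_verts[OF cobs_verts]])
  (use coval_functional in simp)

lemma imap_pe:
 assumes \<phi>: "\<phi> \<in> carrier (IS (colin xs n))" and j: "j < length bs" and p: "(w, q) \<in> gto (fst (bs ! j))"
 shows "imap n xs bs \<phi> j (pe (w, q)) =
  (\<Sum>i<length xs. \<Sum>a\<in>arcs Q. if (w, q @ [a]) \<in> good then snd (bs ! j) (i, a) * \<phi> i (pe (w, q @ [a])) else 0)"
proof -
 note cv = colin_verts[OF vs, of n]
 interpret I: graded_pre Q J F "IS (colin xs n)" by (rule graded_preI[OF isum_pre[OF cv]])
 have wq: "(w, q) \<in> good" "path_end Q (w, q) = fst (bs ! j)" using p by (auto simp: gto_def)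
 have "imap n xs bs \<phi> j (pe (w, q)) = coval xs bs j (I.ev (single (w, q) 1) \<phi>)"
  unfolding imap_def by (rule I.ihom_pe[OF colin_verts[OF cobs_verts] \<phi>]) (use j p in simp_all)
 also have "... = (\<Sum>i<length xs. \<Sum>a\<in>arcs Q. if (w, q @ [a]) \<in> good then snd (bs ! j) (i, a) * \<phi> i (pe (w, q @ [a])) else 0)"
  unfolding coval_def
 proof (intro sum.cong refl)
  fix i a assume "i \<in> {..<length xs}" and a: "a \<in> arcs Q"
  then have i: "i < length xs" by simp
  show "snd (bs ! j) (i, a) * I.ev (single (w, q) 1) \<phi> i (pe (tail Q a, [a])) =
    (if (w, q @ [a]) \<in> good then snd (bs ! j) (i, a) * \<phi> i (pe (w, q @ [a])) else 0)"
  proof (cases "snd (bs ! j) (i, a) = 0")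
   case False
   have s: "head Q a = xs ! i" "tail Q a = fst (bs ! j)" using cobs_st[OF j False] R.step_basis_tgt[OF sb j False] by auto
   have v: "xs ! i \<in> verts Q" using vs nth_mem[OF i] by blast
   have \<phi>i: "\<phi> i \<in> graded_dual Q J (xs ! i)" using \<phi> i unfolding isum_carrier[OF cv] by simp
   have e: "pe (tail Q a, [a]) \<in> EI (xs ! i)" using pe_EI[OF v] gto_arc[OF a] s(1) by simp
   have "I.ev (single (w, q) 1) \<phi> i (pe (tail Q a, [a])) = \<phi> i (pe (tail Q a, [a]) \<otimes>\<^bsub>A\<^esub> cls (single (w, q) 1))"
    using i e by (simp add: I.ev_def isum_smult[OF cv])
   also have "pe (tail Q a, [a]) \<otimes>\<^bsub>A\<^esub> cls (single (w, q) 1) = cls (single (w, q @ [a]) 1)"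
    using a wq s(2) by (simp add: pe_def cls_mult[symmetric] good_paths path_times_single)
   also have "cls (single (w, q @ [a]) 1) = (if (w, q @ [a]) \<in> good then pe (w, q @ [a]) else cls 0)"
   proof (cases "(w, q @ [a]) \<in> good")
    case False
    have "(w, q @ [a]) \<in> paths Q" using a wq s(2) by (simp add: good_paths paths_append)
    then have "cls (single (w, q @ [a]) 1) = cls 0"
     using False by (subst cls_eq_iff) (auto simp: lookup_single when_def)
    with False show ?thesis by simp
   qed (simp add: pe_def)
   finally show ?thesis using dual_zero[OF v \<phi>i] by simp
  qed simp
 qed
 finally show ?thesis .
qed

end

text \<open>
 An element \<open>\<psi>\<close> of the kernel is annihilated by all syzygies, hence its values at the paths that begin with
 a given path and end with \<open>b\<close> are combinations of rows; the coefficients of these combinations are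
 the values of a preimage.  They are chosen to be zero where \<open>\<psi>\<close> vanishes, so that the preimage lives in
 finitely many degrees.
\<close>
lemma imap_exact:
 assumes vs: "set xs <= verts Q" and st: "R.starts_at xs R" and sb: "R.step_basis R bs"
  and sc: "R.step_basis (R.syzygies bs) cs"
 shows "gr_im (IS (colin xs n)) (imap n xs bs) =
  gr_ker (IS (colin (map fst bs) (Suc n))) (IS (colin (map fst cs) (Suc (Suc n)))) (imap (Suc n) (map fst bs) cs)"
proof -
 let ?ys = "map fst bs" and ?zs = "map fst cs"
 note vb = cobs_verts[OF vs st sb]
 note sts = R.starts_at_syzygies[of bs]
 note vc = cobs_verts[OF vb sts sc]
 let ?I0 = "IS (colin xs n)" and ?I1 = "IS (colin ?ys (Suc n))" and ?I2 = "IS (colin ?zs (Suc (Suc n)))"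
 interpret H1: graded_hom Q J F ?I0 ?I1 "imap n xs bs"
  by (intro graded_homI graded_preI isum_pre colin_verts vb vs imap_hom[OF vs st sb])
 interpret H2: graded_hom Q J F ?I1 ?I2 "imap (Suc n) ?ys cs"
  by (intro graded_homI graded_preI isum_pre colin_verts vb vc imap_hom[OF vb sts sc])
 have cs_syz: "snd (cs ! l) \<in> R.syzygies bs" if "l < length cs" for l by (rule R.step_basis_mem[OF sc that])
 have zero2: "\<zero>\<^bsub>?I2\<^esub> l (pe p) = 0" if "l < length cs" "p \<in> gto (fst (cs ! l))" for l p
 proof -
  have "fst (cs ! l) \<in> verts Q" using vc that(1) by (auto simp: subset_iff)
  from pe_EI[OF this that(2)] that(1) show ?thesis by (simp add: isum_zero[OF colin_verts[OF vc]])
 qed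
 show ?thesis
 proof (intro equalityI subsetI)
  fix \<psi> assume "\<psi> \<in> gr_im ?I0 (imap n xs bs)"
  then obtain \<phi> where \<phi>: "\<phi> \<in> carrier ?I0" "\<psi> = imap n xs bs \<phi>" by (auto simp: gr_im_def)
  have \<psi>: "\<psi> \<in> carrier ?I1" using \<phi> by simp
  have "imap (Suc n) ?ys cs \<psi> = \<zero>\<^bsub>?I2\<^esub>"
  proof (rule isum_ext[OF colin_verts[OF vc]])
   fix l p assume "l < length (colin ?zs (Suc (Suc n)))" and p: "p \<in> gto (fst (colin ?zs (Suc (Suc n)) ! l))"
   then have l: "l < length cs" and p': "p \<in> gto (fst (cs ! l))" by simp_all
   obtain w q where pw: "p = (w, q)" by (cases p)
   have "imap (Suc n) ?ys cs \<psi> l (pe (w, q)) =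
    (\<Sum>j<length bs. \<Sum>b\<in>arcs Q. if (w, q @ [b]) \<in> good then snd (cs ! l) (j, b) * \<psi> j (pe (w, q @ [b])) else 0)"
    using imap_pe[OF vb sts sc \<psi> l p'[unfolded pw]] by simp
   also have "... = (\<Sum>j<length bs. \<Sum>b\<in>arcs Q. \<Sum>i<length xs. \<Sum>a\<in>arcs Q.
     if (w, q @ [b, a]) \<in> good then (snd (bs ! j) (i, a) * snd (cs ! l) (j, b)) * \<phi> i (pe (w, q @ [b, a])) else 0)"
   proof (intro sum.cong refl)
    fix j b assume "j \<in> {..<length bs}" and b: "b \<in> arcs Q"
    then have j: "j < length bs" by simp
    show "(if (w, q @ [b]) \<in> good then snd (cs ! l) (j, b) * \<psi> j (pe (w, q @ [b])) else 0) =
     (\<Sum>i<length xs. \<Sum>a\<in>arcs Q. if (w, q @ [b, a]) \<in> good then (snd (bs ! j) (i, a) * snd (cs ! l) (j, b)) * \<phi> i (pe (w, q @ [b, a])) else 0)"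
    proof (cases "(w, q @ [b]) \<in> good & snd (cs ! l) (j, b) ~= 0")
     case True
     then have "head Q b = fst (bs ! j)" using cobs_st[OF vb sts sc l, of j b] j by simp
     then have "(w, q @ [b]) \<in> gto (fst (bs ! j))" using True by (simp add: gto_def path_end_simp)
     from imap_pe[OF vs st sb \<phi>(1) j this] have "\<psi> j (pe (w, q @ [b])) =
      (\<Sum>i<length xs. \<Sum>a\<in>arcs Q. if (w, q @ [b, a]) \<in> good then snd (bs ! j) (i, a) * \<phi> i (pe (w, q @ [b, a])) else 0)"
      by (simp only: \<phi>(2) append_assoc append.simps)
     then have "snd (cs ! l) (j, b) * \<psi> j (pe (w, q @ [b])) = (\<Sum>i<length xs. \<Sum>a\<in>arcs Q. snd (cs ! l) (j, b) *
      (if (w, q @ [b, a]) \<in> good then snd (bs ! j) (i, a) * \<phi> i (pe (w, q @ [b, a])) else 0))"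
      by (simp only: sum_distrib_left)
     also have "... = (\<Sum>i<length xs. \<Sum>a\<in>arcs Q. if (w, q @ [b, a]) \<in> good then (snd (bs ! j) (i, a) * snd (cs ! l) (j, b)) * \<phi> i (pe (w, q @ [b, a])) else 0)"
      by (intro sum.cong refl) simp
     finally show ?thesis using True by simp
    next
     case False
     have "(w, q @ [b, a]) ~: good" if "(w, q @ [b]) ~: good" for a
      using that good_snoc[of w "q @ [b]" a] by simp
     then have "(if (w, q @ [b, a]) \<in> good then (snd (bs ! j) (i, a) * snd (cs ! l) (j, b)) * \<phi> i (pe (w, q @ [b, a])) else 0) = 0" for i a
      using False by auto
     then show ?thesis using False by auto
    qed
   qed
   also have "... = (\<Sum>b\<in>arcs Q. \<Sum>i<length xs. \<Sum>a\<in>arcs Q. \<Sum>j<length bs.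
     if (w, q @ [b, a]) \<in> good then (snd (bs ! j) (i, a) * snd (cs ! l) (j, b)) * \<phi> i (pe (w, q @ [b, a])) else 0)"
    by (rule trans[OF sum.swap sum.cong[OF refl trans[OF sum.swap sum.cong[OF refl sum.swap]]]])
   also have "... = 0"
   proof (rule sum.neutral, rule ballI, rule sum.neutral, rule ballI, rule sum.neutral, rule ballI)
    fix b i a assume b: "b \<in> arcs Q" and a: "a \<in> arcs Q"
    show "(\<Sum>j<length bs. if (w, q @ [b, a]) \<in> good then (snd (bs ! j) (i, a) * snd (cs ! l) (j, b)) * \<phi> i (pe (w, q @ [b, a])) else 0) = 0"
    proof (cases "(w, q @ [b, a]) \<in> good")
     case True
     then have "head Q b = tail Q a" "(b, a) ~: F" using good_snoc[of w "q @ [b]" a] by (auto simp: path_end_simp)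
     then have "(\<Sum>j<length bs. snd (bs ! j) (i, a) * snd (cs ! l) (j, b)) = 0"
      using cs_syz[OF l] a b by (simp add: R.syzygies_def)
     with True show ?thesis by (simp add: sum_distrib_right[symmetric])
    qed simp
   qed
   finally show "imap (Suc n) ?ys cs \<psi> l (pe p) = \<zero>\<^bsub>?I2\<^esub> l (pe p)" using zero2[OF l p'] by (simp add: pw)
  qed (use \<psi> in auto)
  then show "\<psi> \<in> gr_ker ?I1 ?I2 (imap (Suc n) ?ys cs)" using \<psi> by (simp add: gr_ker_def)
 next
  fix \<psi> assume "\<psi> \<in> gr_ker ?I1 ?I2 (imap (Suc n) ?ys cs)"
  then have \<psi>: "\<psi> \<in> carrier ?I1" and d\<psi>: "imap (Suc n) ?ys cs \<psi> = \<zero>\<^bsub>?I2\<^esub>" by (auto simp: gr_ker_def)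
  have \<psi>j: "\<psi> j \<in> graded_dual Q J (fst (bs ! j))" if "j < length bs" for j
   using \<psi> that unfolding isum_carrier[OF colin_verts[OF vb]] by simp
  \<comment> \<open>every syzygy annihilates the values of \<open>\<psi>\<close>, not only the chosen basis\<close>
  have ann: "(\<Sum>j<length bs. \<Sum>b\<in>arcs Q. if (w, q @ [b]) \<in> good then r (j, b) * \<psi> j (pe (w, q @ [b])) else 0) = 0"
   if r: "r \<in> R.syzygies bs" and wq: "(w, q) \<in> good" for r w q
  proof -
   have basis: "(\<Sum>j<length bs. \<Sum>b\<in>arcs Q. if (w, q @ [b]) \<in> good then snd (cs ! l) (j, b) * \<psi> j (pe (w, q @ [b])) else 0) = 0"
    if l: "l < length cs" for l
   proof (cases "path_end Q (w, q) = fst (cs ! l)")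
    case True
    then have p: "(w, q) \<in> gto (fst (cs ! l))" using wq by (simp add: gto_def)
    show ?thesis using imap_pe[OF vb sts sc \<psi> l p] zero2[OF l p] by (simp add: d\<psi>)
   next
    case False
    have "snd (cs ! l) (j, b) = 0" if "(w, q @ [b]) \<in> good" for j b
     using that False R.step_basis_tgt[OF sc l, of j b] by (auto simp: good_snoc)
    then show ?thesis by (intro sum.neutral ballI) simp
   qed
   from R.step_basis_span[OF sc r] obtain t where "\<forall>j b. r (j, b) = (\<Sum>l<length cs. t l * snd (cs ! l) (j, b))" ..
   then have t: "r (j, b) = (\<Sum>l<length cs. t l * snd (cs ! l) (j, b))" for j b by simp
   have tr: "(if c then r (j, b) * y else 0) = (\<Sum>l<length cs. t l * (if c then snd (cs ! l) (j, b) * y else 0))" for c j b y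
    by (cases c) (simp_all only: t if_True if_False sum_distrib_right mult.assoc mult_zero_right sum.neutral_const)
   have "(\<Sum>j<length bs. \<Sum>b\<in>arcs Q. if (w, q @ [b]) \<in> good then r (j, b) * \<psi> j (pe (w, q @ [b])) else 0) =
    (\<Sum>j<length bs. \<Sum>b\<in>arcs Q. \<Sum>l<length cs. t l * (if (w, q @ [b]) \<in> good then snd (cs ! l) (j, b) * \<psi> j (pe (w, q @ [b])) else 0))"
    by (intro sum.cong refl tr)
   also have "... = (\<Sum>j<length bs. \<Sum>l<length cs. \<Sum>b\<in>arcs Q. t l * (if (w, q @ [b]) \<in> good then snd (cs ! l) (j, b) * \<psi> j (pe (w, q @ [b])) else 0))"
    by (intro sum.cong refl sum.swap)
   also have "... = (\<Sum>l<length cs. \<Sum>j<length bs. \<Sum>b\<in>arcs Q. t l * (if (w, q @ [b]) \<in> good then snd (cs ! l) (j, b) * \<psi> j (pe (w, q @ [b])) else 0))"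
    by (rule sum.swap)
   also have "... = (\<Sum>l<length cs. t l * (\<Sum>j<length bs. \<Sum>b\<in>arcs Q. if (w, q @ [b]) \<in> good then snd (cs ! l) (j, b) * \<psi> j (pe (w, q @ [b])) else 0))"
    by (simp only: sum_distrib_left)
   also have "... = 0" by (simp add: basis)
   finally show ?thesis .
  qed
  obtain s0 where s0: "\<forall>j<length bs. \<psi> j (pe (fst (bs ! j), [])) = (\<Sum>(i, a)\<in>{..<length xs} \<times> arcs Q. s0 (i, a) * snd (bs ! j) (i, a))"
   using R.dual_generators[OF st sb, of "%j. \<psi> j (pe (fst (bs ! j), []))"] by blast
  define K where "K b = {(i, a). i < length xs & a \<in> arcs Q & tail Q a = head Q b & (b, a) ~: F}" for b
  have exs: "\<exists>s. (\<forall>j<length bs. fst (bs ! j) = head Q b -->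
    \<psi> j (pe (w, q @ [b])) = (\<Sum>(i, a)\<in>K b. s (i, a) * snd (bs ! j) (i, a))) &
    ((\<forall>j<length bs. fst (bs ! j) = head Q b --> \<psi> j (pe (w, q @ [b])) = 0) --> s = (%_. 0))"
   if g: "(w, q @ [b]) \<in> good" for w q b
  proof (cases "\<forall>j<length bs. fst (bs ! j) = head Q b --> \<psi> j (pe (w, q @ [b])) = 0")
   case True
   then show ?thesis by (intro exI[of _ "%_. 0"]) simp
  next
   case False
   have b: "b \<in> arcs Q" "(w, q) \<in> good" using g by (auto simp: good_snoc)
   have "(\<Sum>j<length bs. snd (cs ! l) (j, b) * \<psi> j (pe (w, q @ [b]))) = 0" if l: "l < length cs" for l
   proof -
    define r where "r = (%(j, b'). if b' = b then snd (cs ! l) (j, b') else 0)"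
    have "(\<Sum>j<length bs. snd (bs ! j) (i, a) * r (j, b')) = 0"
     if "b' \<in> arcs Q" "a \<in> arcs Q" "tail Q a = head Q b'" "(b', a) ~: F" for i a b'
     using cs_syz[OF l] that by (cases "b' = b") (simp_all add: r_def R.syzygies_def)
    moreover have "j < length bs & b' \<in> arcs Q & head Q b' = fst (bs ! j)" if "r (j, b') ~= 0" for j b'
     using cobs_st[OF vb sts sc l, of j b'] that by (auto simp: r_def split: if_splits)
    ultimately have "r \<in> R.syzygies bs" unfolding R.syzygies_def by simp
    from ann[OF this b(2)] have "(\<Sum>j<length bs. \<Sum>b'\<in>arcs Q. if b' = b then snd (cs ! l) (j, b) * \<psi> j (pe (w, q @ [b])) else 0) = 0"
     by (rule trans[rotated], intro sum.cong refl) (auto simp: r_def g)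
    then show ?thesis using b(1) by simp
   qed
   from R.dual_syzygy_combination[OF sc b(1) st sb this]
   show ?thesis using False unfolding K_def by blast
  qed
  define s where "s w q b = (SOME s. (\<forall>j<length bs. fst (bs ! j) = head Q b -->
    \<psi> j (pe (w, q @ [b])) = (\<Sum>(i, a)\<in>K b. s (i, a) * snd (bs ! j) (i, a))) &
    ((\<forall>j<length bs. fst (bs ! j) = head Q b --> \<psi> j (pe (w, q @ [b])) = 0) --> s = (%_. 0)))" for w q b
  note s = someI_ex[OF exs, folded s_def]
  define V where "V i p = (if snd p = [] then 0 else if butlast (snd p) = [] then s0 (i, last (snd p))
    else s (fst p) (butlast (butlast (snd p))) (last (butlast (snd p))) (i, last (snd p)))" for i and p :: "('v, 'e) path"
  define \<phi> where "\<phi> = (\<lambda>i\<in>{..<length xs}. mkd (xs ! i) (V i))"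
  have xv: "xs ! i \<in> verts Q" if "i < length xs" for i using vs nth_mem[OF that] by blast
  define D where "D = (\<Union>j<length bs. {n. \<exists>a\<in>EI (fst (bs ! j)) \<inter> bq_degree Q J n. \<psi> j a ~= 0})"
  have D: "finite D" using dualD(4)[OF \<psi>j] by (simp add: D_def)
  have Vfin: "finite {n. \<exists>p\<in>gto (xs ! i). length (snd p) = n & V i p ~= 0}" for i
  proof (rule finite_subset)
   show "{n. \<exists>p\<in>gto (xs ! i). length (snd p) = n & V i p ~= 0} <= insert 1 (Suc ` D)"
   proof
    fix n assume "n \<in> {n. \<exists>p\<in>gto (xs ! i). length (snd p) = n & V i p ~= 0}"
    then obtain w r where p: "(w, r) \<in> gto (xs ! i)" "length r = n" "V i (w, r) ~= 0" by auto
    show "n \<in> insert 1 (Suc ` D)"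
    proof (cases r rule: rev_cases)
     case Nil
     then show ?thesis using p(3) by (simp add: V_def)
    next
     case (snoc r' a)
     show ?thesis
     proof (cases r' rule: rev_cases)
      case Nil
      then show ?thesis using p(2) snoc by simp
     next
      case (snoc q b)
      then have r: "r = q @ [b] @ [a]" using \<open>r = r' @ [a]\<close> by simp
      have g: "(w, q @ [b]) \<in> good" using p(1) good_snoc[of w "q @ [b]" a] by (simp add: r gto_def)
      have "s w q b (i, a) ~= 0" using p(3) by (simp add: V_def r butlast_append)
      then have "s w q b ~= (%_. 0)" by auto
      then obtain j where j: "j < length bs" "fst (bs ! j) = head Q b" "\<psi> j (pe (w, q @ [b])) ~= 0" using s[OF g] by blast
      have "(w, q @ [b]) \<in> gto (fst (bs ! j))" using g j(2) by (simp add: gto_def path_end_simp)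
      moreover have "fst (bs ! j) \<in> verts Q" using vb j(1) by (auto simp: subset_iff)
      ultimately have "pe (w, q @ [b]) \<in> EI (fst (bs ! j)) \<inter> bq_degree Q J (length (q @ [b]))"
       using pe_EI pe_degree[OF g] by simp
      then have "length (q @ [b]) \<in> D" using j(1,3) by (auto simp: D_def)
      then have "Suc (length (q @ [b])) \<in> Suc ` D" by (rule imageI)
      then show ?thesis using p(2) by (simp add: r)
     qed
    qed
   qed
  qed (use D in simp)
  have \<phi>C: "\<phi> \<in> carrier ?I0"
   unfolding isum_carrier[OF colin_verts[OF vs]] \<phi>_def using mkd_dual[OF xv Vfin] by simp
  have \<phi>pe: "\<phi> i (pe p) = V i p" if "i < length xs" "p \<in> gto (xs ! i)" for i p
   using that mkd_pe[OF xv[OF that(1)] that(2)] by (simp add: \<phi>_def)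
  have "imap n xs bs \<phi> = \<psi>"
  proof (rule isum_ext[OF colin_verts[OF vb] _ \<psi>])
   show "imap n xs bs \<phi> \<in> carrier ?I1" using \<phi>C by simp
   fix j p assume "j < length (colin ?ys (Suc n))" and p: "p \<in> gto (fst (colin ?ys (Suc n) ! j))"
   then have j: "j < length bs" and p': "p \<in> gto (fst (bs ! j))" by simp_all
   obtain w q where pw: "p = (w, q)" by (cases p)
   have wq: "(w, q) \<in> good" "path_end Q (w, q) = fst (bs ! j)" using p' by (simp_all add: gto_def pw)
   have eq: "imap n xs bs \<phi> j (pe (w, q)) =
    (\<Sum>i<length xs. \<Sum>a\<in>arcs Q. if (w, q @ [a]) \<in> good then snd (bs ! j) (i, a) * V i (w, q @ [a]) else 0)"
    unfolding imap_pe[OF vs st sb \<phi>C j p'[unfolded pw]]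
   proof (intro sum.cong refl)
    fix i a assume "i \<in> {..<length xs}" and a: "a \<in> arcs Q"
    then have i: "i < length xs" by simp
    show "(if (w, q @ [a]) \<in> good then snd (bs ! j) (i, a) * \<phi> i (pe (w, q @ [a])) else 0) =
     (if (w, q @ [a]) \<in> good then snd (bs ! j) (i, a) * V i (w, q @ [a]) else 0)"
    proof (cases "(w, q @ [a]) \<in> good & snd (bs ! j) (i, a) ~= 0")
     case True
     then have "(w, q @ [a]) \<in> gto (xs ! i)" using cobs_st[OF vs st sb j, of i a] by (simp add: gto_def path_end_simp)
     then show ?thesis using \<phi>pe[OF i] by simp
    qed auto
   qed
   show "imap n xs bs \<phi> j (pe p) = \<psi> j (pe p)"
   proof (cases q rule: rev_cases)
    case Nil
    then have w: "w = fst (bs ! j)" using wq(2) by (simp add: path_end_simp)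
    have "imap n xs bs \<phi> j (pe (w, q)) = (\<Sum>i<length xs. \<Sum>a\<in>arcs Q. s0 (i, a) * snd (bs ! j) (i, a))"
     unfolding eq
    proof (intro sum.cong refl)
     fix i a assume a: "a \<in> arcs Q"
     have "(w, [a]) \<in> good" if "snd (bs ! j) (i, a) ~= 0"
      using R.step_basis_tgt[OF sb j that] a w by (auto simp: good_Cons good_Nil)
     then show "(if (w, q @ [a]) \<in> good then snd (bs ! j) (i, a) * V i (w, q @ [a]) else 0) = s0 (i, a) * snd (bs ! j) (i, a)"
      by (cases "snd (bs ! j) (i, a) = 0") (simp_all add: Nil V_def)
    qed
    also have "... = \<psi> j (pe (w, q))" using s0 j w Nil by (simp add: sum.cartesian_product)
    finally show ?thesis by (simp add: pw)
   next
    case (snoc q' b)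
    have g: "(w, q' @ [b]) \<in> good" using wq(1) by (simp add: snoc)
    have hb: "head Q b = fst (bs ! j)" using wq(2) by (simp add: snoc path_end_simp)
    have "imap n xs bs \<phi> j (pe (w, q)) = (\<Sum>i<length xs. \<Sum>a\<in>arcs Q. if (i, a) \<in> K b then s w q' b (i, a) * snd (bs ! j) (i, a) else 0)"
     unfolding eq
    proof (intro sum.cong refl)
     fix i a assume "i \<in> {..<length xs}" and a: "a \<in> arcs Q"
     then have i: "i < length xs" by simp
     have "(w, q @ [a]) \<in> good \<longleftrightarrow> tail Q a = head Q b & (b, a) ~: F"
      using good_snoc[of w q a] wq a hb by (auto simp: snoc)
     then show "(if (w, q @ [a]) \<in> good then snd (bs ! j) (i, a) * V i (w, q @ [a]) else 0) =
       (if (i, a) \<in> K b then s w q' b (i, a) * snd (bs ! j) (i, a) else 0)"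
      using i a by (simp add: K_def V_def snoc butlast_append)
    qed
    also have "... = (\<Sum>x\<in>{..<length xs} \<times> arcs Q. if x \<in> K b then s w q' b x * snd (bs ! j) x else 0)"
     by (simp add: sum.cartesian_product case_prod_unfold cong: if_cong)
    also have "... = (\<Sum>x\<in>K b. s w q' b x * snd (bs ! j) x)"
     by (rule sum.mono_neutral_cong_right) (auto simp: K_def)
    also have "... = \<psi> j (pe (w, q))" using s[OF g] j hb by (simp add: snoc case_prod_unfold)
    finally show ?thesis by (simp add: pw)
   qed
  qed
  then show "\<psi> \<in> gr_im ?I0 (imap n xs bs)" using \<phi>C by (auto simp: gr_im_def)
 qed
qed

end

section \<open>Modules with quadratic copresentation are coKoszul\<close>

text \<open>
 The dual of the description of the kernel of a projective cover.  The elements \<open>a \<phi>\<close> are images by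
 induction on the distance from degree \<open>0\<close>; quadratic corelations glue their preimages to an element
 \<open>x\<close>, and \<open>e x - \<phi>\<close> is killed by all arrows, hence zero.
\<close>
lemma (in monomial_quotient) image_lift:
 assumes he: "graded_hom Q J F M I e" and hd: "graded_hom Q J F I I1 d"
  and cogen: "!!m. m < 0 ==> graded_pre.cogen_at Q J I m"
  and corel: "!!m. m \<le> - 2 ==> graded_pre.corel_at Q J F M m"
  and inj: "!!m x. x \<in> hcomp M m ==> e x = \<zero>\<^bsub>I\<^esub> ==> x = \<zero>\<^bsub>M\<^esub>"
  and base: "!!\<phi>. \<phi> \<in> hcomp I (- 1) ==> d \<phi> = \<zero>\<^bsub>I1\<^esub> ==> \<exists>x\<in>hcomp M (- 1). e x = \<phi>"
 shows "\<phi> \<in> hcomp I (- int (Suc n)) ==> d \<phi> = \<zero>\<^bsub>I1\<^esub> ==> \<exists>x\<in>hcomp M (- int (Suc n)). e x = \<phi>"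
proof (induction n arbitrary: \<phi>)
 case 0
 then show ?case using base by simp
next
 case (Suc n)
 interpret e: graded_hom Q J F M I e by fact
 interpret d: graded_hom Q J F I I1 d by fact
 define m where "m = - int (Suc (Suc n))"
 have m: "m \<le> - 2" "- int (Suc n) = m + 1" by (simp_all add: m_def)
 have \<phi>: "\<phi> \<in> hcomp I m" "d \<phi> = \<zero>\<^bsub>I1\<^esub>" using Suc.prems by (auto simp: m_def)
 have \<phi>C: "\<phi> \<in> carrier I" using \<phi>(1) by (rule e.cod.hc_carrier)
 have "\<exists>x\<in>hcomp M (m + 1). e x = e.cod.ev (arr a) \<phi>" if a: "a \<in> arcs Q" for a
  unfolding m(2)[symmetric]
 proof (rule Suc.IH)
  show "e.cod.ev (arr a) \<phi> \<in> hcomp I (- int (Suc n))" unfolding m(2) by (rule e.cod.arr_hc[OF a \<phi>(1)])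
  show "d (e.cod.ev (arr a) \<phi>) = \<zero>\<^bsub>I1\<^esub>" using a \<phi>C \<phi>(2) by (simp add: d.f_ev)
 qed
 then have "\<forall>a. \<exists>x. a \<in> arcs Q --> x \<in> hcomp M (m + 1) & e x = e.cod.ev (arr a) \<phi>" by blast
 from choice[OF this] obtain z where "\<forall>a. a \<in> arcs Q --> z a \<in> hcomp M (m + 1) & e (z a) = e.cod.ev (arr a) \<phi>" ..
 then have z: "z a \<in> hcomp M (m + 1)" "e (z a) = e.cod.ev (arr a) \<phi>" if "a \<in> arcs Q" for a using that by blast+
 have zC: "z a \<in> carrier M" if "a \<in> arcs Q" for a using z(1)[OF that] by (rule e.dom.hc_carrier)
 define y where "y a = e.dom.ev (vtx (head Q a)) (z a)" for a
 have yh: "y a \<in> hcomp M (m + 1)" if "a \<in> arcs Q" for a unfolding y_def using that by (intro e.dom.vtx_hc z) auto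
 have yC: "y a \<in> carrier M" if "a \<in> arcs Q" for a using yh[OF that] by (rule e.dom.hc_carrier)
 have ye: "e (y a) = e.cod.ev (arr a) \<phi>" if "a \<in> arcs Q" for a
  using that zC z(2) \<phi>C by (simp add: y_def e.f_ev e.cod.ev_times[symmetric] vtx_times_arr)
 have yv: "e.dom.ev (vtx (head Q a)) (y a) = y a" if "a \<in> arcs Q" for a
  using that zC by (simp add: y_def e.dom.ev_times[symmetric] vtx_times_vtx)
 have yF: "e.dom.ev (arr b) (y a) = \<zero>\<^bsub>M\<^esub>" if ab: "(a, b) \<in> F" for a b
 proof (rule inj)
  have arcs: "a \<in> arcs Q" "b \<in> arcs Q" using F_arcs[OF ab] by auto
  show "e.dom.ev (arr b) (y a) \<in> hcomp M (m + 1 + 1)" by (rule e.dom.arr_hc[OF arcs(2) yh[OF arcs(1)]])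
  show "e (e.dom.ev (arr b) (y a)) = \<zero>\<^bsub>I\<^esub>"
   using arcs yC ye e.cod.ev_arr_F[OF ab \<phi>C] by (simp add: e.f_ev)
 qed
 from e.dom.corel_atD[OF corel[OF m(1)] yh yv yF] obtain x where
  x: "x \<in> hcomp M m" "\<forall>a\<in>arcs Q. e.dom.ev (arr a) x = y a" by blast
 have xC: "x \<in> carrier M" using x(1) by (rule e.dom.hc_carrier)
 have "e x \<oplus>\<^bsub>I\<^esub> (\<ominus>\<^bsub>I\<^esub> \<phi>) = \<zero>\<^bsub>I\<^esub>"
 proof (rule cogen[of m, unfolded e.cod.cogen_at_def, THEN bspec, THEN mp])
  show "m < 0" using m(1) by simp
  show "e x \<oplus>\<^bsub>I\<^esub> (\<ominus>\<^bsub>I\<^esub> \<phi>) \<in> hcomp I m" by (intro e.cod.hc_add e.cod.hc_minus e.f_hc x(1) \<phi>(1))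
  show "\<forall>a\<in>arcs Q. e.cod.ev (arr a) (e x \<oplus>\<^bsub>I\<^esub> (\<ominus>\<^bsub>I\<^esub> \<phi>)) = \<zero>\<^bsub>I\<^esub>"
  proof
   fix a assume a: "a \<in> arcs Q"
   have "e.cod.ev (arr a) (e x) = e.cod.ev (arr a) \<phi>"
    using a xC x(2) ye by (simp add: e.f_ev[symmetric])
   then show "e.cod.ev (arr a) (e x \<oplus>\<^bsub>I\<^esub> (\<ominus>\<^bsub>I\<^esub> \<phi>)) = \<zero>\<^bsub>I\<^esub>"
    using a xC \<phi>C by (simp add: e.cod.ev_add_right e.cod.ev_minus e.cod.ag.r_neg)
  qed
 qed
 then have "e x = \<phi>" using xC \<phi>C by (metis e.cod.ag.minus_equality e.cod.ag.minus_minus e.cod.ag.a_inv_closed e.f_closed)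
 then show ?case using x(1) by (auto simp: m_def)
qed

context graded_mod
begin

text \<open>
 The coordinates in degree \<open>0\<close> embed the module into a sum of injectives.  The linear conditions \<open>R\<close> that
 hold for the products of arrows with elements of degree \<open>-1\<close> cut out the image in degree \<open>-1\<close> by the
 double annihilator theorem, and then in all lower degrees.
\<close>
theorem cokoszul_if_quadratic:
 assumes pos: "!!m x. 0 < m ==> x \<in> hcomp M m ==> x = \<zero>"
  and cogen: "!!m. m < 0 ==> cogen_at m" and corel: "!!m. m \<le> - 2 ==> corel_at m"
 shows "cokoszul Q J M"
proof -
 obtain hb where hb: "\<forall>(v, b)\<in>set hb. v \<in> verts Q & b \<in> hcomp M 0 & ev (vtx v) b = b"
  "\<forall>t. (\<Oplus>j\<in>{..<length hb}. ev (single (fst (hb ! j), []) (t j)) (snd (hb ! j))) = \<zero> --> (\<forall>j<length hb. t j = 0)"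
  "\<forall>x\<in>hcomp M 0. \<exists>t. x = (\<Oplus>j\<in>{..<length hb}. ev (single (fst (hb ! j), []) (t j)) (snd (hb ! j)))"
  using homogeneous_basis[of 0] by (elim exE conjE)
 define xs where "xs = map fst hb"
 define b where "b j = snd (hb ! j)" for j
 have xs_nth: "fst (hb ! j) = xs ! j" if "j < length hb" for j using that by (simp add: xs_def)
 have len: "length xs = length hb" by (simp add: xs_def)
 have bh: "xs ! j \<in> verts Q" "b j \<in> hcomp M 0" if "j < length hb" for j
  using bspec[OF hb(1) nth_mem[OF that]] xs_nth[OF that] by (auto simp: b_def case_prod_unfold)
 have vs: "set xs <= verts Q" using bh(1) by (auto simp: in_set_conv_nth len)
 have bC: "b j \<in> carrier M" if "j < length hb" for j using bh(2)[OF that] by (rule hc_carrier)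
 define comb where "comb t = (\<Oplus>j\<in>{..<length hb}. ev (single (xs ! j, []) (t j)) (b j))" for t
 have comb': "(\<Oplus>j\<in>{..<length hb}. ev (single (fst (hb ! j), []) (t j)) (snd (hb ! j))) = comb t" for t
  unfolding comb_def by (rule ag.finsum_cong') (use bh bC xs_nth in "auto simp: b_def")
 note indep = hb(2)[unfolded comb'] and span = hb(3)[unfolded comb']
 have elC: "(%j. ev (single (xs ! j, []) (t j)) (b j)) \<in> {..<length hb} \<rightarrow> carrier M" for t
  using bh bC by (intro Pi_I ev_closed) auto
 have combC: "comb t \<in> carrier M" for t unfolding comb_def by (rule ag.finsum_closed[OF elC])
 have combh: "comb t \<in> hcomp M 0" for t
  unfolding comb_def
 proof (rule hc_finsum)
  fix j assume "j \<in> {..<length hb}"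
  then have j: "j < length hb" by simp
  show "ev (single (xs ! j, []) (t j)) (b j) \<in> hcomp M 0"
   using ev_hc[OF HQ_single[of "(xs ! j, [])" "t j"] bh(2)[OF j]] bh(1)[OF j] by simp
 qed
 have comb_add: "comb (%j. t j + t' j) = comb t \<oplus> comb t'" for t t'
 proof -
  have "comb (%j. t j + t' j) = (\<Oplus>j\<in>{..<length hb}. ev (single (xs ! j, []) (t j)) (b j) \<oplus> ev (single (xs ! j, []) (t' j)) (b j))"
   unfolding comb_def using bh bC by (intro ag.finsum_cong') (auto simp: single_add ev_add_left)
  then show ?thesis unfolding comb_def using elC by (simp add: ag.finsum_addf)
 qed
 have comb_path: "ev f (comb t) = comb t'"
  if f: "f \<in> KQ" "!!j. j < length hb ==> path_times Q f (single (xs ! j, []) (t j)) = single (xs ! j, []) (t' j)" for f t t'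
 proof -
  have "ev f (comb t) = (\<Oplus>j\<in>{..<length hb}. ev f (ev (single (xs ! j, []) (t j)) (b j)))"
   unfolding comb_def by (rule ev_finsum_right[OF f(1) elC])
  also have "... = comb t'"
   unfolding comb_def
  proof (rule ag.finsum_cong'[OF refl elC])
   fix j assume "j \<in> {..<length hb}"
   then have j: "j < length hb" by simp
   show "ev f (ev (single (xs ! j, []) (t j)) (b j)) = ev (single (xs ! j, []) (t' j)) (b j)"
    using bh(1)[OF j] bC[OF j] f(1) by (simp add: ev_times[symmetric] f(2)[OF j])
  qed
  finally show ?thesis .
 qed
 have comb_scale: "ev (path_scalar Q c) (comb t) = comb (%j. c * t j)" for c t
 proof (rule comb_path)
  fix j assume "j < length hb"
  then show "path_times Q (path_scalar Q c) (single (xs ! j, []) (t j)) = single (xs ! j, [] :: 'e list) (c * t j)"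
   using path_scalar_times(1)[of "single (xs ! j, []) (t j)" c] bh(1) by auto
 qed (use scalar_HQ HQ_KQ in blast)
 have comb_vtx: "ev (vtx v) (comb t) = comb (%j. if xs ! j = v then t j else 0)" if "v \<in> verts Q" for v t
  by (rule comb_path) (use that in "auto simp: vtx_def path_times_single path_end_simp")
 have comb0: "comb t = \<zero>" if "!!j. j < length hb ==> t j = 0" for t
  unfolding comb_def using that bC by (intro ag.add.finprod_one_eqI) simp
 have uniq: "t j = t' j" if eq: "comb t = comb t'" and j: "j < length hb" for t t' j
 proof -
  have "comb (%j. t j - t' j) \<oplus> comb t' = comb t" by (simp add: comb_add[symmetric])
  then have "comb (%j. t j - t' j) = \<zero>"
   using eq combC ag.add.r_cancel_one'[of "comb t'" "comb (%j. t j - t' j)"] by simp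
  with indep j show ?thesis by fastforce
 qed
 \<comment> \<open>the coordinates of the component of degree \<open>0\<close>\<close>
 define tc where "tc y = (SOME t. y = comb t)" for y
 have tc: "comb (tc y) = y" if "y \<in> hcomp M 0" for y
  using someI_ex[OF bspec[OF span that], folded tc_def] by simp
 define lam where "lam j x = tc (hp x 0) j" for j x
 have lamI: "lam j x = t j" if "hp x 0 = comb t" "j < length hb" for j x t
  unfolding lam_def using that tc[OF combh[of t]] uniq by auto
 have hpc: "hp x 0 = comb (tc (hp x 0))" if "x \<in> carrier M" for x using tc[OF hp_hc[OF that]] by simp
 have lam_fun: "functional 0 (lam j)" if j: "j < length hb" for j
  unfolding functional_def
 proof (intro conjI ballI allI impI)
  fix x y assume "x \<in> carrier M" "y \<in> carrier M"
  then have "hp (x \<oplus> y) 0 = comb (%j. tc (hp x 0) j + tc (hp y 0) j)"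
   using hpc by (simp add: hp_add comb_add)
  from lamI[OF this j] show "lam j (x \<oplus> y) = lam j x + lam j y" by (simp add: lam_def)
 next
  fix c x assume x: "x \<in> carrier M"
  then have "hp (ev (path_scalar Q c) x) 0 = comb (%j. c * tc (hp x 0) j)"
   using hpc hp_ev[OF scalar_HQ x, of c 0] by (simp add: comb_scale[symmetric])
  from lamI[OF this j] show "lam j (ev (path_scalar Q c) x) = c * lam j x" by (simp add: lam_def)
 next
  fix m x assume "x \<in> hcomp M m" "m ~= 0"
  then have "hp x 0 = comb (%_. 0)" using comb0[of "%_. 0"] by (simp add: hp_hom)
  from lamI[OF this j] show "lam j x = 0" .
 qed
 have lam_vtx: "lam j (ev (vtx (xs ! j)) x) = lam j x" if j: "j < length hb" and x: "x \<in> carrier M" for j x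
 proof -
  have "hp (ev (vtx (xs ! j)) x) 0 = ev (vtx (xs ! j)) (hp x 0)"
   using hp_ev[OF HQ_single[of "(xs ! j, [])" 1] x, of 0] bh(1)[OF j] by (simp add: vtx_def)
  also have "... = comb (%i. if xs ! i = xs ! j then tc (hp x 0) i else 0)"
   using comb_vtx[OF bh(1)[OF j]] hpc[OF x] by metis
  finally have "hp (ev (vtx (xs ! j)) x) 0 = comb (%i. if xs ! i = xs ! j then tc (hp x 0) i else 0)" .
  from lamI[OF this j] show ?thesis by (simp add: lam_def)
 qed
 define I where "I = IS (colin xs 0)"
 define e where "e = ihom (colin xs 0) lam"
 have lv: "set (colin xs 0) <= verts Q \<times> UNIV" by (rule colin_verts[OF vs])
 have e_hom: "e \<in> gr_hom Q J M I" unfolding e_def I_def by (rule ihom_hom[OF lv]) (use lam_fun len in simp)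
 interpret e: graded_hom Q J F M I e
  by (intro graded_homI graded_pre_axioms e_hom)
   (unfold I_def, rule graded_preI[OF isum_pre[OF lv]])
 have e_pe: "e x j (pe p) = lam j (ev (single p 1) x)" if "x \<in> carrier M" "j < length xs" "p \<in> gto (xs ! j)" for x j p
  unfolding e_def by (rule ihom_pe[OF lv]) (use that in simp_all)
 have xv: "xs ! j \<in> verts Q" if "j < length xs" for j using bh(1) that len by simp
 have I_ext: "z = w" if "z \<in> carrier I" "w \<in> carrier I"
   "!!j p. j < length xs ==> p \<in> gto (xs ! j) ==> z j (pe p) = w j (pe p)" for z w
  by (rule isum_ext[OF lv]) (use that in "simp_all add: I_def")
 have Ih: "z j (pe p) = 0" if z: "z \<in> hcomp I m" and j: "j < length xs" and p: "p \<in> gto (xs ! j)" "int (length (snd p)) ~= - m" for z m j p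
 proof -
  have "z j \<in> hcomp (gr_inj Q J (xs ! j)) m" using z j unfolding I_def isum_hcomp[OF lv] by simp
  from inj_hc_pe[OF xv[OF j] this p(1)] p(2) show ?thesis by simp
 qed
 have I0: "\<zero>\<^bsub>I\<^esub> j (pe p) = 0" if "j < length xs" "p \<in> gto (xs ! j)" for j p
  by (rule Ih[OF e.cod.hc_zero that, of 1]) simp
 have nil: "(xs ! j, []) \<in> gto (xs ! j)" if "j < length xs" for j using xv[OF that] by (simp add: gto_def good_Nil path_end_simp)
 have inj0: "x = \<zero>" if x: "x \<in> hcomp M 0" and ex: "e x = \<zero>\<^bsub>I\<^esub>" for x
 proof -
  have xC: "x \<in> carrier M" using x by (rule hc_carrier)
  have "tc x j = 0" if j: "j < length hb" for j
  proof -
   have j': "j < length xs" using j len by simp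
   have "lam j x = 0" using e_pe[OF xC j' nil[OF j']] I0[OF j' nil[OF j']] lam_vtx[OF j xC] by (simp add: ex vtx_def)
   then show ?thesis using x by (simp add: lam_def hp_hom)
  qed
  from comb0[OF this] tc[OF x] show ?thesis by simp
 qed
 have inj_neg: "x \<in> hcomp M (- int n) ==> e x = \<zero>\<^bsub>I\<^esub> ==> x = \<zero>" for n x
 proof (induction n arbitrary: x)
  case (Suc n)
  have xC: "x \<in> carrier M" using Suc.prems(1) by (rule hc_carrier)
  have "ev (arr a) x = \<zero>" if a: "a \<in> arcs Q" for a
   by (rule Suc.IH) (use arr_hc[OF a Suc.prems(1)] a xC Suc.prems(2) in "simp_all add: e.f_ev")
  moreover have "cogen_at (- int (Suc n))" by (rule cogen) simp
  ultimately show ?case using Suc.prems(1) unfolding cogen_at_def by blast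
 qed (use inj0 in simp)
 have inj: "x = \<zero>" if "x \<in> hcomp M m" "e x = \<zero>\<^bsub>I\<^esub>" for m x
 proof (cases "0 < m")
  case False
  then show ?thesis using inj_neg[of x "nat (- m)"] that by simp
 qed (use pos that in blast)
 have base0: "\<exists>x\<in>hcomp M 0. e x = \<phi>" if \<phi>: "\<phi> \<in> hcomp I 0" for \<phi>
 proof (intro bexI[of _ "comb (%j. \<phi> j (pe (xs ! j, [])))"] combh)
  let ?x = "comb (%j. \<phi> j (pe (xs ! j, [])))"
  show "e ?x = \<phi>"
  proof (rule I_ext[OF e.f_closed[OF combC] e.cod.hc_carrier[OF \<phi>]])
   fix j p assume j: "j < length xs" and p: "p \<in> gto (xs ! j)"
   show "e ?x j (pe p) = \<phi> j (pe p)"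
   proof (cases "snd p = []")
    case True
    then have "p = (xs ! j, [])" using p by (cases p) (auto simp: gto_def path_end_simp)
    moreover have "hp ?x 0 = ?x" by (simp add: hp_hom[OF combh])
    ultimately show ?thesis
     using e_pe[OF combC j p] lam_vtx[of j ?x] lamI[of ?x _ j] j len combC by (simp add: vtx_def)
   next
    case False
    then show ?thesis using Ih[OF \<phi> j p] Ih[OF e.f_hc[OF combh] j p] by simp
   qed
  qed
 qed
 define R where "R = {r. (\<forall>i a. r (i, a) ~= 0 --> i < length xs & a \<in> arcs Q & head Q a = xs ! i) &
  (\<forall>x\<in>hcomp M (- 1). (\<Sum>i<length xs. \<Sum>a\<in>arcs Q. r (i, a) * lam i (ev (arr a) x)) = 0)}"
 have stR: "R.starts_at xs R" unfolding R.starts_at_def R_def by blast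
 have restr: "(%(i, a). if tail Q a = v then r (i, a) else 0) \<in> R" if r: "r \<in> R" for r v
 proof -
  have "(\<Sum>i<length xs. \<Sum>a\<in>arcs Q. (if tail Q a = v then r (i, a) else 0) * lam i (ev (arr a) x)) = 0"
   if x: "x \<in> hcomp M (- 1)" for x
  proof (cases "v \<in> verts Q")
   case True
   have xC: "x \<in> carrier M" using x by (rule hc_carrier)
   have "(if tail Q a = v then r (i, a) else 0) * lam i (ev (arr a) x) = r (i, a) * lam i (ev (arr a) (ev (vtx v) x))"
    if "i < length xs" "a \<in> arcs Q" for i a
   proof -
    have "path_times Q (arr a) (vtx v) = (if tail Q a = v then arr a else 0)"
     by (simp add: arr_def vtx_def path_times_single path_end_simp)
    then have "ev (arr a) (ev (vtx v) x) = (if tail Q a = v then ev (arr a) x else \<zero>)"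
     using True that xC by (simp add: ev_times[symmetric])
    then show ?thesis using functional_zero[OF lam_fun] that len by simp
   qed
   then have "(\<Sum>i<length xs. \<Sum>a\<in>arcs Q. (if tail Q a = v then r (i, a) else 0) * lam i (ev (arr a) x)) =
    (\<Sum>i<length xs. \<Sum>a\<in>arcs Q. r (i, a) * lam i (ev (arr a) (ev (vtx v) x)))" by simp
   also have "... = 0" using r vtx_hc[OF True x] unfolding R_def by blast
   finally show ?thesis .
  next
   case False
   then show ?thesis by (intro sum.neutral ballI) auto
  qed
  then show ?thesis using r unfolding R_def by auto
 qed
 from R.linear_resolution_exists[OF stR restr] obtain bs where bs: "R.linear_resolution xs R bs" .
 then have sb0: "R.step_basis R (bs 0)" and sbS: "!!n. R.step_basis (R.syzygies (bs n)) (bs (Suc n))"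
  unfolding R.linear_resolution_def by blast+
 obtain l where l: "!!n. l \<le> n ==> bs n = []" using bs unfolding R.linear_resolution_def by blast
 define X where "X n = (case n of 0 => xs | Suc n => map fst (bs n))" for n
 define RR where "RR n = (case n of 0 => R | Suc n => R.syzygies (bs n))" for n
 have stn: "R.starts_at (X n) (RR n)" for n
  using stR R.starts_at_syzygies by (cases n) (simp_all add: X_def RR_def)
 have sbn: "R.step_basis (RR n) (bs n)" for n using sb0 sbS by (cases n) (simp_all add: RR_def)
 have vX: "set (X n) <= verts Q" for n
 proof (induction n)
  case 0
  then show ?case using vs by (simp add: X_def)
 next
  case (Suc n)
  have "set (map fst (bs n)) <= verts Q" by (rule cobs_verts[OF Suc stn sbn])
  then show ?case by (simp add: X_def)
 qed
 define d where "d n = imap n (X n) (bs n)" for n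
 have XS: "X (Suc n) = map fst (bs n)" for n by (simp add: X_def)
 have X0: "X 0 = xs" by (simp add: X_def)
 have dh: "d n \<in> gr_hom Q J (IS (colin (X n) n)) (IS (colin (X (Suc n)) (Suc n)))" for n
  unfolding d_def XS by (rule imap_hom[OF vX stn sbn])
 have dex: "gr_im (IS (colin (X n) n)) (d n) =
   gr_ker (IS (colin (X (Suc n)) (Suc n))) (IS (colin (X (Suc (Suc n))) (Suc (Suc n)))) (d (Suc n))" for n
  unfolding d_def XS by (rule imap_exact[OF vX stn sbn sbS])
 define I1 where "I1 = IS (colin (X 1) 1)"
 have d0h: "d 0 \<in> gr_hom Q J I I1" using dh[of 0] by (simp add: I1_def I_def X0)
 have hd: "graded_hom Q J F I I1 (d 0)"
  by (intro graded_homI e.cod.graded_pre_axioms d0h)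
   (unfold I1_def, rule graded_preI[OF isum_pre[OF colin_verts[OF vX]]])
 then interpret d: graded_hom Q J F I I1 "d 0" .
 have I1': "I1 = IS (colin (map fst (bs 0)) (Suc 0))" by (simp add: I1_def X_def)
 have d0: "d 0 = imap 0 xs (bs 0)" by (simp add: d_def X0)
 have bv: "set (map fst (bs 0)) <= verts Q" using vX[of 1] by (simp add: X_def)
 have I1zero: "\<zero>\<^bsub>I1\<^esub> j (pe p) = 0" if "j < length (bs 0)" "p \<in> gto (fst (bs 0 ! j))" for j p
 proof -
  have "fst (bs 0 ! j) \<in> verts Q" using bv that(1) by (auto simp: subset_iff)
  from pe_EI[OF this that(2)] that(1) show ?thesis by (simp add: I1' isum_zero[OF colin_verts[OF bv]])
 qed
 note cob = cobs_st[OF vs stR sb0]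
 have ar: "single (tail Q a, [a]) 1 = arr a" for a by (simp add: arr_def)
 have comp: "d 0 (e y) = \<zero>\<^bsub>I1\<^esub>" if y: "y \<in> carrier M" for y
 proof (rule isum_ext[OF colin_verts[OF bv, of "Suc 0"], folded I1'])
  show "d 0 (e y) \<in> carrier I1" "\<zero>\<^bsub>I1\<^esub> \<in> carrier I1" using y d.cod.ag.zero_closed by simp_all
  fix j p assume "j < length (colin (map fst (bs 0)) (Suc 0))" "p \<in> gto (fst (colin (map fst (bs 0)) (Suc 0) ! j))"
  then have j: "j < length (bs 0)" and p: "p \<in> gto (fst (bs 0 ! j))" by simp_all
  have pK: "single p 1 \<in> KQ" using p good_paths[of p] by (simp add: gto_def)
  define y' where "y' = ev (single p 1) y"
  have y': "y' \<in> carrier M" using pK y by (simp add: y'_def)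
  have "d 0 (e y) j (pe p) = coval xs (bs 0) j (e.cod.ev (single p 1) (e y))"
   unfolding d0 imap_def I_def
   by (rule graded_pre.ihom_pe[OF graded_preI[OF isum_pre[OF lv]] colin_verts[OF bv]])
    (use y j p e.f_closed[OF y] in "simp_all add: I_def")
  also have "e.cod.ev (single p 1) (e y) = e y'" using pK y by (simp add: y'_def e.f_ev)
  also have "coval xs (bs 0) j (e y') = (\<Sum>i<length xs. \<Sum>a\<in>arcs Q. snd (bs 0 ! j) (i, a) * lam i (ev (arr a) (hp y' (- 1))))"
   unfolding coval_def
  proof (intro sum.cong refl)
   fix i a assume "i \<in> {..<length xs}" and a: "a \<in> arcs Q"
   then have i: "i < length xs" by simp
   show "snd (bs 0 ! j) (i, a) * e y' i (pe (tail Q a, [a])) = snd (bs 0 ! j) (i, a) * lam i (ev (arr a) (hp y' (- 1)))"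
   proof (cases "snd (bs 0 ! j) (i, a) = 0")
    case False
    then have "(tail Q a, [a]) \<in> gto (xs ! i)" using cob[OF j False] gto_arc[OF a] by simp
    then have "e y' i (pe (tail Q a, [a])) = lam i (ev (arr a) y')" using e_pe[OF y' i] by (simp add: ar)
    also have "... = lam i (hp (ev (arr a) y') 0)" by (rule functional_hp) (use i len lam_fun a y' in simp_all)
    also have "hp (ev (arr a) y') 0 = ev (arr a) (hp y' (- 1))"
     using hp_ev[OF HQ_single[of "(tail Q a, [a])" 1] y', of 0] a by (simp add: ar)
    finally show ?thesis by simp
   qed simp
  qed
  also have "... = 0" using R.step_basis_mem[OF sb0 j] hp_hc[OF y'] unfolding R_def by blast
  finally show "d 0 (e y) j (pe p) = \<zero>\<^bsub>I1\<^esub> j (pe p)" using I1zero[OF j p] by simp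
 qed
 have base1: "\<exists>x\<in>hcomp M (- 1). e x = \<phi>" if \<phi>: "\<phi> \<in> hcomp I (- 1)" and d\<phi>: "d 0 \<phi> = \<zero>\<^bsub>I1\<^esub>" for \<phi>
 proof -
  have \<phi>C: "\<phi> \<in> carrier I" using \<phi> by (rule e.cod.hc_carrier)
  define Y where "Y = {(i, a). i < length xs & a \<in> arcs Q & head Q a = xs ! i}"
  have Y: "finite Y" by (rule finite_subset[of _ "{..<length xs} \<times> arcs Q"]) (auto simp: Y_def)
  define f where "f = (%(i, a). if (i, a) \<in> Y then \<phi> i (pe (tail Q a, [a])) else 0)"
  define g where "g x = (%(i, a). if (i, a) \<in> Y then lam i (ev (arr a) x) else 0)" for x
  have Ysum: "(\<Sum>i<length xs. \<Sum>a\<in>arcs Q. h (i, a)) = (\<Sum>y\<in>Y. h y)" if "!!y. y ~: Y ==> h y = 0" for h :: "nat \<times> 'e => 'k"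
  proof -
   have "(\<Sum>i<length xs. \<Sum>a\<in>arcs Q. h (i, a)) = (\<Sum>y\<in>{..<length xs} \<times> arcs Q. h y)"
    by (simp add: sum.cartesian_product)
   also have "... = (\<Sum>y\<in>Y. h y)" by (rule sum.mono_neutral_right) (use that in "auto simp: Y_def")
   finally show ?thesis .
  qed
  have f0: "f y = 0" if "y ~: Y" for y using that by (cases y) (simp add: f_def)
  have annb: "(\<Sum>y\<in>Y. snd (bs 0 ! j) y * f y) = 0" if j: "j < length (bs 0)" for j
  proof -
   have "fst (bs 0 ! j) \<in> verts Q" using bv j by (auto simp: subset_iff)
   then have n: "(fst (bs 0 ! j), []) \<in> gto (fst (bs 0 ! j))" by (simp add: gto_def good_Nil path_end_simp)
   have "(\<Sum>y\<in>Y. snd (bs 0 ! j) y * f y) = (\<Sum>i<length xs. \<Sum>a\<in>arcs Q. snd (bs 0 ! j) (i, a) * f (i, a))"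
    by (rule Ysum[symmetric]) (simp add: f0)
   also have "... = (\<Sum>i<length xs. \<Sum>a\<in>arcs Q. if (fst (bs 0 ! j), [] @ [a]) \<in> good then snd (bs 0 ! j) (i, a) * \<phi> i (pe (fst (bs 0 ! j), [] @ [a])) else 0)"
   proof (intro sum.cong refl)
    fix i a assume "i \<in> {..<length xs}" and a: "a \<in> arcs Q"
    show "snd (bs 0 ! j) (i, a) * f (i, a) = (if (fst (bs 0 ! j), [] @ [a]) \<in> good then snd (bs 0 ! j) (i, a) * \<phi> i (pe (fst (bs 0 ! j), [] @ [a])) else 0)"
    proof (cases "snd (bs 0 ! j) (i, a) = 0")
     case False
     have "(i, a) \<in> Y" using cob[OF j False] by (simp add: Y_def)
     moreover have "tail Q a = fst (bs 0 ! j)" by (rule R.step_basis_tgt[OF sb0 j False])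
     ultimately show ?thesis using a by (simp add: f_def good_Cons good_Nil)
    qed simp
   qed
   also have "... = 0"
    using imap_pe[OF vs stR sb0 \<phi>C[unfolded I_def] j n] I1zero[OF j n] d\<phi> by (simp add: d0)
   finally show ?thesis .
  qed
  have "f \<in> fv.span (g ` hcomp M (- 1))"
  proof (rule in_span_if_annihilated[OF Y])
   fix u assume u: "!!y. y ~: Y ==> u y = 0" and ann: "!!l. l \<in> g ` hcomp M (- 1) ==> (\<Sum>y\<in>Y. l y * u y) = 0"
   have "u \<in> R"
    unfolding R_def mem_Collect_eq
   proof (intro conjI ballI allI impI)
    fix i a assume "u (i, a) ~= 0"
    then have "(i, a) \<in> Y" using u by blast
    then show "i < length xs" "a \<in> arcs Q" "head Q a = xs ! i" by (auto simp: Y_def)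
   next
    fix x assume "x \<in> hcomp M (- 1)"
    then have g0: "(\<Sum>y\<in>Y. g x y * u y) = 0" using ann by blast
    have h0: "(%(i, a). u (i, a) * lam i (ev (arr a) x)) y = 0" if "y ~: Y" for y
     using u[OF that] by (cases y) simp
    have "(\<Sum>i<length xs. \<Sum>a\<in>arcs Q. u (i, a) * lam i (ev (arr a) x)) = (\<Sum>y\<in>Y. (%(i, a). u (i, a) * lam i (ev (arr a) x)) y)"
     using Ysum[of "%(i, a). u (i, a) * lam i (ev (arr a) x)", OF h0] by simp
    also have "... = (\<Sum>y\<in>Y. g x y * u y)" by (rule sum.cong) (auto simp: g_def)
    also have "... = 0" by (rule g0)
    finally show "(\<Sum>i<length xs. \<Sum>a\<in>arcs Q. u (i, a) * lam i (ev (arr a) x)) = 0" .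
   qed
   from R.step_basis_span[OF sb0 this] obtain t where t: "!!i a. u (i, a) = (\<Sum>l<length (bs 0). t l * snd (bs 0 ! l) (i, a))" by blast
   have "(\<Sum>y\<in>Y. f y * u y) = (\<Sum>y\<in>Y. \<Sum>l<length (bs 0). t l * (snd (bs 0 ! l) y * f y))"
   proof (rule sum.cong[OF refl])
    fix y :: "nat \<times> 'e"
    obtain i a where y: "y = (i, a)" by (cases y)
    show "f y * u y = (\<Sum>l<length (bs 0). t l * (snd (bs 0 ! l) y * f y))"
     unfolding y t sum_distrib_left by (intro sum.cong refl) (simp only: ac_simps)
   qed
   also have "... = (\<Sum>l<length (bs 0). \<Sum>y\<in>Y. t l * (snd (bs 0 ! l) y * f y))" by (rule sum.swap)
   also have "... = (\<Sum>l<length (bs 0). t l * (\<Sum>y\<in>Y. snd (bs 0 ! l) y * f y))" by (simp only: sum_distrib_left)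
   also have "... = 0" using annb by simp
   finally show "(\<Sum>y\<in>Y. f y * u y) = 0" .
  qed (auto simp: f_def g_def)
  also have "fv.span (g ` hcomp M (- 1)) = g ` hcomp M (- 1)"
  proof (rule fv.span_eq_iff[THEN iffD2], unfold fv.subspace_def, intro conjI ballI allI)
   have lm': "functional 0 (lam i)" if "(i, a) \<in> Y" for i a using that lam_fun len by (simp add: Y_def)
   have aY: "arr a \<in> KQ" if "(i, a) \<in> Y" for i a using that by (simp add: Y_def)
   have "g \<zero> = 0" using functional_zero[OF lm'] aY by (auto simp: g_def fun_eq_iff)
   then show "0 \<in> g ` hcomp M (- 1)" by (metis hc_zero imageI)
   fix l assume "l \<in> g ` hcomp M (- 1)"
   then obtain x where x: "x \<in> hcomp M (- 1)" "l = g x" by blast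
   have xC: "x \<in> carrier M" using x(1) by (rule hc_carrier)
   {
    fix l' assume "l' \<in> g ` hcomp M (- 1)"
    then obtain y where y: "y \<in> hcomp M (- 1)" "l' = g y" by blast
    have yC: "y \<in> carrier M" using y(1) by (rule hc_carrier)
    have "g (x \<oplus> y) = l + l'"
     using aY xC yC functional_add[OF lm'] by (auto simp: g_def x(2) y(2) fun_eq_iff ev_add_right)
    then show "l + l' \<in> g ` hcomp M (- 1)" using hc_add[OF x(1) y(1)] by (metis imageI)
   }
   fix c
   have c: "ev (path_scalar Q c) x \<in> hcomp M (- 1)" using ev_hc[OF scalar_HQ x(1)] by simp
   have "lam i (ev (arr a) (ev (path_scalar Q c) x)) = c * lam i (ev (arr a) x)" if ia: "(i, a) \<in> Y" for i a
   proof -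
    have a: "a \<in> arcs Q" using ia by (simp add: Y_def)
    have "path_times Q (arr a) (path_scalar Q c) = path_times Q (path_scalar Q c) (arr a)"
     using path_scalar_times[of "arr a" c] a by (simp add: arr_def)
    then have "ev (arr a) (ev (path_scalar Q c) x) = ev (path_scalar Q c) (ev (arr a) x)"
     using a xC HQ_KQ[OF scalar_HQ] by (simp add: ev_times[symmetric])
    then show ?thesis using functional_scalar[OF lm'[OF ia]] a xC by simp
   qed
   then have "g (ev (path_scalar Q c) x) = (%y. c * l y)" by (auto simp: g_def x(2) fun_eq_iff)
   then show "(%y. c * l y) \<in> g ` hcomp M (- 1)" using c by (metis imageI)
  qed
  finally obtain x where x: "x \<in> hcomp M (- 1)" "f = g x" by blast
  have xC: "x \<in> carrier M" using x(1) by (rule hc_carrier)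
  have "e x = \<phi>"
  proof (rule I_ext[OF e.f_closed[OF xC] \<phi>C])
   fix j p assume j: "j < length xs" and p: "p \<in> gto (xs ! j)"
   show "e x j (pe p) = \<phi> j (pe p)"
   proof (cases "length (snd p) = 1")
    case True
    then obtain w a where wa: "p = (w, [a])" by (cases p) (auto simp: length_Suc_conv)
    have a: "a \<in> arcs Q" "w = tail Q a" "head Q a = xs ! j"
     using p by (auto simp: wa gto_def good_Cons path_end_simp)
    have "(j, a) \<in> Y" using a j by (simp add: Y_def)
    then have "\<phi> j (pe p) = lam j (ev (arr a) x)" using fun_cong[OF x(2), of "(j, a)"] by (simp add: f_def g_def wa a(2))
    then show ?thesis using e_pe[OF xC j p] by (simp add: wa a(2) ar)
   next
    case False
    then show ?thesis using Ih[OF \<phi> j p] Ih[OF e.f_hc[OF x(1)] j p] by simp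
   qed
  qed
  with x(1) show ?thesis by blast
 qed
 have lift: "\<exists>x\<in>carrier M. e x = \<phi>" if \<phi>: "\<phi> \<in> hcomp I m" and d\<phi>: "d 0 \<phi> = \<zero>\<^bsub>I1\<^esub>" for m \<phi>
 proof -
  consider "0 < m" | "m = 0" | "m < 0" by linarith
  then show ?thesis
  proof cases
   case 1
   have "\<phi> = \<zero>\<^bsub>I\<^esub>" by (rule I_ext[OF e.cod.hc_carrier[OF \<phi>] e.cod.ag.zero_closed]) (use Ih[OF \<phi>] I0 1 in simp)
   then show ?thesis by (intro bexI[of _ "\<zero>"]) auto
  next
   case 2
   then show ?thesis using base0[of \<phi>] \<phi> hc_carrier by blast
  next
   case 3
   then have m: "- int (Suc (nat (- m - 1))) = m" by simp
   have cog: "graded_pre.cogen_at Q J I k" if "k < 0" for k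
    unfolding I_def by (rule isum_cogen[OF lv]) (use that in "auto simp: colin_def")
   have "\<exists>x\<in>hcomp M (- int (Suc (nat (- m - 1)))). e x = \<phi>"
    by (rule image_lift[OF e.graded_hom_axioms hd cog corel inj base1]) (use \<phi> d\<phi> m in simp_all)
   then show ?thesis using hc_carrier by blast
  qed
 qed
 have ex0: "gr_im M e = gr_ker I I1 (d 0)"
  by (rule exact_from_homogeneous[OF hd e.graded_hom_axioms comp lift])
 have ker0: "gr_ker M I e = {\<zero>}"
 proof (intro equalityI subsetI)
  fix x assume "x \<in> gr_ker M I e"
  then have x: "x \<in> carrier M" "e x = \<zero>\<^bsub>I\<^esub>" by (auto simp: gr_ker_def)
  have "hp x n = \<zero>" for n by (rule inj[OF hp_hc[OF x(1)]]) (use e.f_hp[OF x(1), of n] x(2) in simp)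
  note hp0 = this
  have "x = \<zero>" by (rule hp_ext) (use x hp0 in simp_all)
  then show "x \<in> {\<zero>}" by simp
 qed (auto simp: gr_ker_def)
 have gm: "gr_module Q J M" using gr fd by (simp add: gr_module_iff)
 show ?thesis
  unfolding cokoszul_def Let_def colin_def[symmetric]
 proof (intro conjI exI[of _ X] exI[of _ d] exI[of _ e] allI)
  show "\<exists>l. \<forall>n>l. X n = []"
  proof (intro exI[of _ l] allI impI)
   fix n assume "l < n"
   then obtain k where "n = Suc k" "l \<le> k" by (cases n) auto
   then show "X n = []" using l[of k] by (simp add: X_def)
  qed
  show "gr_im M e = gr_ker (IS (colin (X 0) 0)) (IS (colin (X 1) 1)) (d 0)"
   using ex0 by (simp add: I1_def I_def X0)
 qed (use gm vX e_hom dh ker0 dex in "simp_all add: I_def X0")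
qed

end

section \<open>Truncations of finitely presented and of finitely copresented modules\<close>

lemma (in graded_hom) homogeneous_preimage:
 assumes y: "y \<in> hcomp N m" and im: "y \<in> gr_im M f"
 shows "\<exists>x\<in>hcomp M m. f x = y"
proof -
 from im obtain x where x: "x \<in> carrier M" "y = f x" by (auto simp: gr_im_def)
 have "f (dom.hp x m) = y" using f_hp[OF x(1), of m] cod.hp_hom[OF y, of m] x(2) by simp
 then show ?thesis using dom.hp_hc[OF x(1)] by blast
qed

context graded_pre
begin

lemma cut_hc: "x \<in> hcomp M n ==> n \<in> D ==> cut D x = x"
 by (rule cut_id) (auto simp: hp_hom hc_carrier)


context
 fixes D :: "int set"
 assumes D: "convex D"
begin

lemma trunc_graded_pre: "graded_pre Q J F (trunc D)"
 by (rule graded_preI[OF trunc_gr_pre[OF D]])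

lemma trunc_ev: "graded_pre.ev Q J (trunc D) f x = cut D (ev f x)"
 unfolding graded_pre.ev_def[OF trunc_graded_pre] ev_def by simp

lemma trunc_ev_hc:
 assumes "f \<in> HQ i" "x \<in> hcomp M n" "n + int i \<in> D"
 shows "graded_pre.ev Q J (trunc D) f x = ev f x"
 unfolding trunc_ev by (rule cut_hc[OF ev_hc[OF assms(1,2)] assms(3)])

lemma trunc_arr: "a \<in> arcs Q ==> x \<in> hcomp M n ==> n + 1 \<in> D ==> graded_pre.ev Q J (trunc D) (arr a) x = ev (arr a) x"
 using trunc_ev_hc[OF HQ_single[of "(tail Q a, [a])" 1], of x n] by (simp add: arr_def)

lemma trunc_vtx: "v \<in> verts Q ==> x \<in> hcomp M n ==> n \<in> D ==> graded_pre.ev Q J (trunc D) (vtx v) x = ev (vtx v) x"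
 using trunc_ev_hc[OF HQ_single[of "(v, [])" 1], of x n] by (simp add: vtx_def)

lemma trunc_arr_sum:
 assumes S: "S <= arcs Q" and u: "!!a. a \<in> S ==> u a \<in> hcomp M m" and m: "m + 1 \<in> D"
 shows "(\<Oplus>\<^bsub>trunc D\<^esub>a\<in>S. graded_pre.ev Q J (trunc D) (arr a) (u a)) = (\<Oplus>a\<in>S. ev (arr a) (u a))"
proof -
 interpret T: abelian_group "trunc D" by (rule trunc_abelian_group)
 have a: "ev (arr a) (u a) \<in> hcomp M (m + 1)" if "a \<in> S" for a using arr_hc[OF _ u[OF that]] S that by blast
 have c: "(%a. ev (arr a) (u a)) \<in> S \<rightarrow> carrier (trunc D)" by (intro Pi_I hc_trunc_sub[OF m] a)
 have "(\<Oplus>\<^bsub>trunc D\<^esub>a\<in>S. graded_pre.ev Q J (trunc D) (arr a) (u a)) = (\<Oplus>\<^bsub>trunc D\<^esub>a\<in>S. ev (arr a) (u a))"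
 proof (rule T.finsum_cong'[OF refl c])
  fix a assume "a \<in> S"
  then show "graded_pre.ev Q J (trunc D) (arr a) (u a) = ev (arr a) (u a)" using trunc_arr[OF _ u m, of a] S by blast
 qed
 also have "... = (\<Oplus>a\<in>S. ev (arr a) (u a))" by (rule trunc_finsum[OF c])
 finally show ?thesis .
qed

lemma trunc_gen:
 assumes "gen_at m" and m: "m \<in> D" "m + 1 \<in> D"
 shows "graded_pre.gen_at Q J (trunc D) m"
 unfolding graded_pre.gen_at_def[OF trunc_graded_pre]
proof
 fix x assume "x \<in> hcomp (trunc D) (m + 1)"
 then have "x \<in> hcomp M (m + 1)" using m by simp
 with assms(1) obtain u where u: "\<forall>a\<in>arcs Q. u a \<in> hcomp M m" "x = (\<Oplus>a\<in>arcs Q. ev (arr a) (u a))"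
  unfolding gen_at_def by blast
 have "x = (\<Oplus>\<^bsub>trunc D\<^esub>a\<in>arcs Q. graded_pre.ev Q J (trunc D) (arr a) (u a))"
  unfolding u(2) by (rule trunc_arr_sum[symmetric, OF subset_refl _ m(2)]) (use u(1) in blast)
 then show "\<exists>u. (\<forall>a\<in>arcs Q. u a \<in> hcomp (trunc D) m) & x = (\<Oplus>\<^bsub>trunc D\<^esub>a\<in>arcs Q. graded_pre.ev Q J (trunc D) (arr a) (u a))"
  using u(1) m(1) by (intro exI[of _ u]) simp
qed

lemma trunc_rel:
 assumes rel: "rel_at m" and m: "m - 1 \<in> D" "m \<in> D" "m + 1 \<in> D"
 shows "graded_pre.rel_at Q J F (trunc D) m"
 unfolding graded_pre.rel_at_def[OF trunc_graded_pre]
proof (intro allI impI)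
 fix u assume "\<forall>a\<in>arcs Q. u a \<in> hcomp (trunc D) m & graded_pre.ev Q J (trunc D) (vtx (tail Q a)) (u a) = u a"
  and z: "(\<Oplus>\<^bsub>trunc D\<^esub>a\<in>arcs Q. graded_pre.ev Q J (trunc D) (arr a) (u a)) = \<zero>\<^bsub>trunc D\<^esub>"
 then have u: "u a \<in> hcomp M m" "ev (vtx (tail Q a)) (u a) = u a" if "a \<in> arcs Q" for a
  using that m(2) trunc_vtx[of "tail Q a" "u a" m] by auto
 have "(\<Oplus>a\<in>arcs Q. ev (arr a) (u a)) = \<zero>"
  using z trunc_arr_sum[OF subset_refl u(1) m(3)] by simp
 from rel_atD[OF rel u this] obtain t where
  t: "\<forall>a\<in>arcs Q. \<forall>b\<in>arcs Q. t a b \<in> hcomp M (m - 1)" "\<forall>a\<in>arcs Q. u a = (\<Oplus>b\<in>{b. (b, a) \<in> F}. ev (arr b) (t a b))" by blast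
 have "u a = (\<Oplus>\<^bsub>trunc D\<^esub>b\<in>{b. (b, a) \<in> F}. graded_pre.ev Q J (trunc D) (arr b) (t a b))" if a: "a \<in> arcs Q" for a
 proof -
  have S: "{b. (b, a) \<in> F} <= arcs Q" using F_arcs by blast
  have "u a = (\<Oplus>b\<in>{b. (b, a) \<in> F}. ev (arr b) (t a b))" using t(2) a by blast
  also have "... = (\<Oplus>\<^bsub>trunc D\<^esub>b\<in>{b. (b, a) \<in> F}. graded_pre.ev Q J (trunc D) (arr b) (t a b))"
   by (rule trunc_arr_sum[symmetric, OF S, of _ "m - 1"]) (use t(1) a S m(2) in auto)
  finally show ?thesis .
 qed
 then show "\<exists>t. (\<forall>a\<in>arcs Q. \<forall>b\<in>arcs Q. t a b \<in> hcomp (trunc D) (m - 1)) &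
   (\<forall>a\<in>arcs Q. u a = (\<Oplus>\<^bsub>trunc D\<^esub>b\<in>{b. (b, a) \<in> F}. graded_pre.ev Q J (trunc D) (arr b) (t a b)))"
  using t(1) m(1) by (intro exI[of _ t]) simp
qed

lemma trunc_cogen:
 assumes "cogen_at m" and m: "m \<in> D" "m + 1 \<in> D"
 shows "graded_pre.cogen_at Q J (trunc D) m"
 using assms(1) trunc_arr[OF _ _ m(2)] m unfolding graded_pre.cogen_at_def[OF trunc_graded_pre] cogen_at_def by simp

lemma trunc_corel:
 assumes corel: "corel_at m" and m: "m \<in> D" "m + 1 \<in> D" "m + 2 \<in> D"
 shows "graded_pre.corel_at Q J F (trunc D) m"
 unfolding graded_pre.corel_at_def[OF trunc_graded_pre]
proof (intro allI impI)
 fix y assume "\<forall>a\<in>arcs Q. y a \<in> hcomp (trunc D) (m + 1) & graded_pre.ev Q J (trunc D) (vtx (head Q a)) (y a) = y a"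
  and yF: "\<forall>a b. (a, b) \<in> F --> graded_pre.ev Q J (trunc D) (arr b) (y a) = \<zero>\<^bsub>trunc D\<^esub>"
 then have y: "y a \<in> hcomp M (m + 1)" "ev (vtx (head Q a)) (y a) = y a" if "a \<in> arcs Q" for a
  using that m(2) trunc_vtx[of "head Q a" "y a" "m + 1"] by auto
 have m2: "m + 1 + 1 \<in> D" using m(3) by (simp add: add.assoc)
 have "ev (arr b) (y a) = \<zero>" if "(a, b) \<in> F" for a b
  using yF that F_arcs[OF that] trunc_arr[OF _ y(1) m2, of b a] by simp
 from corel_atD[OF corel y this] obtain x where x: "x \<in> hcomp M m" "\<forall>a\<in>arcs Q. ev (arr a) x = y a" by blast
 then show "\<exists>x\<in>hcomp (trunc D) m. \<forall>a\<in>arcs Q. graded_pre.ev Q J (trunc D) (arr a) x = y a"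
  using m trunc_arr[OF _ x(1) m(2)] by (intro bexI[of _ x]) simp_all
qed

end

end

context monomial_quotient
begin

lemma gr_moduleD: "gr_module Q J M ==> graded_mod Q J F M"
 by (intro graded_mod.intro graded_mod_axioms.intro graded_preI) (auto simp: gr_module_iff)

lemma exponent_bounds: "\<exists>l u. \<forall>x i. (x, i) \<in> set xs --> l \<le> i & i \<le> u" for xs :: "('v \<times> int) list"
proof (intro exI allI impI)
 fix x i assume "(x, i) \<in> set xs"
 then have "i \<in> snd ` set xs" by force
 then show "Min (snd ` set xs) \<le> i & i \<le> Max (snd ` set xs)" by simp
qed

text \<open>
 In degrees beyond all generators of the two projectives, both are generated by the preceding degree and
 the first one has quadratic relations.  A relation in \<open>M\<close> lifts to one in the first projective after
 a correction by elements of the second.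
\<close>
lemma fin_pres_tail_quadratic:
 assumes M: "M \<in> fin_pres Q J"
 shows "\<exists>l n. (\<forall>m x. m < l --> x \<in> hcomp M m --> x = \<zero>\<^bsub>M\<^esub>) &
  (\<forall>m\<ge>n. graded_pre.gen_at Q J M m & graded_pre.rel_at Q J F M m)"
proof -
 from M obtain xs ys d e where gm: "gr_module Q J M" and xs: "set xs <= verts Q \<times> UNIV" and ys: "set ys <= verts Q \<times> UNIV"
  and hd: "d \<in> gr_hom Q J (PS ys) (PS xs)" and he: "e \<in> gr_hom Q J (PS xs) M"
  and ex: "gr_im (PS ys) d = gr_ker (PS xs) M e" and im: "gr_im (PS xs) e = carrier M"
  unfolding fin_pres_def by blast
 interpret M: graded_mod Q J F M by (rule gr_moduleD[OF gm])
 define P where "P = PS xs"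
 define P1 where "P1 = PS ys"
 note ex = ex[folded P_def P1_def] and im = im[folded P_def]
 have P: "graded_pre Q J F P" and P1: "graded_pre Q J F P1"
  unfolding P_def P1_def by (rule graded_preI[OF psum_pre[OF xs]], rule graded_preI[OF psum_pre[OF ys]])
 interpret e: graded_hom Q J F P M e
  by (intro graded_homI M.graded_pre_axioms P he[folded P_def])
 interpret d: graded_hom Q J F P1 P d
  by (intro graded_homI P P1 hd[folded P_def P1_def])
 obtain l u where "\<forall>x i. (x, i) \<in> set xs --> l \<le> i & i \<le> u" using exponent_bounds[of xs] by (elim exE)
 note lu = this[rule_format]
 obtain l1 u1 where "\<forall>x i. (x, i) \<in> set ys --> l1 \<le> i & i \<le> u1" using exponent_bounds[of ys] by (elim exE)
 note lu1 = this[rule_format]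
 define n where "n = max (u + 1) u1"
 have genP: "e.dom.gen_at m" if "n \<le> m" for m
  unfolding P_def by (rule psum_gen[OF xs]) (use lu that in "force simp: n_def")
 have relP: "e.dom.rel_at m" if "n \<le> m" for m
  unfolding P_def by (rule psum_rel[OF xs]) (use lu that in "force simp: n_def")
 have genP1: "d.dom.gen_at m" if "n \<le> m" for m
  unfolding P1_def by (rule psum_gen[OF ys]) (use lu1 that in "force simp: n_def")
 have lift: "\<exists>x\<in>hcomp P m. e x = y" if "y \<in> hcomp M m" for y m
  by (rule e.homogeneous_preimage[OF that]) (use im M.hc_carrier[OF that] in simp)
 have bnd: "x = \<zero>\<^bsub>M\<^esub>" if m: "m < l" and x: "x \<in> hcomp M m" for m x
 proof -
  obtain z where z: "z \<in> hcomp P m" "e z = x" using lift[OF x] by blast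
  have "z = \<zero>\<^bsub>P\<^esub>"
  proof (rule extensionalityI)
   show "z \<in> extensional {..<length xs}" using z(1) unfolding P_def psum_hcomp[OF xs] by blast
   show "\<zero>\<^bsub>P\<^esub> \<in> extensional {..<length xs}" unfolding P_def psum_zero[OF xs] by simp
   fix j assume "j \<in> {..<length xs}"
   then have j: "j < length xs" by simp
   obtain f where f: "z j = cls f" "\<forall>p\<in>keys f. int (length (snd p)) = m - snd (xs ! j)"
    using z(1) j unfolding P_def psum_hcomp[OF xs] by blast
   have "m - snd (xs ! j) < 0" using lu[of "fst (xs ! j)" "snd (xs ! j)"] nth_mem[OF j] m by simp
   then have "keys f = {}" using f(2) by fastforce
   then show "z j = \<zero>\<^bsub>P\<^esub> j" using f(1) j unfolding P_def psum_zero[OF xs] by (simp add: cls_zero)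
  qed
  then show ?thesis using z(2) by simp
 qed
 have gen: "M.gen_at m" if m: "n \<le> m" for m
  unfolding M.gen_at_def
 proof
  fix y assume "y \<in> hcomp M (m + 1)"
  from lift[OF this] obtain x where x: "x \<in> hcomp P (m + 1)" "e x = y" by blast
  from e.dom.gen_atD[OF genP[OF m] x(1)] obtain w where w: "\<forall>a\<in>arcs Q. w a \<in> hcomp P m"
   "x = (\<Oplus>\<^bsub>P\<^esub>a\<in>arcs Q. e.dom.ev (arr a) (w a))" by blast
  have wC: "w a \<in> carrier P" if "a \<in> arcs Q" for a by (rule e.dom.hc_carrier) (use w(1) that in blast)
  have "e x = (\<Oplus>\<^bsub>M\<^esub>a\<in>arcs Q. e (e.dom.ev (arr a) (w a)))" unfolding w(2) using wC by (intro e.f_finsum) auto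
  also have "... = (\<Oplus>\<^bsub>M\<^esub>a\<in>arcs Q. M.ev (arr a) (e (w a)))" using wC by (intro M.ag.finsum_cong') (auto simp: e.f_ev)
  finally show "\<exists>u. (\<forall>a\<in>arcs Q. u a \<in> hcomp M m) & y = (\<Oplus>\<^bsub>M\<^esub>a\<in>arcs Q. M.ev (arr a) (u a))"
   using x(2) w(1) e.f_hc by (intro exI[of _ "%a. e (w a)"]) blast
 qed
 have rel: "M.rel_at m" if m: "n \<le> m" for m
  unfolding M.rel_at_def
 proof (intro allI impI)
  fix u assume u: "\<forall>a\<in>arcs Q. u a \<in> hcomp M m & M.ev (vtx (tail Q a)) (u a) = u a"
   and z: "(\<Oplus>\<^bsub>M\<^esub>a\<in>arcs Q. M.ev (arr a) (u a)) = \<zero>\<^bsub>M\<^esub>"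
  have "\<forall>a. \<exists>x. a \<in> arcs Q --> x \<in> hcomp P m & e x = u a" using lift u by blast
  from choice[OF this] obtain w0 where "\<forall>a. a \<in> arcs Q --> w0 a \<in> hcomp P m & e (w0 a) = u a" ..
  then have w0: "w0 a \<in> hcomp P m" "e (w0 a) = u a" if "a \<in> arcs Q" for a using that by blast+
  define w where "w a = e.dom.ev (vtx (tail Q a)) (w0 a)" for a
  have w0C: "w0 a \<in> carrier P" if "a \<in> arcs Q" for a using w0(1)[OF that] by (rule e.dom.hc_carrier)
  have wh: "w a \<in> hcomp P m" if "a \<in> arcs Q" for a unfolding w_def using that by (intro e.dom.vtx_hc w0) auto
  have wC: "w a \<in> carrier P" if "a \<in> arcs Q" for a using wh[OF that] by (rule e.dom.hc_carrier)
  have we: "e (w a) = u a" if "a \<in> arcs Q" for a using that w0C w0(2) u by (simp add: w_def e.f_ev)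
  have wv: "e.dom.ev (vtx (tail Q a)) (w a) = w a" if "a \<in> arcs Q" for a
   using that w0C by (simp add: w_def e.dom.ev_times[symmetric] vtx_times_vtx)
  define x where "x = (\<Oplus>\<^bsub>P\<^esub>a\<in>arcs Q. e.dom.ev (arr a) (w a))"
  have xh: "x \<in> hcomp P (m + 1)" unfolding x_def by (intro e.dom.hc_finsum e.dom.arr_hc wh)
  have "e x = (\<Oplus>\<^bsub>M\<^esub>a\<in>arcs Q. e (e.dom.ev (arr a) (w a)))" unfolding x_def using wC by (intro e.f_finsum) auto
  also have "... = (\<Oplus>\<^bsub>M\<^esub>a\<in>arcs Q. M.ev (arr a) (u a))"
   using wC we e.f_closed[OF wC] by (intro M.ag.finsum_cong') (auto simp: e.f_ev)
  finally have "x \<in> gr_im P1 d" unfolding ex using z e.dom.hc_carrier[OF xh] by (simp add: gr_ker_def)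
  from d.homogeneous_preimage[OF xh this] obtain y where y: "y \<in> hcomp P1 (m + 1)" "d y = x" by blast
  from d.dom.gen_atD[OF genP1[OF m] y(1)] obtain v where
   v: "!!a. a \<in> arcs Q ==> v a \<in> hcomp P1 m" "!!a. a \<in> arcs Q ==> d.dom.ev (vtx (tail Q a)) (v a) = v a"
    "y = (\<Oplus>\<^bsub>P1\<^esub>a\<in>arcs Q. d.dom.ev (arr a) (v a))" by blast
  have vC: "v a \<in> carrier P1" if "a \<in> arcs Q" for a using v(1)[OF that] by (rule d.dom.hc_carrier)
  have dv: "e.dom.ev (arr a) (d (v a)) = d (d.dom.ev (arr a) (v a))" "e.dom.ev (vtx (tail Q a)) (d (v a)) = d (v a)" if "a \<in> arcs Q" for a
   using that vC v(2) d.f_ev[of "arr a" "v a"] d.f_ev[of "vtx (tail Q a)" "v a"] by simp_all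
  have x_dv: "x = (\<Oplus>\<^bsub>P\<^esub>a\<in>arcs Q. e.dom.ev (arr a) (d (v a)))"
  proof -
   have "x = (\<Oplus>\<^bsub>P\<^esub>a\<in>arcs Q. d (d.dom.ev (arr a) (v a)))" unfolding y(2)[symmetric] v(3) using vC by (intro d.f_finsum) auto
   also have "... = (\<Oplus>\<^bsub>P\<^esub>a\<in>arcs Q. e.dom.ev (arr a) (d (v a)))" using vC dv(1) by (intro e.dom.ag.finsum_cong') auto
   finally show ?thesis .
  qed
  \<comment> \<open>correcting the lifts by an element of the kernel turns the relation into one in the projective\<close>
  define k where "k a = w a \<oplus>\<^bsub>P\<^esub> (\<ominus>\<^bsub>P\<^esub> d (v a))" for a
  have kh: "k a \<in> hcomp P m" if "a \<in> arcs Q" for a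
   unfolding k_def by (intro e.dom.hc_add e.dom.hc_minus wh d.f_hc v(1) that)
  have kv: "e.dom.ev (vtx (tail Q a)) (k a) = k a" if "a \<in> arcs Q" for a
   using that wC vC wv dv(2) by (simp add: k_def e.dom.ev_add_right e.dom.ev_minus)
  have "(\<Oplus>\<^bsub>P\<^esub>a\<in>arcs Q. e.dom.ev (arr a) (k a)) =
    (\<Oplus>\<^bsub>P\<^esub>a\<in>arcs Q. e.dom.ev (arr a) (w a) \<oplus>\<^bsub>P\<^esub> (\<ominus>\<^bsub>P\<^esub> e.dom.ev (arr a) (d (v a))))"
   using wC vC by (intro e.dom.ag.finsum_cong') (auto simp: k_def e.dom.ev_add_right e.dom.ev_minus)
  also have "... = x \<oplus>\<^bsub>P\<^esub> (\<Oplus>\<^bsub>P\<^esub>a\<in>arcs Q. \<ominus>\<^bsub>P\<^esub> e.dom.ev (arr a) (d (v a)))"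
   unfolding x_def using wC vC by (intro e.dom.ag.finsum_addf) auto
  also have "(\<Oplus>\<^bsub>P\<^esub>a\<in>arcs Q. \<ominus>\<^bsub>P\<^esub> e.dom.ev (arr a) (d (v a))) = \<ominus>\<^bsub>P\<^esub> x"
  proof -
   have "x \<oplus>\<^bsub>P\<^esub> (\<Oplus>\<^bsub>P\<^esub>a\<in>arcs Q. \<ominus>\<^bsub>P\<^esub> e.dom.ev (arr a) (d (v a))) =
     (\<Oplus>\<^bsub>P\<^esub>a\<in>arcs Q. e.dom.ev (arr a) (d (v a)) \<oplus>\<^bsub>P\<^esub> (\<ominus>\<^bsub>P\<^esub> e.dom.ev (arr a) (d (v a))))"
    unfolding x_dv using vC by (intro e.dom.ag.finsum_addf[symmetric]) auto
   also have "... = \<zero>\<^bsub>P\<^esub>" using vC by (intro e.dom.ag.add.finprod_one_eqI) (simp add: e.dom.ag.r_neg)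
   finally have s: "x \<oplus>\<^bsub>P\<^esub> (\<Oplus>\<^bsub>P\<^esub>a\<in>arcs Q. \<ominus>\<^bsub>P\<^esub> e.dom.ev (arr a) (d (v a))) = \<zero>\<^bsub>P\<^esub>" .
   have c: "x \<in> carrier P" "(\<Oplus>\<^bsub>P\<^esub>a\<in>arcs Q. \<ominus>\<^bsub>P\<^esub> e.dom.ev (arr a) (d (v a))) \<in> carrier P"
    using e.dom.hc_carrier[OF xh] vC by (auto intro!: e.dom.ag.finsum_closed)
   show ?thesis by (rule e.dom.ag.minus_equality[symmetric]) (use s c in "simp_all add: e.dom.ag.a_comm")
  qed
  finally have "(\<Oplus>\<^bsub>P\<^esub>a\<in>arcs Q. e.dom.ev (arr a) (k a)) = \<zero>\<^bsub>P\<^esub>" using e.dom.hc_carrier[OF xh] by (simp add: e.dom.ag.r_neg)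
  from e.dom.rel_atD[OF relP[OF m] kh kv this] obtain t where
   t: "\<forall>a\<in>arcs Q. \<forall>b\<in>arcs Q. t a b \<in> hcomp P (m - 1)" "\<forall>a\<in>arcs Q. k a = (\<Oplus>\<^bsub>P\<^esub>b\<in>{b. (b, a) \<in> F}. e.dom.ev (arr b) (t a b))" by blast
  have "u a = (\<Oplus>\<^bsub>M\<^esub>b\<in>{b. (b, a) \<in> F}. M.ev (arr b) (e (t a b)))" if a: "a \<in> arcs Q" for a
  proof -
   have S: "b \<in> arcs Q" if "b \<in> {b. (b, a) \<in> F}" for b using that F_arcs by blast
   have tC: "t a b \<in> carrier P" if "b \<in> arcs Q" for b by (rule e.dom.hc_carrier) (use t(1) a that in blast)
   have "d (v a) \<in> gr_im P1 d" using vC[OF a] by (simp add: gr_im_def)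
   then have "e (d (v a)) = \<zero>\<^bsub>M\<^esub>" unfolding ex by (simp add: gr_ker_def)
   then have "e (k a) = u a" using a wC vC we[OF a] e.f_closed[OF wC[OF a]] by (simp add: k_def e.f_add e.f_minus)
   moreover have "e (k a) = (\<Oplus>\<^bsub>M\<^esub>b\<in>{b. (b, a) \<in> F}. e (e.dom.ev (arr b) (t a b)))"
    unfolding bspec[OF t(2) a] using tC S by (intro e.f_finsum) auto
   moreover have "... = (\<Oplus>\<^bsub>M\<^esub>b\<in>{b. (b, a) \<in> F}. M.ev (arr b) (e (t a b)))"
    using tC S by (intro M.ag.finsum_cong') (auto simp: e.f_ev)
   ultimately show ?thesis by simp
  qed
  then show "\<exists>t. (\<forall>a\<in>arcs Q. \<forall>b\<in>arcs Q. t a b \<in> hcomp M (m - 1)) &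
    (\<forall>a\<in>arcs Q. u a = (\<Oplus>\<^bsub>M\<^esub>b\<in>{b. (b, a) \<in> F}. M.ev (arr b) (t a b)))"
   using t(1) e.f_hc by (intro exI[of _ "%a b. e (t a b)"]) blast
 qed
 show ?thesis using bnd gen rel by blast
qed

text \<open>
 A kernel of a map of cofree modules inherits injectivity of \<open>x \<mapsto> (a x)\<^sub>a\<close> in low degrees; a solution of
 \<open>a \<phi> = y\<^sub>a\<close> in the first injective belongs to the kernel, as its image in the second one is killed by
 all arrows.
\<close>
lemma fin_copres_tail_quadratic:
 assumes N: "N \<in> fin_copres Q J"
 shows "\<exists>u n. (\<forall>m x. u < m --> x \<in> hcomp N m --> x = \<zero>\<^bsub>N\<^esub>) &
  (\<forall>m<n. graded_pre.cogen_at Q J N m & graded_pre.corel_at Q J F N m)"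
proof -
 from N obtain xs ys d e where gm: "gr_module Q J N" and xs: "set xs <= verts Q \<times> UNIV" and ys: "set ys <= verts Q \<times> UNIV"
  and he: "e \<in> gr_hom Q J N (IS xs)" and hd: "d \<in> gr_hom Q J (IS xs) (IS ys)"
  and ker: "gr_ker N (IS xs) e = {\<zero>\<^bsub>N\<^esub>}" and ex: "gr_im N e = gr_ker (IS xs) (IS ys) d"
  unfolding fin_copres_def by blast
 interpret N: graded_mod Q J F N by (rule gr_moduleD[OF gm])
 define I where "I = IS xs"
 define I1 where "I1 = IS ys"
 note ex = ex[folded I_def I1_def] and ker = ker[folded I_def]
 have I: "graded_pre Q J F I" and I1: "graded_pre Q J F I1"
  unfolding I_def I1_def by (rule graded_preI[OF isum_pre[OF xs]], rule graded_preI[OF isum_pre[OF ys]])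
 interpret e: graded_hom Q J F N I e
  by (intro graded_homI N.graded_pre_axioms I he[folded I_def])
 interpret d: graded_hom Q J F I I1 d
  by (intro graded_homI I I1 hd[folded I_def I1_def])
 obtain l u where "\<forall>x i. (x, i) \<in> set xs --> l \<le> i & i \<le> u" using exponent_bounds[of xs] by (elim exE)
 note lu = this[rule_format]
 obtain l1 u1 where "\<forall>x i. (x, i) \<in> set ys --> l1 \<le> i & i \<le> u1" using exponent_bounds[of ys] by (elim exE)
 note lu1 = this[rule_format]
 define n where "n = min l l1"
 have cogI: "e.cod.cogen_at m" and corI: "e.cod.corel_at m" if "m < n" for m
  unfolding I_def by (rule isum_cogen[OF xs], use lu that in "force simp: n_def")
   (rule isum_corel[OF xs], use lu that in "force simp: n_def")
 have cogI1: "d.cod.cogen_at m" if "m < n" for m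
  unfolding I1_def by (rule isum_cogen[OF ys]) (use lu1 that in "force simp: n_def")
 have inj: "x = \<zero>\<^bsub>N\<^esub>" if "x \<in> carrier N" "e x = \<zero>\<^bsub>I\<^esub>" for x
 proof -
  have "x \<in> gr_ker N I e" using that by (simp add: gr_ker_def)
  then show ?thesis unfolding ker by simp
 qed
 have inj2: "x = y" if "x \<in> carrier N" "y \<in> carrier N" "e x = e y" for x y
 proof -
  have "x \<oplus>\<^bsub>N\<^esub> (\<ominus>\<^bsub>N\<^esub> y) = \<zero>\<^bsub>N\<^esub>" by (rule inj) (use that in "simp_all add: e.f_add e.f_minus e.cod.ag.r_neg")
  then show ?thesis using that(1,2) by (metis N.ag.minus_equality N.ag.minus_minus N.ag.a_inv_closed)
 qed
 have bnd: "x = \<zero>\<^bsub>N\<^esub>" if m: "u < m" and x: "x \<in> hcomp N m" for m x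
 proof (rule inj[OF N.hc_carrier[OF x]])
  have ex: "e x \<in> hcomp I m" by (rule e.f_hc[OF x])
  show "e x = \<zero>\<^bsub>I\<^esub>"
   unfolding I_def
  proof (rule isum_ext[OF xs], unfold I_def[symmetric])
   show "e x \<in> carrier I" "\<zero>\<^bsub>I\<^esub> \<in> carrier I" using e.cod.hc_carrier[OF ex] e.cod.ag.zero_closed by auto
   fix j p assume j: "j < length xs" and p: "p \<in> gto (fst (xs ! j))"
   have "snd (xs ! j) \<le> u" using lu[of "fst (xs ! j)" "snd (xs ! j)"] nth_mem[OF j] by simp
   then have *: "int (length (snd p)) ~= - (m - snd (xs ! j))" using m by linarith
   have "z j (pe p) = 0" if "z \<in> hcomp I m" for z
    by (rule inj_hc_pe[OF xs_nth[OF xs j] _ p *]) (use that j in "simp add: I_def isum_hcomp[OF xs]")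
   from this[OF ex] this[OF e.cod.hc_zero] show "e x j (pe p) = \<zero>\<^bsub>I\<^esub> j (pe p)" by simp
  qed
 qed
 have cogen: "N.cogen_at m" if m: "m < n" for m
  unfolding N.cogen_at_def
 proof (intro ballI impI)
  fix x assume x: "x \<in> hcomp N m" and a: "\<forall>a\<in>arcs Q. N.ev (arr a) x = \<zero>\<^bsub>N\<^esub>"
  have xC: "x \<in> carrier N" using x by (rule N.hc_carrier)
  have "e.cod.ev (arr a) (e x) = \<zero>\<^bsub>I\<^esub>" if "a \<in> arcs Q" for a
   using a that xC e.f_ev[of "arr a" x] by simp
  then have "e x = \<zero>\<^bsub>I\<^esub>" using cogI[OF m] e.f_hc[OF x] unfolding e.cod.cogen_at_def by blast
  then show "x = \<zero>\<^bsub>N\<^esub>" by (rule inj[OF xC])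
 qed
 have corel: "N.corel_at m" if m: "m < n" for m
  unfolding N.corel_at_def
 proof (intro allI impI)
  fix y assume "\<forall>a\<in>arcs Q. y a \<in> hcomp N (m + 1) & N.ev (vtx (head Q a)) (y a) = y a"
   and yF: "\<forall>a b. (a, b) \<in> F --> N.ev (arr b) (y a) = \<zero>\<^bsub>N\<^esub>"
  then have y: "y a \<in> hcomp N (m + 1)" "N.ev (vtx (head Q a)) (y a) = y a" if "a \<in> arcs Q" for a using that by blast+
  have yC: "y a \<in> carrier N" if "a \<in> arcs Q" for a using y(1)[OF that] by (rule N.hc_carrier)
  have "\<exists>\<phi>\<in>hcomp I m. \<forall>a\<in>arcs Q. e.cod.ev (arr a) \<phi> = e (y a)"
  proof (rule e.cod.corel_atD[OF corI[OF m]])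
   show "e (y a) \<in> hcomp I (m + 1)" if "a \<in> arcs Q" for a by (rule e.f_hc[OF y(1)[OF that]])
   show "e.cod.ev (vtx (head Q a)) (e (y a)) = e (y a)" if "a \<in> arcs Q" for a
    using that yC y(2) e.f_ev[of "vtx (head Q a)" "y a"] by simp
   show "e.cod.ev (arr b) (e (y a)) = \<zero>\<^bsub>I\<^esub>" if "(a, b) \<in> F" for a b
    using yF that F_arcs[OF that] yC[of a] e.f_ev[of "arr b" "y a"] by simp
  qed
  then obtain \<phi> where \<phi>: "\<phi> \<in> hcomp I m" "\<forall>a\<in>arcs Q. e.cod.ev (arr a) \<phi> = e (y a)" by blast
  have \<phi>C: "\<phi> \<in> carrier I" using \<phi>(1) by (rule e.cod.hc_carrier)
  have "d.cod.ev (arr a) (d \<phi>) = \<zero>\<^bsub>I1\<^esub>" if a: "a \<in> arcs Q" for a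
  proof -
   have "e (y a) \<in> gr_im N e" using yC[OF a] by (simp add: gr_im_def)
   then have "d (e (y a)) = \<zero>\<^bsub>I1\<^esub>" unfolding ex by (simp add: gr_ker_def)
   then show ?thesis using a \<phi>(2) \<phi>C d.f_ev[of "arr a" \<phi>] by simp
  qed
  then have "d \<phi> = \<zero>\<^bsub>I1\<^esub>" using cogI1[OF m] d.f_hc[OF \<phi>(1)] unfolding d.cod.cogen_at_def by blast
  then have "\<phi> \<in> gr_im N e" unfolding ex using \<phi>C by (simp add: gr_ker_def)
  from e.homogeneous_preimage[OF \<phi>(1) this] obtain x where x: "x \<in> hcomp N m" "e x = \<phi>" by blast
  have xC: "x \<in> carrier N" using x(1) by (rule N.hc_carrier)
  have "N.ev (arr a) x = y a" if a: "a \<in> arcs Q" for a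
   by (rule inj2) (use a xC yC \<phi>(2) x(2) in "simp_all add: e.f_ev")
  then show "\<exists>x\<in>hcomp N m. \<forall>a\<in>arcs Q. N.ev (arr a) x = y a" using x(1) by blast
 qed
 show ?thesis using bnd cogen corel by blast
qed

end

section \<open>Linear modules are finitely presented, colinear modules finitely copresented\<close>

lemma gr_shift_shift: "gr_shift i (gr_shift j M) = gr_shift (i + j) M"
 by (simp add: gr_shift_def algebra_simps)

lemma gr_shift_0: "gr_shift 0 M = M"
 by (simp add: gr_shift_def)

lemma gr_hom_shift:
 fixes M :: "(('v, 'e, 'k::field) bq_elem, 'm) graded_module" and N :: "(('v, 'e, 'k) bq_elem, 'n) graded_module"
 shows "gr_hom Q J (gr_shift i M) (gr_shift i N) = gr_hom Q J M N"
proof -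
 have "(\<forall>n. f ` hcomp M (n - i) <= hcomp N (n - i)) \<longleftrightarrow> (\<forall>n. f ` hcomp M n <= hcomp N n)" for f :: "'m => 'n"
  by (metis add_diff_cancel_right')
 then show ?thesis by (simp add: gr_hom_def gr_shift_def)
qed

lemma gr_ker_shift: "gr_ker (gr_shift i M) (gr_shift j N) f = gr_ker M N f"
 and gr_im_shift: "gr_im (gr_shift i M) f = gr_im M f"
 by (simp_all add: gr_ker_def gr_im_def gr_shift_def)

lemma gr_shift_dsum: "gr_shift i (gr_dsum Ms) = gr_dsum (map (gr_shift i) Ms)"
 by (auto simp: gr_dsum_def gr_shift_def fun_eq_iff intro!: PiE_cong restrict_ext)

lemma proj_sum_shift: "gr_shift i (proj_sum Q J xs) = proj_sum Q J (map (%(x, j). (x, i + j)) xs)"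
 by (simp add: proj_sum_def gr_shift_dsum gr_shift_shift comp_def case_prod_unfold)

lemma inj_sum_shift: "gr_shift i (inj_sum Q J xs) = inj_sum Q J (map (%(x, j). (x, i + j)) xs)"
 by (simp add: inj_sum_def gr_shift_dsum gr_shift_shift comp_def case_prod_unfold)

lemma linear_fin_pres:
 assumes M: "gr_module Q J M" and kos: "koszul Q J (gr_shift (- i) M)"
 shows "M \<in> fin_pres Q J"
proof -
 let ?P = "%X n. proj_sum Q J (map (%x. (x, int n)) X)" and ?M = "gr_shift (- i) M"
 from kos obtain X d e where X: "\<forall>n. set (X n) <= verts Q" and e: "e \<in> gr_hom Q J (?P (X 0) 0) ?M"
  and d: "\<forall>n. d n \<in> gr_hom Q J (?P (X (Suc n)) (Suc n)) (?P (X n) n)" and im: "gr_im (?P (X 0) 0) e = carrier ?M"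
  and ex: "gr_im (?P (X 1) 1) (d 0) = gr_ker (?P (X 0) 0) ?M e"
  unfolding koszul_def Let_def by blast
 let ?s = "%X n. map (%(x, j). (x, i + j)) (map (%x. (x, int n)) X)"
 have sM: "M = gr_shift i ?M" by (simp add: gr_shift_shift gr_shift_0)
 have sP: "proj_sum Q J (?s X n) = gr_shift i (?P X n)" for X n by (rule proj_sum_shift[symmetric])
 have "set (?s (X n) m) <= verts Q \<times> UNIV" for n m using X by auto
 moreover have "e \<in> gr_hom Q J (proj_sum Q J (?s (X 0) 0)) M" using e sM gr_hom_shift[of Q J i] sP by metis
 moreover have "d 0 \<in> gr_hom Q J (proj_sum Q J (?s (X 1) 1)) (proj_sum Q J (?s (X 0) 0))"
  using d[rule_format, of 0] by (simp only: sP gr_hom_shift One_nat_def)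
 moreover have "gr_im (proj_sum Q J (?s (X 1) 1)) (d 0) = gr_ker (proj_sum Q J (?s (X 0) 0)) M e"
  unfolding sP gr_im_shift ex by (subst (2) sM) (simp only: gr_ker_shift)
 moreover have "gr_im (proj_sum Q J (?s (X 0) 0)) e = carrier M"
  unfolding sP gr_im_shift im by (simp add: gr_shift_def)
 ultimately show ?thesis using M unfolding fin_pres_def by blast
qed

lemma colinear_fin_copres:
 assumes M: "gr_module Q J M" and kos: "cokoszul Q J (gr_shift (- i) M)"
 shows "M \<in> fin_copres Q J"
proof -
 let ?I = "%X n. inj_sum Q J (map (%x. (x, - int n)) X)" and ?M = "gr_shift (- i) M"
 from kos obtain X d e where X: "\<forall>n. set (X n) <= verts Q" and e: "e \<in> gr_hom Q J ?M (?I (X 0) 0)"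
  and d: "\<forall>n. d n \<in> gr_hom Q J (?I (X n) n) (?I (X (Suc n)) (Suc n))" and ker: "gr_ker ?M (?I (X 0) 0) e = {\<zero>\<^bsub>?M\<^esub>}"
  and ex: "gr_im ?M e = gr_ker (?I (X 0) 0) (?I (X 1) 1) (d 0)"
  unfolding cokoszul_def Let_def by blast
 let ?s = "%X n. map (%(x, j). (x, i + j)) (map (%x. (x, - int n)) X)"
 have sM: "M = gr_shift i ?M" by (simp add: gr_shift_shift gr_shift_0)
 have sI: "inj_sum Q J (?s X n) = gr_shift i (?I X n)" for X n by (rule inj_sum_shift[symmetric])
 have "set (?s (X n) m) <= verts Q \<times> UNIV" for n m using X by auto
 moreover have "e \<in> gr_hom Q J M (inj_sum Q J (?s (X 0) 0))" using e sM gr_hom_shift[of Q J i] sI by metis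
 moreover have "d 0 \<in> gr_hom Q J (inj_sum Q J (?s (X 0) 0)) (inj_sum Q J (?s (X 1) 1))"
  using d[rule_format, of 0] by (simp only: sI gr_hom_shift One_nat_def)
 moreover have "gr_im M e = gr_ker (inj_sum Q J (?s (X 0) 0)) (inj_sum Q J (?s (X 1) 1)) (d 0)"
  unfolding sI gr_ker_shift ex[symmetric] gr_im_shift ..
 moreover have "gr_ker M (inj_sum Q J (?s (X 0) 0)) e = {\<zero>\<^bsub>M\<^esub>}"
  using ker unfolding sI gr_ker_shift by (simp add: gr_ker_def gr_shift_def)
 ultimately show ?thesis using M unfolding fin_copres_def by blast
qed

section \<open>The truncation sequence in the Serre quotient\<close>

lemma serre_isosI:
 assumes "f \<in> gr_hom Q J M N" "K \<in> \<B>" "i \<in> gr_hom Q J K M" "inj_on i (carrier K)" "gr_im K i = gr_ker M N f"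
  "C \<in> \<B>" "p \<in> gr_hom Q J N C" "gr_im N p = carrier C" "gr_ker N C p = gr_im M f"
 shows "(M, f, N) \<in> serre_isos Q J \<B>"
 unfolding serre_isos_def using assms by blast

context graded_mod
begin

lemma zero_module: "trunc {} \<in> gmod Q J"
 by (rule trunc_gmod[of _ 0 0]) (auto simp: convex_def)

lemma carrier_zero_module: "carrier (trunc {}) = {\<zero>}"
 by (auto intro: hp_ext)

lemma KQ_rep: "a \<in> carrier A ==> \<exists>f\<in>KQ. a = cls f"
 unfolding carrier_A by blast

text \<open>Arrows raise degrees, so cutting off low degrees leaves a submodule and cutting off high degrees a quotient.\<close>
lemma incl_hom: "(\<lambda>x\<in>carrier (trunc {n..}). x) \<in> gr_hom Q J (trunc {n..}) M"
proof -
 have "cut {n..} (a \<odot> x) = a \<odot> x" if a: "a \<in> carrier A" and x: "x \<in> carrier (trunc {n..})" for a x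
 proof -
  obtain f where f: "f \<in> KQ" "a = cls f" using KQ_rep[OF a] by blast
  have xC: "x \<in> carrier M" using x by simp
  have "cut {..<n} x = \<zero>" by (rule hp_ext) (use x in "auto simp: hp_cut")
  then have "cut {..<n} (ev f x) = \<zero>" using cut_ev_cut[OF f(1) xC, of "{..<n}"] f(1) by simp
  then have hz: "hp (ev f x) m = \<zero>" if "m ~: {n..}" for m
   using hp_cut[of "ev f x" "{..<n}" m] f(1) xC that by simp
  have "cut {n..} (ev f x) = ev f x" by (rule cut_id) (simp add: f xC, rule hz)
  then show ?thesis by (simp add: ev_def f(2))
 qed
 then show ?thesis
  using left_module.smult_closed[OF trunc_left_module[of "{n..}"]]
  unfolding gr_hom_def by (auto simp: convex_def hp_add hp_hom intro: hc_carrier)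
qed

lemma proj_hom: "(\<lambda>x\<in>carrier M. cut {..<n} x) \<in> gr_hom Q J M (trunc {..<n})"
proof -
 have "cut {..<n} (a \<odot> cut {..<n} x) = cut {..<n} (a \<odot> x)" if a: "a \<in> carrier A" and x: "x \<in> carrier M" for a x
 proof -
  obtain f where f: "f \<in> KQ" "a = cls f" using KQ_rep[OF a] by blast
  show ?thesis using cut_ev_cut[OF f(1) x, of "{..<n}"] by (simp add: f(2) ev_def)
 qed
 moreover have "cut {..<n} x \<in> hcomp M m" if "x \<in> hcomp M m" "m < n" for x m
  using cut_hc[OF that(1)] that by simp
 moreover have "cut {..<n} x = \<zero>" if x: "x \<in> hcomp M m" "\<not> m < n" for x m
  by (rule hp_ext) (use x hc_carrier[OF x(1)] in "auto simp: hp_cut hp_hom")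
 ultimately show ?thesis
  using left_module.smult_closed[OF lm] unfolding gr_hom_def
  by (auto simp: hp_cut cut_add hc_carrier)
qed

lemma proj_ker: "gr_ker M (trunc {..<n}) (\<lambda>x\<in>carrier M. cut {..<n} x) = carrier (trunc {n..})"
proof (intro equalityI subsetI)
 fix x assume "x \<in> gr_ker M (trunc {..<n}) (\<lambda>x\<in>carrier M. cut {..<n} x)"
 then have x: "x \<in> carrier M" "cut {..<n} x = \<zero>" by (auto simp: gr_ker_def)
 have "hp x m = \<zero>" if "m ~: {n..}" for m using hp_cut[OF x(1), of "{..<n}" m] x(2) that by simp
 with x(1) show "x \<in> carrier (trunc {n..})" by simp
next
 fix x assume x: "x \<in> carrier (trunc {n..})"
 have "cut {..<n} x = \<zero>" by (rule hp_ext) (use x in "auto simp: hp_cut")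
 with x show "x \<in> gr_ker M (trunc {..<n}) (\<lambda>x\<in>carrier M. cut {..<n} x)" by (simp add: gr_ker_def)
qed

lemma proj_im: "gr_im M (\<lambda>x\<in>carrier M. cut {..<n} x) = carrier (trunc {..<n})"
proof (intro equalityI subsetI)
 fix x assume x: "x \<in> carrier (trunc {..<n})"
 then have "cut {..<n} x = x" by (intro cut_id) auto
 with x show "x \<in> gr_im M (\<lambda>x\<in>carrier M. cut {..<n} x)" unfolding gr_im_def by (intro image_eqI[of _ _ x]) auto
qed (auto simp: gr_im_def hp_cut)

lemma incl_im: "gr_im (trunc {n..}) (\<lambda>x\<in>carrier (trunc {n..}). x) = carrier (trunc {n..})"
 by (simp add: gr_im_def)

lemma incl_inj: "inj_on (\<lambda>x\<in>carrier (trunc {n..}). x) (carrier (trunc {n..}))"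
 by (simp add: inj_on_def)

lemma zero_smult: "a \<in> carrier A ==> a \<odot> \<zero> = \<zero>"
 using KQ_rep[of a] ev_zero_right by (auto simp: ev_def)

text \<open>
 The cokernel of the inclusion is the part of bounded degrees and therefore finite-dimensional.
\<close>
lemma incl_serre_iso:
 assumes low: "!!m x. m < l ==> x \<in> hcomp M m ==> x = \<zero>"
 shows "(trunc {n..}, \<lambda>x\<in>carrier (trunc {n..}). x, M) \<in> serre_isos Q J (gmod Q J)"
proof (rule serre_isosI[OF incl_hom zero_module _ _ _ _ proj_hom proj_im])
 let ?i = "\<lambda>x\<in>carrier (trunc {}). x"
 show "?i \<in> gr_hom Q J (trunc {}) (trunc {n..})"
  unfolding gr_hom_def carrier_zero_module by (auto simp: zero_smult)
 show "inj_on ?i (carrier (trunc {}))" "gr_im (trunc {}) ?i = gr_ker (trunc {n..}) M (\<lambda>x\<in>carrier (trunc {n..}). x)"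
  unfolding gr_im_def gr_ker_def carrier_zero_module by auto
 show "trunc {..<n} \<in> gmod Q J"
 proof (rule trunc_gmod[of _ l n])
  show "convex {..<n}" by (auto simp: convex_def)
  have "hp x m = \<zero>" if "x \<in> carrier M" "m < l" for x m using low[OF that(2) hp_hc[OF that(1)]] .
  then show "carrier (trunc {..<n}) = carrier (trunc {l..<n})" by (auto simp: not_le)
 qed
 show "gr_ker M (trunc {..<n}) (\<lambda>x\<in>carrier M. cut {..<n} x) = gr_im (trunc {n..}) (\<lambda>x\<in>carrier (trunc {n..}). x)"
  by (simp only: proj_ker incl_im)
qed

lemma proj_serre_iso:
 assumes high: "!!m x. u < m ==> x \<in> hcomp M m ==> x = \<zero>"
 shows "(M, \<lambda>x\<in>carrier M. cut {..<n} x, trunc {..<n}) \<in> serre_isos Q J (gmod Q J)"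
proof (rule serre_isosI[OF proj_hom _ incl_hom incl_inj _ zero_module])
 show "trunc {n..} \<in> gmod Q J"
 proof (rule trunc_gmod[of _ n "u + 1"])
  show "convex {n..}" by (auto simp: convex_def)
  have "hp x m = \<zero>" if "x \<in> carrier M" "u < m" for x m using high[OF that(2) hp_hc[OF that(1)]] .
  then show "carrier (trunc {n..}) = carrier (trunc {n..<u + 1})" by (auto simp: not_less)
 qed
 show "gr_im (trunc {n..}) (\<lambda>x\<in>carrier (trunc {n..}). x) = gr_ker M (trunc {..<n}) (\<lambda>x\<in>carrier M. cut {..<n} x)"
  by (simp only: proj_ker incl_im)
 let ?p = "\<lambda>x\<in>carrier (trunc {..<n}). \<zero>"
 have "convex {..<n}" by (auto simp: convex_def)
 note cl = left_module.smult_closed[OF trunc_left_module[OF this]]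
 interpret T: abelian_group "trunc {..<n}" by (rule trunc_abelian_group)
 have z: "\<zero> \<in> carrier (trunc {..<n})" by simp
 show "?p \<in> gr_hom Q J (trunc {..<n}) (trunc {})"
  unfolding gr_hom_def carrier_zero_module mem_Collect_eq
 proof (intro conjI ballI allI)
  fix x y assume "x \<in> carrier (trunc {..<n})" "y \<in> carrier (trunc {..<n})"
  then show "?p (x \<oplus>\<^bsub>trunc {..<n}\<^esub> y) = ?p x \<oplus>\<^bsub>trunc {}\<^esub> ?p y"
   using T.a_closed[of x y] by (simp del: trunc_simps(1) add: restrict_apply')
 next
  fix a x assume "a \<in> carrier A" "x \<in> carrier (trunc {..<n})"
  then show "?p (a \<odot>\<^bsub>trunc {..<n}\<^esub> x) = a \<odot>\<^bsub>trunc {}\<^esub> ?p x"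
   using cl(1)[of a x] by (simp del: trunc_simps(1,4) add: restrict_apply') (simp add: zero_smult)
 next
  fix m show "?p ` hcomp (trunc {..<n}) m <= hcomp (trunc {}) m"
   using hc_trunc_sub[of m "{..<n}"] z by (auto simp del: trunc_simps(1) simp: restrict_apply' split: if_splits)
 qed auto
 show "gr_im (trunc {..<n}) ?p = carrier (trunc {})" unfolding gr_im_def carrier_zero_module using z by force
 show "gr_ker (trunc {..<n}) (trunc {}) ?p = gr_im M (\<lambda>x\<in>carrier M. cut {..<n} x)"
  unfolding proj_im by (auto simp: gr_ker_def)
qed

end

lemma zigzag_append: "zigzag C S X u Y ==> zigzag C S Y v Z ==> zigzag C S X (u @ v) Z"
 by (induction rule: zigzag.induct) (auto intro: zigzag.intros)

lemma zz_step_append: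
 assumes u: "equivclp (zz_step C S X Y) u u'" and v: "equivclp (zz_step C S Y Z) v v'"
  and z: "zigzag C S X u' Y" "zigzag C S Y v Z"
 shows "equivclp (zz_step C S X Z) (u @ v) (u' @ v')"
proof -
 have l: "zz_step C S X Z (w @ v) (w' @ v)" if "zz_step C S X Y w w'" for w w'
  using that zigzag_append[OF _ z(2)] unfolding zz_step_def by (metis append.assoc)
 have r: "zz_step C S X Z (u' @ w) (u' @ w')" if "zz_step C S Y Z w w'" for w w'
  using that zigzag_append[OF z(1)] unfolding zz_step_def by (metis append.assoc)
 have "equivclp (zz_step C S X Z) (u @ v) (u' @ v)"
  using u
 proof (induction rule: equivclp_induct)
  case (step w w')
  then have "zz_step C S X Z (w @ v) (w' @ v) \<or> zz_step C S X Z (w' @ v) (w @ v)" using l by blast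
  with step.IH show ?case by (rule equivclp_into_equivclp)
 qed simp
 moreover have "equivclp (zz_step C S X Z) (u' @ v) (u' @ v')"
  using v
 proof (induction rule: equivclp_induct)
  case (step w w')
  then have "zz_step C S X Z (u' @ w) (u' @ w') \<or> zz_step C S X Z (u' @ w') (u' @ w)" using r by blast
  with step.IH show ?case by (rule equivclp_into_equivclp)
 qed simp
 ultimately show ?thesis by (rule equivclp_trans)
qed

text \<open>
 The inverse is the class of the formal inverse, but the composite in the localisation is formed from
 all representatives, so the congruence is needed on both sides.
\<close>
lemma isomorphic_in_localization:
 assumes s: "(X, s, Y) \<in> S" "X \<in> Ob C" "Y \<in> Ob C" "s \<in> Hom C X Y"
 shows "isomorphic_in (localization C S) X Y"
proof -
 have z: "zigzag C S X [Fwd X s Y] Y" "zigzag C S Y [Bwd Y s X] X"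
  using s by (auto intro: zigzag.intros)
 have cancel: "zz_rel C S V V `` {u @ v | u v. u \<in> zz_rel C S V W `` {[a]} & v \<in> zz_rel C S W V `` {[b]}} = zz_rel C S V V `` {[]}"
  if V: "V \<in> Ob C" and zz: "zigzag C S V [a] W" "zigzag C S W [b] V" and rule: "zz_rule C [a, b] []" for V W a b
 proof -
  have n: "zigzag C S V [] V" using V by (rule zz_nil)
  have ab: "zigzag C S V [a, b] V" using zigzag_append[OF zz] by simp
  have "zz_step C S V V [a, b] []"
   unfolding zz_step_def using ab n rule by (intro conjI exI[of _ "[]"] exI[of _ "[a, b]"]) auto
  then have e: "equivclp (zz_step C S V V) [a, b] []" by (rule r_into_equivclp)
  have uv: "(u @ v, []) \<in> zz_rel C S V V" if u: "([a], u) \<in> zz_rel C S V W" and v: "([b], v) \<in> zz_rel C S W V" for u v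
  proof -
   have zu: "zigzag C S V u W" "zigzag C S W v V" using u v by (auto simp: zz_rel_def)
   have "equivclp (zz_step C S V V) (u @ v) ([a] @ [b])"
    by (rule zz_step_append) (use u v zu zz in "auto simp: zz_rel_def intro: equivclp_sym")
   then have "equivclp (zz_step C S V V) (u @ v) []" using equivclp_trans[OF _ e] by simp
   then show ?thesis using zigzag_append[OF zu] n by (simp add: zz_rel_def)
  qed
  have sym: "(p, q) \<in> zz_rel C S V V ==> (q, p) \<in> zz_rel C S V V" for p q
   by (auto simp: zz_rel_def intro: equivclp_sym)
  have tr: "(p, q) \<in> zz_rel C S V V ==> (q, r) \<in> zz_rel C S V V ==> (p, r) \<in> zz_rel C S V V" for p q r
   by (auto simp: zz_rel_def intro: equivclp_trans)
  have r: "([a], [a]) \<in> zz_rel C S V W" "([b], [b]) \<in> zz_rel C S W V" using zz by (auto simp: zz_rel_def)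
  show ?thesis
  proof (intro equalityI subsetI)
   fix w assume "w \<in> zz_rel C S V V `` {u @ v | u v. u \<in> zz_rel C S V W `` {[a]} & v \<in> zz_rel C S W V `` {[b]}}"
   then obtain u v where "([a], u) \<in> zz_rel C S V W" "([b], v) \<in> zz_rel C S W V" "(u @ v, w) \<in> zz_rel C S V V" by auto
   then have "([], w) \<in> zz_rel C S V V" using tr[OF sym[OF uv]] by blast
   then show "w \<in> zz_rel C S V V `` {[]}" by simp
  next
   fix w assume "w \<in> zz_rel C S V V `` {[]}"
   then have "([a] @ [b], w) \<in> zz_rel C S V V" using tr[OF uv[OF r]] by simp
   then show "w \<in> zz_rel C S V V `` {u @ v | u v. u \<in> zz_rel C S V W `` {[a]} & v \<in> zz_rel C S W V `` {[b]}}"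
    using r by (intro ImageI[of "[a] @ [b]"]) (assumption, blast)
  qed
 qed
 show ?thesis
  unfolding isomorphic_in_def localization_def
 proof (simp only: category.simps, intro conjI s(2,3) bexI)
  show "zz_rel C S X X `` {u @ v | u v. u \<in> zz_rel C S X Y `` {[Fwd X s Y]} & v \<in> zz_rel C S Y X `` {[Bwd Y s X]}} = zz_rel C S X X `` {[]}"
   by (rule cancel[OF s(2) z zz_inv_right])
  show "zz_rel C S Y Y `` {u @ v | u v. u \<in> zz_rel C S Y X `` {[Bwd Y s X]} & v \<in> zz_rel C S X Y `` {[Fwd X s Y]}} = zz_rel C S Y Y `` {[]}"
   by (rule cancel[OF s(3) z(2,1) zz_inv_left])
 qed (use z in "auto simp: quotient_def")
qed

lemma isomorphic_in_sym: "isomorphic_in C X Y ==> isomorphic_in C Y X"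
 unfolding isomorphic_in_def by blast

context monomial_quotient
begin

text \<open>
 The tail in degrees at least \<open>n\<close> has quadratic presentation, and it differs from the module by a
 finite-dimensional quotient.
\<close>
theorem fin_pres_iso_linear:
 assumes M: "M \<in> fin_pres Q J"
 shows "\<exists>N. linear_module Q J N & isomorphic_in (serre_quotient Q J (fin_pres Q J) (gmod Q J)) M N"
proof -
 interpret M: graded_mod Q J F M by (rule gr_moduleD) (use M in "simp add: fin_pres_def")
 obtain l n where low: "!!m x. m < l ==> x \<in> hcomp M m ==> x = \<zero>\<^bsub>M\<^esub>"
  and gr: "!!m. n \<le> m ==> M.gen_at m" "!!m. n \<le> m ==> M.rel_at m"
  using fin_pres_tail_quadratic[OF M] by blast
 have D: "M.convex {n..}" by (auto simp: M.convex_def)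
 define N where "N = M.trunc {n..}"
 have N: "gr_module Q J N" unfolding N_def by (rule M.trunc_gr_module[OF D])
 interpret N: graded_mod Q J F N by (rule gr_moduleD[OF N])
 have "gr_module Q J (gr_shift (- n) N)"
  unfolding gr_module_iff using N.shift_pre[of "- n"] N.fd by (simp add: gr_shift_def fin_dim_def finsum_def)
 then interpret S: graded_mod Q J F "gr_shift (- n) N" by (rule gr_moduleD)
 have kos: "koszul Q J (gr_shift (- n) N)"
 proof (rule S.koszul_if_quadratic)
  show "x = \<zero>\<^bsub>gr_shift (- n) N\<^esub>" if "m < 0" "x \<in> hcomp (gr_shift (- n) N) m" for m x
   using that by (simp add: gr_shift_def N_def)
  show "S.gen_at m" if "0 \<le> m" for m
   unfolding N.shift_gen unfolding N_def by (rule M.trunc_gen[OF D gr(1)]) (use that in simp_all)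
  show "S.rel_at m" if "1 \<le> m" for m
   unfolding N.shift_rel unfolding N_def by (rule M.trunc_rel[OF D gr(2)]) (use that in simp_all)
 qed
 have Nfp: "N \<in> fin_pres Q J" by (rule linear_fin_pres[OF N kos])
 have ser: "(N, \<lambda>x\<in>carrier N. x, M) \<in> serre_isos Q J (gmod Q J)"
  unfolding N_def by (rule M.incl_serre_iso) (rule low)
 have iso: "isomorphic_in (serre_quotient Q J (fin_pres Q J) (gmod Q J)) N M"
  unfolding serre_quotient_def
  by (rule isomorphic_in_localization[OF ser])
   (use M Nfp M.incl_hom[of n] in "simp_all add: gr_category_def N_def")
 have "linear_module Q J N" unfolding linear_module_def by (rule exI[of _ n]) (rule kos)
 then show ?thesis by (intro exI[of _ N] conjI isomorphic_in_sym[OF iso])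
qed

text \<open>
 The shift is by \<open>n - 1\<close> since that is the top degree of the quotient in degrees below \<open>n\<close>.
\<close>
theorem fin_copres_iso_colinear:
 assumes M: "M \<in> fin_copres Q J"
 shows "\<exists>N. colinear_module Q J N & isomorphic_in (serre_quotient Q J (fin_copres Q J) (gmod Q J)) M N"
proof -
 interpret M: graded_mod Q J F M by (rule gr_moduleD) (use M in "simp add: fin_copres_def")
 obtain u n where high: "!!m x. u < m ==> x \<in> hcomp M m ==> x = \<zero>\<^bsub>M\<^esub>"
  and gr: "!!m. m < n ==> M.cogen_at m" "!!m. m < n ==> M.corel_at m"
  using fin_copres_tail_quadratic[OF M] by blast
 have D: "M.convex {..<n}" by (auto simp: M.convex_def)
 define N where "N = M.trunc {..<n}"
 have N: "gr_module Q J N" unfolding N_def by (rule M.trunc_gr_module[OF D])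
 interpret N: graded_mod Q J F N by (rule gr_moduleD[OF N])
 have "gr_module Q J (gr_shift (- (n - 1)) N)"
  unfolding gr_module_iff using N.shift_pre[of "- (n - 1)"] N.fd by (simp add: gr_shift_def fin_dim_def finsum_def)
 then interpret S: graded_mod Q J F "gr_shift (- (n - 1)) N" by (rule gr_moduleD)
 have kos: "cokoszul Q J (gr_shift (- (n - 1)) N)"
 proof (rule S.cokoszul_if_quadratic)
  show "x = \<zero>\<^bsub>gr_shift (- (n - 1)) N\<^esub>" if "0 < m" "x \<in> hcomp (gr_shift (- (n - 1)) N) m" for m x
   using that by (simp add: gr_shift_def N_def)
  show "S.cogen_at m" if "m < 0" for m
   unfolding N.shift_cogen unfolding N_def by (rule M.trunc_cogen[OF D gr(1)]) (use that in simp_all)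
  show "S.corel_at m" if "m \<le> - 2" for m
   unfolding N.shift_corel unfolding N_def by (rule M.trunc_corel[OF D gr(2)]) (use that in simp_all)
 qed
 have Nfp: "N \<in> fin_copres Q J" by (rule colinear_fin_copres[OF N kos])
 have ser: "(M, \<lambda>x\<in>carrier M. M.cut {..<n} x, N) \<in> serre_isos Q J (gmod Q J)"
  unfolding N_def by (rule M.proj_serre_iso) (rule high)
 have iso: "isomorphic_in (serre_quotient Q J (fin_copres Q J) (gmod Q J)) M N"
  unfolding serre_quotient_def
  by (rule isomorphic_in_localization[OF ser])
   (use M Nfp M.proj_hom[of n] in "simp_all add: gr_category_def N_def")
 have "colinear_module Q J N" unfolding colinear_module_def by (rule exI[of _ "n - 1"]) (rule kos)
 then show ?thesis by (intro exI[of _ N] conjI iso)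
qed

end

section \<open>The quadratic dual as a monomial quotient\<close>

lemma (in fin_digraph) path_in_arrow_ideal_power:
 "(u, p) \<in> paths G ==>
  path_basis (u, p) \<in> ideal_power (path_algebra G :: ('a, 'b, 'k::field) path_elem ring) (arrow_ideal G) (length p)"
proof (induction p rule: rev_induct)
 case Nil
 then show ?case by (simp add: ideal_power_def path_basis_def)
next
 case (snoc a p)
 interpret R: ring "path_algebra G :: ('a, 'b, 'k) path_elem ring" by (rule ring_path_algebra)
 have p: "(u, p) \<in> paths G" "a \<in> arcs G" "tail G a = path_end G (u, p)"
  using snoc.prems by (simp_all add: paths_append)
 have gen: "{path_basis (tail G a, [a]) | a. a \<in> arcs G} <= carrier (path_algebra G :: ('a, 'b, 'k) path_elem ring)"
  by (auto simp: path_basis_def)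
 have arr: "path_basis (tail G a, [a]) \<in> (arrow_ideal G :: ('a, 'b, 'k) path_elem set)"
  unfolding arrow_ideal_def using R.genideal_self[OF gen] p(2) by blast
 have "path_basis (tail G a, [a]) \<otimes>\<^bsub>path_algebra G\<^esub> path_basis (u, p) \<in>
   ideal_prod (path_algebra G :: ('a, 'b, 'k) path_elem ring) (arrow_ideal G) (ideal_power (path_algebra G) (arrow_ideal G) (length p))"
  by (rule ideal_prod.prod[OF arr snoc.IH[OF p(1)]])
 then show ?case using p(3) by (simp add: ideal_power_def path_basis_def path_times_single)
qed

text \<open>
 Chains of relations of the dual, reversed, are paths of \<open>Q\<close> outside \<open>I\<close>, because \<open>I\<close> is monomial.  They
 are bounded, because \<open>I\<close> contains a power of the arrow ideal.
\<close>
lemma quadratic_dual_monomial: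
 fixes I :: "('v, 'e, 'k::field) path_elem set"
 assumes QI: "quadratic_monomial Q I"
 shows "\<exists>F. monomial_quotient (op_quiver Q) (quadratic_dual_ideal Q I) F"
proof -
 interpret Q: fin_digraph Q using QI by (simp add: quadratic_monomial_def)
 have oQ: "verts (op_quiver Q) = verts Q" "arcs (op_quiver Q) = arcs Q" "tail (op_quiver Q) = head Q" "head (op_quiver Q) = tail Q"
  by (simp_all add: op_quiver_def)
 interpret O: fin_digraph "op_quiver Q" by unfold_locales (simp_all add: oQ)
 define F where "F = {(b, a). a \<in> arcs Q & b \<in> arcs Q & head Q a = tail Q b & path_basis (tail Q a, [a, b]) ~: I}"
 from QI obtain S where S: "S <= {p \<in> paths Q. length (snd p) = 2}" and IS: "I = Idl\<^bsub>path_algebra Q\<^esub> (path_basis ` S)"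
  unfolding quadratic_monomial_def by blast
 from QI obtain m where m: "2 \<le> m" "ideal_power (path_algebra Q) (arrow_ideal Q) m <= I"
  unfolding quadratic_monomial_def admissible_def by blast
 define FS where "FS = {(a, b). (tail Q a, [a, b]) \<in> S}"
 have Sp: "\<exists>a b. p = (tail Q a, [a, b]) & a \<in> arcs Q & b \<in> arcs Q & head Q a = tail Q b" if "p \<in> S" for p
 proof -
  obtain u q where p: "p = (u, q)" by (cases p)
  have "length q = 2" using S that p by auto
  then obtain a b where q: "q = [a, b]" by (auto simp: length_Suc_conv numeral_2_eq_2)
  have "(u, [a, b]) \<in> paths Q" using S that by (auto simp: p q)
  then show ?thesis by (auto simp: p q)
 qed
 have FS: "a \<in> arcs Q & b \<in> arcs Q & head Q a = tail Q b" if "(a, b) \<in> FS" for a b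
  using Sp[of "(tail Q a, [a, b])"] that by (auto simp: FS_def)
 have "path_basis ` S = {path_basis (tail Q a, [a, b]) :: ('v, 'e, 'k) path_elem | a b. (a, b) \<in> FS}"
  unfolding FS_def using Sp by fastforce
 then have I: "I = monomial_span Q FS" unfolding IS using Q.genideal_monomial[OF FS] by simp
 have IF: "path_basis (tail Q a, [a, b]) \<in> I" if "(a, b) \<in> FS" for a b
  unfolding I monomial_span_def using FS[OF that] that by (simp add: path_basis_def)
 have "monomial_quotient (op_quiver Q) (quadratic_dual_ideal Q I) F"
 proof unfold_locales
  show "quadratic_dual_ideal Q I = monomial_span (op_quiver Q) F"
  proof -
   have "(quadratic_dual_ideal Q I :: ('v, 'e, 'k) path_elem set) =
    Idl\<^bsub>path_algebra (op_quiver Q)\<^esub> {path_basis (tail (op_quiver Q) a, [a, b]) | a b. (a, b) \<in> F}"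
    unfolding quadratic_dual_ideal_def oQ F_def by (rule arg_cong[where f = "genideal _"]) auto
   also have "... = monomial_span (op_quiver Q) F" by (rule O.genideal_monomial) (auto simp: F_def oQ)
   finally show ?thesis .
  qed
  show "\<exists>n. \<forall>as. set as <= arcs (op_quiver Q) --> successively (%a b. (a, b) \<in> F) as --> length as \<le> n"
  proof (intro exI[of _ m] allI impI, rule ccontr)
   fix as assume as: "set as <= arcs (op_quiver Q)" "successively (%a b. (a, b) \<in> F) as" and "\<not> length as \<le> m"
   define p where "p = rev (take m as)"
   have len: "length p = m" using \<open>\<not> length as \<le> m\<close> by (simp add: p_def)
   have "successively (%a b. (a, b) \<in> F) (take m as @ drop m as)" using as(2) by simp
   then have suc: "successively (%a b. (b, a) \<in> F) p" unfolding p_def successively_rev successively_append_iff by blast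
   have arcs: "set p <= arcs Q" using as(1) set_take_subset[of m as] by (auto simp: p_def oQ)
   have path: "(tail Q a, a # q) \<in> paths Q" if "successively (%a b. (b, a) \<in> F) (a # q)" "set (a # q) <= arcs Q" for a q
    using that by (induction q arbitrary: a) (auto simp: F_def)
   obtain a q where p: "p = a # q" using len m(1) by (cases p) auto
   have "(tail Q a, p) \<in> paths Q" using path suc arcs unfolding p by blast
   from Q.path_in_arrow_ideal_power[OF this] have "path_basis (tail Q a, p) \<in> I" using m(2) unfolding len by blast
   then have "\<not> successively (%a b. (a, b) ~: FS) p" unfolding I monomial_span_def by (simp add: path_basis_def)
   then obtain r a b s where r: "p = r @ [a, b] @ s" "\<not> (a, b) ~: FS" by (rule not_successivelyE)
   from suc have "(b, a) \<in> F" unfolding r(1) by (simp add: successively_append_iff)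
   then show False using IF[of a b] r(2) by (simp add: F_def)
  qed
 qed (auto simp: F_def oQ)
 then show ?thesis ..
qed

theorem corollary3p14:
  fixes Q :: "('v, 'e) pre_digraph" and I :: "('v, 'e, 'k::field) path_elem set"
    and Q' :: "('v, 'e) pre_digraph" and I' :: "('v, 'e, 'k) path_elem set"
  assumes "quadratic_monomial Q I"
  defines "Q' \<equiv> op_quiver Q" and "I' \<equiv> quadratic_dual_ideal Q I"
  shows
    "(\<forall>M :: (('v, 'e, 'k) bq_elem, 'm) graded_module.
        M \<in> Ob (serre_quotient Q' I' (fin_pres Q' I') (gmod Q' I')) \<longrightarrow>
        (\<exists>N. linear_module Q' I' N \<and>
           isomorphic_in (serre_quotient Q' I' (fin_pres Q' I') (gmod Q' I')) M N)) \<and>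
     (\<forall>M :: (('v, 'e, 'k) bq_elem, 'm) graded_module.
        M \<in> Ob (serre_quotient Q' I' (fin_copres Q' I') (gmod Q' I')) \<longrightarrow>
        (\<exists>N. colinear_module Q' I' N \<and>
           isomorphic_in (serre_quotient Q' I' (fin_copres Q' I') (gmod Q' I')) M N))"
proof -
 from quadratic_dual_monomial[OF assms(1)] obtain F where "monomial_quotient Q' I' F"
  unfolding Q'_def I'_def by blast
 then interpret monomial_quotient Q' I' F .
 have Ob: "Ob (serre_quotient Q' I' B C) = B" for B C :: "(('v, 'e, 'k) bq_elem, 'm) graded_module set"
  by (simp add: serre_quotient_def localization_def gr_category_def)
 show ?thesis unfolding Ob using fin_pres_iso_linear fin_copres_iso_colinear by blast
qed

end
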